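(* Let $n\ge3$, let $\varphi$ be a function on $\mathscr{H}$, let $$\Phi(\tau)=\frac{\sigma_{n-2}}{2|\tau|}\,(R^*\varphi)(\nu^{-1}(\tau))$$ for $(n-2)$-planes $\tau$ in $\mathbb{R}^n$ not passing through the origin, and let $$(\tilde R^*_x\Phi)(r)=\int_{SO(n)}\Phi(\gamma\mathbb{R}^{n-2}+x+r\gamma e_n)\,d\gamma .$$ If $\varphi\in\tilde L^p(\mathscr{H})$, $1\le p<n/(n-2)$, then for any integer $m>n/2-1$, $$\varphi(h)=\frac{\pi^{1-n/2}}{\kappa_m\,|h|^{n-1}}\int_0^\infty\Bigl[\sum_{j=0}^m\binom{m}{j}(-1)^j\,(\tilde R^*_{\nu(h)}\Phi)(\sqrt{jr})\Bigr]\frac{dr}{r^{n/2}},$$ where $\int_0^\infty=\lim_{\varepsilon\to0}\int_\varepsilon^\infty$ in the almost everywhere sense. If $\varphi\in\tilde C_\mu(\mathscr{H})$, $\mu>n-2$, this limit is uniform on every compact subset of $\mathscr{H}$ not containing hyperplanes through the origin.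
   Context: $\mathscr{L}$ and $\mathscr{H}$ are the sets of all non-oriented lines and all non-oriented hyperplanes in $\mathbb{R}^n$. Lines are written $\ell(\omega,u)=\mathbb{R}\omega+u$, $\omega\in\mathbb{S}^{n-1}$, $u\in\omega^\perp$; hyperplanes are written $h(\theta,t)=\{x:x\cdot\theta=t\}$, $\theta\in\mathbb{S}^{n-1}$, $t\in\mathbb{R}$. A function on $\mathscr{H}$ is identified with $\varphi(\theta,t)$ satisfying $\varphi(\theta,t)=\varphi(-\theta,-t)$, and $dh=d_*\theta\,dt$, where $d_*\theta$ is normalized surface measure on $\mathbb{S}^{n-1}$. For an affine plane $\tau$, $|\tau|$ is its Euclidean distance to the origin (so $|h(\theta,t)|=|t|$). $\sigma_{k-1}=2\pi^{k/2}/\Gamma(k/2)$ is the area of $\mathbb{S}^{k-1}$. Dual Radon transform: $(R^*\varphi)(\omega,u)=\int_{\mathbb{S}^{n-1}\cap\omega^\perp}\varphi(\theta,\theta\cdot u)\,d_\omega\theta$, with $d_\omega\theta$ the invariant probability measure on $\mathbb{S}^{n-1}\cap\omega^\perp$. Quasi-orthogonal inversion $\nu$: for a line $\ell(\omega,u)$ with $u\ne0$, $\nu(\ell)=\{\omega,u\}^\perp-u/|u|^2$, an $(n-2)$-plane not passing through the origin, where $\{\omega,u\}^\perp$ is the orthogonal complement of $\mathrm{span}(\omega,u)$; this is a bijection from lines not through $0$ onto $(n-2)$-planes not through $0$, and $\nu^{-1}$ in the definition of $\Phi$ is its inverse. For a hyperplane $h(\theta,t)$ with $t\neq0$, $\nu(h)=-\theta/t\in\mathbb{R}^n\setminus\{0\}$.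 In the definition of $\tilde R^*_x\Phi$: $x\in\mathbb{R}^n$, $r\ge0$, $\mathbb{R}^{n-2}=\mathrm{span}(e_1,\dots,e_{n-2})$, $d\gamma$ is normalized Haar measure on $SO(n)$. Constant: for an integer $m>n/2-1$, $$\kappa_m=\int_0^\infty(1-e^{-t})^m\,t^{-n/2}\,dt=\begin{cases}\Gamma(1-n/2)\displaystyle\sum_{j=1}^m\binom mj(-1)^j\,j^{n/2-1}, & n\text{ odd},\\[2mm] \displaystyle\frac{(-1)^{n/2}}{(n/2-1)!}\sum_{j=1}^m\binom mj(-1)^j\,j^{n/2-1}\log j, & n\text{ even}.\end{cases}$$ Function spaces: for $1\le p<\infty$, $$\tilde L^p(\mathscr{H})=\Bigl\{\varphi:\int_{\mathscr{H}}|h|^{(n-1)(p-1)-2}|\varphi(h)|^p\,dh<\infty\Bigr\}.$$ For $\mu>0$, $\tilde C_\mu(\mathscr{H})$ is the space of functions $\varphi$ continuous on the set of hyperplanes not passing through the origin with $|h|^{n-1-\mu}\varphi(h)=O(1)$ as $|h|\to0$ and $|h|^{n-1}\varphi(h)\to c=\mathrm{const}$ as $|h|\to\infty$. *)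

theory Defs
  imports "HOL-Probability.Probability"
begin

section \<open>Invariant measures on spheres and on the rotation group\<close>

text \<open>
  The ambient space is \<open>real ^ 'n\<close>, so the dimension is \<open>n = CARD('n)\<close>.

  For a nonzero subspace \<open>V\<close>, the unit sphere of \<open>V\<close> carries exactly one Borel probability
  measure invariant under the orthogonal transformations preserving \<open>V\<close>.  For \<open>V = UNIV\<close> it is
  the normalized surface measure of the whole unit sphere.
\<close>

definition invariant_sphere_prob ::
  "(real ^ 'n) set \<Rightarrow> (real ^ 'n) measure \<Rightarrow> bool" where
  "invariant_sphere_prob V M \<longleftrightarrow>
     sets M = sets (restrict_space borel (sphere 0 1 \<inter> V)) \<and>
     prob_space M \<and>
     (\<forall>T. orthogonal_transformation T \<and> T ` V = V \<longrightarrow> distr M M T = M)"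

definition sphere_prob :: "(real ^ 'n) set \<Rightarrow> (real ^ 'n) measure" where
  "sphere_prob V = (THE M. invariant_sphere_prob V M)"

text \<open>Normalized (left-invariant) Haar measure on \<open>SO(n)\<close>.\<close>

definition haar_prob_SO :: "(real ^ 'n ^ 'n) measure \<Rightarrow> bool" where
  "haar_prob_SO G \<longleftrightarrow>
     sets G = sets (restrict_space borel {A. rotation_matrix A}) \<and>
     prob_space G \<and>
     (\<forall>A. rotation_matrix A \<longrightarrow> distr G G (\<lambda>B. A ** B) = G)"


section \<open>Functions of hyperplanes\<close>

text \<open>
  A function of non-oriented hyperplanes is a function \<open>\<phi> \<theta> t\<close>, \<open>norm \<theta> = 1\<close>, which takes the same
  value at the two representations \<open>(\<theta>, t)\<close> and \<open>(-\<theta>, -t)\<close> of \<open>{x. x \<bullet> \<theta> = t}\<close>.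
  Values of \<open>\<phi>\<close> at vectors \<open>\<theta>\<close> that are not of unit length are irrelevant.
\<close>

definition hyperplane_function :: "(real ^ 'n \<Rightarrow> real \<Rightarrow> complex) \<Rightarrow> bool" where
  "hyperplane_function \<phi> \<longleftrightarrow> (\<forall>\<theta> t. norm \<theta> = 1 \<longrightarrow> \<phi> \<theta> t = \<phi> (- \<theta>) (- t))"

definition hyperplane_measure :: "((real ^ 'n) \<times> real) measure" where
  "hyperplane_measure = sphere_prob UNIV \<Otimes>\<^sub>M lborel"

text \<open>
  Measurability and integrability below refer to completed measures, so that functions that are
  only Lebesgue measurable, or arbitrary on a null set such as the set of hyperplanes
  through the origin, are admitted.
\<close>

definition tilde_Lp :: "real \<Rightarrow> (real ^ 'n \<Rightarrow> real \<Rightarrow> complex) set" where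
  "tilde_Lp p = {\<phi>.
     (\<lambda>(\<theta>, t). \<phi> \<theta> t) \<in> borel_measurable (completion hyperplane_measure) \<and>
     (\<integral>\<^sup>+ (\<theta>, t). ennreal (\<bar>t\<bar> powr ((real CARD('n) - 1) * (p - 1) - 2) * norm (\<phi> \<theta> t) powr p)
        \<partial>completion hyperplane_measure) < \<infinity>}"

definition tilde_C :: "real \<Rightarrow> (real ^ 'n \<Rightarrow> real \<Rightarrow> complex) set" where
  "tilde_C \<mu> = {\<phi>.
     continuous_on (sphere 0 1 \<times> (- {0})) (\<lambda>(\<theta>, t). \<phi> \<theta> t) \<and>
     (\<exists>B. \<exists>\<delta>>0. \<forall>\<theta> t. norm \<theta> = 1 \<and> 0 < \<bar>t\<bar> \<and> \<bar>t\<bar> < \<delta> \<longrightarrow>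
        \<bar>t\<bar> powr (real CARD('n) - 1 - \<mu>) * norm (\<phi> \<theta> t) \<le> B) \<and>
     (\<exists>c. \<forall>\<epsilon>>0. \<exists>R. \<forall>\<theta> t. norm \<theta> = 1 \<and> R < \<bar>t\<bar> \<longrightarrow>
        norm (of_real (\<bar>t\<bar> ^ (CARD('n) - 1)) * \<phi> \<theta> t - c) < \<epsilon>)}"


section \<open>Dual Radon transform and quasi-orthogonal inversion\<close>

text \<open>
  A line is given by a unit vector \<open>\<omega>\<close> and \<open>u\<close> orthogonal to \<open>\<omega>\<close>; it determines \<open>u\<close>,
  and \<open>\<omega>\<close> up to sign.  The functions of \<open>(\<omega>, u)\<close> below do not depend on that sign.
\<close>

definition dual_radon :: "(real ^ 'n \<Rightarrow> real \<Rightarrow> complex) \<Rightarrow> real ^ 'n \<Rightarrow> real ^ 'n \<Rightarrow> complex" where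
  "dual_radon \<phi> \<omega> u = (LINT \<theta>|completion (sphere_prob (orthogonal_comp {\<omega>})). \<phi> \<theta> (\<theta> \<bullet> u))"

definition nu_line :: "real ^ 'n \<Rightarrow> real ^ 'n \<Rightarrow> (real ^ 'n) set" where
  "nu_line \<omega> u = (\<lambda>v. v - u /\<^sub>R (norm u)\<^sup>2) ` orthogonal_comp {\<omega>, u}"

text \<open>The inverse of \<open>nu_line\<close>, with an arbitrary choice of one of the two admissible \<open>\<omega>\<close>.\<close>

definition nu_line_inv :: "(real ^ 'n) set \<Rightarrow> (real ^ 'n) \<times> (real ^ 'n)" where
  "nu_line_inv \<tau> =
     (SOME (\<omega>, u). norm \<omega> = 1 \<and> \<omega> \<bullet> u = 0 \<and> u \<noteq> 0 \<and> nu_line \<omega> u = \<tau>)"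

definition nu_hyperplane :: "real ^ 'n \<Rightarrow> real \<Rightarrow> real ^ 'n" where
  "nu_hyperplane \<theta> t = - \<theta> /\<^sub>R t"


section \<open>The ingredients of the inversion formula\<close>

text \<open>\<open>sphere_area d\<close> is the area of the \<open>d\<close>-dimensional unit sphere.\<close>

definition sphere_area :: "nat \<Rightarrow> real" where
  "sphere_area d = 2 * pi powr ((real d + 1) / 2) / Gamma ((real d + 1) / 2)"

definition Phi :: "(real ^ 'n \<Rightarrow> real \<Rightarrow> complex) \<Rightarrow> (real ^ 'n) set \<Rightarrow> complex" where
  "Phi \<phi> \<tau> = of_real (sphere_area (CARD('n) - 2) / (2 * infdist 0 \<tau>)) *
     (case nu_line_inv \<tau> of (\<omega>, u) \<Rightarrow> dual_radon \<phi> \<omega> u)"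

text \<open>
  The coordinates are enumerated by a bijection \<open>e\<close> from \<open>{1..n}\<close> onto the index type, so that
  \<open>axis (e k) 1\<close> is the \<open>k\<close>-th standard basis vector.  \<open>G\<close> is the Haar measure on \<open>SO(n)\<close>.
\<close>

definition coordinate_plane :: "(nat \<Rightarrow> 'n) \<Rightarrow> nat \<Rightarrow> (real ^ 'n) set" where
  "coordinate_plane e k = span ((\<lambda>i. axis (e i) 1) ` {1..k})"

definition shifted_dual ::
  "(real ^ 'n ^ 'n) measure \<Rightarrow> (nat \<Rightarrow> 'n) \<Rightarrow> ((real ^ 'n) set \<Rightarrow> complex)
     \<Rightarrow> real ^ 'n \<Rightarrow> real \<Rightarrow> complex" where
  "shifted_dual G e F x r =
     (LINT \<gamma>|completion G.
        F ((\<lambda>v. \<gamma> *v v + x + r *\<^sub>R (\<gamma> *v axis (e CARD('n)) 1)) ` coordinate_plane e (CARD('n) - 2)))"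

definition inversion_integrand ::
  "(real ^ 'n ^ 'n) measure \<Rightarrow> (nat \<Rightarrow> 'n) \<Rightarrow> nat \<Rightarrow> ((real ^ 'n) set \<Rightarrow> complex)
     \<Rightarrow> real ^ 'n \<Rightarrow> real \<Rightarrow> complex" where
  "inversion_integrand G e m F x r =
     (\<Sum>j\<le>m. of_nat (m choose j) * (- 1) ^ j * shifted_dual G e F x (sqrt (real j * r)))
       / of_real (r powr (real CARD('n) / 2))"

definition kappa :: "nat \<Rightarrow> nat \<Rightarrow> real" where
  "kappa n m = (LBINT t:{0<..}. (1 - exp (- t)) ^ m * t powr (- real n / 2))"

end

theory Submission
  imports Defs
begin

text \<open>
  The hyperplane \<open>h(\<theta>, t)\<close> corresponds to its pole \<open>- \<theta> / t\<close>. In this coordinate \<open>\<phi>\<close> becomes the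
  function \<open>f(x) = \<phi>(x / |x|, - 1 / |x|) / |x|^(n - 1)\<close>, and gnomonic projection of the sphere
  orthogonal to \<open>\<omega>\<close> shows that \<open>\<Phi>(\<tau>)\<close> is the plain Lebesgue integral of \<open>f\<close> over the
  \<open>(n - 2)\<close>-plane \<open>\<tau>\<close>. Averaging over all \<open>(n - 2)\<close>-planes at distance \<open>r\<close> from \<open>x\<close> produces, as a
  function of \<open>r^2\<close>, a Weyl fractional integral of order \<open>\<alpha> = n/2 - 1\<close> of the spherical means of \<open>f\<close>
  about \<open>x\<close>; the bracket in the theorem is Marchaud's fractional derivative, which inverts it.

  Concretely, the integral truncated at \<open>\<epsilon>\<close> is a convolution of \<open>f\<close> with a radial kernel, rescaled
  by \<open>sqrt \<epsilon>\<close>. This kernel is integrable, because finite differences of order \<open>m > \<alpha>\<close> decay fast enough,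
  its integral is \<open>pi powr \<alpha> * kappa n m\<close>, and it has an integrable radially decreasing majorant.
  The error of the approximation is therefore controlled by the mean oscillation of \<open>f\<close> about \<open>x\<close>,
  which tends to zero at every Lebesgue point, and uniformly on compact sets if \<open>f\<close> is continuous.
  The weights in the two function spaces say exactly that \<open>f\<close> lies in \<open>L^p\<close>, respectively that \<open>f\<close>
  extends continuously to the origin and is \<open>O(|x| powr (- \<mu>))\<close> at infinity; the bounds on \<open>p\<close> and
  \<open>\<mu>\<close> make the plane integrals converge.
\<close>

section \<open>Uniformly distributed measures\<close>

text \<open>\<open>sphere_prob\<close> is a definite description and \<open>G\<close> an arbitrary
  Haar measure, so neither comes with a formula. Uniqueness of the invariant measure on a sphere is
  read off from the masses of balls, existence comes from normalising a Gaussian vector, and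
  \<open>G\<close> is exploited through the law of \<open>\<gamma> *v v\<close>, which is uniform on
  a sphere. The Gaussian turns sphere integrals into Lebesgue integrals that split along
  coordinates. Radial integrals use the squared norm \<open>v\<close> as variable: Lebesgue measure
  then has density proportional to \<open>v powr (n / 2 - 1)\<close>, and the fractional kernels
  appear without further substitution. The single terms of the bracket have kernels that decay only
  like \<open>1 / |z|^2\<close>; only their alternating sum is integrable. They are separated under
  the one condition \<open>good\<close>, integrability of \<open>|g (x + z)| / |z|^2\<close>. At
  infinity \<open>1 / |z|^2\<close> lies in the dual of \<open>L^p\<close> exactly when
  \<open>p < n / (n - 2)\<close>, and \<open>|z| powr (- 2 - \<mu>)\<close> is integrable exactly
  when \<open>\<mu> > n - 2\<close>: this is the origin of the two bounds.\<close>

lemma emeasure_open_le_of_uniform_balls: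
  fixes M N :: "'a::euclidean_space measure"
  assumes sM: "sets M = sets borel" and sN: "sets N = sets borel"
    and fM: "sigma_finite_measure M" and fN: "sigma_finite_measure N"
    and aM: "AE x in M. x \<in> S" and aN: "AE x in N. x \<in> S"
    and bM: "\<And>y r. y \<in> S \<Longrightarrow> 0 < r \<Longrightarrow> emeasure M (ball y r) = c r"
    and bN: "\<And>y r. y \<in> S \<Longrightarrow> 0 < r \<Longrightarrow> emeasure N (ball y r) = c r"
    and c: "\<And>r. 0 < r \<Longrightarrow> 0 < c r \<and> c r < (\<infinity>::ennreal)"
    and U: "open U"
  shows "emeasure M U \<le> emeasure N U"
proof -
  interpret M: sigma_finite_measure M by fact
  interpret N: sigma_finite_measure N by fact
  interpret P: pair_sigma_finite M N by unfold_locales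
  note [measurable_cong] = sM sN
  \<comment> \<open>\<open>V k\<close> keeps distance \<open>1 / (k + 1)\<close> from the complement
    of \<open>U\<close>; a ball of that radius about a point of \<open>V k\<close> therefore stays
    inside \<open>U\<close>, and the closed sets \<open>V k\<close> increase to
    \<open>U\<close>.\<close>
  define V where "V k = (\<Inter>z\<in>-U. {x. 1 / real (Suc k) \<le> dist x z})" for k
  have clV: "closed (V k)" for k
    unfolding V_def by (intro closed_INT ballI closed_Collect_le continuous_intros)
  have [measurable]: "V k \<in> sets borel" for k using clV by auto
  have [measurable]: "U \<in> sets borel" using U by auto
  \<comment> \<open>Count the pairs at distance less than \<open>r\<close> twice. Integrating over
    \<open>y\<close> first gives \<open>M (V k) * c r\<close>; integrating over \<open>x\<close>
    first gives at most \<open>N U * c r\<close>, because \<open>x\<close> in \<open>V k\<close>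
    forces \<open>y\<close> into \<open>U\<close>. The factor \<open>c r\<close> is then
    cancelled.\<close>
  have le: "emeasure M (V k) \<le> emeasure N U" for k
  proof -
    define r where "r = 1 / real (Suc k)"
    have r: "r > 0" by (simp add: r_def)
    have "emeasure M (V k) * c r = (\<integral>\<^sup>+x. indicator (V k) x * c r \<partial>M)"
      by (subst nn_integral_multc) (auto simp: sM)
    also have "\<dots> = (\<integral>\<^sup>+x. indicator (V k) x * emeasure N (ball x r) \<partial>M)"
      by (rule nn_integral_cong_AE) (use aM r bN in \<open>auto elim!: eventually_mono\<close>)
    also have "\<dots> = (\<integral>\<^sup>+x. \<integral>\<^sup>+y. indicator (V k) x * indicator {z. dist (fst z) (snd z) < r} (x,y) \<partial>N \<partial>M)"
    proof (rule nn_integral_cong)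
      fix x
      have "emeasure N (ball x r) = (\<integral>\<^sup>+y. indicator (ball x r) y \<partial>N)"
        by (subst nn_integral_indicator) (auto simp: sN)
      also have "\<dots> = (\<integral>\<^sup>+y. indicator {z. dist (fst z) (snd z) < r} (x,y) \<partial>N)"
        by (rule nn_integral_cong) (auto simp: indicator_def)
      finally have e: "emeasure N (ball x r) = (\<integral>\<^sup>+y. indicator {z. dist (fst z) (snd z) < r} (x,y) \<partial>N)" .
      show "indicator (V k) x * emeasure N (ball x r) = (\<integral>\<^sup>+y. indicator (V k) x * indicator {z. dist (fst z) (snd z) < r} (x,y) \<partial>N)"
        unfolding e by (subst nn_integral_cmult) (auto simp: indicator_def)
    qed
    also have "\<dots> \<le> (\<integral>\<^sup>+x. \<integral>\<^sup>+y. indicator U y * indicator {z. dist (fst z) (snd z) < r} (x,y) \<partial>N \<partial>M)"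
    proof (intro nn_integral_mono)
      fix x y
      show "indicator (V k) x * indicator {z. dist (fst z) (snd z) < r} (x,y) \<le>
         (indicator U y * indicator {z. dist (fst z) (snd z) < r} (x,y) :: ennreal)"
        by (auto simp: indicator_def V_def r_def not_less[symmetric])
    qed
    also have "\<dots> = (\<integral>\<^sup>+y. \<integral>\<^sup>+x. indicator U y * indicator {z. dist (fst z) (snd z) < r} (x,y) \<partial>M \<partial>N)"
    proof -
      have "{z::'a\<times>'a. dist (fst z) (snd z) < r} \<in> sets (borel \<Otimes>\<^sub>M borel)"
        unfolding borel_prod by (intro borel_open open_Collect_less continuous_intros)
      hence [measurable]: "{z::'a\<times>'a. dist (fst z) (snd z) < r} \<in> sets (M \<Otimes>\<^sub>M N)"
        by (simp cong: sets_pair_measure_cong add: sM sN)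
      show ?thesis
        by (rule P.Fubini'[symmetric]) measurable
    qed
    also have "\<dots> = (\<integral>\<^sup>+y. indicator U y * emeasure M (ball y r) \<partial>N)"
    proof (rule nn_integral_cong)
      fix y
      have "emeasure M (ball y r) = (\<integral>\<^sup>+x. indicator (ball y r) x \<partial>M)"
        by (subst nn_integral_indicator) (auto simp: sM)
      also have "\<dots> = (\<integral>\<^sup>+x. indicator {z. dist (fst z) (snd z) < r} (x,y) \<partial>M)"
        by (rule nn_integral_cong) (auto simp: indicator_def dist_commute)
      finally have e: "emeasure M (ball y r) = (\<integral>\<^sup>+x. indicator {z. dist (fst z) (snd z) < r} (x,y) \<partial>M)" .
      show "(\<integral>\<^sup>+x. indicator U y * indicator {z. dist (fst z) (snd z) < r} (x,y) \<partial>M) = indicator U y * emeasure M (ball y r)"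
        unfolding e by (subst nn_integral_cmult) (auto simp: indicator_def)
    qed
    also have "\<dots> = (\<integral>\<^sup>+y. indicator U y * c r \<partial>N)"
      by (rule nn_integral_cong_AE) (use aN r bM in \<open>auto elim!: eventually_mono\<close>)
    also have "\<dots> = emeasure N U * c r"
      by (subst nn_integral_multc) (auto simp: sN)
    finally have "emeasure M (V k) * c r \<le> emeasure N U * c r" .
    thus ?thesis using c[OF r]
      by (subst (asm) (1 2) mult.commute) (auto dest: ennreal_mult_le_mult_iff[THEN iffD1, rotated 2] simp: ennreal_mult_le_mult_iff)
  qed
  have "incseq V"
  proof (rule incseq_SucI)
    fix k have "1 / real (Suc (Suc k)) \<le> 1 / real (Suc k)" by (simp add: field_simps)
    thus "V k \<subseteq> V (Suc k)" unfolding V_def by (force intro: order_trans)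
  qed
  moreover have "(\<Union>k. V k) = U"
  proof (intro set_eqI iffI)
    fix x assume "x \<in> (\<Union>k. V k)"
    then obtain k where k: "x \<in> V k" by auto
    show "x \<in> U"
    proof (rule ccontr)
      assume "x \<notin> U"
      with k have "1 / real (Suc k) \<le> dist x x" unfolding V_def by blast
      thus False by simp
    qed
  next
    fix x assume "x \<in> U"
    then obtain d where d: "d > 0" "ball x d \<subseteq> U" using U openE by blast
    obtain k where k: "inverse (real (Suc k)) < d" using reals_Archimedean[OF d(1)] by auto
    have "1 / real (Suc k) \<le> dist x z" if "z \<notin> U" for z
    proof -
      have "z \<notin> ball x d" using d that by auto
      thus ?thesis using k by (simp add: inverse_eq_divide)
    qed
    thus "x \<in> (\<Union>k. V k)" by (auto simp: V_def)
  qed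
  ultimately have "(\<lambda>k. emeasure M (V k)) \<longlonglongrightarrow> emeasure M U"
    using Lim_emeasure_incseq[of V M] clV by (auto simp: sM image_subset_iff)
  thus ?thesis
    by (rule LIMSEQ_le_const2) (use le in auto)
qed

text \<open>Christensen's argument: a measure is determined by its values on balls as soon as these
  depend only on the radius.\<close>

lemma measure_eq_of_uniform_balls:
  fixes M N :: "'a::euclidean_space measure"
  assumes sM: "sets M = sets borel" and sN: "sets N = sets borel"
    and fM: "sigma_finite_measure M" and fN: "sigma_finite_measure N"
    and aM: "AE x in M. x \<in> S" and aN: "AE x in N. x \<in> S"
    and bM: "\<And>y r. y \<in> S \<Longrightarrow> 0 < r \<Longrightarrow> emeasure M (ball y r) = c r"
    and bN: "\<And>y r. y \<in> S \<Longrightarrow> 0 < r \<Longrightarrow> emeasure N (ball y r) = c r"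
    and c: "\<And>r. 0 < r \<Longrightarrow> 0 < c r \<and> c r < (\<infinity>::ennreal)"
    and y0: "y0 \<in> S"
  shows "M = N"
proof (rule measure_eqI_generator_eq[where E="{U. open U}" and \<Omega>=UNIV and A="\<lambda>i. ball y0 (real (Suc i))"])
  show "Int_stable {U::'a set. open U}" by (auto simp: Int_stable_def)
  show "sets M = sigma_sets UNIV {U. open U}" "sets N = sigma_sets UNIV {U. open U}"
    by (simp_all add: sM sN sets_borel)
  show "emeasure M X = emeasure N X" if "X \<in> {U. open U}" for X
    using that
    by (intro antisym emeasure_open_le_of_uniform_balls[OF sM sN fM fN aM aN bM bN c]
         emeasure_open_le_of_uniform_balls[OF sN sM fN fM aN aM bN bM c]) auto
  show "(\<Union>i. ball y0 (real (Suc i))) = UNIV"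
  proof -
    have "\<exists>i. dist y0 x < real (Suc i)" for x
      by (metis reals_Archimedean2 less_Suc_eq_le of_nat_less_iff order.strict_trans lessI)
    thus ?thesis by (auto simp: mem_ball)
  qed
  show "emeasure M (ball y0 (real (Suc i))) \<noteq> \<infinity>" for i
    using bM[OF y0, of "real (Suc i)"] c[of "real (Suc i)"] by (simp add: less_top)
qed auto

text \<open>No common ball function is given here, so it has to be produced: the product mass of the
  pairs at distance less than \<open>r\<close> equals the constant \<open>N\<close>-mass of a ball
  by one order of integration and the constant \<open>M\<close>-mass by the other. Compactness makes
  this mass positive, since finitely many balls cover \<open>S\<close>.\<close>

lemma measure_eq_of_uniform_balls_prob:
  fixes M N :: "'a::euclidean_space measure"
  assumes sM: "sets M = sets borel" and sN: "sets N = sets borel"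
    and pM: "prob_space M" and pN: "prob_space N"
    and aM: "AE x in M. x \<in> S" and aN: "AE x in N. x \<in> S" and S: "compact S"
    and bM: "\<And>y z r. y \<in> S \<Longrightarrow> z \<in> S \<Longrightarrow> 0 < r \<Longrightarrow> emeasure M (ball y r) = emeasure M (ball z r)"
    and bN: "\<And>y z r. y \<in> S \<Longrightarrow> z \<in> S \<Longrightarrow> 0 < r \<Longrightarrow> emeasure N (ball y r) = emeasure N (ball z r)"
  shows "M = N"
proof -
  interpret M: prob_space M by fact
  interpret N: prob_space N by fact
  interpret P: pair_sigma_finite M N by unfold_locales
  note [measurable_cong] = sM sN
  have "S \<noteq> {}"
  proof
    assume "S = {}" hence "AE x in M. False" using aM by simp
    thus False using M.AE_False by simp
  qed
  then obtain y0 where y0: "y0 \<in> S" by auto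
  have pos: "emeasure L (ball y0 r) > 0"
    if L: "sets L = sets borel" "prob_space L" "AE x in L. x \<in> S" "r > 0"
      and b: "\<And>y z r. y \<in> S \<Longrightarrow> z \<in> S \<Longrightarrow> 0 < r \<Longrightarrow> emeasure L (ball y r) = emeasure L (ball z r)" for L r
  proof (rule ccontr)
    assume "\<not> 0 < emeasure L (ball y0 r)"
    hence 0: "emeasure L (ball y r) = 0" if "y \<in> S" for y using b[OF that y0 \<open>r>0\<close>] by simp
    interpret L: prob_space L by fact
    obtain T where T: "T \<subseteq> S" "finite T" "S \<subseteq> (\<Union>y\<in>T. ball y r)"
      proof (rule compactE_image[OF S, of S "\<lambda>y. ball y r"])
      show "S \<subseteq> (\<Union>c\<in>S. ball c r)" using \<open>r > 0\<close> by auto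
    qed (use that in auto)
    have "(\<Union>y\<in>T. ball y r) \<in> null_sets L"
      using T 0 by (intro null_sets_UN' countable_finite) (auto simp: null_sets_def L)
    hence "AE x in L. x \<notin> (\<Union>y\<in>T. ball y r)" by (rule AE_not_in)
    with L(3) have "AE x in L. False" by eventually_elim (use T in auto)
    thus False using L.AE_False by simp
  qed
  have eq: "emeasure M (ball y0 r) = emeasure N (ball y0 r)" if r: "r > 0" for r
  proof -
    have m [measurable]: "{z::'a\<times>'a. dist (fst z) (snd z) < r} \<in> sets (M \<Otimes>\<^sub>M N)"
    proof -
      have "{z::'a\<times>'a. dist (fst z) (snd z) < r} \<in> sets (borel \<Otimes>\<^sub>M borel)"
        unfolding borel_prod by (intro borel_open open_Collect_less continuous_intros)
      thus ?thesis by (simp cong: sets_pair_measure_cong add: sM sN)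
    qed
    let ?D = "{z::'a\<times>'a. dist (fst z) (snd z) < r}"
    have "emeasure N (ball y0 r) = (\<integral>\<^sup>+x. emeasure N (ball y0 r) \<partial>M)"
      by (simp add: M.emeasure_space_1)
    also have "\<dots> = (\<integral>\<^sup>+x. \<integral>\<^sup>+y. indicator ?D (x,y) \<partial>N \<partial>M)"
    proof (rule nn_integral_cong_AE, use aM in eventually_elim)
      fix x assume x: "x \<in> S"
      have "emeasure N (ball y0 r) = emeasure N (ball x r)" by (rule bN[OF y0 x r])
      also have "\<dots> = (\<integral>\<^sup>+y. indicator (ball x r) y \<partial>N)"
        by (subst nn_integral_indicator) (auto simp: sN)
      also have "\<dots> = (\<integral>\<^sup>+y. indicator ?D (x,y) \<partial>N)"
        by (rule nn_integral_cong) (auto simp: indicator_def)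
      finally show "emeasure N (ball y0 r) = (\<integral>\<^sup>+y. indicator ?D (x,y) \<partial>N)" .
    qed
    also have "\<dots> = (\<integral>\<^sup>+y. \<integral>\<^sup>+x. indicator ?D (x,y) \<partial>M \<partial>N)"
      by (rule P.Fubini'[symmetric]) measurable
    also have "\<dots> = (\<integral>\<^sup>+y. emeasure M (ball y0 r) \<partial>N)"
    proof (rule nn_integral_cong_AE, use aN in eventually_elim)
      fix x assume x: "x \<in> S"
      have "emeasure M (ball y0 r) = emeasure M (ball x r)" by (rule bM[OF y0 x r])
      also have "\<dots> = (\<integral>\<^sup>+y. indicator (ball x r) y \<partial>M)"
        by (subst nn_integral_indicator) (auto simp: sM)
      also have "\<dots> = (\<integral>\<^sup>+y. indicator ?D (y,x) \<partial>M)"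
        by (rule nn_integral_cong) (auto simp: indicator_def dist_commute)
      finally show "(\<integral>\<^sup>+y. indicator ?D (y,x) \<partial>M) = emeasure M (ball y0 r)" ..
    qed
    also have "\<dots> = emeasure M (ball y0 r)" by (simp add: N.emeasure_space_1)
    finally show ?thesis ..
  qed
  show ?thesis
  proof (rule measure_eq_of_uniform_balls[OF sM sN _ _ aM aN _ _ _ y0, where c = "\<lambda>r. emeasure M (ball y0 r)"])
    show "sigma_finite_measure M" "sigma_finite_measure N" by unfold_locales
    show "emeasure M (ball y r) = emeasure M (ball y0 r)" if "y \<in> S" "0 < r" for y r by (rule bM[OF that(1) y0 that(2)])
    show "emeasure N (ball y r) = emeasure M (ball y0 r)" if "y \<in> S" "0 < r" for y r
      using bN[OF that(1) y0 that(2)] eq[OF that(2)] by simp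
    show "0 < emeasure M (ball y0 r) \<and> emeasure M (ball y0 r) < \<infinity>" if "0 < r" for r
      using pos[OF sM pM aM that bM] by (simp add: M.emeasure_finite less_top[symmetric])
  qed
qed

lemma orthogonal_transformation_vimage_ball:
  fixes T :: "'a::euclidean_space \<Rightarrow> 'a"
  assumes "orthogonal_transformation T" "T z = y"
  shows "T -` ball y r = ball z r"
  using assms by (auto simp: mem_ball orthogonal_transformation_def dist_norm linear_diff[symmetric]
     norm_eq_sqrt_inner)

lemma orthogonal_transformation_measurable:
  fixes T :: "'a::euclidean_space \<Rightarrow> 'a"
  assumes "orthogonal_transformation T"
  shows "T \<in> borel_measurable borel"
  using assms by (intro borel_measurable_continuous_onI linear_continuous_on)
    (auto simp: orthogonal_transformation_def linear_conv_bounded_linear)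

text \<open>An orthogonal map sends balls to balls of the same radius, so the image measure agrees
  with Lebesgue measure on every ball, and the ball criterion applies with the whole space as
  \<open>S\<close>.\<close>

lemma lborel_distr_orthogonal_transformation:
  fixes T :: "'a::euclidean_space \<Rightarrow> 'a"
  assumes T: "orthogonal_transformation T"
  shows "distr lborel borel T = lborel"
proof -
  note [measurable] = orthogonal_transformation_measurable[OF T]
  obtain T' where T': "orthogonal_transformation T'" "\<And>x. T (T' x) = x"  "\<And>x. T' (T x) = x"
    using orthogonal_transformation_inv[OF T] orthogonal_transformation_bij[OF T]
    by (metis bij_inv_eq_iff)
  have b: "emeasure (distr lborel borel T) (ball y r) = emeasure lborel (ball y r)" if "0 < r" for y :: 'a and r
    using that by (simp add: emeasure_distr emeasure_ball orthogonal_transformation_vimage_ball[OF T T'(2)])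
  have cov: "\<exists>i. norm x < real (Suc i)" for x :: 'a
    by (metis reals_Archimedean2 less_Suc_eq_le of_nat_less_iff order.strict_trans lessI)
  have sf: "sigma_finite_measure (distr lborel borel T)"
  proof
    show "\<exists>A. countable A \<and> A \<subseteq> sets (distr lborel borel T) \<and> \<Union> A = space (distr lborel borel T) \<and>
       (\<forall>a\<in>A. emeasure (distr lborel borel T) a \<noteq> \<infinity>)"
      using cov
      by (intro exI[of _ "range (\<lambda>i. ball 0 (real (Suc i)))"]) (auto simp: b emeasure_ball mem_ball)
  qed
  show ?thesis
  proof (rule measure_eq_of_uniform_balls)
    show "AE x in distr lborel borel T. x \<in> UNIV" "AE x in lborel. x \<in> (UNIV::'a set)" by auto
    show "emeasure (distr lborel borel T) (ball y r) = ennreal (unit_ball_vol (DIM('a)) * r ^ DIM('a))"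
      if "0 < r" for y :: 'a and r
      using that by (simp add: b emeasure_ball)
    show "emeasure lborel (ball y r) = ennreal (unit_ball_vol (DIM('a)) * r ^ DIM('a))"
      if "0 < r" for y :: 'a and r
      using that by (simp add: emeasure_ball)
    show "0 \<in> (UNIV::'a set)" by simp
  qed (auto simp: sf intro: lborel.sigma_finite_measure_axioms)
qed

lemma nn_integral_lborel_orthogonal:
  fixes T :: "'a::euclidean_space \<Rightarrow> 'a"
  assumes T: "orthogonal_transformation T" and h: "h \<in> borel_measurable borel"
  shows "(\<integral>\<^sup>+x. h (T x) \<partial>lborel) = (\<integral>\<^sup>+x. h x \<partial>lborel)"
  using nn_integral_distr[of T lborel borel h] h orthogonal_transformation_measurable[OF T]
  by (simp add: lborel_distr_orthogonal_transformation[OF T])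

section \<open>Lebesgue measure in coordinates\<close>

text \<open>The planes have dimension \<open>n - 2\<close> while the ambient type fixes the
  dimension \<open>n\<close>. A product over a subset \<open>A\<close> of the index type supplies
  Lebesgue measure on a coordinate plane, and \<open>vec_of\<close> embeds it by padding with
  zeros.\<close>

abbreviation lebesgue_on_coords :: "'n set \<Rightarrow> ('n \<Rightarrow> real) measure" where
  "lebesgue_on_coords A \<equiv> Pi\<^sub>M A (\<lambda>_. lborel)"

definition vec_of :: "'n set \<Rightarrow> ('n \<Rightarrow> real) \<Rightarrow> real ^ 'n" where
  "vec_of A y = (\<chi> i. if i \<in> A then y i else 0)"

lemma vec_of_nth [simp]: "vec_of A y $ i = (if i \<in> A then y i else 0)"
  by (simp add: vec_of_def)

lemma vec_of_eq_sum: "vec_of A y = (\<Sum>i\<in>A. y i *\<^sub>R axis i (1::real))"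
proof (subst vec_eq_iff, intro allI)
  fix k
  have "(\<Sum>i\<in>A. y i *\<^sub>R axis i (1::real)) $ k = (\<Sum>i\<in>A. if i = k then y k else 0)"
    unfolding sum_component by (rule sum.cong) (auto simp: axis_def)
  thus "vec_of A y $ k = (\<Sum>i\<in>A. y i *\<^sub>R axis i (1::real)) $ k"
    by (simp add: sum.delta)
qed

lemma vec_of_measurable [measurable]: "vec_of A \<in> borel_measurable (lebesgue_on_coords A)"
  unfolding vec_of_eq_sum[abs_def] by measurable

lemma norm_vec_of: "(norm (vec_of A y))\<^sup>2 = (\<Sum>i\<in>A. (y i)\<^sup>2)"
proof -
  have "(norm (vec_of A y))\<^sup>2 = (\<Sum>i\<in>UNIV. if i \<in> A then (y i)\<^sup>2 else 0)"
    unfolding power2_norm_eq_inner inner_vec_def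
    by (rule sum.cong) (auto simp: power2_eq_square)
  thus ?thesis by (simp add: sum.If_cases)
qed

interpretation lborel_prod: product_sigma_finite "\<lambda>_::'n. lborel :: real measure"
  by standard

lemma lborel_vec_eq: "lborel = distr (lebesgue_on_coords UNIV) borel (vec_of (UNIV :: 'n::finite set))"
proof (rule lborel_eqI)
  fix l u :: "real ^ 'n"
  assume "\<And>b. b \<in> Basis \<Longrightarrow> l \<bullet> b \<le> u \<bullet> b"
  hence le: "l $ i \<le> u $ i" for i
    by (metis axis_in_Basis_iff cart_eq_inner_axis norm_one Basis_real_def insertI1)
  have "emeasure (distr (lebesgue_on_coords UNIV) borel (vec_of UNIV)) (box l u)
      = emeasure (lebesgue_on_coords UNIV) (vec_of UNIV -` box l u \<inter> space (lebesgue_on_coords UNIV))"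
    by (subst emeasure_distr) auto
  also have "vec_of UNIV -` box l u \<inter> space (lebesgue_on_coords UNIV) = Pi\<^sub>E UNIV (\<lambda>i. {l $ i <..< u $ i})"
    by (auto simp: mem_box_cart space_PiM PiE_def Pi_def)
  also have "emeasure (lebesgue_on_coords UNIV) \<dots> = (\<Prod>i\<in>UNIV. emeasure lborel {l $ i <..< u $ i})"
    by (rule lborel_prod.emeasure_PiM) auto
  also have "\<dots> = (\<Prod>i\<in>UNIV. ennreal (u $ i - l $ i))"
    using le by (intro prod.cong) auto
  also have "\<dots> = ennreal (\<Prod>i\<in>UNIV. u $ i - l $ i)"
    using le by (intro prod_ennreal) auto
  also have "(\<Prod>i\<in>UNIV. u $ i - l $ i) = (\<Prod>b\<in>Basis. (u - l) \<bullet> b)"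
  proof -
    have "(\<Prod>b\<in>Basis. (u - l) \<bullet> b) = (\<Prod>b\<in>range (\<lambda>i. axis i (1::real)). (u - l) \<bullet> b)"
      by (rule prod.cong) (auto simp: Basis_vec_def)
    also have "\<dots> = (\<Prod>i\<in>UNIV. (u - l) \<bullet> axis i 1)"
      by (subst prod.reindex) (auto simp: inj_on_def axis_eq_axis)
    finally show ?thesis by (simp add: cart_eq_inner_axis[symmetric])
  qed
  finally show "emeasure (distr (lebesgue_on_coords UNIV) borel (vec_of UNIV)) (box l u) = ennreal (\<Prod>b\<in>Basis. (u - l) \<bullet> b)" .
qed simp

lemma nn_integral_lborel_vec:
  fixes h :: "real ^ 'n::finite \<Rightarrow> ennreal"
  assumes [measurable]: "h \<in> borel_measurable borel"
  shows "(\<integral>\<^sup>+x. h x \<partial>lborel) = (\<integral>\<^sup>+y. h (vec_of UNIV y) \<partial>lebesgue_on_coords UNIV)"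
  by (subst lborel_vec_eq) (simp add: nn_integral_distr)

text \<open>The two coordinates split off are the normal directions of the coordinate plane; in the
  gnomonic computation one of them carries the direction of the line, the other the direction
  towards the plane.\<close>

lemma nn_integral_lborel_split2:
  fixes h :: "real ^ 'n::finite \<Rightarrow> ennreal"
  assumes h [measurable]: "h \<in> borel_measurable borel"
    and U: "insert a (insert b K) = UNIV" and ab: "a \<noteq> b" "a \<notin> K" "b \<notin> K"
  shows "(\<integral>\<^sup>+x. h x \<partial>lborel) =
    (\<integral>\<^sup>+y. \<integral>\<^sup>+t. \<integral>\<^sup>+s. h (vec_of K y + s *\<^sub>R axis a 1 + t *\<^sub>R axis b 1) \<partial>lborel \<partial>lborel \<partial>lebesgue_on_coords K)"
proof -
  have [measurable]: "vec_of (insert a (insert b K)) \<in> borel_measurable (lebesgue_on_coords (insert a (insert b K)))"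
    by (rule vec_of_measurable)
  have eq: "vec_of (insert a (insert b K)) (y(b := t, a := s)) = vec_of K y + s *\<^sub>R axis a 1 + t *\<^sub>R axis b 1"
    for y s t using ab by (auto simp: vec_eq_iff axis_def)
  have "(\<integral>\<^sup>+x. h x \<partial>lborel) = (\<integral>\<^sup>+y. h (vec_of (insert a (insert b K)) y) \<partial>lebesgue_on_coords (insert a (insert b K)))"
    by (subst nn_integral_lborel_vec) (simp_all add: U)
  also have "\<dots> = (\<integral>\<^sup>+y. \<integral>\<^sup>+s. h (vec_of (insert a (insert b K)) (y(a := s))) \<partial>lborel \<partial>lebesgue_on_coords (insert b K))"
    using ab by (subst lborel_prod.product_nn_integral_insert) auto
  also have "\<dots> = (\<integral>\<^sup>+y. \<integral>\<^sup>+t. \<integral>\<^sup>+s. h (vec_of (insert a (insert b K)) (y(b := t, a := s))) \<partial>lborel \<partial>lborel \<partial>lebesgue_on_coords K)"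
  proof (subst lborel_prod.product_nn_integral_insert)
    have "(\<lambda>z. h (vec_of (insert a (insert b K)) ((fst z)(a := snd z)))) \<in> borel_measurable (lebesgue_on_coords (insert b K) \<Otimes>\<^sub>M lborel)"
      by measurable
    hence "(\<lambda>(y,s). h (vec_of (insert a (insert b K)) (y(a := s)))) \<in> borel_measurable (lebesgue_on_coords (insert b K) \<Otimes>\<^sub>M lborel)"
      by (simp add: case_prod_unfold)
    thus "(\<lambda>y. \<integral>\<^sup>+s. h (vec_of (insert a (insert b K)) (y(a := s))) \<partial>lborel) \<in> borel_measurable (lebesgue_on_coords (insert b K))"
      by measurable
  qed (use ab in auto)
  finally show ?thesis unfolding eq .
qed

lemma lebesgue_on_coords_affine:
  fixes A :: "'n::finite set" and c :: real
  assumes c: "c \<noteq> 0"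
  shows "density (distr (lebesgue_on_coords A) (lebesgue_on_coords A) (\<lambda>y. \<lambda>i\<in>A. t i + c * y i))
      (\<lambda>_. ennreal (\<bar>c\<bar> ^ card A)) = lebesgue_on_coords A"
proof (rule lborel_prod.PiM_eqI)
  fix E :: "'n \<Rightarrow> real set"
  assume "\<And>i. i \<in> A \<Longrightarrow> E i \<in> sets lborel"
  hence E [measurable]: "\<And>i. i \<in> A \<Longrightarrow> E i \<in> sets borel" by simp
  have m [measurable]: "(\<lambda>y. \<lambda>i\<in>A. t i + c * y i) \<in> lebesgue_on_coords A \<rightarrow>\<^sub>M lebesgue_on_coords A"
    by measurable
  have pE [measurable]: "Pi\<^sub>E A E \<in> sets (lebesgue_on_coords A)"
    by (rule sets_PiM_I_finite) (auto simp: E)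
  have "emeasure (density (distr (lebesgue_on_coords A) (lebesgue_on_coords A) (\<lambda>y. \<lambda>i\<in>A. t i + c * y i))
      (\<lambda>_. ennreal (\<bar>c\<bar> ^ card A))) (Pi\<^sub>E A E)
      = ennreal (\<bar>c\<bar> ^ card A) * emeasure (distr (lebesgue_on_coords A) (lebesgue_on_coords A) (\<lambda>y. \<lambda>i\<in>A. t i + c * y i)) (Pi\<^sub>E A E)"
    by (rule emeasure_density_const) simp
  also have "emeasure (distr (lebesgue_on_coords A) (lebesgue_on_coords A) (\<lambda>y. \<lambda>i\<in>A. t i + c * y i)) (Pi\<^sub>E A E)
     = emeasure (lebesgue_on_coords A) ((\<lambda>y. \<lambda>i\<in>A. t i + c * y i) -` Pi\<^sub>E A E \<inter> space (lebesgue_on_coords A))"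
    by (subst emeasure_distr) auto
  also have "(\<lambda>y. \<lambda>i\<in>A. t i + c * y i) -` Pi\<^sub>E A E \<inter> space (lebesgue_on_coords A) = Pi\<^sub>E A (\<lambda>i. (\<lambda>x. t i + c * x) -` E i)"
    by (auto simp: space_PiM PiE_def Pi_def)
  also have "emeasure (lebesgue_on_coords A) \<dots> = (\<Prod>i\<in>A. emeasure lborel ((\<lambda>x. t i + c * x) -` E i))"
    by (rule lborel_prod.emeasure_PiM) (auto intro!: measurable_sets_borel[OF _ E])
  also have "ennreal (\<bar>c\<bar> ^ card A) * \<dots> = (\<Prod>i\<in>A. ennreal \<bar>c\<bar> * emeasure lborel ((\<lambda>x. t i + c * x) -` E i))"
    by (simp add: prod.distrib ennreal_power)
  also have "\<dots> = (\<Prod>i\<in>A. emeasure lborel (E i))"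
  proof (rule prod.cong)
    fix i assume i: "i \<in> A"
    have [measurable]: "E i \<in> sets borel" by (rule E[OF i])
    have "emeasure lborel (E i) = emeasure (density (distr lborel borel (\<lambda>x. t i + c * x)) (\<lambda>_. ennreal \<bar>c\<bar>)) (E i)"
      using lborel_real_affine[OF c, of "t i"] by simp
    also have "\<dots> = ennreal \<bar>c\<bar> * emeasure (distr lborel borel (\<lambda>x. t i + c * x)) (E i)"
      by (rule emeasure_density_const) simp
    also have "\<dots> = ennreal \<bar>c\<bar> * emeasure lborel ((\<lambda>x. t i + c * x) -` E i)"
      by (subst emeasure_distr) auto
    finally show "ennreal \<bar>c\<bar> * emeasure lborel ((\<lambda>x. t i + c * x) -` E i) = emeasure lborel (E i)" ..
  qed simp
  finally show "emeasure (density (distr (lebesgue_on_coords A) (lebesgue_on_coords A) (\<lambda>y. \<lambda>i\<in>A. t i + c * y i))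
      (\<lambda>_. ennreal (\<bar>c\<bar> ^ card A))) (Pi\<^sub>E A E) = (\<Prod>i\<in>A. emeasure lborel (E i))" .
qed simp_all

lemma nn_integral_coords_affine:
  fixes A :: "'n::finite set" and c :: real
  assumes c: "c \<noteq> 0" and h [measurable]: "h \<in> borel_measurable borel"
  shows "(\<integral>\<^sup>+y. h (vec_of A y) \<partial>lebesgue_on_coords A)
     = ennreal (\<bar>c\<bar> ^ card A) * (\<integral>\<^sup>+y. h (vec_of A t + c *\<^sub>R vec_of A y) \<partial>lebesgue_on_coords A)"
proof -
  have eq: "vec_of A (\<lambda>i\<in>A. t i + c * y i) = vec_of A t + c *\<^sub>R vec_of A y" for y
    by (auto simp: vec_eq_iff)
  have "(\<integral>\<^sup>+y. h (vec_of A y) \<partial>lebesgue_on_coords A)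
     = (\<integral>\<^sup>+y. h (vec_of A y) \<partial>density (distr (lebesgue_on_coords A) (lebesgue_on_coords A) (\<lambda>y. \<lambda>i\<in>A. t i + c * y i))
      (\<lambda>_. ennreal (\<bar>c\<bar> ^ card A)))"
    by (simp add: lebesgue_on_coords_affine[OF c])
  also have "\<dots> = ennreal (\<bar>c\<bar> ^ card A) * (\<integral>\<^sup>+y. h (vec_of A y) \<partial>distr (lebesgue_on_coords A) (lebesgue_on_coords A) (\<lambda>y. \<lambda>i\<in>A. t i + c * y i))"
    by (subst nn_integral_density) (auto simp: nn_integral_cmult)
  also have "(\<integral>\<^sup>+y. h (vec_of A y) \<partial>distr (lebesgue_on_coords A) (lebesgue_on_coords A) (\<lambda>y. \<lambda>i\<in>A. t i + c * y i))
     = (\<integral>\<^sup>+y. h (vec_of A (\<lambda>i\<in>A. t i + c * y i)) \<partial>lebesgue_on_coords A)"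
    by (subst nn_integral_distr) auto
  finally show ?thesis unfolding eq .
qed

text \<open>Half the area of the unit sphere in dimension \<open>k\<close>: with \<open>v\<close>
  the squared radius, \<open>r ^ (k - 1) dr\<close> becomes
  \<open>v powr (k / 2 - 1) dv / 2\<close>.\<close>

definition radial_const :: "real \<Rightarrow> real" where
  "radial_const k = pi powr (k / 2) / Gamma (k / 2)"

lemma radial_const_pos: "k > 0 \<Longrightarrow> radial_const k > 0"
  by (simp add: radial_const_def)

text \<open>Both sides give the half-line up to \<open>x > 0\<close> the volume of the ball of
  radius \<open>sqrt x\<close>, and the half-lines determine a Borel measure.\<close>

lemma distr_sum_squares:
  fixes A :: "'n::finite set"
  assumes A: "A \<noteq> {}"
  shows "distr (lebesgue_on_coords A) borel (\<lambda>y. \<Sum>i\<in>A. (y i)\<^sup>2) =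
    density lborel (\<lambda>v. ennreal (radial_const (real (card A)) * v powr (real (card A) / 2 - 1)) * indicator {0<..} v)"
    (is "?M = ?N")
proof -
  define k where "k = card A"
  have k: "k > 0" using A by (simp add: k_def card_gt_0_iff)
  have N: "emeasure ?N {..x} = ennreal (unit_ball_vol (real k) * x powr (real k / 2))" if x: "x \<ge> 0" for x
  proof -
    have hi: "((\<lambda>v. v powr (real k / 2 - 1)) has_integral x powr (real k / 2) / (real k / 2)) {0..x}"
      using has_integral_powr_from_0[of "real k / 2 - 1" x] k x by simp
    have "emeasure ?N {..x} = (\<integral>\<^sup>+v. ennreal (radial_const (real k) * v powr (real k / 2 - 1)) * indicator {0<..} v * indicator {..x} v \<partial>lborel)"
      by (subst emeasure_density) (auto simp: k_def)
    also have "\<dots> = (\<integral>\<^sup>+v. ennreal (radial_const (real k)) * ennreal (v powr (real k / 2 - 1) * indicator {0..x} v) \<partial>lborel)"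
    proof (rule nn_integral_cong_AE)
      have "AE v::real in lborel. v \<noteq> 0" by (rule AE_lborel_singleton)
      thus "AE v in lborel. ennreal (radial_const (real k) * v powr (real k / 2 - 1)) * indicator {0<..} v * indicator {..x} v
         = ennreal (radial_const (real k)) * ennreal (v powr (real k / 2 - 1) * indicator {0..x} v)"
      proof eventually_elim
        case (elim v)
        have "ennreal (radial_const (real k) * v powr (real k / 2 - 1)) =
            ennreal (radial_const (real k)) * ennreal (v powr (real k / 2 - 1))"
          using k radial_const_pos[of "real k"] by (intro ennreal_mult) auto
        thus ?case using elim by (auto simp: indicator_def)
      qed
    qed
    also have "\<dots> = ennreal (radial_const (real k)) * (\<integral>\<^sup>+v. ennreal (v powr (real k / 2 - 1) * indicator {0..x} v) \<partial>lborel)"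
      by (rule nn_integral_cmult) auto
    also have "(\<integral>\<^sup>+v. ennreal (v powr (real k / 2 - 1) * indicator {0..x} v) \<partial>lborel) = ennreal (x powr (real k / 2) / (real k / 2))"
      using nn_integral_has_integral_lebesgue[OF _ hi] by (simp add: mult.commute)
    also have "ennreal (radial_const (real k)) * \<dots> = ennreal (radial_const (real k) * (x powr (real k / 2) / (real k / 2)))"
      using k by (subst ennreal_mult') (auto intro!: less_imp_le[OF radial_const_pos])
    also have "radial_const (real k) * (x powr (real k / 2) / (real k / 2)) = unit_ball_vol (real k) * x powr (real k / 2)"
      proof -
      have "real k / 2 \<notin> \<int>\<^sub>\<le>\<^sub>0" using k by (auto elim!: nonpos_Ints_cases)
      hence G: "Gamma (real k / 2 + 1) = real k / 2 * Gamma (real k / 2)" by (rule Gamma_plus1)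
      show ?thesis unfolding radial_const_def unit_ball_vol_def G by (simp add: mult_ac)
    qed
    finally show ?thesis .
  qed
  have M: "emeasure ?M {..x} = ennreal (unit_ball_vol (real k) * x powr (real k / 2))" if x: "x > 0" for x
  proof -
    have "emeasure ?M {..x} = emeasure (lebesgue_on_coords A) ((\<lambda>y. \<Sum>i\<in>A. (y i)\<^sup>2) -` {..x} \<inter> space (lebesgue_on_coords A))"
      by (subst emeasure_distr) auto
    also have "(\<lambda>y. \<Sum>i\<in>A. (y i)\<^sup>2) -` {..x} \<inter> space (lebesgue_on_coords A) =
       {f. sqrt (\<Sum>i\<in>A. (f i)\<^sup>2) \<le> sqrt x} \<inter> space (lebesgue_on_coords A)" by auto
    also have "emeasure (lebesgue_on_coords A) \<dots> = ennreal (unit_ball_vol (real k) * sqrt x ^ k)"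
      unfolding k_def by (rule emeasure_cball_aux) (use x in auto)
    also have "sqrt x ^ k = x powr (real k / 2)"
      using x by (simp add: powr_half_sqrt[symmetric] powr_realpow[symmetric] powr_powr)
    finally show ?thesis .
  qed
  \<comment> \<open>The ball formula needs a positive radius; at \<open>0\<close> the mass is
    squeezed by the half-lines up to \<open>1 / (j + 1)\<close>.\<close>
  have M0: "emeasure ?M {..0} = 0"
  proof -
    have "emeasure ?M {..0} \<le> ennreal (unit_ball_vol (real k) * inverse (real (Suc j)) powr (real k / 2))" for j
      using M[of "inverse (real (Suc j))"] emeasure_mono[of "{..0}" "{..inverse (real (Suc j))}" ?M]
      by (auto simp del: of_nat_Suc)
    moreover have "(\<lambda>j. ennreal (unit_ball_vol (real k) * inverse (real (Suc j)) powr (real k / 2))) \<longlonglongrightarrow> ennreal (unit_ball_vol (real k) * 0 powr (real k / 2))"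
      by (intro tendsto_ennrealI tendsto_mult tendsto_const tendsto_powr2 LIMSEQ_inverse_real_of_nat) (use k in auto)
    ultimately have "emeasure ?M {..0} \<le> ennreal (unit_ball_vol (real k) * 0 powr (real k / 2))"
      by (intro LIMSEQ_le_const) auto
    thus ?thesis using k by simp
  qed
  have eq: "emeasure ?M {..x} = emeasure ?N {..x}" for x
  proof (cases "x > 0")
    case False
    have "emeasure ?M {..x} \<le> emeasure ?M {..0}" "emeasure ?N {..x} \<le> emeasure ?N {..0}"
      using False by (auto intro!: emeasure_mono)
    thus ?thesis using M0 N[of 0] k by simp
  qed (simp add: N M)
  show ?thesis
  proof (rule measure_eqI_generator_eq[where E="range atMost" and \<Omega>=UNIV and A="\<lambda>i. {..real i}"])
    show "Int_stable (range atMost :: real set set)"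
      by (auto simp: Int_stable_def)
    show "sets ?M = sigma_sets UNIV (range atMost)" "sets ?N = sigma_sets UNIV (range atMost)"
      by (simp_all add: borel_eq_atMost)
    show "(\<Union>i. {..real i}) = UNIV" using real_arch_simple by auto
    show "emeasure ?M {..real i} \<noteq> \<infinity>" for i
      using eq[of "real i"] N[of "real i"] by simp
    show "\<And>X. X \<in> range atMost \<Longrightarrow> emeasure ?M X = emeasure ?N X" using eq by auto
  qed auto
qed

lemma nn_integral_coords_radial:
  fixes A :: "'n::finite set"
  assumes A: "A \<noteq> {}" and h [measurable]: "h \<in> borel_measurable borel"
  shows "(\<integral>\<^sup>+y. h ((norm (vec_of A y))\<^sup>2) \<partial>lebesgue_on_coords A) =
    (\<integral>\<^sup>+v. ennreal (radial_const (real (card A)) * v powr (real (card A) / 2 - 1)) * indicator {0<..} v * h v \<partial>lborel)"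
proof -
  have "(\<integral>\<^sup>+y. h ((norm (vec_of A y))\<^sup>2) \<partial>lebesgue_on_coords A)
     = (\<integral>\<^sup>+v. h v \<partial>distr (lebesgue_on_coords A) borel (\<lambda>y. \<Sum>i\<in>A. (y i)\<^sup>2))"
    by (subst nn_integral_distr) (auto simp: norm_vec_of)
  thus ?thesis unfolding distr_sum_squares[OF A] by (simp add: nn_integral_density)
qed

lemma nn_integral_lborel_radial:
  fixes h :: "real \<Rightarrow> ennreal"
  assumes [measurable]: "h \<in> borel_measurable borel"
  shows "(\<integral>\<^sup>+y. h ((norm (y :: real ^ 'n::finite))\<^sup>2) \<partial>lborel) =
    (\<integral>\<^sup>+v. ennreal (radial_const (real CARD('n)) * v powr (real CARD('n) / 2 - 1)) * indicator {0<..} v * h v \<partial>lborel)"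
  using nn_integral_coords_radial[OF UNIV_not_empty assms] by (subst nn_integral_lborel_vec) simp_all

text \<open>The radial formula for a one-element index set, taken from the type \<open>1\<close>;
  the constant disappears because \<open>Gamma (1 / 2) = sqrt pi\<close>.\<close>

lemma nn_integral_real_even:
  fixes h :: "real \<Rightarrow> ennreal"
  assumes [measurable]: "h \<in> borel_measurable borel"
  shows "(\<integral>\<^sup>+s. h (s\<^sup>2) \<partial>lborel) = (\<integral>\<^sup>+v. ennreal (v powr (- 1 / 2)) * indicator {0<..} v * h v \<partial>lborel)"
proof -
  have "(\<integral>\<^sup>+s. h (s\<^sup>2) \<partial>lborel) = (\<integral>\<^sup>+y. h ((y undefined)\<^sup>2) \<partial>lebesgue_on_coords {undefined :: 1})"
    by (subst lborel_prod.product_nn_integral_singleton[symmetric]) auto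
  also have "\<dots> = (\<integral>\<^sup>+y. h ((norm (vec_of {undefined :: 1} y))\<^sup>2) \<partial>lebesgue_on_coords {undefined :: 1})"
    by (simp add: norm_vec_of)
  also have "\<dots> = (\<integral>\<^sup>+v. ennreal (v powr (- 1 / 2)) * indicator {0<..} v * h v \<partial>lborel)"
    using nn_integral_coords_radial[of "{undefined :: 1}" h]
    by (simp add: radial_const_def Gamma_one_half_real powr_half_sqrt)
  finally show ?thesis .
qed

lemma nn_integral_powr_exp:
  assumes x: "x > 0" and c: "c > (0::real)"
  shows "(\<integral>\<^sup>+t. ennreal (t powr (x - 1) * exp (- c * t)) * indicator {0<..} t \<partial>lborel) = ennreal (Gamma x * c powr (- x))"
proof -
  have "ennreal (Gamma x) = (\<integral>\<^sup>+t. ennreal (indicator {0..} t * t powr (x - 1) / exp t) \<partial>lborel)"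
    by (rule Gamma_conv_nn_integral_real[OF x])
  also have "\<dots> = ennreal \<bar>c\<bar> * (\<integral>\<^sup>+t. ennreal (indicator {0..} (0 + c * t) * (0 + c * t) powr (x - 1) / exp (0 + c * t)) \<partial>lborel)"
    by (rule nn_integral_real_affine) (use c in auto)
  also have "\<dots> = (\<integral>\<^sup>+t. ennreal \<bar>c\<bar> * ennreal (indicator {0..} (0 + c * t) * (0 + c * t) powr (x - 1) / exp (0 + c * t)) \<partial>lborel)"
    by (rule nn_integral_cmult[symmetric]) auto
  also have "\<dots> = (\<integral>\<^sup>+t. ennreal (c powr x) * (ennreal (t powr (x - 1) * exp (- c * t)) * indicator {0<..} t) \<partial>lborel)"
  proof (rule nn_integral_cong_AE)
    have "AE t::real in lborel. t \<noteq> 0" by (rule AE_lborel_singleton)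
    thus "AE t in lborel. ennreal \<bar>c\<bar> * ennreal (indicator {0..} (0 + c * t) * (0 + c * t) powr (x - 1) / exp (0 + c * t))
       = ennreal (c powr x) * (ennreal (t powr (x - 1) * exp (- c * t)) * indicator {0<..} t)"
    proof eventually_elim
      case (elim t)
      show ?case
      proof (cases "t > 0")
        case True
        have "\<bar>c\<bar> * (indicator {0..} (0 + c * t) * (0 + c * t) powr (x - 1) / exp (0 + c * t)) = c powr x * (t powr (x - 1) * exp (- c * t))"
          using True c by (simp add: powr_mult powr_diff exp_minus field_simps)
        thus ?thesis using True c by (simp add: ennreal_mult'[symmetric])
      next
        case False
        with elim have "t < 0" by simp
        hence "\<not> 0 \<le> c * t" using c by (simp add: zero_le_mult_iff)
        thus ?thesis using False by simp
      qed
    qed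
  qed
  also have "\<dots> = ennreal (c powr x) * (\<integral>\<^sup>+t. ennreal (t powr (x - 1) * exp (- c * t)) * indicator {0<..} t \<partial>lborel)"
    by (rule nn_integral_cmult) auto
  finally have e: "ennreal (Gamma x) = ennreal (c powr x) * (\<integral>\<^sup>+t. ennreal (t powr (x - 1) * exp (- c * t)) * indicator {0<..} t \<partial>lborel)" .
  have "ennreal (Gamma x * c powr (- x)) = ennreal (c powr (- x)) * ennreal (Gamma x)"
    by (subst ennreal_mult'[symmetric]) (simp_all add: mult.commute)
  also have "\<dots> = ennreal (c powr (- x)) * ennreal (c powr x) * (\<integral>\<^sup>+t. ennreal (t powr (x - 1) * exp (- c * t)) * indicator {0<..} t \<partial>lborel)"
    unfolding e by (simp add: mult.assoc)
  also have "ennreal (c powr (- x)) * ennreal (c powr x) = 1"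
    using c by (subst ennreal_mult'[symmetric]) (simp_all add: powr_add[symmetric])
  finally show ?thesis by simp
qed

lemma nn_integral_gauss_moment:
  fixes q :: real
  assumes q: "q > 0"
  shows "(\<integral>\<^sup>+s. ennreal (\<bar>s\<bar> ^ j * exp (- q * s\<^sup>2)) \<partial>lborel) =
    ennreal (Gamma ((real j + 1) / 2) * q powr (- (real j + 1) / 2))"
proof -
  have e: "\<bar>s\<bar> ^ j = (s\<^sup>2) powr (real j / 2)" if "s \<noteq> 0" for s :: real
  proof -
    have "(s\<^sup>2) powr (real j / 2) = (\<bar>s\<bar> powr 2) powr (real j / 2)" using that by simp
    also have "\<dots> = \<bar>s\<bar> powr real j" unfolding powr_powr by simp
    finally show ?thesis using that by (simp add: powr_realpow)
  qed
  have "(\<integral>\<^sup>+s. ennreal (\<bar>s\<bar> ^ j * exp (- q * s\<^sup>2)) \<partial>lborel)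
    = (\<integral>\<^sup>+s. ennreal ((s\<^sup>2) powr (real j / 2) * exp (- q * s\<^sup>2)) \<partial>lborel)"
  proof (rule nn_integral_cong_AE)
    have "AE t::real in lborel. t \<noteq> 0" by (rule AE_lborel_singleton)
    thus "AE s in lborel. ennreal (\<bar>s\<bar> ^ j * exp (- q * s\<^sup>2)) = ennreal ((s\<^sup>2) powr (real j / 2) * exp (- q * s\<^sup>2))"
      by eventually_elim (simp add: e)
  qed
  also have "\<dots> = (\<integral>\<^sup>+v. ennreal (v powr (- 1 / 2)) * indicator {0<..} v * ennreal (v powr (real j / 2) * exp (- q * v)) \<partial>lborel)"
    by (rule nn_integral_real_even) auto
  also have "\<dots> = (\<integral>\<^sup>+v. ennreal (v powr ((real j + 1) / 2 - 1) * exp (- q * v)) * indicator {0<..} v \<partial>lborel)"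
  proof (rule nn_integral_cong)
    fix v :: real
    have "v powr (- 1 / 2) * (v powr (real j / 2) * exp (- q * v)) = v powr ((real j + 1) / 2 - 1) * exp (- q * v)" if "v > 0"
    proof -
      have "v powr (- 1 / 2) * v powr (real j / 2) = v powr ((real j + 1) / 2 - 1)"
        by (subst powr_add[symmetric]) (simp add: field_simps)
      thus ?thesis by (simp add: mult.assoc[symmetric])
    qed
    thus "ennreal (v powr (- 1 / 2)) * indicator {0<..} v * ennreal (v powr (real j / 2) * exp (- q * v))
      = ennreal (v powr ((real j + 1) / 2 - 1) * exp (- q * v)) * indicator {0<..} v"
      by (auto simp: indicator_def ennreal_mult'[symmetric])
  qed
  also have "\<dots> = ennreal (Gamma ((real j + 1) / 2) * q powr (- ((real j + 1) / 2)))"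
    by (rule nn_integral_powr_exp) (use q in auto)
  finally show ?thesis by (simp add: minus_divide_left)
qed

section \<open>The Gaussian model of the invariant measure on spheres\<close>

text \<open>The reflection in the hyperplane orthogonal to \<open>z - y\<close> exchanges the two
  vectors, because they have equal norm. It moves every vector by a multiple of
  \<open>z - y\<close>, an element of \<open>V\<close>, and so preserves \<open>V\<close>; for
  \<open>y = z\<close> it is the identity.\<close>

lemma reflection_exists:
  fixes y z :: "'a::euclidean_space"
  assumes V: "subspace V" and yz: "y \<in> V" "z \<in> V" "norm y = norm z"
  obtains T where "orthogonal_transformation T" "T ` V = V" "T z = y"
proof -
  define w where "w = z - y"
  define T where "T x = x - (2 * (x \<bullet> w) / (w \<bullet> w)) *\<^sub>R w" for x
  have lin: "linear T"
    unfolding T_def by (rule linearI) (auto simp: algebra_simps inner_add_left add_divide_distrib)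
  have nrm: "norm (T x) = norm x" for x
  proof (cases "w = 0")
    case False
    have "T x \<bullet> T x = x \<bullet> x - 4 * (x \<bullet> w)\<^sup>2 / (w \<bullet> w) + (2 * (x \<bullet> w) / (w \<bullet> w))\<^sup>2 * (w \<bullet> w)"
      unfolding T_def by (simp add: inner_diff_left inner_diff_right inner_commute power2_eq_square algebra_simps)
    also have "\<dots> = x \<bullet> x" using False by (simp add: power2_eq_square field_simps)
    finally show ?thesis by (simp add: norm_eq_sqrt_inner)
  qed (simp add: T_def)
  have orth: "orthogonal_transformation T" using lin nrm by (simp add: orthogonal_transformation)
  have wV: "w \<in> V" using yz V by (simp add: w_def subspace_diff)
  have TV: "T x \<in> V" if "x \<in> V" for x
    using that wV V by (simp add: T_def subspace_diff subspace_scale)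
  have inv: "T (T x) = x" for x
  proof (cases "w = 0")
    case False
    have "T x \<bullet> w = - (x \<bullet> w)" using False by (simp add: T_def inner_diff_left)
    thus ?thesis using False by (simp add: T_def[of "T x"]) (simp add: T_def)
  qed (simp add: T_def)
  have "T ` V = V" using TV inv by (metis (no_types, lifting) image_subset_iff rev_image_eqI subsetI subset_antisym)
  moreover have "T z = y"
  proof (cases "w = 0")
    case False
    have "z \<bullet> z = y \<bullet> y" using yz(3) by (simp add: norm_eq_sqrt_inner)
    hence "w \<bullet> w = 2 * (z \<bullet> w)" by (simp add: w_def inner_diff_left inner_diff_right inner_commute)
    hence "2 * (z \<bullet> w) / (w \<bullet> w) = (w \<bullet> w) / (w \<bullet> w)" by (simp only:)
    also have "\<dots> = 1" using False by simp
    finally have "T z = z - 1 *\<^sub>R w" unfolding T_def by (simp only:)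
    thus ?thesis by (simp add: w_def)
  qed (simp add: T_def w_def)
  ultimately show ?thesis using that orth by blast
qed

text \<open>Reflections preserving \<open>V\<close> act transitively on its unit sphere, so
  invariance makes the mass of a ball centred on the sphere depend on the radius only. The measures
  live on a restricted sigma-algebra and are pushed to \<open>borel\<close> by \<open>id\<close>,
  where the ball criterion is stated.\<close>

lemma invariant_sphere_prob_unique:
  fixes V :: "(real ^ 'n) set"
  assumes V: "subspace V" and M: "invariant_sphere_prob V M" and N: "invariant_sphere_prob V N"
  shows "M = N"
proof -
  define S where "S = sphere 0 1 \<inter> V"
  have cS: "compact S" unfolding S_def using V by (intro compact_Int_closed closed_subspace) auto
  have Sb: "S \<in> sets borel" using cS by (intro borel_closed compact_imp_closed)
  have props: "sets (distr L borel id) = sets borel \<and> prob_space (distr L borel id) \<and> (AE x in distr L borel id. x \<in> S) \<and>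
      (\<forall>y z r. y \<in> S \<and> z \<in> S \<and> 0 < r \<longrightarrow> emeasure (distr L borel id) (ball y r) = emeasure (distr L borel id) (ball z r)) \<and>
      (\<forall>A\<in>sets L. A \<in> sets borel \<and> emeasure L A = emeasure (distr L borel id) A)"
    if L: "invariant_sphere_prob V L" for L
  proof -
    have sL: "sets L = sets (restrict_space borel S)" and pL: "prob_space L"
      and inv: "\<And>T. orthogonal_transformation T \<Longrightarrow> T ` V = V \<Longrightarrow> distr L L T = L"
      using L by (auto simp: invariant_sphere_prob_def S_def)
    have spL: "space L = S" using sets_eq_imp_space_eq[OF sL] by (simp add: space_restrict_space)
    have idm [measurable]: "id \<in> borel_measurable L"
      unfolding measurable_cong_sets[OF sL refl] by (intro measurable_restrict_space1) auto
    have Lb: "A \<in> sets borel \<and> A \<subseteq> S" if "A \<in> sets L" for A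
      using that Sb unfolding sL by (auto simp: sets_restrict_space)
    have em: "emeasure (distr L borel id) A = emeasure L (A \<inter> S)" if "A \<in> sets borel" for A
      using that by (subst emeasure_distr) (auto simp: spL)
    have "emeasure (distr L borel id) (ball y r) = emeasure (distr L borel id) (ball z r)" if yz: "y \<in> S" "z \<in> S" and "0 < r" for y z r
    proof -
      obtain T where T: "orthogonal_transformation T" "T ` V = V" "T z = y"
        using reflection_exists[OF V, of y z] yz by (auto simp: S_def)
      have TS: "T x \<in> S \<longleftrightarrow> x \<in> S" for x
      proof -
        have "T x \<in> V \<longleftrightarrow> x \<in> V"
          using inj_image_mem_iff[OF orthogonal_transformation_inj[OF T(1)], of x V] T(2) by simp
        thus ?thesis by (simp add: S_def orthogonal_transformation_norm[OF T(1)])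
      qed
      have Tm [measurable]: "T \<in> L \<rightarrow>\<^sub>M L"
        unfolding measurable_cong_sets[OF sL sL]
        using orthogonal_transformation_measurable[OF T(1)] TS
        by (intro measurable_restrict_space3) auto
      have bL: "ball y r \<inter> S \<in> sets L" for y
        unfolding sL by (auto simp: sets_restrict_space)
      have "emeasure L (ball y r \<inter> S) = emeasure (distr L L T) (ball y r \<inter> S)"
        by (simp add: inv[OF T(1,2)])
      also have "\<dots> = emeasure L (T -` (ball y r \<inter> S) \<inter> space L)"
        by (rule emeasure_distr[OF Tm bL])
      also have "T -` (ball y r \<inter> S) \<inter> space L = ball z r \<inter> S"
        using orthogonal_transformation_vimage_ball[OF T(1,3), of r] TS by (auto simp: spL)
      finally show ?thesis by (simp add: em)
    qed
    moreover have "AE x in distr L borel id. x \<in> S"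
      by (subst AE_distr_iff) (auto simp: Sb spL intro!: AE_I2)
    moreover have "emeasure L A = emeasure (distr L borel id) A" if "A \<in> sets L" for A
      using Lb[OF that] by (simp add: em inf_absorb1)
    ultimately show ?thesis using prob_space.prob_space_distr[OF pL idm] Lb by auto
  qed
  have "distr M borel id = distr N borel id"
    using props[OF M] props[OF N] by (intro measure_eq_of_uniform_balls_prob[OF _ _ _ _ _ _ cS]) blast+
  moreover have "sets M = sets N" using M N by (simp add: invariant_sphere_prob_def)
  ultimately show ?thesis using props[OF M] props[OF N] by (intro measure_eqI) auto
qed

lemma sphere_prob_eq:
  assumes "subspace V" "invariant_sphere_prob V M"
  shows "sphere_prob V = M"
  unfolding sphere_prob_def
  by (rule the_equality) (use assms invariant_sphere_prob_unique in blast)+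

text \<open>Variance 1/2 per coordinate instead of 1: the exponent is then exactly the squared norm,
  the variable of all radial formulas.\<close>

definition gauss :: "(real ^ 'n) measure" where
  "gauss = density lborel (\<lambda>x. ennreal (pi powr (- real CARD('n) / 2) * exp (- (norm x)\<^sup>2)))"

lemma sets_gauss [simp, measurable_cong]: "sets gauss = sets borel"
  by (simp add: gauss_def)

lemma space_gauss [simp]: "space gauss = UNIV"
  by (simp add: gauss_def)

lemma nn_integral_gauss:
  assumes [measurable]: "h \<in> borel_measurable borel"
  shows "(\<integral>\<^sup>+x. h x \<partial>gauss) = (\<integral>\<^sup>+x. ennreal (pi powr (- real CARD('n) / 2) * exp (- (norm (x :: real ^ 'n))\<^sup>2)) * h x \<partial>lborel)"
  unfolding gauss_def by (subst nn_integral_density) auto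

lemma prob_space_gauss: "prob_space (gauss :: (real ^ 'n) measure)"
proof
  let ?n = "real CARD('n)"
  have "emeasure (gauss :: (real ^ 'n) measure) UNIV = (\<integral>\<^sup>+x. 1 \<partial>(gauss :: (real ^ 'n) measure))"
    by simp
  also have "\<dots> = (\<integral>\<^sup>+(x::real^'n). ennreal (pi powr (- ?n / 2) * exp (- (norm x)\<^sup>2)) \<partial>lborel)"
    by (subst nn_integral_gauss) auto
  also have "\<dots> = (\<integral>\<^sup>+v. ennreal (radial_const ?n * v powr (?n / 2 - 1)) * indicator {0<..} v * ennreal (pi powr (- ?n / 2) * exp (- v)) \<partial>lborel)"
    by (rule nn_integral_lborel_radial) auto
  also have "\<dots> = (\<integral>\<^sup>+v. ennreal (radial_const ?n * pi powr (- ?n / 2)) * (ennreal (v powr (?n / 2 - 1) * exp (- 1 * v)) * indicator {0<..} v) \<partial>lborel)"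
  proof (rule nn_integral_cong)
    fix v :: real
    have "radial_const ?n \<ge> 0" by (rule less_imp_le[OF radial_const_pos]) simp
    thus "ennreal (radial_const ?n * v powr (?n / 2 - 1)) * indicator {0<..} v * ennreal (pi powr (- ?n / 2) * exp (- v))
      = ennreal (radial_const ?n * pi powr (- ?n / 2)) * (ennreal (v powr (?n / 2 - 1) * exp (- 1 * v)) * indicator {0<..} v)"
      by (auto simp: indicator_def ennreal_mult'[symmetric] mult_ac)
  qed
  also have "\<dots> = ennreal (radial_const ?n * pi powr (- ?n / 2)) * (\<integral>\<^sup>+v. ennreal (v powr (?n / 2 - 1) * exp (- 1 * v)) * indicator {0<..} v \<partial>lborel)"
    by (rule nn_integral_cmult) auto
  also have "\<dots> = ennreal (radial_const ?n * pi powr (- ?n / 2)) * ennreal (Gamma (?n / 2) * 1 powr (- (?n / 2)))"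
    by (subst nn_integral_powr_exp) auto
  also have "\<dots> = ennreal (radial_const ?n * pi powr (- ?n / 2) * Gamma (?n / 2))"
    by (subst ennreal_mult'[symmetric]) (auto intro!: mult_nonneg_nonneg less_imp_le[OF Gamma_real_pos] less_imp_le[OF radial_const_pos])
  also have "radial_const ?n * pi powr (- ?n / 2) * Gamma (?n / 2) = 1"
  proof -
    have "Gamma (?n / 2) \<noteq> 0" by (rule less_imp_neq[OF Gamma_real_pos, symmetric]) simp
    moreover have "pi powr (?n / 2) * pi powr (- ?n / 2) = 1" by (simp add: powr_add[symmetric])
    ultimately show ?thesis by (simp add: radial_const_def)
  qed
  finally show "emeasure (gauss :: (real ^ 'n) measure) (space gauss) = 1" by simp
qed

lemma distr_gauss_orthogonal:
  assumes T: "orthogonal_transformation (T :: real ^ 'n \<Rightarrow> real ^ 'n)"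
  shows "distr gauss borel T = gauss"
proof (rule measure_eqI)
  fix A assume "A \<in> sets (distr gauss borel T)"
  hence A [measurable]: "A \<in> sets borel" by simp
  note [measurable] = orthogonal_transformation_measurable[OF T]
  have "emeasure (distr gauss borel T) A = (\<integral>\<^sup>+x. indicator A x \<partial>distr gauss borel T)"
    by simp
  also have "\<dots> = (\<integral>\<^sup>+x. indicator A (T x) \<partial>gauss)"
    by (subst nn_integral_distr) auto
  also have "\<dots> = (\<integral>\<^sup>+x. ennreal (pi powr (- real CARD('n) / 2) * exp (- (norm (T x))\<^sup>2)) * indicator A (T x) \<partial>lborel)"
    by (subst nn_integral_gauss) (auto simp: orthogonal_transformation_norm[OF T])
  also have "\<dots> = (\<integral>\<^sup>+x. ennreal (pi powr (- real CARD('n) / 2) * exp (- (norm x)\<^sup>2)) * indicator A x \<partial>lborel)"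
    by (rule nn_integral_lborel_orthogonal[OF T]) auto
  also have "\<dots> = emeasure gauss A"
    by (subst nn_integral_gauss[symmetric]) auto
  finally show "emeasure (distr gauss borel T) A = emeasure gauss A" .
qed simp

lemma AE_gauss_inner_nonzero:
  assumes "v \<noteq> (0 :: real ^ 'n)"
  shows "AE x in gauss. x \<bullet> v \<noteq> 0"
proof -
  have "negligible {x. v \<bullet> x = 0}" using assms by (intro negligible_hyperplane) auto
  moreover have "{x. v \<bullet> x = 0} \<in> sets borel" by (intro borel_closed closed_hyperplane)
  ultimately have "{x. v \<bullet> x = 0} \<in> null_sets lborel"
    by (auto simp: negligible_iff_null_sets null_sets_completion_iff)
  hence "AE x in lborel. x \<notin> {x. v \<bullet> x = 0}" by (rule AE_not_in)
  hence "AE x in lborel. x \<bullet> v \<noteq> 0" by eventually_elim (auto simp: inner_commute)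
  thus ?thesis unfolding gauss_def by (subst AE_density) auto
qed

text \<open>The case \<open>\<omega> = 0\<close> covers the sphere of the whole space.\<close>

lemma invariant_sphere_prob_gauss:
  fixes \<omega> :: "real ^ 'n"
  assumes w: "norm \<omega> = 1 \<or> \<omega> = 0" and n: "CARD('n) \<ge> 2"
  shows "\<exists>s. s \<in> gauss \<rightarrow>\<^sub>M restrict_space borel (sphere 0 1 \<inter> orthogonal_comp {\<omega>}) \<and>
    (AE x in gauss. s x = sgn (x - (x \<bullet> \<omega>) *\<^sub>R \<omega>)) \<and>
    invariant_sphere_prob (orthogonal_comp {\<omega>}) (distr gauss (restrict_space borel (sphere 0 1 \<inter> orthogonal_comp {\<omega>})) s)"
proof -
  define V where "V = orthogonal_comp {\<omega>}"
  define R where "R = restrict_space borel (sphere 0 1 \<inter> V)"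
  define P where "P x = x - (x \<bullet> \<omega>) *\<^sub>R \<omega>" for x :: "real ^ 'n"
  have memV: "x \<in> V \<longleftrightarrow> x \<bullet> \<omega> = 0" for x
    by (simp add: V_def orthogonal_comp_def orthogonal_def inner_commute)
  have PV: "P x \<in> V" for x
    using w by (auto simp: memV P_def inner_diff_left norm_eq_sqrt_inner)
  have Pid: "P x = x" if "x \<in> V" for x using that by (simp add: memV P_def)
  have Plin: "linear P"
    unfolding P_def by (rule linearI) (auto simp: algebra_simps inner_add_left)
  obtain v :: "real ^ 'n" where v: "v \<noteq> 0" "orthogonal \<omega> v"
    using vector_choose_size orthogonal_to_vector_exists[of \<omega>] n by auto
  define v0 where "v0 = v /\<^sub>R norm v"
  have v0: "norm v0 = 1" "v0 \<in> V" "\<omega> \<bullet> v0 = 0" using v by (auto simp: v0_def memV orthogonal_def inner_commute)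
  \<comment> \<open>The normalised projection is undefined where \<open>P x = 0\<close>; the default
    \<open>v0\<close>, a unit vector of \<open>V\<close> that exists because \<open>n >= 2\<close>,
    keeps the range of \<open>s\<close> inside the sphere everywhere.\<close>
  define s where "s x = (if P x = 0 then v0 else P x /\<^sub>R norm (P x))" for x
  have sS: "s x \<in> sphere 0 1 \<inter> V" for x
    using v0 PV[of x] by (auto simp: s_def memV)
  have Pm [measurable]: "P \<in> borel_measurable borel"
    unfolding P_def by measurable
  have sm': "s \<in> borel_measurable borel"
    unfolding s_def by measurable
  have sm [measurable]: "s \<in> gauss \<rightarrow>\<^sub>M R"
    unfolding R_def using sm' sS by (intro measurable_restrict_space2) auto
  have ae: "AE x in gauss. P x \<noteq> 0"
  proof -
    have "v0 \<noteq> 0" using v0 by auto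
    from AE_gauss_inner_nonzero[OF this] show ?thesis
    proof eventually_elim
      case (elim x)
      have "P x \<bullet> v0 = x \<bullet> v0" by (simp add: P_def inner_diff_left v0(3))
      thus ?case using elim by auto
    qed
  qed
  have ae': "AE x in gauss. s x = sgn (P x)"
    using ae by eventually_elim (auto simp: s_def sgn_div_norm)
  have inv: "invariant_sphere_prob V (distr gauss R s)"
    unfolding invariant_sphere_prob_def
  proof (intro conjI allI impI; (elim conjE)?)
    show "sets (distr gauss R s) = sets (restrict_space borel (sphere 0 1 \<inter> V))" by (simp add: R_def)
    show "prob_space (distr gauss R s)" by (rule prob_space.prob_space_distr[OF prob_space_gauss sm])
    fix T :: "real ^ 'n \<Rightarrow> real ^ 'n" assume T: "orthogonal_transformation T" and TV: "T ` V = V"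
    note Tb [measurable] = orthogonal_transformation_measurable[OF T]
    have linT: "linear T" using T by (rule orthogonal_transformation_linear)
    have TS: "T x \<in> sphere 0 1 \<inter> V" if "x \<in> sphere 0 1 \<inter> V" for x
      using that TV by (auto simp: orthogonal_transformation_norm[OF T])
    have Tm [measurable]: "T \<in> R \<rightarrow>\<^sub>M R"
      unfolding R_def using Tb TS by (intro measurable_restrict_space3) auto
    \<comment> \<open>\<open>T\<close> preserves \<open>V\<close> and hence its orthogonal
      complement, so it commutes with the orthogonal projection \<open>P\<close>.\<close>
    have PT: "P (T x) = T (P x)" for x
    proof -
      have "T (x - P x) \<bullet> z = 0" if z: "z \<in> V" for z
      proof -
        obtain z' where z': "z' \<in> V" "z = T z'" using z TV by auto
        have "T (x - P x) \<bullet> T z' = (x - P x) \<bullet> z'"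
          using T by (simp add: orthogonal_transformation_def)
        also have "\<dots> = 0" using z'(1) by (simp add: P_def memV inner_commute)
        finally show ?thesis by (simp add: z')
      qed
      hence "T (x - P x) \<bullet> P (T (x - P x)) = 0" using PV by blast
      moreover have "P y \<bullet> w = y \<bullet> w" if "w \<in> V" for y w
        using that by (simp add: P_def inner_diff_left inner_diff_right memV inner_commute)
      ultimately have "P (T (x - P x)) \<bullet> P (T (x - P x)) = 0" using PV by simp
      hence "P (T (x - P x)) = 0" by simp
      moreover have "P (T (P x)) = T (P x)" using Pid TV PV by blast
      moreover have "P (T x) = P (T (x - P x)) + P (T (P x))"
        by (simp add: linear_add[OF Plin, symmetric] linear_add[OF linT, symmetric])
      ultimately show ?thesis by simp
    qed
    \<comment> \<open>Only almost everywhere: \<open>T\<close> need not fix the default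
      \<open>v0\<close>.\<close>
    have comm: "AE x in gauss. T (s x) = s (T x)"
      using ae
    proof eventually_elim
      case (elim x)
      hence "T (P x) \<noteq> 0" using orthogonal_transformation_norm[OF T, of "P x"] by auto
      thus ?case using elim by (simp add: s_def PT linear_scale[OF linT] orthogonal_transformation_norm[OF T])
    qed
    have "distr (distr gauss R s) (distr gauss R s) T = distr (distr gauss R s) R T"
      by (rule distr_cong) auto
    also have "\<dots> = distr gauss R (T \<circ> s)"
      by (rule distr_distr[OF Tm sm])
    also have "\<dots> = distr gauss R (s \<circ> T)"
    proof (rule measure_eqI)
      fix A assume "A \<in> sets (distr gauss R (T \<circ> s))"
      hence A [measurable]: "A \<in> sets R" by simp
      have "emeasure (distr gauss R (T \<circ> s)) A = emeasure gauss ((T \<circ> s) -` A \<inter> space gauss)"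
        by (rule emeasure_distr) (auto intro: measurable_comp)
      also have "\<dots> = emeasure gauss ((s \<circ> T) -` A \<inter> space gauss)"
      proof (rule emeasure_eq_AE)
        show "AE x in gauss. (x \<in> (T \<circ> s) -` A \<inter> space gauss) = (x \<in> (s \<circ> T) -` A \<inter> space gauss)"
          using comm by eventually_elim auto
        show "(T \<circ> s) -` A \<inter> space gauss \<in> sets gauss" "(s \<circ> T) -` A \<inter> space gauss \<in> sets gauss"
          by (rule measurable_sets[OF _ A], measurable)+
      qed
      also have "\<dots> = emeasure (distr gauss R (s \<circ> T)) A"
        by (rule emeasure_distr[symmetric]) auto
      finally show "emeasure (distr gauss R (T \<circ> s)) A = emeasure (distr gauss R (s \<circ> T)) A" .
    qed simp
    also have "\<dots> = distr (distr gauss borel T) R s"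
      by (rule distr_distr[symmetric]) (use sm in auto)
    also have "\<dots> = distr gauss R s" by (simp add: distr_gauss_orthogonal[OF T])
    finally show "distr (distr gauss R s) (distr gauss R s) T = distr gauss R s" .
  qed
  show ?thesis using sm ae' inv unfolding V_def R_def P_def by blast
qed

text \<open>The Gaussian construction gives existence, and uniqueness resolves the description
  \<open>THE\<close>. From here on a sphere integral is a Gaussian integral of the normalised
  projection.\<close>

lemma
  fixes \<omega> :: "real ^ 'n"
  assumes w: "norm \<omega> = 1 \<or> \<omega> = 0" and n: "CARD('n) \<ge> 2"
  shows invariant_sphere_prob_sphere_prob: "invariant_sphere_prob (orthogonal_comp {\<omega>}) (sphere_prob (orthogonal_comp {\<omega>}))"
    and nn_integral_sphere_prob: "h \<in> borel_measurable borel \<Longrightarrow>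
      (\<integral>\<^sup>+x. h x \<partial>sphere_prob (orthogonal_comp {\<omega>})) = (\<integral>\<^sup>+x. h (sgn (x - (x \<bullet> \<omega>) *\<^sub>R \<omega>)) \<partial>gauss)"
proof -
  let ?R = "restrict_space borel (sphere 0 1 \<inter> orthogonal_comp {\<omega>})"
  obtain s where s: "s \<in> gauss \<rightarrow>\<^sub>M ?R" "AE x in gauss. s x = sgn (x - (x \<bullet> \<omega>) *\<^sub>R \<omega>)"
    "invariant_sphere_prob (orthogonal_comp {\<omega>}) (distr gauss ?R s)"
    using invariant_sphere_prob_gauss[OF assms] by blast
  have eq: "sphere_prob (orthogonal_comp {\<omega>}) = distr gauss ?R s"
    by (rule sphere_prob_eq[OF subspace_orthogonal_comp s(3)])
  show "invariant_sphere_prob (orthogonal_comp {\<omega>}) (sphere_prob (orthogonal_comp {\<omega>}))"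
    unfolding eq by (rule s(3))
  assume h: "h \<in> borel_measurable borel"
  have "(\<integral>\<^sup>+x. h x \<partial>sphere_prob (orthogonal_comp {\<omega>})) = (\<integral>\<^sup>+x. h (s x) \<partial>gauss)"
    unfolding eq by (rule nn_integral_distr[OF s(1)]) (simp add: measurable_restrict_space1 h)
  also have "\<dots> = (\<integral>\<^sup>+x. h (sgn (x - (x \<bullet> \<omega>) *\<^sub>R \<omega>)) \<partial>gauss)"
    using s(2) by (intro nn_integral_cong_AE) (auto elim!: eventually_mono)
  finally show "(\<integral>\<^sup>+x. h x \<partial>sphere_prob (orthogonal_comp {\<omega>})) = (\<integral>\<^sup>+x. h (sgn (x - (x \<bullet> \<omega>) *\<^sub>R \<omega>)) \<partial>gauss)" .
qed

section \<open>Gnomonic projection\<close>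

lemma measurable_completion_cong_AE:
  assumes g: "g \<in> M \<rightarrow>\<^sub>M N" and ae: "AE x in M. f x = g x" and sp: "f \<in> space M \<rightarrow> space N"
  shows "f \<in> completion M \<rightarrow>\<^sub>M N"
proof (rule measurableI)
  show "f x \<in> space N" if "x \<in> space (completion M)" for x using that sp by auto
  fix A assume A: "A \<in> sets N"
  show "f -` A \<inter> space (completion M) \<in> sets (completion M)"
  proof (rule completion.in_sets_AE)
    show "g -` A \<inter> space M \<in> sets (completion M)"
      using measurable_sets[OF g A] by (rule sets_completionI_sets)
    show "AE x in completion M. (x \<in> g -` A \<inter> space M) = (x \<in> f -` A \<inter> space (completion M))"
      using AE_completion[OF ae] by eventually_elim auto
  qed auto
qed

text \<open>The definitions integrate over completed measures; this trades such an integral for one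
  of a Borel representative over the original measure, whether or not it converges.\<close>

lemma integral_completion_cong_AE:
  fixes f :: "'a \<Rightarrow> 'b::{banach, second_countable_topology}"
  assumes g: "g \<in> borel_measurable M" and ae: "AE x in M. f x = g x"
  shows "integral\<^sup>L (completion M) f = integral\<^sup>L M g"
proof -
  have "integral\<^sup>L (completion M) f = integral\<^sup>L (completion M) g"
    using measurable_completion_cong_AE[OF g ae] g ae
    by (intro integral_cong_AE) (auto intro: measurable_completion AE_completion)
  thus ?thesis using integral_completion[OF g] by simp
qed

locale frame =
  fixes e :: "nat \<Rightarrow> 'n::finite"
  assumes card3: "CARD('n) \<ge> 3" and bij_e: "bij_betw e {1..CARD('n)} UNIV"
begin

text \<open>\<open>K\<close> indexes the coordinate plane and \<open>b\<close> the last axis, along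
  which \<open>shifted_dual\<close> displaces it; \<open>a\<close> is the second normal
  direction.\<close>

definition "K = e ` {1..CARD('n) - 2}"
definition "a = e (CARD('n) - 1)"
definition "b = e CARD('n)"

lemma inj_e: "inj_on e {1..CARD('n)}" using bij_e by (rule bij_betw_imp_inj_on)

lemma frame_props: "insert a (insert b K) = UNIV" "a \<noteq> b" "a \<notin> K" "b \<notin> K" "card K = CARD('n) - 2"
proof -
  have "{1..CARD('n)} = insert (CARD('n) - 1) (insert CARD('n) {1..CARD('n) - 2})"
    using card3 by auto
  hence "insert a (insert b K) = e ` {1..CARD('n)}" by (simp add: a_def b_def K_def)
  thus "insert a (insert b K) = UNIV" using bij_e by (simp add: bij_betw_def)
  show "a \<noteq> b" 
  proof
    assume "a = b"
    hence "CARD('n) - 1 = CARD('n)"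
      unfolding a_def b_def by (rule inj_onD[OF inj_e]) (use card3 in auto)
    thus False using card3 by simp
  qed
  show "a \<notin> K"
  proof
    assume "a \<in> K"
    then obtain i where i: "i \<in> {1..CARD('n) - 2}" "e (CARD('n) - 1) = e i" by (auto simp: a_def K_def)
    moreover from this have "CARD('n) - 1 = i"
      by (intro inj_onD[OF inj_e]) (use card3 in auto)
    ultimately show False using card3 i(1) unfolding atLeastAtMost_iff by arith
  qed
  show "b \<notin> K"
  proof
    assume "b \<in> K"
    then obtain i where i: "i \<in> {1..CARD('n) - 2}" "e CARD('n) = e i" by (auto simp: b_def K_def)
    moreover from this have "CARD('n) = i"
      by (intro inj_onD[OF inj_e]) (use card3 in auto)
    ultimately show False using card3 i(1) unfolding atLeastAtMost_iff by arith
  qed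
  have "inj_on e {1..CARD('n) - 2}" by (rule inj_on_subset[OF inj_e]) auto
  thus "card K = CARD('n) - 2" by (simp add: K_def card_image)
qed

lemma K_nonempty: "K \<noteq> {}" using frame_props(5) card3 by force

lemma coordinate_plane_eq: "coordinate_plane e (CARD('n) - 2) = range (vec_of K)"
proof -
  have "(\<lambda>i. axis (e i) (1::real)) ` {1..CARD('n) - 2} = (\<lambda>i. axis i 1) ` K"
    by (auto simp: K_def)
  hence "coordinate_plane e (CARD('n) - 2) = span ((\<lambda>i. axis i (1::real)) ` K)"
    by (simp add: coordinate_plane_def)
  also have "\<dots> = range (vec_of K)"
  proof
    show "range (vec_of K) \<subseteq> span ((\<lambda>i. axis i (1::real)) ` K)"
      unfolding image_subset_iff vec_of_eq_sum
      by (intro ballI span_sum span_scale span_base imageI)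
    have "subspace (range (vec_of K))"
    proof (rule subspaceI)
      show "0 \<in> range (vec_of K)" by (rule range_eqI[of _ _ "\<lambda>_. 0"]) (simp add: vec_eq_iff)
      fix x y assume "x \<in> range (vec_of K)" "y \<in> range (vec_of K)"
      then obtain p q where "x = vec_of K p" "y = vec_of K q" by auto
      thus "x + y \<in> range (vec_of K)" by (intro range_eqI[of _ _ "\<lambda>i. p i + q i"]) (simp add: vec_eq_iff)
    next
      fix c x assume "x \<in> range (vec_of K)"
      then obtain p where "x = vec_of K p" by auto
      thus "c *\<^sub>R x \<in> range (vec_of K)" by (intro range_eqI[of _ _ "\<lambda>i. c * p i"]) (simp add: vec_eq_iff)
    qed
    moreover have "axis i 1 \<in> range (vec_of K)" if "i \<in> K" for i
      by (rule range_eqI[of _ _ "\<lambda>k. if k = i then 1 else 0"]) (use that in \<open>auto simp: vec_eq_iff axis_def\<close>)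
    ultimately show "span ((\<lambda>i. axis i (1::real)) ` K) \<subseteq> range (vec_of K)"
      by (intro span_minimal) auto
  qed
  finally show ?thesis .
qed

abbreviation "LK \<equiv> lebesgue_on_coords K"

lemma sigma_finite_LK: "sigma_finite_measure LK"
  by (rule lborel_prod.sigma_finite) simp

lemma axis_ab_nth: "axis a (1::real) $ b = 0" "axis b (1::real) $ a = 0"
  using frame_props by (auto simp: axis_def)

lemma norm_plane:
  "(norm (vec_of K y + s *\<^sub>R axis a 1 + t *\<^sub>R axis b (1::real)))\<^sup>2 = (norm (vec_of K y))\<^sup>2 + s\<^sup>2 + t\<^sup>2"
proof -
  have "vec_of K y \<bullet> axis a 1 = 0" "vec_of K y \<bullet> axis b 1 = 0" "axis a (1::real) \<bullet> axis b 1 = 0"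
    "axis a (1::real) \<bullet> axis a 1 = 1" "axis b (1::real) \<bullet> axis b 1 = 1"
    using frame_props by (auto simp: inner_axis axis_ab_nth)
  thus ?thesis
    unfolding power2_norm_eq_inner
    by (simp add: inner_add_left inner_add_right inner_commute power2_eq_square algebra_simps)
qed

text \<open>The last integral of the gnomonic computation, with \<open>q = 1 + |y|^2 / d^2\<close>.
  The factor \<open>(d * sqrt q) ^ (n - 1)\<close> cancels the power of \<open>q\<close> from the
  Gaussian moment, so the value does not depend on \<open>y\<close>: this is why the projected
  measure is unweighted Lebesgue measure on the plane.\<close>

lemma nn_integral_slice:
  assumes q: "q \<ge> (1::real)" and d: "d > 0"
  shows "(\<integral>\<^sup>+s. ennreal ((\<bar>s\<bar> / d) ^ (CARD('n) - 2) * exp (- (s\<^sup>2 * q)) * (d * sqrt q) ^ (CARD('n) - 1)) \<partial>lborel)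
    = ennreal (Gamma ((real CARD('n) - 1) / 2) * d)"
proof -
  obtain k where k: "CARD('n) = Suc (Suc k)" using card3 by (intro that[of "CARD('n) - 2"]) linarith
  have ks: "CARD('n) - 2 = k" "CARD('n) - 1 = Suc k" "real CARD('n) - 1 = real k + 1" using k by linarith+
  have al: "(x / d) ^ k * E * (d * r) ^ Suc k = d * r ^ Suc k * (x ^ k * E)" for x E r :: real
    using d by (simp add: power_divide power_mult_distrib)
  have "(\<integral>\<^sup>+s. ennreal ((\<bar>s\<bar> / d) ^ k * exp (- (s\<^sup>2 * q)) * (d * sqrt q) ^ Suc k) \<partial>lborel)
    = (\<integral>\<^sup>+s. ennreal (d * sqrt q ^ Suc k) * ennreal (\<bar>s\<bar> ^ k * exp (- q * s\<^sup>2)) \<partial>lborel)"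
  proof (rule nn_integral_cong)
    fix s :: real
    have "- q * s\<^sup>2 = - (s\<^sup>2 * q)" by simp
    moreover have "0 \<le> d * sqrt q ^ Suc k" using q d by simp
    ultimately show "ennreal ((\<bar>s\<bar> / d) ^ k * exp (- (s\<^sup>2 * q)) * (d * sqrt q) ^ Suc k)
       = ennreal (d * sqrt q ^ Suc k) * ennreal (\<bar>s\<bar> ^ k * exp (- q * s\<^sup>2))"
      unfolding al by (simp only: ennreal_mult')
  qed
  also have "\<dots> = ennreal (d * sqrt q ^ Suc k) * ennreal (Gamma ((real k + 1) / 2) * q powr (- (real k + 1) / 2))"
    by (subst nn_integral_cmult, simp, subst nn_integral_gauss_moment) (use q in auto)
  also have "\<dots> = ennreal (d * sqrt q ^ Suc k * (Gamma ((real k + 1) / 2) * q powr (- (real k + 1) / 2)))"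
    by (rule ennreal_mult'[symmetric]) (use q d in simp)
  also have "sqrt q ^ Suc k = q powr ((real k + 1) / 2)"
  proof -
    have "sqrt q ^ Suc k = (q powr (1 / 2)) powr real (Suc k)"
      using q by (subst powr_realpow) (auto simp: powr_half_sqrt)
    thus ?thesis by (simp add: powr_powr add.commute)
  qed
  also have "d * q powr ((real k + 1) / 2) * (Gamma ((real k + 1) / 2) * q powr (- (real k + 1) / 2)) =
     Gamma ((real k + 1) / 2) * d * (q powr ((real k + 1) / 2) * q powr (- (real k + 1) / 2))"
    by (simp only: mult_ac)
  also have "q powr ((real k + 1) / 2) * q powr (- (real k + 1) / 2) = 1"
    using q by (subst powr_add[symmetric]) (simp add: add_divide_distrib[symmetric])
  finally show ?thesis unfolding ks by simp
qed

text \<open>Gnomonic projection of the sphere in a hyperplane through the origin. The Gaussian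
  representation of the invariant measure turns it into a linear scaling of the plane coordinates.\<close>

lemma nn_integral_gnomonic:
  fixes T :: "real ^ 'n \<Rightarrow> real ^ 'n" and h :: "real ^ 'n \<Rightarrow> ennreal"
  assumes T: "orthogonal_transformation T" and d: "d > 0"
    and w: "\<omega> = T (axis b 1)" and u: "u = - (1 / d) *\<^sub>R T (axis a 1)"
    and h [measurable]: "h \<in> borel_measurable borel"
  shows "(\<integral>\<^sup>+\<theta>. ennreal (inverse (\<bar>\<theta> \<bullet> u\<bar> ^ (CARD('n) - 1))) * h (- (1 / (\<theta> \<bullet> u)) *\<^sub>R \<theta>) \<partial>sphere_prob (orthogonal_comp {\<omega>}))
    = ennreal (pi powr (- (real CARD('n) - 1) / 2) * Gamma ((real CARD('n) - 1) / 2) * d) *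
      (\<integral>\<^sup>+y. h (T (vec_of K y + d *\<^sub>R axis a 1)) \<partial>LK)"
proof -
  let ?n = "CARD('n)"
  interpret LK: sigma_finite_measure LK by (rule sigma_finite_LK)
  interpret P: pair_sigma_finite LK lborel by unfold_locales
  note [measurable] = orthogonal_transformation_measurable[OF T]
  have linT: "linear T" by (rule orthogonal_transformation_linear[OF T])
  have innT: "T x \<bullet> T y = x \<bullet> y" for x y using T by (simp add: orthogonal_transformation_def)
  define H where "H \<theta> = ennreal (inverse (\<bar>\<theta> \<bullet> u\<bar> ^ (?n - 1))) * h (- (1 / (\<theta> \<bullet> u)) *\<^sub>R \<theta>)" for \<theta>
  have [measurable]: "H \<in> borel_measurable borel" unfolding H_def by measurable
  define c where "c = pi powr (- real ?n / 2)"
  have c: "c \<ge> 0" by (simp add: c_def)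
  define G where "G y s = ennreal (exp (- (norm (vec_of K y))\<^sup>2 - s\<^sup>2)) * H (sgn (T (vec_of K y + s *\<^sub>R axis a 1)))" for y s
  have sgnm [measurable]: "sgn \<in> borel_measurable (borel :: (real ^ 'n) measure)"
    unfolding sgn_div_norm[abs_def] by measurable
  have Gm [measurable]: "(\<lambda>z. G (fst z) (snd z)) \<in> borel_measurable (LK \<Otimes>\<^sub>M lborel)"
    unfolding G_def by measurable
  hence Gm' [measurable]: "(\<lambda>(y,s). G y s) \<in> borel_measurable (LK \<Otimes>\<^sub>M lborel)" by (simp add: case_prod_unfold)
  have nw: "norm \<omega> = 1 \<or> \<omega> = 0" unfolding w by (simp add: orthogonal_transformation_norm[OF T])
  have proj: "T x - (T x \<bullet> \<omega>) *\<^sub>R \<omega> = T (x - (x $ b) *\<^sub>R axis b 1)" for x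
    unfolding w by (simp add: innT linear_diff[OF linT] linear_scale[OF linT] inner_axis)
  have e1: "ennreal (exp (- t\<^sup>2)) * G y s = ennreal (exp (- (norm (vec_of K y + s *\<^sub>R axis a 1 + t *\<^sub>R axis b (1::real)))\<^sup>2)) *
      H (sgn (T (vec_of K y + s *\<^sub>R axis a 1)))" for y s t
    unfolding G_def norm_plane mult.assoc[symmetric]
    by (subst ennreal_mult'[symmetric], simp, subst exp_add[symmetric])
       (rule arg_cong[where f="\<lambda>x. ennreal (exp x) * _"], simp)
  have "(\<integral>\<^sup>+\<theta>. H \<theta> \<partial>sphere_prob (orthogonal_comp {\<omega>})) = (\<integral>\<^sup>+x. H (sgn (x - (x \<bullet> \<omega>) *\<^sub>R \<omega>)) \<partial>gauss)"
    by (rule nn_integral_sphere_prob) (use nw card3 in auto)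
  also have "\<dots> = (\<integral>\<^sup>+x. ennreal (c * exp (- (norm x)\<^sup>2)) * H (sgn (x - (x \<bullet> \<omega>) *\<^sub>R \<omega>)) \<partial>lborel)"
    unfolding c_def by (rule nn_integral_gauss) measurable
  also have "\<dots> = (\<integral>\<^sup>+x. ennreal (c * exp (- (norm (T x))\<^sup>2)) * H (sgn (T x - (T x \<bullet> \<omega>) *\<^sub>R \<omega>)) \<partial>lborel)"
    by (rule nn_integral_lborel_orthogonal[OF T, symmetric]) measurable
  also have "\<dots> = (\<integral>\<^sup>+x. ennreal c * (ennreal (exp (- (norm x)\<^sup>2)) * H (sgn (T (x - (x $ b) *\<^sub>R axis b 1)))) \<partial>lborel)"
    unfolding proj by (rule nn_integral_cong)
      (simp add: orthogonal_transformation_norm[OF T] ennreal_mult'[OF c] mult.assoc)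
  also have "\<dots> = ennreal c * (\<integral>\<^sup>+x. ennreal (exp (- (norm x)\<^sup>2)) * H (sgn (T (x - (x $ b) *\<^sub>R axis b 1))) \<partial>lborel)"
    by (rule nn_integral_cmult) measurable
  also have "(\<integral>\<^sup>+x. ennreal (exp (- (norm x)\<^sup>2)) * H (sgn (T (x - (x $ b) *\<^sub>R axis b 1))) \<partial>lborel) =
      (\<integral>\<^sup>+y. \<integral>\<^sup>+t. \<integral>\<^sup>+s. ennreal (exp (- t\<^sup>2)) * G y s \<partial>lborel \<partial>lborel \<partial>LK)"
  proof (subst nn_integral_lborel_split2[OF _ frame_props(1-4)])
    have eq: "vec_of K y + s *\<^sub>R axis a 1 + t *\<^sub>R axis b 1 - ((vec_of K y + s *\<^sub>R axis a 1 + t *\<^sub>R axis b 1) $ b) *\<^sub>R axis b (1::real) = vec_of K y + s *\<^sub>R axis a 1"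
      for y s t using frame_props by (auto simp: vec_eq_iff axis_def)
    show "(\<integral>\<^sup>+y. \<integral>\<^sup>+t. \<integral>\<^sup>+s. ennreal (exp (- (norm (vec_of K y + s *\<^sub>R axis a 1 + t *\<^sub>R axis b 1))\<^sup>2)) * 
       H (sgn (T (vec_of K y + s *\<^sub>R axis a 1 + t *\<^sub>R axis b 1 - ((vec_of K y + s *\<^sub>R axis a 1 + t *\<^sub>R axis b 1) $ b) *\<^sub>R axis b 1))) \<partial>lborel \<partial>lborel \<partial>LK)
      = (\<integral>\<^sup>+y. \<integral>\<^sup>+t. \<integral>\<^sup>+s. ennreal (exp (- t\<^sup>2)) * G y s \<partial>lborel \<partial>lborel \<partial>LK)"
      unfolding eq e1 ..
  qed measurable
  \<comment> \<open>The coordinate \<open>t\<close> along \<open>\<omega>\<close> is removed by the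
    projection and contributes only its Gaussian integral \<open>sqrt pi\<close>.\<close>
  also have "\<dots> = (\<integral>\<^sup>+y. (\<integral>\<^sup>+t. ennreal (exp (- t\<^sup>2)) \<partial>lborel) * (\<integral>\<^sup>+s. G y s \<partial>lborel) \<partial>LK)"
  proof (rule nn_integral_cong)
    fix y assume y [measurable]: "y \<in> space LK"
    have [measurable]: "(\<lambda>s. G y s) \<in> borel_measurable lborel"
      using measurable_Pair2[OF Gm' y] by simp
    show "(\<integral>\<^sup>+t. \<integral>\<^sup>+s. ennreal (exp (- t\<^sup>2)) * G y s \<partial>lborel \<partial>lborel) = (\<integral>\<^sup>+t. ennreal (exp (- t\<^sup>2)) \<partial>lborel) * (\<integral>\<^sup>+s. G y s \<partial>lborel)"
      by (subst nn_integral_cmult, simp, subst nn_integral_multc) auto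
  qed
  also have "(\<integral>\<^sup>+t. ennreal (exp (- t\<^sup>2)) \<partial>lborel) = ennreal (sqrt pi)"
    using nn_integral_gauss_moment[of 1 0] by (simp add: Gamma_one_half_real)
  also have "(\<integral>\<^sup>+y. ennreal (sqrt pi) * (\<integral>\<^sup>+s. G y s \<partial>lborel) \<partial>LK) = ennreal (sqrt pi) * (\<integral>\<^sup>+y. \<integral>\<^sup>+s. G y s \<partial>lborel \<partial>LK)"
    by (rule nn_integral_cmult) measurable
  also have "(\<integral>\<^sup>+y. \<integral>\<^sup>+s. G y s \<partial>lborel \<partial>LK) = (\<integral>\<^sup>+s. \<integral>\<^sup>+y. G y s \<partial>LK \<partial>lborel)"
    by (rule P.Fubini'[symmetric, OF Gm'])
  also have "\<dots> = (\<integral>\<^sup>+s. \<integral>\<^sup>+y. ennreal ((\<bar>s\<bar> / d) ^ (?n - 2) * exp (- (s\<^sup>2 * (1 + (norm (vec_of K y))\<^sup>2 / d\<^sup>2))) * (d * sqrt (1 + (norm (vec_of K y))\<^sup>2 / d\<^sup>2)) ^ (?n - 1))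
       * h (T (vec_of K y + d *\<^sub>R axis a 1)) \<partial>LK \<partial>lborel)"
  proof (rule nn_integral_cong_AE)
    have "AE s::real in lborel. s \<noteq> 0" by (rule AE_lborel_singleton)
    thus "AE s in lborel. (\<integral>\<^sup>+y. G y s \<partial>LK) = (\<integral>\<^sup>+y. ennreal ((\<bar>s\<bar> / d) ^ (?n - 2) * exp (- (s\<^sup>2 * (1 + (norm (vec_of K y))\<^sup>2 / d\<^sup>2))) * (d * sqrt (1 + (norm (vec_of K y))\<^sup>2 / d\<^sup>2)) ^ (?n - 1))
       * h (T (vec_of K y + d *\<^sub>R axis a 1)) \<partial>LK)"
    proof eventually_elim
      case (elim s)
      define F where "F v = ennreal (exp (- (norm v)\<^sup>2 - s\<^sup>2)) * H (sgn (T (v + s *\<^sub>R axis a 1)))" for v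
      have [measurable]: "F \<in> borel_measurable borel" unfolding F_def by measurable
      have "(\<integral>\<^sup>+y. G y s \<partial>LK) = (\<integral>\<^sup>+y. F (vec_of K y) \<partial>LK)" by (simp add: G_def F_def)
      also have "\<dots> = ennreal (\<bar>s / d\<bar> ^ card K) * (\<integral>\<^sup>+y. F (vec_of K (\<lambda>_. 0) + (s / d) *\<^sub>R vec_of K y) \<partial>LK)"
        by (rule nn_integral_coords_affine) (use elim d in auto)
      also have "\<dots> = (\<integral>\<^sup>+y. ennreal (\<bar>s / d\<bar> ^ card K) * F (vec_of K (\<lambda>_. 0) + (s / d) *\<^sub>R vec_of K y) \<partial>LK)"
        by (rule nn_integral_cmult[symmetric]) measurable
      also have "\<dots> = (\<integral>\<^sup>+y. ennreal ((\<bar>s\<bar> / d) ^ (?n - 2) * exp (- (s\<^sup>2 * (1 + (norm (vec_of K y))\<^sup>2 / d\<^sup>2))) * (d * sqrt (1 + (norm (vec_of K y))\<^sup>2 / d\<^sup>2)) ^ (?n - 1))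
       * h (T (vec_of K y + d *\<^sub>R axis a 1)) \<partial>LK)"
      \<comment> \<open>After scaling the plane variable by \<open>s / d\<close> the argument of
        \<open>H\<close> lies on the line through \<open>T v\<close>, where
        \<open>v = vec_of K y + d *\<^sub>R axis a 1\<close>. \<open>H\<close> sees a direction only
        up to sign, and \<open>T v \<bullet> u = - 1\<close> makes the gnomonic image of that
        direction equal to \<open>T v\<close> itself.\<close>
      proof (rule nn_integral_cong)
        fix y
        define v where "v = vec_of K y + d *\<^sub>R axis a (1::real)"
        define q where "q = 1 + (norm (vec_of K y))\<^sup>2 / d\<^sup>2"
        have q: "q \<ge> 1" by (simp add: q_def)
        have z: "vec_of K (\<lambda>_. 0) = (0 :: real ^ 'n)" by (simp add: vec_eq_iff)
        have v1: "(s / d) *\<^sub>R vec_of K y + s *\<^sub>R axis a 1 = (s / d) *\<^sub>R v"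
          using d by (simp add: v_def algebra_simps)
        have "(norm v)\<^sup>2 = d\<^sup>2 * q"
          using norm_plane[of y d 0] d by (simp add: v_def q_def field_simps)
        hence nv: "norm v = d * sqrt q" using d
          by (metis norm_ge_zero real_sqrt_abs2 real_sqrt_mult abs_of_pos abs_of_nonneg power2_eq_square)
        have nvp: "norm v > 0" using nv d q by simp
        have sg: "sgn (T ((s / d) *\<^sub>R v)) = (sgn s / norm v) *\<^sub>R T v"
        proof -
          have "sgn (s / d) = sgn s" using d by (simp add: sgn_real_def zero_less_divide_iff)
          hence "sgn (T ((s / d) *\<^sub>R v)) = sgn s *\<^sub>R sgn (T v)"
            by (simp only: linear_scale[OF linT] sgn_scaleR)
          thus ?thesis
            by (simp only: sgn_div_norm[of "T v"] orthogonal_transformation_norm[OF T] scaleR_scaleR divide_inverse)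
        qed
        have "v \<bullet> axis a 1 = d" using frame_props by (simp add: v_def inner_axis)
        hence iu: "T v \<bullet> u = - 1" using d by (simp add: u innT)
        have H: "H (sgn (T ((s / d) *\<^sub>R v))) = ennreal ((norm v) ^ (?n - 1)) * h (T v)"
          unfolding sg H_def using elim nvp by (simp add: iu sgn_real_def power_inverse power_divide)
        have "ennreal (\<bar>s / d\<bar> ^ card K) * F ((s / d) *\<^sub>R vec_of K y) =
           ennreal ((\<bar>s\<bar> / d) ^ (?n - 2)) * (ennreal (exp (- (s\<^sup>2 * q))) * (ennreal ((d * sqrt q) ^ (?n - 1)) * h (T v)))"
        proof -
          have "- (norm ((s / d) *\<^sub>R vec_of K y))\<^sup>2 - s\<^sup>2 = - (s\<^sup>2 * q)"
            using d by (simp add: q_def power_mult_distrib power_divide field_simps)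
          moreover have "\<bar>s / d\<bar> = \<bar>s\<bar> / d" using d by simp
          ultimately show ?thesis unfolding F_def v1 H nv frame_props(5) by (simp only:)
        qed
        also have "\<dots> = ennreal ((\<bar>s\<bar> / d) ^ (?n - 2) * exp (- (s\<^sup>2 * q)) * (d * sqrt q) ^ (?n - 1)) * h (T v)"
          using d q by (simp add: ennreal_mult mult.assoc)
        finally show "ennreal (\<bar>s / d\<bar> ^ card K) * F (vec_of K (\<lambda>_. 0) + (s / d) *\<^sub>R vec_of K y) =
          ennreal ((\<bar>s\<bar> / d) ^ (?n - 2) * exp (- (s\<^sup>2 * (1 + (norm (vec_of K y))\<^sup>2 / d\<^sup>2))) * (d * sqrt (1 + (norm (vec_of K y))\<^sup>2 / d\<^sup>2)) ^ (?n - 1))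
          * h (T (vec_of K y + d *\<^sub>R axis a 1))"
          unfolding z by (simp add: q_def v_def)
      qed
      finally show ?case .
    qed
  qed
  also have "\<dots> = (\<integral>\<^sup>+y. \<integral>\<^sup>+s. ennreal ((\<bar>s\<bar> / d) ^ (?n - 2) * exp (- (s\<^sup>2 * (1 + (norm (vec_of K y))\<^sup>2 / d\<^sup>2))) * (d * sqrt (1 + (norm (vec_of K y))\<^sup>2 / d\<^sup>2)) ^ (?n - 1))
       * h (T (vec_of K y + d *\<^sub>R axis a 1)) \<partial>lborel \<partial>LK)"
    by (rule P.Fubini') measurable
  also have "\<dots> = (\<integral>\<^sup>+y. ennreal (Gamma ((real ?n - 1) / 2) * d) * h (T (vec_of K y + d *\<^sub>R axis a 1)) \<partial>LK)"
  proof (rule nn_integral_cong)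
    fix y
    show "(\<integral>\<^sup>+s. ennreal ((\<bar>s\<bar> / d) ^ (?n - 2) * exp (- (s\<^sup>2 * (1 + (norm (vec_of K y))\<^sup>2 / d\<^sup>2))) * (d * sqrt (1 + (norm (vec_of K y))\<^sup>2 / d\<^sup>2)) ^ (?n - 1))
       * h (T (vec_of K y + d *\<^sub>R axis a 1)) \<partial>lborel) = ennreal (Gamma ((real ?n - 1) / 2) * d) * h (T (vec_of K y + d *\<^sub>R axis a 1))"
      by (subst nn_integral_multc, measurable, subst nn_integral_slice) (use d in auto)
  qed
  also have "\<dots> = ennreal (Gamma ((real ?n - 1) / 2) * d) * (\<integral>\<^sup>+y. h (T (vec_of K y + d *\<^sub>R axis a 1)) \<partial>LK)"
    by (rule nn_integral_cmult) measurable
  also have "ennreal c * (ennreal (sqrt pi) * (ennreal (Gamma ((real ?n - 1) / 2) * d) * (\<integral>\<^sup>+y. h (T (vec_of K y + d *\<^sub>R axis a 1)) \<partial>LK)))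
     = ennreal (c * sqrt pi * (Gamma ((real ?n - 1) / 2) * d)) * (\<integral>\<^sup>+y. h (T (vec_of K y + d *\<^sub>R axis a 1)) \<partial>LK)"
    using c d card3 by (simp add: ennreal_mult' mult.assoc)
  also have "c * sqrt pi = pi powr (- (real ?n - 1) / 2)"
    by (simp add: c_def powr_half_sqrt[symmetric] powr_add[symmetric] field_simps)
  finally show ?thesis by (simp add: H_def mult.assoc)
qed

end

section \<open>Functions in pole coordinates and their plane integrals\<close>

definition point_function :: "(real ^ 'n \<Rightarrow> real \<Rightarrow> complex) \<Rightarrow> real ^ 'n \<Rightarrow> complex" where
  "point_function \<phi> x = \<phi> (x /\<^sub>R norm x) (- inverse (norm x)) / of_real (norm x ^ (CARD('n) - 1))"

text \<open>Evenness enters for \<open>t > 0\<close>, where the pole \<open>- \<theta> / t\<close>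
  has direction \<open>- \<theta>\<close>; for \<open>t < 0\<close> the direction is
  \<open>\<theta>\<close> already.\<close>

lemma point_function_nu:
  assumes "hyperplane_function (\<phi> :: real ^ 'n \<Rightarrow> real \<Rightarrow> complex)" "norm \<theta> = 1" "t \<noteq> 0"
  shows "\<phi> \<theta> t = point_function \<phi> (- (1 / t) *\<^sub>R \<theta>) / of_real (\<bar>t\<bar> ^ (CARD('n) - 1))"
proof -
  have n: "norm (- (1 / t) *\<^sub>R \<theta>) = inverse \<bar>t\<bar>" using assms by (simp add: inverse_eq_divide)
  have "\<phi> ((- (1 / t) *\<^sub>R \<theta>) /\<^sub>R inverse \<bar>t\<bar>) (- inverse (inverse \<bar>t\<bar>)) = \<phi> \<theta> t"
  proof (cases "t > 0")
    case True
    hence "(- (1 / t) *\<^sub>R \<theta>) /\<^sub>R inverse \<bar>t\<bar> = - \<theta>" by simp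
    moreover have "\<phi> (- \<theta>) (- t) = \<phi> \<theta> t" using assms unfolding hyperplane_function_def by metis
    ultimately show ?thesis using True by simp
  next
    case False
    hence "(- (1 / t) *\<^sub>R \<theta>) /\<^sub>R inverse \<bar>t\<bar> = \<theta>" using assms by (simp add: divide_inverse)
    thus ?thesis using False by simp
  qed
  thus ?thesis unfolding point_function_def n using assms by (simp add: power_inverse)
qed

context frame
begin

definition plane_point :: "real ^ 'n ^ 'n \<Rightarrow> real ^ 'n \<Rightarrow> real \<Rightarrow> ('n \<Rightarrow> real) \<Rightarrow> real ^ 'n" where
  "plane_point \<gamma> x r y = \<gamma> *v vec_of K y + x + r *\<^sub>R (\<gamma> *v axis b 1)"

lemma plane_eq:
  "(\<lambda>v. \<gamma> *v v + x + r *\<^sub>R (\<gamma> *v axis (e CARD('n)) 1)) ` coordinate_plane e (CARD('n) - 2) = range (plane_point \<gamma> x r)"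
  unfolding coordinate_plane_eq plane_point_def b_def by auto

lemma plane_point_measurable [measurable]: "plane_point \<gamma> x r \<in> borel_measurable LK"
proof -
  have [measurable]: "(\<lambda>v. \<gamma> *v v) \<in> borel_measurable borel"
    by (intro borel_measurable_continuous_onI linear_continuous_on) simp
  show ?thesis unfolding plane_point_def by measurable
qed

text \<open>On the plane \<open>u \<bullet> z = - 1\<close>, so Cauchy-Schwarz bounds
  \<open>norm z\<close> below by \<open>1 / norm u\<close>; the foot \<open>- u / |u|^2\<close>
  attains the bound.\<close>

lemma infdist_nu_line:
  assumes "u \<noteq> 0"
  shows "infdist 0 (nu_line \<omega> u) = 1 / norm u"
proof -
  have n: "norm (- u /\<^sub>R (norm u)\<^sup>2) = 1 / norm u"
    using assms by (simp add: power2_eq_square inverse_eq_divide)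
  have mem: "- u /\<^sub>R (norm u)\<^sup>2 \<in> nu_line \<omega> u"
    unfolding nu_line_def by (rule image_eqI[of _ _ 0]) (simp_all add: subspace_0[OF subspace_orthogonal_comp])
  have le: "1 / norm u \<le> dist 0 z" if z: "z \<in> nu_line \<omega> u" for z
  proof -
    obtain v where v: "v \<in> orthogonal_comp {\<omega>, u}" "z = v - u /\<^sub>R (norm u)\<^sup>2" using z by (auto simp: nu_line_def)
    have "u \<bullet> v = 0" using v(1) by (auto simp: orthogonal_comp_def orthogonal_def)
    hence "u \<bullet> z = - 1" using assms by (simp add: v(2) inner_diff_right power2_norm_eq_inner)
    hence "1 \<le> norm u * norm z" using Cauchy_Schwarz_ineq2[of u z] by simp
    thus ?thesis using assms by (simp add: field_simps)
  qed
  show ?thesis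
  proof (rule antisym)
    show "infdist 0 (nu_line \<omega> u) \<le> 1 / norm u" using infdist_le[OF mem, of 0] n by simp
    have "nu_line \<omega> u \<noteq> {}" using mem by auto
    thus "1 / norm u \<le> infdist 0 (nu_line \<omega> u)"
      unfolding infdist_notempty[OF \<open>nu_line \<omega> u \<noteq> {}\<close>] using le by (intro cINF_greatest) auto
  qed
qed

text \<open>\<open>\<omega>\<close> and \<open>u\<close> arise from the images of the axes
  \<open>a\<close> and \<open>b\<close> by a matrix of determinant \<open>- (p^2 + q^2)\<close>, so
  they span the same 2-plane; its orthogonal complement is the image of the coordinate
  plane.\<close>

lemma orthogonal_comp_pair:
  fixes \<gamma> :: "real ^ 'n ^ 'n"
  assumes \<gamma>: "orthogonal_transformation ((*v) \<gamma>)"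
    and pq: "p \<noteq> 0 \<or> q \<noteq> 0"
    and w: "\<omega> = (- q) *\<^sub>R (\<gamma> *v axis a 1) + p *\<^sub>R (\<gamma> *v axis b 1)"
    and u: "u = p *\<^sub>R (\<gamma> *v axis a 1) + q *\<^sub>R (\<gamma> *v axis b 1)"
    and that: "c \<noteq> 0" "c' \<noteq> 0"
  shows "orthogonal_comp {c *\<^sub>R \<omega>, c' *\<^sub>R u} = (\<lambda>v. \<gamma> *v v) ` range (vec_of K)"
proof -
  have inn: "(\<gamma> *v x) \<bullet> (\<gamma> *v y) = x \<bullet> y" for x y using \<gamma> by (simp add: orthogonal_transformation_def)
  have "surj ((*v) \<gamma>)" using orthogonal_transformation_surj[OF \<gamma>] .
  have mem: "\<gamma> *v x \<in> orthogonal_comp {c *\<^sub>R \<omega>, c' *\<^sub>R u} \<longleftrightarrow> x \<in> range (vec_of K)" for x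
  proof -
    have "\<gamma> *v x \<in> orthogonal_comp {c *\<^sub>R \<omega>, c' *\<^sub>R u} \<longleftrightarrow> - q * x $ a + p * x $ b = 0 \<and> p * x $ a + q * x $ b = 0"
      using that unfolding orthogonal_comp_def orthogonal_def w u
      by (simp add: inner_add_left inner_diff_left inn inner_axis' scaleR_right_diff_distrib)
    also have "\<dots> \<longleftrightarrow> x $ a = 0 \<and> x $ b = 0"
    proof
      assume *: "- q * x $ a + p * x $ b = 0 \<and> p * x $ a + q * x $ b = 0"
      have "(p\<^sup>2 + q\<^sup>2) * x $ a = p * (p * x $ a + q * x $ b) - q * (- q * x $ a + p * x $ b)"
        "(p\<^sup>2 + q\<^sup>2) * x $ b = q * (p * x $ a + q * x $ b) + p * (- q * x $ a + p * x $ b)"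
        by (simp_all add: power2_eq_square algebra_simps)
      with * have "(p\<^sup>2 + q\<^sup>2) * x $ a = 0" "(p\<^sup>2 + q\<^sup>2) * x $ b = 0" by simp_all
      moreover have "p\<^sup>2 + q\<^sup>2 \<noteq> 0" using pq by (simp add: sum_power2_eq_zero_iff)
      ultimately show "x $ a = 0 \<and> x $ b = 0" using pq by auto
    qed simp
    also have "\<dots> \<longleftrightarrow> x \<in> range (vec_of K)"
    proof
      assume ab: "x $ a = 0 \<and> x $ b = 0"
      have "x $ i = 0" if "i \<notin> K" for i
      proof -
        have "i \<in> insert a (insert b K)" by (simp only: frame_props UNIV_I)
        thus ?thesis using ab that by auto
      qed
      hence "x = vec_of K (\<lambda>i. x $ i)" by (simp add: vec_eq_iff)
      thus "x \<in> range (vec_of K)" by (metis rangeI)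
    qed (use frame_props in auto)
    finally show ?thesis .
  qed
  show ?thesis
  proof (intro set_eqI iffI)
    fix z assume z: "z \<in> orthogonal_comp {c *\<^sub>R \<omega>, c' *\<^sub>R u}"
    obtain x where "z = \<gamma> *v x" using \<open>surj ((*v) \<gamma>)\<close> by (metis surj_def)
    thus "z \<in> (\<lambda>v. \<gamma> *v v) ` range (vec_of K)" using mem z by blast
  next
    fix z assume "z \<in> (\<lambda>v. \<gamma> *v v) ` range (vec_of K)"
    thus "z \<in> orthogonal_comp {c *\<^sub>R \<omega>, c' *\<^sub>R u}" using mem by blast
  qed
qed

text \<open>The plane determines its line: \<open>v0\<close> is the foot of the perpendicular from
  the origin, with coordinates \<open>p\<close>, \<open>q\<close> in the normal 2-plane,
  \<open>u = - v0 / |v0|^2\<close>, and \<open>\<omega>\<close> is \<open>v0\<close> turned by a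
  right angle and normalised. The hypothesis on \<open>x\<close> gives \<open>p \<noteq> 0\<close>
  for every displacement \<open>r\<close>, so the plane misses the origin.\<close>

lemma nu_line_exists:
  assumes \<gamma>: "orthogonal_transformation ((*v) \<gamma>)" and x: "x \<bullet> (\<gamma> *v axis a 1) \<noteq> 0"
  shows "\<exists>\<omega> u. norm \<omega> = 1 \<and> \<omega> \<bullet> u = 0 \<and> u \<noteq> 0 \<and> nu_line \<omega> u = range (plane_point \<gamma> x r)"
proof -
  have inn: "(\<gamma> *v x) \<bullet> (\<gamma> *v y) = x \<bullet> y" for x y using \<gamma> by (simp add: orthogonal_transformation_def)
  define z where "z = x + r *\<^sub>R (\<gamma> *v axis b 1)"
  define A B where "A = \<gamma> *v axis a (1::real)" and "B = \<gamma> *v axis b (1::real)"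
  have AB: "A \<bullet> A = 1" "B \<bullet> B = 1" "A \<bullet> B = 0" "B \<bullet> A = 0"
    using frame_props by (auto simp: A_def B_def inn inner_axis axis_ab_nth)
  define p q where "p = z \<bullet> A" and "q = z \<bullet> B"
  have p0: "p \<noteq> 0" using x by (simp add: p_def z_def B_def[symmetric] A_def[symmetric] inner_add_left AB)
  define \<omega>0 v0 where "\<omega>0 = (- q) *\<^sub>R A + p *\<^sub>R B" and "v0 = p *\<^sub>R A + q *\<^sub>R B"
  define \<rho> where "\<rho> = p\<^sup>2 + q\<^sup>2"
  have \<rho>: "\<rho> > 0" using p0 by (simp add: \<rho>_def sum_power2_gt_zero_iff)
  have in0: "\<omega>0 \<bullet> \<omega>0 = \<rho>" "v0 \<bullet> v0 = \<rho>" "\<omega>0 \<bullet> v0 = 0"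
    by (simp_all add: \<omega>0_def v0_def \<rho>_def inner_add_left inner_add_right inner_diff_left inner_diff_right AB power2_eq_square)
  define \<omega> u where "\<omega> = (1 / sqrt \<rho>) *\<^sub>R \<omega>0" and "u = (- 1 / \<rho>) *\<^sub>R v0"
  have "norm \<omega> = 1" using \<rho> by (simp add: \<omega>_def norm_eq_sqrt_inner in0)
  moreover have "\<omega> \<bullet> u = 0" by (simp add: \<omega>_def u_def in0)
  moreover have uu: "(norm u)\<^sup>2 = 1 / \<rho>"
  proof -
    have "u \<bullet> u = (1 / \<rho>) * ((1 / \<rho>) * (v0 \<bullet> v0))" by (simp add: u_def)
    also have "\<dots> = 1 / \<rho>" unfolding in0 using \<rho> by simp
    finally show ?thesis by (simp add: power2_norm_eq_inner)
  qed
  moreover have "u \<noteq> 0" using uu \<rho> by auto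
  moreover have "nu_line \<omega> u = range (plane_point \<gamma> x r)"
  proof -
    have oc: "orthogonal_comp {\<omega>, u} = (\<lambda>v. \<gamma> *v v) ` range (vec_of K)"
      unfolding \<omega>_def u_def
      by (rule orthogonal_comp_pair[OF \<gamma> _ _ _]) (use p0 \<rho> in \<open>auto simp: \<omega>0_def v0_def A_def B_def\<close>)
    have uv: "u /\<^sub>R (norm u)\<^sup>2 = - v0" unfolding uu using \<rho> by (simp add: u_def)
    have sub: "subspace ((\<lambda>v. \<gamma> *v v) ` range (vec_of K))"
      unfolding oc[symmetric] by (rule subspace_orthogonal_comp)
    have "z - v0 \<in> orthogonal_comp {\<omega>, u}"
      unfolding orthogonal_comp_def orthogonal_def \<omega>_def u_def \<omega>0_def v0_def
      by (simp add: inner_add_left inner_diff_left inner_diff_right inner_add_right AB p_def q_def inner_commute algebra_simps)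
    then obtain y0 where y0: "z - v0 = \<gamma> *v vec_of K y0" unfolding oc by auto
    have "plane_point \<gamma> x r y = \<gamma> *v vec_of K (\<lambda>i. y i + y0 i) - u /\<^sub>R (norm u)\<^sup>2" for y
    proof -
      have "vec_of K (\<lambda>i. y i + y0 i) = vec_of K y + vec_of K y0" by (simp add: vec_eq_iff)
      thus ?thesis unfolding uv plane_point_def
        using y0 by (simp add: matrix_vector_right_distrib z_def algebra_simps)
    qed
    hence 1: "range (plane_point \<gamma> x r) \<subseteq> nu_line \<omega> u"
      unfolding nu_line_def oc by auto
    have "\<gamma> *v vec_of K y - u /\<^sub>R (norm u)\<^sup>2 = plane_point \<gamma> x r (\<lambda>i. y i - y0 i)" for y
    proof -
      have e: "vec_of K (\<lambda>i. y i - y0 i) = vec_of K y - vec_of K y0" by (simp add: vec_eq_iff)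
      show ?thesis unfolding uv plane_point_def e
        using y0 by (simp add: matrix_vector_mult_diff_distrib z_def algebra_simps)
    qed
    hence "nu_line \<omega> u \<subseteq> range (plane_point \<gamma> x r)"
      unfolding nu_line_def oc by auto
    with 1 show ?thesis by auto
  qed
  ultimately show ?thesis by blast
qed

text \<open>Whatever representative \<open>nu_line_inv\<close> picks, it can be completed to an orthonormal frame
  which agrees with \<open>\<gamma>\<close> on the coordinate plane.\<close>

lemma frame_of_line:
  assumes \<gamma>: "orthogonal_transformation ((*v) \<gamma>)"
    and w: "norm \<omega> = 1" "\<omega> \<bullet> u = 0" "u \<noteq> 0" and nu: "nu_line \<omega> u = range (plane_point \<gamma> x r)"
  obtains T y0 where "orthogonal_transformation T" "\<omega> = T (axis b 1)" "u = - (1 / (1 / norm u)) *\<^sub>R T (axis a 1)"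
    "\<And>y. T (vec_of K y + (1 / norm u) *\<^sub>R axis a 1) = \<gamma> *v vec_of K y + x + r *\<^sub>R (\<gamma> *v axis b 1) + \<gamma> *v vec_of K y0"
proof -
  have inn: "(\<gamma> *v x) \<bullet> (\<gamma> *v y) = x \<bullet> y" for x y using \<gamma> by (simp add: orthogonal_transformation_def)
  define D where "D = orthogonal_comp {\<omega>, u}"
  define c where "c = u /\<^sub>R (norm u)\<^sup>2"
  define z where "z = x + r *\<^sub>R (\<gamma> *v axis b 1)"
  have subD: "subspace D" unfolding D_def by (rule subspace_orthogonal_comp)
  have zin: "z \<in> range (plane_point \<gamma> x r)"
    by (rule range_eqI[of _ _ "\<lambda>_. 0"]) (simp add: plane_point_def z_def vec_of_def zero_vec_def[symmetric])
  have cin: "- c \<in> nu_line \<omega> u"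
    unfolding nu_line_def c_def by (rule image_eqI[of _ _ 0]) (simp_all add: subspace_0[OF subspace_orthogonal_comp])
  \<comment> \<open>The foot \<open>- c\<close> of the perpendicular and the base point
    \<open>z\<close> differ by a vector of the plane; this \<open>y0\<close> later disappears by
    translation invariance.\<close>
  obtain y0 where y0: "- c = \<gamma> *v vec_of K y0 + z"
    using cin unfolding nu by (auto simp: plane_point_def z_def add.assoc)
  have gD: "\<gamma> *v vec_of K y \<in> D" for y
  proof -
    have "plane_point \<gamma> x r y \<in> nu_line \<omega> u" unfolding nu by simp
    then obtain v where v: "v \<in> D" "plane_point \<gamma> x r y = v - c" by (auto simp: nu_line_def D_def c_def)
    have "plane_point \<gamma> x r (\<lambda>_. 0) \<in> nu_line \<omega> u" unfolding nu by simp
    then obtain v' where v': "v' \<in> D" "plane_point \<gamma> x r (\<lambda>_. 0) = v' - c" by (auto simp: nu_line_def D_def c_def)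
    have "vec_of K (\<lambda>_. 0) = (0::real^'n)" by (simp add: vec_eq_iff)
    hence "\<gamma> *v vec_of K y = plane_point \<gamma> x r y - plane_point \<gamma> x r (\<lambda>_. 0)" by (simp add: plane_point_def)
    also have "\<dots> = v - v'" unfolding v(2) v'(2) by simp
    finally have "\<gamma> *v vec_of K y = v - v'" .
    thus ?thesis using v v' subspace_diff[OF subD] by simp
  qed
  hence perp: "\<omega> \<bullet> (\<gamma> *v vec_of K y) = 0" "u \<bullet> (\<gamma> *v vec_of K y) = 0" for y
    by (auto simp: D_def orthogonal_comp_def orthogonal_def)
  define u' where "u' = - u /\<^sub>R norm u"
  have u': "u' \<bullet> u' = 1" "\<omega> \<bullet> u' = 0" "u' \<bullet> \<omega> = 0" "u' \<bullet> (\<gamma> *v vec_of K y) = 0" "\<omega> \<bullet> \<omega> = 1" for y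
  proof -
    have "norm u' = 1" using w by (simp add: u'_def)
    thus "u' \<bullet> u' = 1" by (simp add: norm_eq_1)
    show "\<omega> \<bullet> \<omega> = 1" using w by (simp add: norm_eq_1)
    show "\<omega> \<bullet> u' = 0" "u' \<bullet> \<omega> = 0" "u' \<bullet> (\<gamma> *v vec_of K y) = 0"
      using w perp by (simp_all add: u'_def inner_commute)
  qed
  \<comment> \<open>\<open>T\<close> follows \<open>\<gamma>\<close> on the coordinate plane and
    sends the axes \<open>a\<close> and \<open>b\<close> to the direction of the foot and to the
    direction of the line.\<close>
  define T where "T v = \<gamma> *v vec_of K (($) v) + (v $ a) *\<^sub>R u' + (v $ b) *\<^sub>R \<omega>" for v
  have linT: "linear T"
  proof (rule linearI)
    show "T (v + v') = T v + T v'" for v v'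
    proof -
      have "vec_of K (($) (v + v')) = vec_of K (($) v) + vec_of K (($) v')" by (simp add: vec_eq_iff)
      thus ?thesis by (simp add: T_def matrix_vector_right_distrib algebra_simps)
    qed
    show "T (k *\<^sub>R v) = k *\<^sub>R T v" for k v
    proof -
      have "vec_of K (($) (k *\<^sub>R v)) = k *\<^sub>R vec_of K (($) v)" by (simp add: vec_eq_iff)
      thus ?thesis by (simp add: T_def matrix_vector_mult_scaleR algebra_simps)
    qed
  qed
  have "norm (T v) = norm v" for v
  proof -
    define y where "y = ($) v"
    have v: "v = vec_of K y + (v $ a) *\<^sub>R axis a 1 + (v $ b) *\<^sub>R axis b 1"
    proof (subst vec_eq_iff, intro allI)
      fix i
      have "i \<in> insert a (insert b K)" by (simp only: frame_props UNIV_I)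
      thus "v $ i = (vec_of K y + (v $ a) *\<^sub>R axis a 1 + (v $ b) *\<^sub>R axis b 1) $ i"
        using frame_props by (auto simp: y_def axis_def)
    qed
    have "(norm (T v))\<^sup>2 = (norm (vec_of K y))\<^sup>2 + (v $ a)\<^sup>2 + (v $ b)\<^sup>2"
      unfolding power2_norm_eq_inner T_def y_def[symmetric]
      using u' perp by (simp add: inner_add_left inner_add_right inn inner_commute power2_eq_square algebra_simps)
    also have "\<dots> = (norm v)\<^sup>2"
      using norm_plane[of y "v $ a" "v $ b"] v by simp
    finally show ?thesis by simp
  qed
  hence orthT: "orthogonal_transformation T" using linT by (simp add: orthogonal_transformation)
  have z0: "vec_of K (($) (axis a 1)) = (0::real^'n)" "vec_of K (($) (axis b 1)) = (0::real^'n)"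
    using frame_props by (auto simp: vec_eq_iff axis_def)
  have Tb: "\<omega> = T (axis b 1)" and Ta: "T (axis a 1) = u'"
    using frame_props by (auto simp: T_def z0 axis_ab_nth)
  show ?thesis
  proof (rule that[OF orthT Tb])
    show "u = - (1 / (1 / norm u)) *\<^sub>R T (axis a 1)" using w by (simp add: Ta u'_def)
    fix y
    have "(\<lambda>i. (vec_of K y :: real ^ 'n) $ i) = (\<lambda>i. if i \<in> K then y i else 0)" by auto
    hence "vec_of K (($) (vec_of K y :: real ^ 'n)) = vec_of K y" by (simp add: vec_eq_iff)
    hence Tv: "T (vec_of K y) = \<gamma> *v vec_of K y" using frame_props by (simp add: T_def)
    have "T (vec_of K y + (1 / norm u) *\<^sub>R axis a 1) = \<gamma> *v vec_of K y + (1 / norm u) *\<^sub>R u'"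
      by (simp add: linear_add[OF linT] linear_scale[OF linT] Ta Tv)
    also have "(1 / norm u) *\<^sub>R u' = - c" by (simp add: u'_def c_def power2_eq_square inverse_eq_divide)
    finally show "T (vec_of K y + (1 / norm u) *\<^sub>R axis a 1) = \<gamma> *v vec_of K y + x + r *\<^sub>R (\<gamma> *v axis b 1) + \<gamma> *v vec_of K y0"
      unfolding y0 by (simp add: z_def algebra_simps)
  qed
qed

text \<open>This is what the factor \<open>sigma_(n-2) / 2\<close> in \<open>Phi\<close> is for: it
  removes the constant of the gnomonic formula, while the division by the distance of the plane
  removes the factor \<open>d\<close>.\<close>

lemma sphere_area_gnomonic:
  "sphere_area (CARD('n) - 2) / 2 * (pi powr (- (real CARD('n) - 1) / 2) * Gamma ((real CARD('n) - 1) / 2)) = 1"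
proof -
  have r: "real (CARD('n) - 2) + 1 = real CARD('n) - 1" using card3 by (simp add: of_nat_diff)
  have "Gamma ((real CARD('n) - 1) / 2) \<noteq> 0"
    by (rule less_imp_neq[OF Gamma_real_pos, symmetric]) (use card3 in simp)
  moreover have "pi powr ((real CARD('n) - 1) / 2) * pi powr (- (real CARD('n) - 1) / 2) = 1"
    by (subst powr_add[symmetric]) (simp add: add_divide_distrib[symmetric])
  ultimately show ?thesis unfolding sphere_area_def r by (simp add: field_simps)
qed

text \<open>In the \<open>L^p\<close> case \<open>\<phi>\<close> is Borel only up to a null set. So
  \<open>g\<close> stands for a Borel version of its pole form, and \<open>ae\<close> asks that this
  particular plane meet the exceptional set \<open>N\<close> in a null set.\<close>

theorem Phi_eq_plane_integral:
  fixes \<phi> :: "real ^ 'n \<Rightarrow> real \<Rightarrow> complex"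
  assumes \<phi>: "hyperplane_function \<phi>"
    and g [measurable]: "g \<in> borel_measurable borel" and N [measurable]: "N \<in> sets borel"
    and gN: "\<And>z. z \<notin> N \<Longrightarrow> point_function \<phi> z = g z"
    and \<gamma>: "orthogonal_transformation ((*v) \<gamma>)" and x: "x \<bullet> (\<gamma> *v axis a 1) \<noteq> 0"
    and ae: "AE y in LK. plane_point \<gamma> x r y \<notin> N"
  shows "Phi \<phi> (range (plane_point \<gamma> x r)) = (LINT y|LK. g (plane_point \<gamma> x r y))"
proof -
  let ?n = "CARD('n)"
  define \<tau> where "\<tau> = range (plane_point \<gamma> x r)"
  define \<omega> u where "\<omega> = fst (nu_line_inv \<tau>)" and "u = snd (nu_line_inv \<tau>)"
  have ex: "\<exists>z. case z of (\<omega>, u) \<Rightarrow> norm \<omega> = 1 \<and> \<omega> \<bullet> u = 0 \<and> u \<noteq> 0 \<and> nu_line \<omega> u = \<tau>"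
    using nu_line_exists[OF \<gamma> x, of r] by (auto simp: \<tau>_def)
  have inv: "nu_line_inv \<tau> = (\<omega>, u)" by (simp add: \<omega>_def u_def)
  have w: "norm \<omega> = 1" "\<omega> \<bullet> u = 0" "u \<noteq> 0" and nu: "nu_line \<omega> u = \<tau>"
    using someI_ex[OF ex] inv by (auto simp: nu_line_inv_def)
  define d where "d = 1 / norm u"
  have d: "d > 0" using w by (simp add: d_def)
  obtain T y0 where T: "orthogonal_transformation T" "\<omega> = T (axis b 1)" "u = - (1 / d) *\<^sub>R T (axis a 1)"
    "\<And>y. T (vec_of K y + d *\<^sub>R axis a 1) = \<gamma> *v vec_of K y + x + r *\<^sub>R (\<gamma> *v axis b 1) + \<gamma> *v vec_of K y0"
    using frame_of_line[OF \<gamma> w nu[unfolded \<tau>_def]] unfolding d_def by metis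
  define C where "C = pi powr (- (real ?n - 1) / 2) * Gamma ((real ?n - 1) / 2) * d"
  have C: "C > 0" using d card3 by (simp add: C_def Gamma_real_pos)
  define S where "S = sphere_prob (orthogonal_comp {\<omega>})"
  have invS: "invariant_sphere_prob (orthogonal_comp {\<omega>}) S"
    unfolding S_def by (rule invariant_sphere_prob_sphere_prob) (use w card3 in auto)
  have sS: "sets S = sets (restrict_space borel (sphere 0 1 \<inter> orthogonal_comp {\<omega>}))"
    using invS by (simp add: invariant_sphere_prob_def)
  have spS: "space S = sphere 0 1 \<inter> orthogonal_comp {\<omega>}"
    using sets_eq_imp_space_eq[OF sS] by (simp add: space_restrict_space)
  have mS: "h \<in> borel_measurable borel \<Longrightarrow> h \<in> borel_measurable S" for h :: "real ^ 'n \<Rightarrow> 'z :: topological_space"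
    unfolding measurable_cong_sets[OF sS refl] by (rule measurable_restrict_space1)
  define wt where "wt \<theta> = inverse (\<bar>\<theta> \<bullet> u\<bar> ^ (?n - 1))" for \<theta>
  have [simp]: "0 \<le> wt \<theta>" for \<theta> by (simp add: wt_def)
  define pt where "pt \<theta> = - (1 / (\<theta> \<bullet> u)) *\<^sub>R \<theta>" for \<theta>
  have [measurable]: "wt \<in> borel_measurable S" "pt \<in> borel_measurable S"
    unfolding wt_def pt_def by (rule mS, measurable)+
  have key: "(\<integral>\<^sup>+\<theta>. ennreal (wt \<theta>) * h (pt \<theta>) \<partial>S) = ennreal C * (\<integral>\<^sup>+y. h (plane_point \<gamma> x r y) \<partial>LK)"
    if h [measurable]: "h \<in> borel_measurable borel" for h
  proof -
    have [measurable]: "(\<lambda>v. \<gamma> *v v) \<in> borel_measurable borel"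
      by (intro borel_measurable_continuous_onI linear_continuous_on) simp
    have "(\<integral>\<^sup>+\<theta>. ennreal (wt \<theta>) * h (pt \<theta>) \<partial>S) = ennreal C * (\<integral>\<^sup>+y. h (T (vec_of K y + d *\<^sub>R axis a 1)) \<partial>LK)"
      unfolding wt_def pt_def S_def C_def by (rule nn_integral_gnomonic[OF T(1) d T(2,3) h])
    also have "(\<integral>\<^sup>+y. h (T (vec_of K y + d *\<^sub>R axis a 1)) \<partial>LK) =
      ennreal (\<bar>1\<bar> ^ card K) * (\<integral>\<^sup>+y. h (\<gamma> *v (vec_of K y0 + 1 *\<^sub>R vec_of K y) + (x + r *\<^sub>R (\<gamma> *v axis b 1))) \<partial>LK)"
      unfolding T(4) by (simp add: matrix_vector_right_distrib add_ac)
    also have "\<dots> = (\<integral>\<^sup>+y. h (\<gamma> *v vec_of K y + (x + r *\<^sub>R (\<gamma> *v axis b 1))) \<partial>LK)"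
      by (rule nn_integral_coords_affine[symmetric]) simp_all
    finally show ?thesis by (simp add: plane_point_def add.assoc)
  qed
  \<comment> \<open>Stated as an equality of measures, the formula for nonnegative functions carries
    over to the complex integrand without any integrability assumption.\<close>
  have meq: "distr (density S (\<lambda>\<theta>. ennreal (wt \<theta>))) borel pt = density (distr LK borel (plane_point \<gamma> x r)) (\<lambda>_. ennreal C)"
  proof (rule measure_eqI)
    fix A assume "A \<in> sets (distr (density S (\<lambda>\<theta>. ennreal (wt \<theta>))) borel pt)"
    hence A [measurable]: "A \<in> sets borel" by simp
    have "emeasure (distr (density S (\<lambda>\<theta>. ennreal (wt \<theta>))) borel pt) A = (\<integral>\<^sup>+z. indicator A z \<partial>distr (density S (\<lambda>\<theta>. ennreal (wt \<theta>))) borel pt)"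
      by simp
    also have "\<dots> = (\<integral>\<^sup>+\<theta>. indicator A (pt \<theta>) \<partial>density S (\<lambda>\<theta>. ennreal (wt \<theta>)))"
      by (subst nn_integral_distr) auto
    also have "\<dots> = (\<integral>\<^sup>+\<theta>. ennreal (wt \<theta>) * indicator A (pt \<theta>) \<partial>S)"
      by (subst nn_integral_density) auto
    also have "\<dots> = ennreal C * (\<integral>\<^sup>+y. indicator A (plane_point \<gamma> x r y) \<partial>LK)" by (rule key) simp
    also have "(\<integral>\<^sup>+y. indicator A (plane_point \<gamma> x r y) \<partial>LK) = emeasure (distr LK borel (plane_point \<gamma> x r)) A"
      by (subst nn_integral_distr[of "plane_point \<gamma> x r" LK borel "indicator A", symmetric]) auto
    also have "ennreal C * \<dots> = emeasure (density (distr LK borel (plane_point \<gamma> x r)) (\<lambda>_. ennreal C)) A"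
      by (rule emeasure_density_const[symmetric]) simp
    finally show "emeasure (distr (density S (\<lambda>\<theta>. ennreal (wt \<theta>))) borel pt) A = emeasure (density (distr LK borel (plane_point \<gamma> x r)) (\<lambda>_. ennreal C)) A" .
  qed simp
  have u0: "AE \<theta> in S. \<theta> \<bullet> u \<noteq> 0"
  proof -
    have "(\<integral>\<^sup>+\<theta>. indicator {\<theta>. \<theta> \<bullet> u = 0} \<theta> \<partial>S) = (\<integral>\<^sup>+x. indicator {\<theta>. \<theta> \<bullet> u = 0} (sgn (x - (x \<bullet> \<omega>) *\<^sub>R \<omega>)) \<partial>gauss)"
      unfolding S_def by (rule nn_integral_sphere_prob) (use w card3 in auto)
    also have "\<dots> = (\<integral>\<^sup>+x. 0 \<partial>(gauss :: (real ^ 'n) measure))"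
    proof (rule nn_integral_cong_AE)
      have "AE x in gauss. x \<bullet> \<omega> \<noteq> 0 \<and> x \<bullet> u \<noteq> 0"
      proof -
        have "\<omega> \<noteq> 0" using w by auto
        from AE_gauss_inner_nonzero[OF w(3)] AE_gauss_inner_nonzero[OF this] show ?thesis
          by eventually_elim auto
      qed
      thus "AE x in gauss. indicator {\<theta>. \<theta> \<bullet> u = 0} (sgn (x - (x \<bullet> \<omega>) *\<^sub>R \<omega>)) = (0::ennreal)"
      proof eventually_elim
        case (elim x)
        have 1: "(x - (x \<bullet> \<omega>) *\<^sub>R \<omega>) \<bullet> u = x \<bullet> u" using w by (simp add: inner_diff_left)
        hence "norm (x - (x \<bullet> \<omega>) *\<^sub>R \<omega>) \<noteq> 0" using elim by auto
        thus ?case using 1 elim by (simp add: sgn_div_norm)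
      qed
    qed
    finally have z: "(\<integral>\<^sup>+\<theta>. indicator {\<theta>. \<theta> \<bullet> u = 0} \<theta> \<partial>S) = 0" by simp
    have m: "(\<lambda>\<theta>. indicator {\<theta>. \<theta> \<bullet> u = 0} \<theta> :: ennreal) \<in> borel_measurable S"
      by (rule mS) (auto intro!: borel_measurable_indicator)
    have "AE \<theta> in S. indicator {\<theta>. \<theta> \<bullet> u = 0} \<theta> = (0::ennreal)"
      using iffD1[OF nn_integral_0_iff_AE[OF m] z] .
    thus ?thesis by eventually_elim (auto simp: indicator_def split: if_splits)
  qed
  \<comment> \<open>The set \<open>N\<close> pulls back to a null set of the sphere because the
    weight is positive wherever \<open>\<theta> \<bullet> u \<noteq> 0\<close>, which is almost
    everywhere.\<close>
  have ptN: "AE \<theta> in S. pt \<theta> \<notin> N"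
  proof -
    have "(\<integral>\<^sup>+\<theta>. ennreal (wt \<theta>) * indicator N (pt \<theta>) \<partial>S) = ennreal C * (\<integral>\<^sup>+y. indicator N (plane_point \<gamma> x r y) \<partial>LK)"
      by (rule key) simp
    also have "(\<integral>\<^sup>+y. indicator N (plane_point \<gamma> x r y) \<partial>LK) = (\<integral>\<^sup>+y. 0 \<partial>LK)"
      using ae by (intro nn_integral_cong_AE) (auto elim!: eventually_mono)
    finally have z: "(\<integral>\<^sup>+\<theta>. ennreal (wt \<theta>) * indicator N (pt \<theta>) \<partial>S) = 0" by simp
    have m: "(\<lambda>\<theta>. ennreal (wt \<theta>) * indicator N (pt \<theta>)) \<in> borel_measurable S" by measurable
    have "AE \<theta> in S. ennreal (wt \<theta>) * indicator N (pt \<theta>) = 0"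
      using iffD1[OF nn_integral_0_iff_AE[OF m] z] .
    with u0 show ?thesis
      by eventually_elim (auto simp: wt_def indicator_def split: if_splits)
  qed
  have "dual_radon \<phi> \<omega> u = (LINT \<theta>|completion S. \<phi> \<theta> (\<theta> \<bullet> u))" by (simp add: dual_radon_def S_def)
  also have "\<dots> = (LINT \<theta>|S. wt \<theta> *\<^sub>R g (pt \<theta>))"
  proof (rule integral_completion_cong_AE)
    show "(\<lambda>\<theta>. wt \<theta> *\<^sub>R g (pt \<theta>)) \<in> borel_measurable S" by measurable
    have "AE \<theta> in S. \<theta> \<in> space S" by simp
    with u0 ptN show "AE \<theta> in S. \<phi> \<theta> (\<theta> \<bullet> u) = wt \<theta> *\<^sub>R g (pt \<theta>)"
    proof eventually_elim
      case (elim \<theta>)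
      have "\<phi> \<theta> (\<theta> \<bullet> u) = point_function \<phi> (pt \<theta>) / of_real (\<bar>\<theta> \<bullet> u\<bar> ^ (?n - 1))"
        unfolding pt_def by (rule point_function_nu[OF \<phi>]) (use elim spS in auto)
      thus ?case using gN[OF elim(2)] by (simp add: wt_def scaleR_conv_of_real divide_inverse mult.commute)
    qed
  qed
  also have "\<dots> = (LINT \<theta>|density S (\<lambda>\<theta>. ennreal (wt \<theta>)). g (pt \<theta>))"
    by (rule integral_density[symmetric]) auto
  also have "\<dots> = (LINT z|distr (density S (\<lambda>\<theta>. ennreal (wt \<theta>))) borel pt. g z)"
    by (rule integral_distr[symmetric]) auto
  also have "\<dots> = (LINT z|distr LK borel (plane_point \<gamma> x r). C *\<^sub>R g z)"
    unfolding meq by (rule integral_density) (use C in auto)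
  also have "\<dots> = C *\<^sub>R (LINT z|distr LK borel (plane_point \<gamma> x r). g z)"
    by (rule integral_scaleR_right)
  also have "(LINT z|distr LK borel (plane_point \<gamma> x r). g z) = (LINT y|LK. g (plane_point \<gamma> x r y))"
    by (rule integral_distr) auto
  finally have dr: "dual_radon \<phi> \<omega> u = C *\<^sub>R (LINT y|LK. g (plane_point \<gamma> x r y))" .
  have inf: "infdist 0 \<tau> = d" using infdist_nu_line[OF w(3), of \<omega>] nu by (simp add: d_def)
  have "Phi \<phi> \<tau> = of_real (sphere_area (?n - 2) / (2 * d)) * dual_radon \<phi> \<omega> u"
    by (simp add: Phi_def inv inf)
  also have "\<dots> = of_real (sphere_area (?n - 2) / (2 * d) * C) * (LINT y|LK. g (plane_point \<gamma> x r y))"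
    unfolding dr by (simp add: scaleR_conv_of_real)
  also have "sphere_area (?n - 2) / (2 * d) * C = 1"
    using sphere_area_gnomonic d by (simp add: C_def)
  finally show ?thesis by (simp add: \<tau>_def)
qed

end

section \<open>Averages over rotations\<close>

lemma matrix_vector_mult_measurable:
  "(\<lambda>z. fst z *v snd z) \<in> borel_measurable (borel \<Otimes>\<^sub>M (borel :: (real ^ 'n::finite) measure) :: ((real ^ 'n ^ 'm::finite) \<times> (real ^ 'n)) measure)"
  unfolding borel_prod matrix_vector_mult_def
  by (intro borel_measurable_continuous_onI continuous_on_vec_lambda continuous_intros)

text \<open>The density at \<open>|z|^2 = w\<close> of the average of Lebesgue measure over all
  \<open>(n - 2)\<close>-planes at distance \<open>sqrt s\<close> from the centre. The factor
  \<open>w powr (1 - n / 2)\<close> cancels the radial density of Lebesgue measure; what remains is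
  the kernel of a Weyl fractional integral of order \<open>n / 2 - 1\<close>, whose
  \<open>1 / Gamma\<close> is contained in \<open>radial_const (n - 2)\<close>.\<close>

definition plane_weight :: "real \<Rightarrow> real \<Rightarrow> real \<Rightarrow> real" where
  "plane_weight n s w = (if s < w then radial_const (n - 2) / radial_const n * w powr (1 - n / 2) * (w - s) powr (n / 2 - 2) else 0)"

lemma plane_weight_measurable [measurable]: "(\<lambda>z. plane_weight n (fst z) (snd z)) \<in> borel_measurable (borel \<Otimes>\<^sub>M borel)"
  unfolding plane_weight_def by measurable

lemma plane_weight_measurable' [measurable]: "plane_weight n s \<in> borel_measurable borel"
  unfolding plane_weight_def by measurable

lemma plane_weight_nonneg: "n > 2 \<Longrightarrow> 0 \<le> plane_weight n s w"
  unfolding plane_weight_def by (auto intro!: divide_nonneg_nonneg mult_nonneg_nonneg less_imp_le[OF radial_const_pos])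

locale haar_frame = frame e for e :: "nat \<Rightarrow> 'n::finite" +
  fixes G :: "(real ^ 'n ^ 'n) measure"
  assumes haar: "haar_prob_SO G"
begin

lemma sets_G: "sets G = sets (restrict_space borel {A. rotation_matrix A})"
  using haar by (simp add: haar_prob_SO_def)

lemma space_G: "space G = {A. rotation_matrix A}"
  using sets_eq_imp_space_eq[OF sets_G] by (simp add: space_restrict_space)

lemma prob_space_G: "prob_space G"
  using haar by (simp add: haar_prob_SO_def)

lemma measurable_G: "f \<in> borel_measurable borel \<Longrightarrow> f \<in> borel_measurable G"
  unfolding measurable_cong_sets[OF sets_G refl] by (rule measurable_restrict_space1)

lemma id_measurable_G [measurable]: "(\<lambda>\<gamma>. \<gamma>) \<in> borel_measurable G"
  by (rule measurable_G) simp

lemma matrix_vector_G [measurable (raw)]: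
  fixes f :: "'z \<Rightarrow> real ^ 'n ^ 'n" and g :: "'z \<Rightarrow> real ^ 'n"
  assumes "f \<in> M \<rightarrow>\<^sub>M G" "g \<in> borel_measurable M"
  shows "(\<lambda>z. f z *v g z) \<in> borel_measurable M"
proof -
  have "(\<lambda>z. (f z, g z)) \<in> M \<rightarrow>\<^sub>M borel \<Otimes>\<^sub>M borel"
    using measurable_compose[OF assms(1) id_measurable_G] assms(2) by (rule measurable_Pair)
  from measurable_compose[OF this matrix_vector_mult_measurable] show ?thesis by simp
qed

lemma orthogonal_rotation:
  fixes A :: "real ^ 'n ^ 'n"
  assumes "rotation_matrix A"
  shows "orthogonal_transformation ((*v) A)"
  unfolding orthogonal_transformation_matrix
  using assms by (simp add: rotation_matrix_def matrix_of_matrix_vector_mul matrix_vector_mul_linear)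

lemma sphere_prob_UNIV: "invariant_sphere_prob UNIV (sphere_prob (UNIV :: (real ^ 'n) set))"
  using invariant_sphere_prob_sphere_prob[of "0 :: real ^ 'n"] card3 by simp

abbreviation "SP \<equiv> sphere_prob (UNIV :: (real ^ 'n) set)"

lemma sets_SP: "sets SP = sets (restrict_space borel (sphere 0 1))"
  and prob_space_SP: "prob_space SP"
  and inv_SP: "orthogonal_transformation T \<Longrightarrow> distr SP SP T = SP"
  using sphere_prob_UNIV orthogonal_transformation_bij[THEN bij_is_surj, of T] by (auto simp: invariant_sphere_prob_def)

lemma space_SP: "space SP = sphere 0 1"
  using sets_eq_imp_space_eq[OF sets_SP] by (simp add: space_restrict_space)

lemma measurable_SP: "f \<in> borel_measurable borel \<Longrightarrow> f \<in> borel_measurable SP"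
  unfolding measurable_cong_sets[OF sets_SP refl] by (rule measurable_restrict_space1)

lemma id_measurable_SP [measurable]: "(\<lambda>\<gamma>. \<gamma>) \<in> borel_measurable SP"
  by (rule measurable_SP) simp

lemma orthogonal_SP:
  assumes "orthogonal_transformation T"
  shows "T \<in> SP \<rightarrow>\<^sub>M SP"
  unfolding measurable_cong_sets[OF sets_SP sets_SP]
  using orthogonal_transformation_measurable[OF assms]
  by (intro measurable_restrict_space3) (auto simp: orthogonal_transformation_norm[OF assms])

text \<open>Left invariance of \<open>G\<close> enters here: it makes the law of
  \<open>\<gamma> *v v\<close> rotation invariant, and rotations act transitively on the sphere, so
  the ball criterion identifies this law with the uniform one.\<close>

lemma distr_G_unit:
  assumes v: "norm (v :: real ^ 'n) = 1"
  shows "distr G borel (\<lambda>\<gamma>. \<gamma> *v v) = distr SP borel (\<lambda>\<theta>. \<theta>)"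
proof (rule measure_eq_of_uniform_balls_prob[where S="sphere 0 1"])
  show "prob_space (distr G borel (\<lambda>\<gamma>. \<gamma> *v v))"
    by (rule prob_space.prob_space_distr[OF prob_space_G]) measurable
  show "prob_space (distr SP borel (\<lambda>\<theta>. \<theta>))"
    by (rule prob_space.prob_space_distr[OF prob_space_SP]) measurable
  have "sphere (0 :: real ^ 'n) 1 \<in> sets borel" by (intro borel_closed) auto
  thus "AE x in distr G borel (\<lambda>\<gamma>. \<gamma> *v v). x \<in> sphere 0 1"
    by (subst AE_distr_iff) (auto simp: space_G orthogonal_transformation_norm[OF orthogonal_rotation] v intro!: AE_I2)
  show "AE x in distr SP borel (\<lambda>\<theta>. \<theta>). x \<in> sphere 0 1"
    using \<open>sphere (0 :: real ^ 'n) 1 \<in> sets borel\<close> by (subst AE_distr_iff) (auto simp: space_SP intro!: AE_I2)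
  fix y z :: "real ^ 'n" and r :: real
  assume y: "y \<in> sphere 0 1" and z: "z \<in> sphere 0 1" and r: "0 < r"
  obtain T where T: "orthogonal_transformation T" "det (matrix T) = 1" "T z = y"
    using rotation_exists[of z y] y z card3 by auto
  define A where "A = matrix T"
  have Tv: "T = (*v) A" unfolding A_def using T(1) by (simp add: fun_eq_iff orthogonal_transformation_linear matrix_works)
  have rotA: "rotation_matrix A"
    using T by (simp add: rotation_matrix_def A_def orthogonal_transformation_matrix)
  have invG: "distr G G ((**) A) = G" using haar rotA by (simp add: haar_prob_SO_def)
  have Am: "(**) A \<in> G \<rightarrow>\<^sub>M G"
  proof -
    have "(**) A \<in> borel_measurable borel"
    proof (intro borel_measurable_continuous_onI)
      show "continuous_on UNIV ((**) A)"
        unfolding matrix_matrix_mult_def[abs_def]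
        by (intro continuous_on_vec_lambda continuous_intros)
    qed
    thus ?thesis
      unfolding measurable_cong_sets[OF sets_G sets_G]
      using rotA by (intro measurable_restrict_space3) (auto simp: rotation_matrix_def orthogonal_matrix_mul det_mul)
  qed
  have pre: "T -` ball y r = ball z r" by (rule orthogonal_transformation_vimage_ball[OF T(1,3)])
  have "emeasure (distr G borel (\<lambda>\<gamma>. \<gamma> *v v)) (ball y r) = emeasure (distr (distr G G ((**) A)) borel (\<lambda>\<gamma>. \<gamma> *v v)) (ball y r)"
    by (simp add: invG)
  also have "distr (distr G G ((**) A)) borel (\<lambda>\<gamma>. \<gamma> *v v) = distr G borel ((\<lambda>\<gamma>. \<gamma> *v v) \<circ> (**) A)"
    by (rule distr_distr[OF _ Am]) measurable
  also have "(\<lambda>\<gamma>. \<gamma> *v v) \<circ> (**) A = T \<circ> (\<lambda>\<gamma>. \<gamma> *v v)"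
    by (auto simp: Tv matrix_vector_mul_assoc)
  also have "distr G borel \<dots> = distr (distr G borel (\<lambda>\<gamma>. \<gamma> *v v)) borel T"
    by (rule distr_distr[symmetric, OF orthogonal_transformation_measurable[OF T(1)]]) measurable
  also have "emeasure \<dots> (ball y r) = emeasure (distr G borel (\<lambda>\<gamma>. \<gamma> *v v)) (T -` ball y r)"
    using orthogonal_transformation_measurable[OF T(1)] by (subst emeasure_distr) auto
  finally show "emeasure (distr G borel (\<lambda>\<gamma>. \<gamma> *v v)) (ball y r) = emeasure (distr G borel (\<lambda>\<gamma>. \<gamma> *v v)) (ball z r)"
    by (simp add: pre)
  have "emeasure (distr SP borel (\<lambda>\<theta>. \<theta>)) (ball y r) = emeasure (distr (distr SP SP T) borel (\<lambda>\<theta>. \<theta>)) (ball y r)"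
    by (simp add: inv_SP[OF T(1)])
  also have "distr (distr SP SP T) borel (\<lambda>\<theta>. \<theta>) = distr SP borel ((\<lambda>\<theta>. \<theta>) \<circ> T)"
    by (rule distr_distr[OF _ orthogonal_SP[OF T(1)]]) measurable
  also have "(\<lambda>\<theta>. \<theta>) \<circ> T = T \<circ> (\<lambda>\<theta>. \<theta>)" by auto
  also have "distr SP borel \<dots> = distr (distr SP borel (\<lambda>\<theta>. \<theta>)) borel T"
    by (rule distr_distr[symmetric, OF orthogonal_transformation_measurable[OF T(1)]]) measurable
  also have "emeasure \<dots> (ball y r) = emeasure (distr SP borel (\<lambda>\<theta>. \<theta>)) (T -` ball y r)"
    using orthogonal_transformation_measurable[OF T(1)] by (subst emeasure_distr) auto
  finally show "emeasure (distr SP borel (\<lambda>\<theta>. \<theta>)) (ball y r) = emeasure (distr SP borel (\<lambda>\<theta>. \<theta>)) (ball z r)"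
    by (simp add: pre)
qed auto

lemma nn_integral_G_vec:
  assumes h [measurable]: "h \<in> borel_measurable borel"
  shows "(\<integral>\<^sup>+\<gamma>. h (\<gamma> *v v) \<partial>G) = (\<integral>\<^sup>+\<theta>. h (norm v *\<^sub>R \<theta>) \<partial>SP)"
proof (cases "v = 0")
  case True
  thus ?thesis
    using prob_space.emeasure_space_1[OF prob_space_G] prob_space.emeasure_space_1[OF prob_space_SP] by simp
next
  case False
  define v' where "v' = v /\<^sub>R norm v"
  have v': "norm v' = 1" "v = norm v *\<^sub>R v'" using False by (simp_all add: v'_def)
  have "(\<integral>\<^sup>+\<gamma>. h (\<gamma> *v v) \<partial>G) = (\<integral>\<^sup>+\<gamma>. h (norm v *\<^sub>R (\<gamma> *v v')) \<partial>G)"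
    by (subst v'(2)) (simp add: matrix_vector_mult_scaleR)
  also have "\<dots> = (\<integral>\<^sup>+\<theta>. h (norm v *\<^sub>R \<theta>) \<partial>distr G borel (\<lambda>\<gamma>. \<gamma> *v v'))"
    by (subst nn_integral_distr) auto
  also have "\<dots> = (\<integral>\<^sup>+\<theta>. h (norm v *\<^sub>R \<theta>) \<partial>SP)"
    unfolding distr_G_unit[OF v'(1)] by (subst nn_integral_distr) auto
  finally show ?thesis .
qed

text \<open>Polar coordinates come from averaging: Lebesgue measure is unchanged by each
  \<open>\<gamma>\<close>, so \<open>h x\<close> may be replaced by the mean of
  \<open>h (\<gamma> *v x)\<close>, which is the mean of \<open>h\<close> over the sphere of radius
  \<open>norm x\<close>.\<close>

lemma nn_integral_polar:
  fixes h :: "real ^ 'n \<Rightarrow> ennreal"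
  assumes h [measurable]: "h \<in> borel_measurable borel"
  shows "(\<integral>\<^sup>+x. h x \<partial>lborel) = (\<integral>\<^sup>+\<theta>. \<integral>\<^sup>+v. ennreal (radial_const (real CARD('n)) * v powr (real CARD('n) / 2 - 1)) * indicator {0<..} v * h (sqrt v *\<^sub>R \<theta>) \<partial>lborel \<partial>SP)"
proof -
  interpret G: prob_space G by (rule prob_space_G)
  interpret SP: prob_space SP by (rule prob_space_SP)
  interpret GL: pair_sigma_finite G "lborel :: (real ^ 'n) measure" by unfold_locales
  interpret SL: pair_sigma_finite SP "lborel :: (real ^ 'n) measure" by unfold_locales
  have "(\<integral>\<^sup>+x. h x \<partial>lborel) = (\<integral>\<^sup>+\<gamma>. \<integral>\<^sup>+x. h x \<partial>lborel \<partial>G)"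
    by (simp add: G.emeasure_space_1)
  also have "\<dots> = (\<integral>\<^sup>+\<gamma>. \<integral>\<^sup>+x. h (\<gamma> *v x) \<partial>lborel \<partial>G)"
    by (intro nn_integral_cong nn_integral_lborel_orthogonal[symmetric] orthogonal_rotation h) (simp add: space_G)
  also have "\<dots> = (\<integral>\<^sup>+x. \<integral>\<^sup>+\<gamma>. h (\<gamma> *v x) \<partial>G \<partial>lborel)"
    by (rule GL.Fubini'[symmetric]) measurable
  also have "\<dots> = (\<integral>\<^sup>+(x :: real ^ 'n). \<integral>\<^sup>+\<theta>. h (norm x *\<^sub>R \<theta>) \<partial>SP \<partial>lborel)"
    by (subst nn_integral_G_vec) (use h in simp_all)
  also have "\<dots> = (\<integral>\<^sup>+\<theta>. \<integral>\<^sup>+(x :: real ^ 'n). h (norm x *\<^sub>R \<theta>) \<partial>lborel \<partial>SP)"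
    by (rule SL.Fubini') measurable
  also have "\<dots> = (\<integral>\<^sup>+\<theta>. \<integral>\<^sup>+v. ennreal (radial_const (real CARD('n)) * v powr (real CARD('n) / 2 - 1)) * indicator {0<..} v * h (sqrt v *\<^sub>R \<theta>) \<partial>lborel \<partial>SP)"
  proof (rule nn_integral_cong)
    fix \<theta>
    show "(\<integral>\<^sup>+x. h (norm (x :: real ^ 'n) *\<^sub>R \<theta>) \<partial>lborel) = (\<integral>\<^sup>+v. ennreal (radial_const (real CARD('n)) * v powr (real CARD('n) / 2 - 1)) * indicator {0<..} v * h (sqrt v *\<^sub>R \<theta>) \<partial>lborel)"
      using nn_integral_lborel_radial[of "\<lambda>v. h (sqrt v *\<^sub>R \<theta>)"] by simp
  qed
  finally show ?thesis .
qed

text \<open>For fixed \<open>y\<close> the rotated point is uniform on the sphere of squared radius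
  \<open>|y|^2 + r^2\<close>. Writing \<open>|y|^2\<close> in the radial variable of dimension
  \<open>n - 2\<close>, shifting by \<open>r^2\<close> and comparing with polar coordinates in
  dimension \<open>n\<close> reads off \<open>plane_weight\<close>.\<close>

lemma nn_integral_average:
  fixes h :: "real ^ 'n \<Rightarrow> ennreal"
  assumes h [measurable]: "h \<in> borel_measurable borel" and r: "r \<ge> 0"
  shows "(\<integral>\<^sup>+\<gamma>. \<integral>\<^sup>+y. h (\<gamma> *v (vec_of K y + r *\<^sub>R axis b 1)) \<partial>LK \<partial>G) =
    (\<integral>\<^sup>+x. ennreal (plane_weight (real CARD('n)) (r\<^sup>2) ((norm x)\<^sup>2)) * h x \<partial>lborel)"
proof -
  let ?n = "real CARD('n)"
  have n: "?n \<ge> 3" using card3 by simp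
  have cK: "real (card K) = ?n - 2" using card3 by (simp add: frame_props(5) of_nat_diff)
  interpret G: prob_space G by (rule prob_space_G)
  interpret SP: prob_space SP by (rule prob_space_SP)
  interpret LK: sigma_finite_measure LK by (rule sigma_finite_LK)
  interpret GL: pair_sigma_finite G LK by unfold_locales
  interpret SL: pair_sigma_finite SP LK by unfold_locales
  have [simp]: "radial_const ?n > 0" "radial_const (?n - 2) > 0" using n by (auto intro!: radial_const_pos)
  have "(\<integral>\<^sup>+\<gamma>. \<integral>\<^sup>+y. h (\<gamma> *v (vec_of K y + r *\<^sub>R axis b 1)) \<partial>LK \<partial>G) = (\<integral>\<^sup>+y. \<integral>\<^sup>+\<gamma>. h (\<gamma> *v (vec_of K y + r *\<^sub>R axis b 1)) \<partial>G \<partial>LK)"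
    by (rule GL.Fubini'[symmetric]) measurable
  also have "\<dots> = (\<integral>\<^sup>+y. \<integral>\<^sup>+\<theta>. h (sqrt ((norm (vec_of K y))\<^sup>2 + r\<^sup>2) *\<^sub>R \<theta>) \<partial>SP \<partial>LK)"
  proof (rule nn_integral_cong)
    fix y
    have "norm (vec_of K y + r *\<^sub>R axis b (1::real)) = sqrt ((norm (vec_of K y))\<^sup>2 + r\<^sup>2)"
      using norm_plane[of y 0 r] by (simp add: real_sqrt_unique)
    thus "(\<integral>\<^sup>+\<gamma>. h (\<gamma> *v (vec_of K y + r *\<^sub>R axis b 1)) \<partial>G) = (\<integral>\<^sup>+\<theta>. h (sqrt ((norm (vec_of K y))\<^sup>2 + r\<^sup>2) *\<^sub>R \<theta>) \<partial>SP)"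
      using nn_integral_G_vec[OF h, of "vec_of K y + r *\<^sub>R axis b 1"] by simp
  qed
  also have "\<dots> = (\<integral>\<^sup>+\<theta>. \<integral>\<^sup>+y. h (sqrt ((norm (vec_of K y))\<^sup>2 + r\<^sup>2) *\<^sub>R \<theta>) \<partial>LK \<partial>SP)"
    by (rule SL.Fubini') measurable
  also have "\<dots> = (\<integral>\<^sup>+\<theta>. \<integral>\<^sup>+v. ennreal (radial_const ?n * v powr (?n / 2 - 1)) * indicator {0<..} v * (ennreal (plane_weight ?n (r\<^sup>2) v) * h (sqrt v *\<^sub>R \<theta>)) \<partial>lborel \<partial>SP)"
  proof (rule nn_integral_cong)
    fix \<theta>
    have "(\<integral>\<^sup>+y. h (sqrt ((norm (vec_of K y))\<^sup>2 + r\<^sup>2) *\<^sub>R \<theta>) \<partial>LK) =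
      (\<integral>\<^sup>+v. ennreal (radial_const (?n - 2) * v powr ((?n - 2) / 2 - 1)) * indicator {0<..} v * h (sqrt (v + r\<^sup>2) *\<^sub>R \<theta>) \<partial>lborel)"
      using nn_integral_coords_radial[OF K_nonempty, of "\<lambda>v. h (sqrt (v + r\<^sup>2) *\<^sub>R \<theta>)"] by (simp add: cK)
    also have "\<dots> = ennreal \<bar>1\<bar> * (\<integral>\<^sup>+v. ennreal (radial_const (?n - 2) * (- r\<^sup>2 + 1 * v) powr ((?n - 2) / 2 - 1)) * indicator {0<..} (- r\<^sup>2 + 1 * v) * h (sqrt ((- r\<^sup>2 + 1 * v) + r\<^sup>2) *\<^sub>R \<theta>) \<partial>lborel)"
      by (rule nn_integral_real_affine) auto
    also have "\<dots> = (\<integral>\<^sup>+v. ennreal (radial_const ?n * v powr (?n / 2 - 1)) * indicator {0<..} v * (ennreal (plane_weight ?n (r\<^sup>2) v) * h (sqrt v *\<^sub>R \<theta>)) \<partial>lborel)"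
    proof -
      have "ennreal (radial_const (?n - 2) * (- r\<^sup>2 + 1 * v) powr ((?n - 2) / 2 - 1)) * indicator {0<..} (- r\<^sup>2 + 1 * v) * h (sqrt ((- r\<^sup>2 + 1 * v) + r\<^sup>2) *\<^sub>R \<theta>)
        = ennreal (radial_const ?n * v powr (?n / 2 - 1)) * indicator {0<..} v * (ennreal (plane_weight ?n (r\<^sup>2) v) * h (sqrt v *\<^sub>R \<theta>))" for v
      proof (cases "r\<^sup>2 < v")
        case True
        hence v: "v > 0" using zero_le_power2[of r] by linarith
        have p: "v powr (?n / 2 - 1) * v powr (1 - ?n / 2) = 1"
          using v by (subst powr_add[symmetric]) simp
        have ex: "(?n - 2) / 2 - 1 = ?n / 2 - 2" by (simp add: field_simps)
        have "radial_const ?n * v powr (?n / 2 - 1) * plane_weight ?n (r\<^sup>2) v =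
           radial_const (?n - 2) * (v - r\<^sup>2) powr (?n / 2 - 2) * (v powr (?n / 2 - 1) * v powr (1 - ?n / 2)) * (radial_const ?n / radial_const ?n)"
          using True unfolding plane_weight_def by (simp add: mult_ac)
        also have "\<dots> = radial_const (?n - 2) * (v - r\<^sup>2) powr (?n / 2 - 2)"
          unfolding p using less_imp_neq[OF \<open>radial_const ?n > 0\<close>] by simp
        finally have e: "ennreal (radial_const (?n - 2) * (v - r\<^sup>2) powr (?n / 2 - 2)) = ennreal (radial_const ?n * v powr (?n / 2 - 1)) * ennreal (plane_weight ?n (r\<^sup>2) v)"
          using n by (subst ennreal_mult[symmetric]) (auto simp: plane_weight_nonneg less_imp_le)
        show ?thesis using True v unfolding ex by (simp add: e mult.assoc)
      next
        case False
        thus ?thesis by (simp add: plane_weight_def)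
      qed
      thus ?thesis by simp
    qed
    finally show "(\<integral>\<^sup>+y. h (sqrt ((norm (vec_of K y))\<^sup>2 + r\<^sup>2) *\<^sub>R \<theta>) \<partial>LK) =
      (\<integral>\<^sup>+v. ennreal (radial_const ?n * v powr (?n / 2 - 1)) * indicator {0<..} v * (ennreal (plane_weight ?n (r\<^sup>2) v) * h (sqrt v *\<^sub>R \<theta>)) \<partial>lborel)" .
  qed
  also have "\<dots> = (\<integral>\<^sup>+\<theta>. \<integral>\<^sup>+v. ennreal (radial_const ?n * v powr (?n / 2 - 1)) * indicator {0<..} v * (ennreal (plane_weight ?n (r\<^sup>2) ((norm (sqrt v *\<^sub>R \<theta>))\<^sup>2)) * h (sqrt v *\<^sub>R \<theta>)) \<partial>lborel \<partial>SP)"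
    by (intro nn_integral_cong) (auto simp: space_SP indicator_def)
  also have "\<dots> = (\<integral>\<^sup>+x. ennreal (plane_weight ?n (r\<^sup>2) ((norm x)\<^sup>2)) * h x \<partial>lborel)"
    by (rule nn_integral_polar[symmetric]) measurable
  finally show ?thesis .
qed

definition plane_average :: "(real ^ 'n \<Rightarrow> complex) \<Rightarrow> real ^ 'n \<Rightarrow> real \<Rightarrow> complex" where
  "plane_average g x r = (LINT \<gamma>|G. LINT y|LK. g (plane_point \<gamma> x r y))"

lemma plane_point_joint [measurable (raw)]:
  assumes "f \<in> M \<rightarrow>\<^sub>M G" "s \<in> borel_measurable M" "q \<in> M \<rightarrow>\<^sub>M LK"
  shows "(\<lambda>z. plane_point (f z) x (s z) (q z)) \<in> borel_measurable M"
  using assms unfolding plane_point_def by measurable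

lemma plane_average_measurable [measurable]:
  assumes [measurable]: "g \<in> borel_measurable borel"
  shows "plane_average g x \<in> borel_measurable borel"
proof -
  interpret G: prob_space G by (rule prob_space_G)
  interpret LK: sigma_finite_measure LK by (rule sigma_finite_LK)
  show ?thesis unfolding plane_average_def by measurable
qed

lemma plane_point_shift: "plane_point \<gamma> x r y = x + \<gamma> *v (vec_of K y + r *\<^sub>R axis b 1)"
  by (simp add: plane_point_def matrix_vector_right_distrib matrix_vector_mult_scaleR add_ac)

text \<open>Two exceptional sets of rotations are discarded: those for which the displaced plane
  might contain the origin, null because \<open>\<gamma> *v axis a 1\<close> is uniform and
  \<open>x \<noteq> 0\<close>, and those whose plane meets \<open>N\<close> in positive measure,
  null because the averaged plane measure has a density.\<close>

lemma shifted_dual_eq_plane_average: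
  fixes \<phi> :: "real ^ 'n \<Rightarrow> real \<Rightarrow> complex"
  assumes \<phi>: "hyperplane_function \<phi>"
    and g [measurable]: "g \<in> borel_measurable borel" and N: "N \<in> null_sets lborel"
    and gN: "\<And>z. z \<notin> N \<Longrightarrow> point_function \<phi> z = g z"
    and x: "x \<noteq> 0" and r: "r \<ge> 0"
  shows "shifted_dual G e (Phi \<phi>) x r = plane_average g x r"
proof -
  interpret G: prob_space G by (rule prob_space_G)
  interpret LK: sigma_finite_measure LK by (rule sigma_finite_LK)
  have [measurable]: "N \<in> sets borel" using N by auto
  have AE1: "AE \<gamma> in G. x \<bullet> (\<gamma> *v axis a 1) \<noteq> 0"
  proof -
    let ?Z = "{\<theta>. x \<bullet> \<theta> = 0}"
    have [measurable]: "?Z \<in> sets borel" by (intro borel_closed closed_hyperplane)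
    have "(\<integral>\<^sup>+\<gamma>. indicator ?Z (\<gamma> *v axis a 1) \<partial>G) = (\<integral>\<^sup>+\<theta>. indicator ?Z (norm (axis a 1 :: real ^ 'n) *\<^sub>R \<theta>) \<partial>SP)"
      by (rule nn_integral_G_vec) measurable
    also have "\<dots> = (\<integral>\<^sup>+\<theta>. indicator ?Z \<theta> \<partial>SP)" by simp
    also have "\<dots> = (\<integral>\<^sup>+\<theta>. indicator ?Z (sgn \<theta>) \<partial>gauss)"
      using nn_integral_sphere_prob[of 0 "indicator ?Z"] card3 by simp
    also have "\<dots> = (\<integral>\<^sup>+(\<theta> :: real ^ 'n). 0 \<partial>gauss)"
    proof (rule nn_integral_cong_AE)
      show "AE \<theta> in gauss. indicator ?Z (sgn \<theta>) = (0::ennreal)"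
        using AE_gauss_inner_nonzero[OF x]
      proof eventually_elim
        case (elim \<theta>)
        hence "\<theta> \<noteq> 0" by auto
        thus ?case using elim by (simp add: sgn_div_norm inner_commute)
      qed
    qed
    finally have z: "(\<integral>\<^sup>+\<gamma>. indicator ?Z (\<gamma> *v axis a 1) \<partial>G) = 0" by simp
    have m: "(\<lambda>\<gamma>. indicator ?Z (\<gamma> *v axis a 1) :: ennreal) \<in> borel_measurable G" by measurable
    have "AE \<gamma> in G. indicator ?Z (\<gamma> *v axis a 1) = (0::ennreal)"
      using iffD1[OF nn_integral_0_iff_AE[OF m] z] .
    thus ?thesis by eventually_elim (auto simp: indicator_def split: if_splits)
  qed
  have AE2: "AE \<gamma> in G. AE y in LK. plane_point \<gamma> x r y \<notin> N"
  proof -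
    have "(\<integral>\<^sup>+\<gamma>. \<integral>\<^sup>+y. indicator N (plane_point \<gamma> x r y) \<partial>LK \<partial>G) =
      (\<integral>\<^sup>+z. ennreal (plane_weight (real CARD('n)) (r\<^sup>2) ((norm z)\<^sup>2)) * indicator N (x + z) \<partial>lborel)"
      unfolding plane_point_shift by (rule nn_integral_average[OF _ r]) measurable
    also have "\<dots> = (\<integral>\<^sup>+z. 0 \<partial>(lborel :: (real ^ 'n) measure))"
    proof (rule nn_integral_cong_AE)
      have "AE z in distr lborel borel ((+) x). z \<notin> N"
        unfolding lborel_distr_plus using N by (rule AE_not_in)
      hence "AE z in lborel. x + z \<notin> N"
        by (subst (asm) AE_distr_iff) auto
      thus "AE z in lborel. ennreal (plane_weight (real CARD('n)) (r\<^sup>2) ((norm z)\<^sup>2)) * indicator N (x + z) = 0"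
        by eventually_elim simp
    qed
    finally have z: "(\<integral>\<^sup>+\<gamma>. \<integral>\<^sup>+y. indicator N (plane_point \<gamma> x r y) \<partial>LK \<partial>G) = 0" by simp
    have m: "(\<lambda>\<gamma>. \<integral>\<^sup>+y. indicator N (plane_point \<gamma> x r y) \<partial>LK) \<in> borel_measurable G" by measurable
    have "AE \<gamma> in G. (\<integral>\<^sup>+y. indicator N (plane_point \<gamma> x r y) \<partial>LK) = 0"
      using iffD1[OF nn_integral_0_iff_AE[OF m] z] .
    thus ?thesis
    proof eventually_elim
      case (elim \<gamma>)
      have m: "(\<lambda>y. indicator N (plane_point \<gamma> x r y) :: ennreal) \<in> borel_measurable LK" by measurable
      have "AE y in LK. indicator N (plane_point \<gamma> x r y) = (0::ennreal)"
        using iffD1[OF nn_integral_0_iff_AE[OF m] elim] .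
      thus ?case by eventually_elim (auto simp: indicator_def split: if_splits)
    qed
  qed
  show ?thesis
    unfolding shifted_dual_def plane_average_def plane_eq
  proof (rule integral_completion_cong_AE)
    show "(\<lambda>\<gamma>. LINT y|LK. g (plane_point \<gamma> x r y)) \<in> borel_measurable G" by measurable
    have "AE \<gamma> in G. \<gamma> \<in> space G" by simp
    with AE1 AE2 show "AE \<gamma> in G. Phi \<phi> (range (plane_point \<gamma> x r)) = (LINT y|LK. g (plane_point \<gamma> x r y))"
    proof eventually_elim
      case (elim \<gamma>)
      show ?case
        by (rule Phi_eq_plane_integral[OF \<phi> g \<open>N \<in> sets borel\<close> gN _ elim(1,2)])
           (use elim in \<open>auto simp: space_G intro: orthogonal_rotation\<close>)
    qed
  qed
qed

text \<open>Rotations and plane coordinates together have an image measure with density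
  \<open>plane_weight\<close>; the finiteness assumption is what lets the iterated complex integral
  be read as one integral over the product.\<close>

lemma plane_average_eq:
  assumes g [measurable]: "g \<in> borel_measurable borel" and r: "r \<ge> 0"
    and fin: "(\<integral>\<^sup>+z. ennreal (plane_weight (real CARD('n)) (r\<^sup>2) ((norm z)\<^sup>2)) * ennreal (norm (g (x + z))) \<partial>lborel) < \<infinity>"
  shows "plane_average g x r = (LINT z|lborel. plane_weight (real CARD('n)) (r\<^sup>2) ((norm z)\<^sup>2) *\<^sub>R g (x + z))"
proof -
  let ?W = "\<lambda>z :: real ^ 'n. plane_weight (real CARD('n)) (r\<^sup>2) ((norm z)\<^sup>2)"
  interpret G: prob_space G by (rule prob_space_G)
  interpret LK: sigma_finite_measure LK by (rule sigma_finite_LK)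
  interpret GL: pair_sigma_finite G LK by unfold_locales
  let ?P = "\<lambda>(\<gamma>, y). \<gamma> *v (vec_of K y + r *\<^sub>R axis b (1::real))"
  have [measurable]: "?P \<in> borel_measurable (G \<Otimes>\<^sub>M LK)" by measurable
  have nonneg: "?W z \<ge> 0" for z using card3 by (intro plane_weight_nonneg) auto
  have meq: "distr (G \<Otimes>\<^sub>M LK) borel ?P = density lborel (\<lambda>z. ennreal (?W z))"
  proof (rule measure_eqI)
    fix A assume "A \<in> sets (distr (G \<Otimes>\<^sub>M LK) borel ?P)"
    hence A [measurable]: "A \<in> sets borel" by simp
    have "emeasure (distr (G \<Otimes>\<^sub>M LK) borel ?P) A = (\<integral>\<^sup>+z. indicator A z \<partial>distr (G \<Otimes>\<^sub>M LK) borel ?P)" by simp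
    also have "\<dots> = (\<integral>\<^sup>+z. indicator A (?P z) \<partial>(G \<Otimes>\<^sub>M LK))" by (subst nn_integral_distr) auto
    also have "\<dots> = (\<integral>\<^sup>+\<gamma>. \<integral>\<^sup>+y. indicator A (?P (\<gamma>, y)) \<partial>LK \<partial>G)"
      by (rule LK.nn_integral_fst[symmetric]) measurable
    also have "\<dots> = (\<integral>\<^sup>+z. ennreal (?W z) * indicator A z \<partial>lborel)"
      unfolding prod.case by (rule nn_integral_average[OF _ r]) measurable
    also have "\<dots> = emeasure (density lborel (\<lambda>z. ennreal (?W z))) A"
      by (subst emeasure_density) auto
    finally show "emeasure (distr (G \<Otimes>\<^sub>M LK) borel ?P) A = emeasure (density lborel (\<lambda>z. ennreal (?W z))) A" .
  qed simp
  have int: "integrable (density lborel (\<lambda>z. ennreal (?W z))) (\<lambda>z. g (x + z))"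
    using fin nonneg by (subst integrable_density) (auto simp: integrable_iff_bounded ennreal_mult')
  have "integrable (G \<Otimes>\<^sub>M LK) (\<lambda>z. g (x + ?P z))"
    using int unfolding meq[symmetric] by (subst (asm) integrable_distr_eq) auto
  hence i: "integrable (G \<Otimes>\<^sub>M LK) (\<lambda>(\<gamma>, y). g (x + \<gamma> *v (vec_of K y + r *\<^sub>R axis b 1)))"
    by (simp add: case_prod_unfold)
  have "(LINT \<gamma>|G. LINT y|LK. g (x + ?P (\<gamma>, y))) = (LINT z|(G \<Otimes>\<^sub>M LK). g (x + ?P z))"
    using GL.integral_fst[OF i] by (simp add: case_prod_unfold)
  also have "\<dots> = (LINT z|distr (G \<Otimes>\<^sub>M LK) borel ?P. g (x + z))"
    by (rule integral_distr[symmetric]) auto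
  also have "\<dots> = (LINT z|lborel. ?W z *\<^sub>R g (x + z))"
    unfolding meq by (rule integral_density) (auto simp: nonneg)
  finally show ?thesis by (simp add: plane_average_def plane_point_shift)
qed

declare id_measurable_SP [measurable del] id_measurable_G [measurable del]

end

section \<open>The kernel of the Marchaud derivative\<close>

text \<open>The recursive form lets the mean value theorem be applied one difference at a time; the
  binomial sum is recovered in \<open>backward_diff_eq_sum\<close>.\<close>

fun backward_diff :: "nat \<Rightarrow> (real \<Rightarrow> real) \<Rightarrow> real \<Rightarrow> real" where
  "backward_diff 0 f w = f w"
| "backward_diff (Suc m) f w = backward_diff m f w - backward_diff m f (w - 1)"

lemma backward_diff_eq_sum:
  "backward_diff m f w = (\<Sum>j\<le>m. real (m choose j) * (- 1) ^ j * f (w - real j))"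
proof (induction m arbitrary: w)
  case (Suc m)
  have "(\<Sum>j\<le>Suc m. real (Suc m choose j) * (- 1) ^ j * f (w - real j))
    = f w + (\<Sum>j\<le>m. real (Suc m choose Suc j) * (- 1) ^ Suc j * f (w - real (Suc j)))"
    by (subst sum.atMost_Suc_shift) simp
  also have "(\<Sum>j\<le>m. real (Suc m choose Suc j) * (- 1) ^ Suc j * f (w - real (Suc j)))
    = (\<Sum>j\<le>m. real (m choose Suc j) * (- 1) ^ Suc j * f (w - real (Suc j))) - (\<Sum>j\<le>m. real (m choose j) * (- 1) ^ j * f (w - 1 - real j))"
    unfolding sum_subtractf[symmetric]
    by (rule sum.cong) (simp_all add: algebra_simps)
  also have "f w + ((\<Sum>j\<le>m. real (m choose Suc j) * (- 1) ^ Suc j * f (w - real (Suc j))) - (\<Sum>j\<le>m. real (m choose j) * (- 1) ^ j * f (w - 1 - real j)))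
    = (\<Sum>j\<le>Suc m. real (m choose j) * (- 1) ^ j * f (w - real j)) - (\<Sum>j\<le>m. real (m choose j) * (- 1) ^ j * f (w - 1 - real j))"
    by (subst sum.atMost_Suc_shift[of _ m]) simp
  also have "(\<Sum>j\<le>Suc m. real (m choose j) * (- 1) ^ j * f (w - real j)) = (\<Sum>j\<le>m. real (m choose j) * (- 1) ^ j * f (w - real j))"
    by simp
  finally show ?case by (simp add: Suc.IH)
qed simp

lemma backward_diff_deriv:
  assumes "\<And>x. w - real m \<le> x \<Longrightarrow> x \<le> w \<Longrightarrow> (f has_real_derivative f' x) (at x)"
  shows "(backward_diff m f has_real_derivative backward_diff m f' w) (at w)"
  using assms
proof (induction m arbitrary: w)
  case (Suc m)
  have 1: "(backward_diff m f has_real_derivative backward_diff m f' w) (at w)"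
    by (rule Suc.IH) (use Suc.prems in auto)
  have 2: "(backward_diff m f has_real_derivative backward_diff m f' (w - 1)) (at (w - 1))"
    by (rule Suc.IH) (use Suc.prems in auto)
  have "((\<lambda>w. backward_diff m f (w - 1)) has_real_derivative backward_diff m f' (w - 1)) (at w)"
    using DERIV_shift[of "backward_diff m f" "backward_diff m f' (w - 1)" w "- 1"] 2 by simp
  from DERIV_diff[OF 1 this] show ?case by simp
next
  case 0
  have "backward_diff 0 f = f" for f by (simp add: fun_eq_iff)
  thus ?case using 0 by simp
qed

text \<open>Each difference costs one derivative: by the mean value theorem an \<open>m\<close>-fold
  difference of \<open>F 0\<close> equals an \<open>(m - 1)\<close>-fold difference of
  \<open>F 1\<close> at an intermediate point, and the induction hypothesis applies to the shifted
  family.\<close>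

lemma backward_diff_bound:
  assumes "\<And>k x. k < m \<Longrightarrow> w - real m \<le> x \<Longrightarrow> x \<le> w \<Longrightarrow> (F k has_real_derivative F (Suc k) x) (at x)"
    and "\<And>x. w - real m \<le> x \<Longrightarrow> x \<le> w \<Longrightarrow> \<bar>F m x\<bar> \<le> B"
  shows "\<bar>backward_diff m (F 0) w\<bar> \<le> B"
  using assms
proof (induction m arbitrary: w F)
  case (Suc m)
  have d: "(backward_diff m (F 0) has_real_derivative backward_diff m (F 1) x) (at x)" if "w - 1 \<le> x" "x \<le> w" for x
    by (rule backward_diff_deriv) (use Suc.prems(1)[of 0] that in auto)
  obtain \<xi> where \<xi>: "w - 1 < \<xi>" "\<xi> < w"
    "backward_diff m (F 0) w - backward_diff m (F 0) (w - 1) = (w - (w - 1)) * backward_diff m (F 1) \<xi>"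
    using MVT2[of "w - 1" w "backward_diff m (F 0)" "backward_diff m (F 1)"] d by auto
  have "\<bar>backward_diff m ((\<lambda>k. F (Suc k)) 0) \<xi>\<bar> \<le> B"
    by (rule Suc.IH) (use Suc.prems \<xi> in auto)
  thus ?case using \<xi> by simp
qed auto

text \<open>The \<open>m\<close>-th backward difference of the truncated power with exponent
  \<open>\<alpha>\<close>; up to scaling and a power of \<open>w\<close>, this is what integrating
  the Marchaud bracket over \<open>r\<close> leaves.\<close>

definition diff_kernel :: "nat \<Rightarrow> real \<Rightarrow> real \<Rightarrow> real" where
  "diff_kernel m \<alpha> w = (\<Sum>j\<le>m. real (m choose j) * (- 1) ^ j * max 0 (w - real j) powr \<alpha>)"

lemma diff_kernel_measurable [measurable]: "diff_kernel m \<alpha> \<in> borel_measurable borel"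
  unfolding diff_kernel_def by measurable

lemma diff_kernel_small:
  assumes "w \<ge> 0" "\<alpha> > 0"
  shows "\<bar>diff_kernel m \<alpha> w\<bar> \<le> 2 ^ m * w powr \<alpha>"
proof -
  have "\<bar>diff_kernel m \<alpha> w\<bar> \<le> (\<Sum>j\<le>m. \<bar>real (m choose j) * (- 1) ^ j * max 0 (w - real j) powr \<alpha>\<bar>)"
    unfolding diff_kernel_def by (rule sum_abs)
  also have "\<dots> \<le> (\<Sum>j\<le>m. real (m choose j) * w powr \<alpha>)"
    using assms by (intro sum_mono) (auto simp: abs_mult power_abs intro!: mult_left_mono powr_mono2)
  also have "\<dots> = 2 ^ m * w powr \<alpha>"
    using choose_row_sum[of m] by (simp add: sum_distrib_right[symmetric] of_nat_sum[symmetric] del: of_nat_sum)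
  finally show ?thesis .
qed

text \<open>For \<open>w \<ge> 2 * m\<close> every node \<open>w - j\<close> is at least
  \<open>w / 2\<close>, so the truncation is inactive and the difference is controlled by the
  \<open>m\<close>-th derivative of the power, of order \<open>w powr (\<alpha> - m)\<close>. This
  is where \<open>m > \<alpha>\<close> buys decay.\<close>

lemma diff_kernel_large:
  assumes \<alpha>: "0 < \<alpha>" "\<alpha> < real m" and w: "w \<ge> 2 * real m" "w > 0"
  shows "\<bar>diff_kernel m \<alpha> w\<bar> \<le> \<bar>\<Prod>i<m. \<alpha> - real i\<bar> * (w / 2) powr (\<alpha> - real m)"
proof -
  define F where "F k x = (\<Prod>i<k. \<alpha> - real i) * x powr (\<alpha> - real k)" for k x
  have eq: "diff_kernel m \<alpha> w = backward_diff m (F 0) w"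
    unfolding backward_diff_eq_sum diff_kernel_def
    using w by (intro sum.cong) (auto simp: F_def max_def)
  have pos: "x > 0" "x \<ge> w / 2" if "w - real m \<le> x" for x using that w by auto
  have der: "(F k has_real_derivative F (Suc k) x) (at x)" if "x > 0" for k x
  proof -
    have "((\<lambda>x. x powr (\<alpha> - real k)) has_real_derivative (\<alpha> - real k) * x powr (\<alpha> - real k - 1)) (at x)"
      by (rule has_real_derivative_powr[OF that])
    from DERIV_cmult[OF this, of "\<Prod>i<k. \<alpha> - real i"] show ?thesis
      unfolding F_def by (simp add: mult_ac diff_diff_eq add.commute)
  qed
  show ?thesis
    unfolding eq
  proof (rule backward_diff_bound)
    show "(F k has_real_derivative F (Suc k) x) (at x)" if "w - real m \<le> x" for k x
      using der pos[OF that] by blast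
    show "\<bar>F m x\<bar> \<le> \<bar>\<Prod>i<m. \<alpha> - real i\<bar> * (w / 2) powr (\<alpha> - real m)" if "w - real m \<le> x" for x
      unfolding F_def abs_mult using pos[OF that] w \<alpha>
      by (intro mult_mono) (auto intro!: powr_mono2')
  qed
qed

lemma diff_kernel_bound:
  assumes \<alpha>: "0 < \<alpha>" "\<alpha> < real m"
  obtains C where "C > 0" "\<And>w. w > 0 \<Longrightarrow> \<bar>diff_kernel m \<alpha> w\<bar> \<le> C * (w powr \<alpha> * (1 + w) powr (- real m))"
proof -
  \<comment> \<open>\<open>C1\<close> serves \<open>w < 2 * m\<close>, where \<open>1 + w\<close> is
    at most \<open>1 + 2 * m\<close>; \<open>C2\<close> serves the rest, where
    \<open>1 + w \<le> 2 * w\<close> and the bound for large arguments holds.\<close>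
  define C1 where "C1 = 2 ^ m * (1 + 2 * real m) powr real m"
  define C2 where "C2 = \<bar>\<Prod>i<m. \<alpha> - real i\<bar> * (1 / 2) powr (\<alpha> - real m) * 2 powr real m"
  have m: "real m > 0" "m \<ge> 1" using \<alpha> by (auto simp: Suc_le_eq intro: gr0I)
  have C1: "C1 > 0" by (auto simp: C1_def intro!: mult_pos_pos)
  have C2: "C2 \<ge> 0" by (simp add: C2_def)
  have "\<bar>diff_kernel m \<alpha> w\<bar> \<le> (C1 + C2) * (w powr \<alpha> * (1 + w) powr (- real m))" if w: "w > 0" for w
  proof (cases "w \<ge> 2 * real m")
    case False
    have "1 \<le> (1 + 2 * real m) powr real m * (1 + w) powr (- real m)"
    proof -
      have "(1 + w) powr real m \<le> (1 + 2 * real m) powr real m"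
        using False w by (intro powr_mono2) auto
      thus ?thesis using w by (simp add: powr_minus field_simps)
    qed
    hence "2 ^ m * w powr \<alpha> * 1 \<le> 2 ^ m * w powr \<alpha> * ((1 + 2 * real m) powr real m * (1 + w) powr (- real m))"
      by (rule mult_left_mono) simp
    also have "\<dots> = C1 * (w powr \<alpha> * (1 + w) powr (- real m))" by (simp add: C1_def mult_ac)
    also have "\<dots> \<le> (C1 + C2) * (w powr \<alpha> * (1 + w) powr (- real m))"
      using C2 by (intro mult_right_mono) auto
    finally show ?thesis using diff_kernel_small[of w \<alpha> m] w \<alpha> by linarith
  next
    case True
    have w1: "1 \<le> w" using True m by linarith
    have "w powr (- real m) \<le> 2 powr real m * (1 + w) powr (- real m)"
    proof -
      have "(1 + w) powr real m \<le> (2 * w) powr real m" using w1 by (intro powr_mono2) auto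
      thus ?thesis using w by (simp add: powr_minus powr_mult field_simps)
    qed
    hence *: "w powr \<alpha> * w powr (- real m) \<le> w powr \<alpha> * (2 powr real m * (1 + w) powr (- real m))"
      by (rule mult_left_mono) simp
    have "\<bar>\<Prod>i<m. \<alpha> - real i\<bar> * (w / 2) powr (\<alpha> - real m) = (\<bar>\<Prod>i<m. \<alpha> - real i\<bar> * (1 / 2) powr (\<alpha> - real m)) * (w powr \<alpha> * w powr (- real m))"
    proof -
      have "(w / 2) powr (\<alpha> - real m) = w powr (\<alpha> - real m) * (1 / 2) powr (\<alpha> - real m)"
        using w by (subst powr_mult[symmetric]) auto
      thus ?thesis by (simp add: powr_add[symmetric] mult_ac)
    qed
    also have "\<dots> \<le> (\<bar>\<Prod>i<m. \<alpha> - real i\<bar> * (1 / 2) powr (\<alpha> - real m)) * (w powr \<alpha> * (2 powr real m * (1 + w) powr (- real m)))"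
      using * by (rule mult_left_mono) simp
    also have "\<dots> = C2 * (w powr \<alpha> * (1 + w) powr (- real m))" by (simp add: C2_def mult_ac)
    also have "\<dots> \<le> (C1 + C2) * (w powr \<alpha> * (1 + w) powr (- real m))"
      using C1 by (intro mult_right_mono) auto
    finally show ?thesis using diff_kernel_large[OF \<alpha> True w] by linarith
  qed
  thus ?thesis using that[of "C1 + C2"] C1 C2 by auto
qed

lemma nn_integral_powr_Ioo_0_1:
  assumes "a > 0"
  shows "(\<integral>\<^sup>+w. ennreal (w powr (a - 1)) * indicator {0<..1} w \<partial>lborel) < \<infinity>"
proof -
  have "((\<lambda>w. w powr (a - 1)) has_integral 1 powr a / a) {0..1}"
    using has_integral_powr_from_0[of "a - 1" 1] assms by simp
  from nn_integral_has_integral_lebesgue[OF _ this]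
  have "(\<integral>\<^sup>+w. ennreal (indicator {0..1} w * w powr (a - 1)) \<partial>lborel) = ennreal (1 powr a / a)" by simp
  moreover have "(\<integral>\<^sup>+w. ennreal (w powr (a - 1)) * indicator {0<..1} w \<partial>lborel) \<le> (\<integral>\<^sup>+w. ennreal (indicator {0..1} w * w powr (a - 1)) \<partial>lborel)"
    by (intro nn_integral_mono) (auto simp: indicator_def)
  ultimately show ?thesis by (metis ennreal_less_top le_less_trans infinity_ennreal_def)
qed

lemma nn_integral_powr_tail:
  assumes "a > 0" "r > 0"
  shows "(\<integral>\<^sup>+w. ennreal (w powr (- 1 - a)) * indicator {r<..} w \<partial>lborel) = ennreal (r powr (- a) / a)"
proof -
  have "((\<lambda>w. w powr (- 1 - a)) has_integral - (r powr (- 1 - a + 1)) / (- 1 - a + 1)) {r..}"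
    by (rule has_integral_powr_to_inf) (use assms in auto)
  from nn_integral_has_integral_lebesgue[OF _ this]
  have "(\<integral>\<^sup>+w. ennreal (indicator {r..} w * w powr (- 1 - a)) \<partial>lborel) = ennreal (r powr (- a) / a)"
    using assms by (simp add: field_simps)
  moreover have "(\<integral>\<^sup>+w. ennreal (indicator {r..} w * w powr (- 1 - a)) \<partial>lborel) = (\<integral>\<^sup>+w. ennreal (w powr (- 1 - a)) * indicator {r<..} w \<partial>lborel)"
    by (rule nn_integral_cong_AE, rule AE_mp[OF AE_lborel_singleton[of r]]) (auto simp: indicator_def)
  ultimately show ?thesis by simp
qed

lemma nn_integral_beta_finite:
  assumes a: "0 < a" "a < b"
  shows "(\<integral>\<^sup>+w. ennreal (w powr (a - 1) * (1 + w) powr (- b)) * indicator {0<..} w \<partial>lborel) < \<infinity>"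
proof -
  have "(\<integral>\<^sup>+w. ennreal (w powr (a - 1) * (1 + w) powr (- b)) * indicator {0<..} w \<partial>lborel) \<le>
    (\<integral>\<^sup>+w. ennreal (w powr (a - 1)) * indicator {0<..1} w + ennreal (w powr (- 1 - (b - a))) * indicator {1<..} w \<partial>lborel)"
  proof (rule nn_integral_mono)
    fix w :: real
    show "ennreal (w powr (a - 1) * (1 + w) powr (- b)) * indicator {0<..} w \<le>
      ennreal (w powr (a - 1)) * indicator {0<..1} w + ennreal (w powr (- 1 - (b - a))) * indicator {1<..} w"
    proof (cases "w > 1")
      case True
      have "(1 + w) powr (- b) \<le> w powr (- b)" using True a by (intro powr_mono2') auto
      hence "w powr (a - 1) * (1 + w) powr (- b) \<le> w powr (a - 1) * w powr (- b)" by (rule mult_left_mono) simp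
      also have "\<dots> = w powr (- 1 - (b - a))" by (simp add: powr_add[symmetric] algebra_simps)
      finally show ?thesis using True by (auto simp: indicator_def intro: ennreal_leI)
    next
      case False
      show ?thesis
      proof (cases "w > 0")
        case True
        have "(1 + w) powr (- b) \<le> 1" using True a by (simp add: powr_minus inverse_le_1_iff ge_one_powr_ge_zero)
        hence "w powr (a - 1) * (1 + w) powr (- b) \<le> w powr (a - 1) * 1" by (rule mult_left_mono) simp
        thus ?thesis using True False by (auto simp: indicator_def intro: ennreal_leI)
      qed simp
    qed
  qed
  also have "\<dots> = (\<integral>\<^sup>+w. ennreal (w powr (a - 1)) * indicator {0<..1} w \<partial>lborel) + (\<integral>\<^sup>+w. ennreal (w powr (- 1 - (b - a))) * indicator {1<..} w \<partial>lborel)"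
    by (rule nn_integral_add) auto
  also have "\<dots> < \<infinity>"
    using nn_integral_powr_Ioo_0_1[OF a(1)] nn_integral_powr_tail[of "b - a" 1] a by simp
  finally show ?thesis .
qed

lemma diff_kernel_integrable:
  assumes \<alpha>: "0 < \<alpha>" "\<alpha> < real m"
  shows "(\<integral>\<^sup>+w. ennreal (\<bar>diff_kernel m \<alpha> w\<bar> / w) * indicator {0<..} w \<partial>lborel) < \<infinity>"
proof -
  obtain C where C: "C > 0" "\<And>w. w > 0 \<Longrightarrow> \<bar>diff_kernel m \<alpha> w\<bar> \<le> C * (w powr \<alpha> * (1 + w) powr (- real m))"
    using diff_kernel_bound[OF \<alpha>] by blast
  have "(\<integral>\<^sup>+w. ennreal (\<bar>diff_kernel m \<alpha> w\<bar> / w) * indicator {0<..} w \<partial>lborel) \<le>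
    (\<integral>\<^sup>+w. ennreal C * (ennreal (w powr (\<alpha> - 1) * (1 + w) powr (- real m)) * indicator {0<..} w) \<partial>lborel)"
  proof (rule nn_integral_mono)
    fix w :: real
    show "ennreal (\<bar>diff_kernel m \<alpha> w\<bar> / w) * indicator {0<..} w \<le> ennreal C * (ennreal (w powr (\<alpha> - 1) * (1 + w) powr (- real m)) * indicator {0<..} w)"
    proof (cases "w > 0")
      case True
      have "\<bar>diff_kernel m \<alpha> w\<bar> / w \<le> C * (w powr \<alpha> * (1 + w) powr (- real m)) / w"
        using C(2)[OF True] True by (intro divide_right_mono) auto
      also have "\<dots> = C * (w powr (\<alpha> - 1) * (1 + w) powr (- real m))"
        using True by (simp add: powr_diff)
      finally show ?thesis using True C by (simp add: ennreal_mult'[symmetric] ennreal_leI)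
    qed simp
  qed
  also have "\<dots> = ennreal C * (\<integral>\<^sup>+w. ennreal (w powr (\<alpha> - 1) * (1 + w) powr (- real m)) * indicator {0<..} w \<partial>lborel)"
    by (rule nn_integral_cmult) measurable
  also have "\<dots> < \<infinity>" using nn_integral_beta_finite[OF \<alpha>] by (simp add: ennreal_mult_less_top)
  finally show ?thesis .
qed

lemma laplace_shifted_powr:
  fixes \<alpha> s j :: real
  assumes \<alpha>: "\<alpha> > 0" and s: "s > 0" and j: "j \<ge> 0"
  shows "has_bochner_integral lborel (\<lambda>w. exp (- s * w) * max 0 (w - j) powr \<alpha>) (exp (- s * j) * (Gamma (\<alpha> + 1) * s powr (- (\<alpha> + 1))))"
proof (rule has_bochner_integral_nn_integral)
  have "(\<integral>\<^sup>+w. ennreal (exp (- s * w) * max 0 (w - j) powr \<alpha>) \<partial>lborel) = ennreal \<bar>1\<bar> * (\<integral>\<^sup>+w. ennreal (exp (- s * (j + 1 * w)) * max 0 ((j + 1 * w) - j) powr \<alpha>) \<partial>lborel)"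
    by (rule nn_integral_real_affine) auto
  also have "\<dots> = (\<integral>\<^sup>+w. ennreal (exp (- s * j)) * (ennreal (w powr (\<alpha> + 1 - 1) * exp (- s * w)) * indicator {0<..} w) \<partial>lborel)"
  proof -
    have "ennreal (exp (- s * (j + 1 * w)) * max 0 ((j + 1 * w) - j) powr \<alpha>) = ennreal (exp (- s * j)) * (ennreal (w powr (\<alpha> + 1 - 1) * exp (- s * w)) * indicator {0<..} w)" for w
      using \<alpha> by (auto simp: indicator_def max_def ennreal_mult'[symmetric] exp_add[symmetric] algebra_simps)
    thus ?thesis by simp
  qed
  also have "\<dots> = ennreal (exp (- s * j)) * (\<integral>\<^sup>+w. ennreal (w powr (\<alpha> + 1 - 1) * exp (- s * w)) * indicator {0<..} w \<partial>lborel)"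
    by (rule nn_integral_cmult) measurable
  also have "\<dots> = ennreal (exp (- s * j)) * ennreal (Gamma (\<alpha> + 1) * s powr (- (\<alpha> + 1)))"
    using \<alpha> s by (subst nn_integral_powr_exp) auto
  finally show "(\<integral>\<^sup>+w. ennreal (exp (- s * w) * max 0 (w - j) powr \<alpha>) \<partial>lborel) = ennreal (exp (- s * j) * (Gamma (\<alpha> + 1) * s powr (- (\<alpha> + 1))))"
    by (simp add: ennreal_mult'[symmetric])
qed (use \<alpha> in \<open>auto intro!: mult_nonneg_nonneg less_imp_le[OF Gamma_real_pos]\<close>)

text \<open>Shifting by \<open>j\<close> multiplies the Laplace transform of the power by
  \<open>exp (- s * j)\<close>, and the binomial theorem sums these factors to
  \<open>(1 - exp (- s)) ^ m\<close>, the factor that occurs in \<open>kappa\<close>.\<close>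

lemma laplace_diff_kernel:
  assumes \<alpha>: "\<alpha> > 0" and s: "s > 0"
  shows "has_bochner_integral lborel (\<lambda>w. exp (- s * w) * diff_kernel m \<alpha> w) (Gamma (\<alpha> + 1) * (s powr (- (\<alpha> + 1)) * (1 - exp (- s)) ^ m))"
proof -
  have "has_bochner_integral lborel (\<lambda>w. \<Sum>j\<le>m. (real (m choose j) * (- 1) ^ j) * (exp (- s * w) * max 0 (w - real j) powr \<alpha>))
     (\<Sum>j\<le>m. (real (m choose j) * (- 1) ^ j) * (exp (- s * real j) * (Gamma (\<alpha> + 1) * s powr (- (\<alpha> + 1)))))"
    by (intro has_bochner_integral_sum has_bochner_integral_mult_right laplace_shifted_powr \<alpha> s) auto
  also have "(\<lambda>w. \<Sum>j\<le>m. (real (m choose j) * (- 1) ^ j) * (exp (- s * w) * max 0 (w - real j) powr \<alpha>)) = (\<lambda>w. exp (- s * w) * diff_kernel m \<alpha> w)"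
    by (simp add: diff_kernel_def sum_distrib_left mult_ac fun_eq_iff)
  also have "(\<Sum>j\<le>m. (real (m choose j) * (- 1) ^ j) * (exp (- s * real j) * (Gamma (\<alpha> + 1) * s powr (- (\<alpha> + 1)))))
     = Gamma (\<alpha> + 1) * (s powr (- (\<alpha> + 1)) * (\<Sum>j\<le>m. real (m choose j) * (- exp (- s)) ^ j * 1 ^ (m - j)))"
  proof -
    have "exp (- s * real j) = exp (- s) ^ j" for j by (simp add: exp_of_nat_mult[symmetric] mult.commute)
    moreover have "(- exp (- s)) ^ j = (- 1) ^ j * exp (- s) ^ j" for j by (rule power_minus)
    ultimately show ?thesis by (simp add: sum_distrib_left mult_ac)
  qed
  also have "(\<Sum>j\<le>m. real (m choose j) * (- exp (- s)) ^ j * 1 ^ (m - j)) = (1 - exp (- s)) ^ m"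
    using binomial_ring[of "- exp (- s)" 1 m] by simp
  finally show ?thesis .
qed

text \<open>The normalizing constant is found by integrating the Laplace transform of the kernel over
  the transform variable, since \<open>1 / w\<close> is the Laplace transform of \<open>1\<close>.\<close>

lemma
  assumes n: "n > 2" and m: "real m > real n / 2 - 1"
  shows diff_kernel_integral: "has_bochner_integral lborel (\<lambda>w. indicator {0<..} w * (diff_kernel m (real n / 2 - 1) w / w)) (Gamma (real n / 2) * kappa n m)"
    and kappa_pos: "kappa n m > 0"
proof -
  define \<alpha> where "\<alpha> = real n / 2 - 1"
  have \<alpha>: "0 < \<alpha>" "\<alpha> < real m" using n m by (auto simp: \<alpha>_def)
  let ?f = "\<lambda>s w. indicator {0<..} s * indicator {0<..} w * (exp (- s * w) * diff_kernel m \<alpha> w) :: real"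
  have [measurable]: "case_prod ?f \<in> borel_measurable (lborel \<Otimes>\<^sub>M lborel)" by measurable
  have inner_s: "(\<integral>\<^sup>+s. ennreal (norm (?f s w)) \<partial>lborel) = ennreal (\<bar>diff_kernel m \<alpha> w\<bar> / w) * indicator {0<..} w" for w
  proof (cases "w > 0")
    case True
    have "(\<integral>\<^sup>+s. ennreal (norm (?f s w)) \<partial>lborel) = (\<integral>\<^sup>+s. ennreal \<bar>diff_kernel m \<alpha> w\<bar> * (ennreal (s powr (1 - 1) * exp (- w * s)) * indicator {0<..} s) \<partial>lborel)"
      using True by (intro nn_integral_cong) (auto simp: indicator_def abs_mult ennreal_mult'[symmetric] mult_ac)
    also have "\<dots> = ennreal \<bar>diff_kernel m \<alpha> w\<bar> * ennreal (Gamma 1 * w powr (- 1))"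
      using True by (subst nn_integral_cmult, measurable, subst nn_integral_powr_exp) auto
    also have "\<dots> = ennreal (\<bar>diff_kernel m \<alpha> w\<bar> / w)"
      using True by (simp add: ennreal_mult'[symmetric] powr_minus divide_inverse)
    finally show ?thesis using True by simp
  qed simp
  \<comment> \<open>Absolute integrability, needed to exchange the order: integrating out
    \<open>s\<close> first leaves the modulus of the kernel divided by \<open>w\<close>, already
    known to be integrable.\<close>
  have int: "integrable (lborel \<Otimes>\<^sub>M lborel) (case_prod ?f)"
    unfolding integrable_iff_bounded
  proof
    have "(\<integral>\<^sup>+z. ennreal (norm (case_prod ?f z)) \<partial>(lborel \<Otimes>\<^sub>M lborel)) = (\<integral>\<^sup>+w. \<integral>\<^sup>+s. ennreal (norm (?f s w)) \<partial>lborel \<partial>lborel)"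
      by (subst lborel_pair.nn_integral_snd[symmetric]) auto
    also have "\<dots> < \<infinity>" unfolding inner_s by (rule diff_kernel_integrable[OF \<alpha>])
    finally show "(\<integral>\<^sup>+z. ennreal (norm (case_prod ?f z)) \<partial>(lborel \<Otimes>\<^sub>M lborel)) < \<infinity>" .
  qed measurable
  have K0: "diff_kernel m \<alpha> w = 0" if "w \<le> 0" for w
    using that \<alpha> unfolding diff_kernel_def by (intro sum.neutral) auto
  have w_int: "(LINT w|lborel. ?f s w) = Gamma (\<alpha> + 1) * (indicator {0<..} s * (s powr (- (\<alpha> + 1)) * (1 - exp (- s)) ^ m))" for s
  proof (cases "s > 0")
    case True
    have "(LINT w|lborel. ?f s w) = (LINT w|lborel. exp (- s * w) * diff_kernel m \<alpha> w)"
      using True K0 by (intro Bochner_Integration.integral_cong) (auto simp: indicator_def not_less)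
    thus ?thesis using has_bochner_integral_integral_eq[OF laplace_diff_kernel[OF \<alpha>(1) True, of m]] True by simp
  qed simp
  have s_int: "(LINT s|lborel. ?f s w) = indicator {0<..} w * (diff_kernel m \<alpha> w / w)" for w
  proof (cases "w > 0")
    case True
    have nn: "(\<integral>\<^sup>+s. ennreal (indicator {0<..} s * exp (- w * s)) \<partial>lborel) = ennreal (1 / w)"
    proof -
      have "(\<integral>\<^sup>+s. ennreal (indicator {0<..} s * exp (- w * s)) \<partial>lborel) = (\<integral>\<^sup>+s. ennreal (s powr (1 - 1) * exp (- w * s)) * indicator {0<..} s \<partial>lborel)"
        by (intro nn_integral_cong) (auto simp: indicator_def)
      also have "\<dots> = ennreal (Gamma 1 * w powr (- 1))" using True by (intro nn_integral_powr_exp) auto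
      finally show ?thesis using True by (simp add: powr_minus divide_inverse)
    qed
    have "has_bochner_integral lborel (\<lambda>s. indicator {0<..} s * exp (- w * s)) (1 / w)"
      by (rule has_bochner_integral_nn_integral[OF _ _ _ nn]) (use True in auto)
    from has_bochner_integral_integral_eq[OF this] show ?thesis
      using True integral_mult_right_zero[of lborel "diff_kernel m \<alpha> w" "\<lambda>s. indicator {0<..} s * exp (- w * s)"]
      by (simp add: mult_ac)
  qed simp
  have kap: "kappa n m = (LINT s|lborel. indicator {0<..} s * (s powr (- (\<alpha> + 1)) * (1 - exp (- s)) ^ m))"
    unfolding kappa_def set_lebesgue_integral_def by (simp add: \<alpha>_def mult_ac)
  have "integrable lborel (\<lambda>w. indicator {0<..} w * (diff_kernel m \<alpha> w / w))"
    using lborel_pair.integrable_snd[OF int] by (simp only: s_int)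
  moreover have "(LINT w|lborel. indicator {0<..} w * (diff_kernel m \<alpha> w / w)) = Gamma (\<alpha> + 1) * kappa n m"
    using lborel_pair.Fubini_integral[OF int] by (simp only: s_int w_int kap integral_mult_right_zero)
  ultimately show "has_bochner_integral lborel (\<lambda>w. indicator {0<..} w * (diff_kernel m (real n / 2 - 1) w / w)) (Gamma (real n / 2) * kappa n m)"
    by (simp add: has_bochner_integral_iff \<alpha>_def)
  have ki: "integrable lborel (\<lambda>s. indicator {0<..} s * (s powr (- (\<alpha> + 1)) * (1 - exp (- s)) ^ m))"
  proof -
    have "Gamma (\<alpha> + 1) \<noteq> 0" using \<alpha> by (intro less_imp_neq[OF Gamma_real_pos, symmetric]) auto
    thus ?thesis using lborel_pair.integrable_fst[OF int] by (simp only: w_int integrable_mult_right_iff) simp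
  qed
  show "kappa n m > 0"
    unfolding kap
  proof -
    let ?k = "\<lambda>s. indicator {0<..} s * (s powr (- (\<alpha> + 1)) * (1 - exp (- s)) ^ m) :: real"
    have nn: "0 \<le> ?k s" for s by (auto simp: indicator_def)
    \<comment> \<open>The integrand is positive between 0 and 1, so a vanishing integral would make
      that interval a null set.\<close>
    have "(LINT s|lborel. ?k s) \<noteq> 0"
    proof
      assume "(LINT s|lborel. ?k s) = 0"
      hence "AE s in lborel. ?k s = 0"
        using integral_nonneg_eq_0_iff_AE[OF ki] nn by simp
      hence "AE s in lborel. s \<notin> {0<..<1::real}"
        by eventually_elim (auto simp: indicator_def)
      hence "{0<..<1::real} \<in> null_sets lborel" by (subst AE_iff_null_sets) auto
      thus False by (simp add: null_sets_def)
    qed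
    moreover have "0 \<le> (LINT s|lborel. ?k s)" using nn by (intro integral_nonneg_AE) auto
    ultimately show "0 < (LINT s|lborel. ?k s)" by simp
  qed
qed

text \<open>Up to sign, \<open>r powr (- \<alpha>) * (w - j * r) powr \<alpha> / (\<alpha> *
  w)\<close> is an antiderivative in \<open>r\<close>, and for \<open>j > 0\<close> it vanishes at
  the end \<open>w / j\<close> of the support. The exponents \<open>- 1 - \<alpha>\<close> and
  \<open>\<alpha> - 1\<close> are those of \<open>r powr (- n / 2)\<close> and of
  \<open>plane_weight\<close>.\<close>

lemma nn_integral_marchaud:
  assumes \<alpha>: "\<alpha> > 0" and \<epsilon>: "\<epsilon> > 0" and w: "w > 0" and j: "j \<ge> 0"
  shows "(\<integral>\<^sup>+r. ennreal (r powr (- 1 - \<alpha>) * (if j * r < w then (w - j * r) powr (\<alpha> - 1) else 0)) * indicator {\<epsilon><..} r \<partial>lborel)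
    = ennreal (\<epsilon> powr (- \<alpha>) * max 0 (w - j * \<epsilon>) powr \<alpha> / (\<alpha> * w))"
proof (cases "j = 0")
  case True
  have "(\<integral>\<^sup>+r. ennreal (r powr (- 1 - \<alpha>) * (if j * r < w then (w - j * r) powr (\<alpha> - 1) else 0)) * indicator {\<epsilon><..} r \<partial>lborel)
    = (\<integral>\<^sup>+r. ennreal (w powr (\<alpha> - 1)) * (ennreal (r powr (- 1 - \<alpha>)) * indicator {\<epsilon><..} r) \<partial>lborel)"
    using True w by (intro nn_integral_cong) (auto simp: indicator_def ennreal_mult'[symmetric] mult.commute)
  also have "\<dots> = ennreal (w powr (\<alpha> - 1)) * ennreal (\<epsilon> powr (- \<alpha>) / \<alpha>)"
    using \<alpha> \<epsilon> by (subst nn_integral_cmult, measurable, subst nn_integral_powr_tail) auto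
  also have "\<dots> = ennreal (w powr (\<alpha> - 1) * (\<epsilon> powr (- \<alpha>) / \<alpha>))"
    by (rule ennreal_mult'[symmetric]) simp
  also have "w powr (\<alpha> - 1) * (\<epsilon> powr (- \<alpha>) / \<alpha>) = \<epsilon> powr (- \<alpha>) * max 0 (w - j * \<epsilon>) powr \<alpha> / (\<alpha> * w)"
    using True w by (simp add: powr_diff mult_ac)
  finally show ?thesis .
next
  case False
  hence j: "j > 0" using j by simp
  define b where "b = w / j"
  have b: "b > 0" using w j by (simp add: b_def)
  have lt: "j * r < w \<longleftrightarrow> r < b" for r using j by (simp add: b_def field_simps)
  show ?thesis
  proof (cases "\<epsilon> < b")
    case False
    hence "w - j * \<epsilon> \<le> 0" using lt[of \<epsilon>] by auto
    moreover have "(\<integral>\<^sup>+r. ennreal (r powr (- 1 - \<alpha>) * (if j * r < w then (w - j * r) powr (\<alpha> - 1) else 0)) * indicator {\<epsilon><..} r \<partial>lborel) = (\<integral>\<^sup>+r. 0 \<partial>(lborel :: real measure))"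
      using False by (intro nn_integral_cong) (auto simp: lt indicator_def)
    ultimately show ?thesis using \<alpha> by simp
  next
    case True
    define A where "A r = - (r powr (- \<alpha>) * (w - j * r) powr \<alpha> / (\<alpha> * w))" for r
    have hi: "((\<lambda>r. r powr (- 1 - \<alpha>) * (w - j * r) powr (\<alpha> - 1)) has_integral (A b - A \<epsilon>)) {\<epsilon>..b}"
    proof (rule fundamental_theorem_of_calculus_interior)
      show "\<epsilon> \<le> b" using True by simp
      show "continuous_on {\<epsilon>..b} A"
        unfolding A_def using \<epsilon> \<alpha> w j
        by (intro continuous_intros continuous_on_powr') (auto simp: b_def field_simps)
      fix r assume r: "r \<in> {\<epsilon><..<b}"
      hence r0: "r > 0" and wr: "w - j * r > 0" using \<epsilon> lt[of r] by auto
      have "((\<lambda>r. r powr (- \<alpha>) * (w - j * r) powr \<alpha>) has_real_derivative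
          (- \<alpha> * r powr (- \<alpha> - 1)) * (w - j * r) powr \<alpha> + (\<alpha> * (w - j * r) powr (\<alpha> - 1) * (- j)) * r powr (- \<alpha>)) (at r)"
      proof (rule DERIV_mult)
        show "((\<lambda>r. r powr (- \<alpha>)) has_real_derivative - \<alpha> * r powr (- \<alpha> - 1)) (at r)"
          by (rule has_real_derivative_powr[OF r0])
        have "((\<lambda>z. z powr \<alpha>) has_real_derivative \<alpha> * (w - j * r) powr (\<alpha> - 1)) (at (w - j * r))"
          by (rule has_real_derivative_powr[OF wr])
        moreover have "((\<lambda>r. w - j * r) has_real_derivative - j) (at r)"
          by (auto intro!: derivative_eq_intros)
        ultimately show "((\<lambda>r. (w - j * r) powr \<alpha>) has_real_derivative \<alpha> * (w - j * r) powr (\<alpha> - 1) * (- j)) (at r)"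
          by (rule DERIV_chain2)
      qed
      from DERIV_cmult[OF this, of "- 1 / (\<alpha> * w)"]
      have "(A has_real_derivative - 1 / (\<alpha> * w) * ((- \<alpha> * r powr (- \<alpha> - 1)) * (w - j * r) powr \<alpha> + (\<alpha> * (w - j * r) powr (\<alpha> - 1) * (- j)) * r powr (- \<alpha>))) (at r)"
        unfolding A_def by (simp add: mult_ac)
      also have "- 1 / (\<alpha> * w) * ((- \<alpha> * r powr (- \<alpha> - 1)) * (w - j * r) powr \<alpha> + (\<alpha> * (w - j * r) powr (\<alpha> - 1) * (- j)) * r powr (- \<alpha>))
         = r powr (- 1 - \<alpha>) * (w - j * r) powr (\<alpha> - 1)"
      proof -
        have e1: "(w - j * r) powr \<alpha> = (w - j * r) powr (\<alpha> - 1) * (w - j * r)" using wr by (simp add: powr_diff)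
        have e2: "r powr (- \<alpha>) = r powr (- 1 - \<alpha>) * r" using r0 by (simp add: powr_diff powr_minus field_simps)
        have e3: "- \<alpha> - 1 = - 1 - \<alpha>" by simp
        show ?thesis unfolding e3 e1 e2 using \<alpha> w by (simp add: field_simps)
      qed
      finally show "(A has_vector_derivative r powr (- 1 - \<alpha>) * (w - j * r) powr (\<alpha> - 1)) (at r)"
        by (simp add: has_real_derivative_iff_has_vector_derivative)
    qed
    have Ab: "A b = 0" using j \<alpha> by (simp add: A_def b_def)
    have "(\<integral>\<^sup>+r. ennreal (r powr (- 1 - \<alpha>) * (if j * r < w then (w - j * r) powr (\<alpha> - 1) else 0)) * indicator {\<epsilon><..} r \<partial>lborel)
      = (\<integral>\<^sup>+r. ennreal (indicator {\<epsilon>..b} r * (r powr (- 1 - \<alpha>) * (w - j * r) powr (\<alpha> - 1))) \<partial>lborel)"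
    proof (rule nn_integral_cong_AE)
      have "AE r::real in lborel. r \<noteq> \<epsilon> \<and> r \<noteq> b"
        using AE_lborel_singleton[of \<epsilon>] AE_lborel_singleton[of b] by auto
      thus "AE r in lborel. ennreal (r powr (- 1 - \<alpha>) * (if j * r < w then (w - j * r) powr (\<alpha> - 1) else 0)) * indicator {\<epsilon><..} r
        = ennreal (indicator {\<epsilon>..b} r * (r powr (- 1 - \<alpha>) * (w - j * r) powr (\<alpha> - 1)))"
        by eventually_elim (auto simp: lt indicator_def)
    qed
    also have "\<dots> = ennreal (A b - A \<epsilon>)"
      using nn_integral_has_integral_lebesgue[OF _ hi] by simp
    also have "A b - A \<epsilon> = \<epsilon> powr (- \<alpha>) * max 0 (w - j * \<epsilon>) powr \<alpha> / (\<alpha> * w)"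
      unfolding Ab using True lt[of \<epsilon>] by (simp add: A_def max_def)
    finally show ?thesis .
  qed
qed

section \<open>Truncated Marchaud integrals as convolutions\<close>

lemma distr_norm_square:
  "distr (lborel :: (real ^ 'n::finite) measure) borel (\<lambda>y. (norm y)\<^sup>2) =
    density lborel (\<lambda>v. ennreal (radial_const (real CARD('n)) * v powr (real CARD('n) / 2 - 1) * indicator {0<..} v))"
proof (rule measure_eqI)
  fix A assume "A \<in> sets (distr (lborel :: (real ^ 'n) measure) borel (\<lambda>y. (norm y)\<^sup>2))"
  hence A [measurable]: "A \<in> sets borel" by simp
  have "emeasure (distr (lborel :: (real ^ 'n) measure) borel (\<lambda>y. (norm y)\<^sup>2)) A
    = (\<integral>\<^sup>+v. indicator A v \<partial>distr (lborel :: (real ^ 'n) measure) borel (\<lambda>y. (norm y)\<^sup>2))" by simp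
  also have "\<dots> = (\<integral>\<^sup>+y. indicator A ((norm (y :: real ^ 'n))\<^sup>2) \<partial>lborel)"
    by (subst nn_integral_distr) auto
  also have "\<dots> = (\<integral>\<^sup>+v. ennreal (radial_const (real CARD('n)) * v powr (real CARD('n) / 2 - 1)) * indicator {0<..} v * indicator A v \<partial>lborel)"
    by (rule nn_integral_lborel_radial) simp
  also have "\<dots> = (\<integral>\<^sup>+v. ennreal (radial_const (real CARD('n)) * v powr (real CARD('n) / 2 - 1) * indicator {0<..} v) * indicator A v \<partial>lborel)"
    by (intro nn_integral_cong) (auto simp: indicator_def)
  also have "\<dots> = emeasure (density lborel (\<lambda>v. ennreal (radial_const (real CARD('n)) * v powr (real CARD('n) / 2 - 1) * indicator {0<..} v))) A"
    by (subst emeasure_density) auto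
  finally show "emeasure (distr (lborel :: (real ^ 'n) measure) borel (\<lambda>y. (norm y)\<^sup>2)) A =
    emeasure (density lborel (\<lambda>v. ennreal (radial_const (real CARD('n)) * v powr (real CARD('n) / 2 - 1) * indicator {0<..} v))) A" .
qed simp

lemma has_bochner_integral_radial:
  fixes h :: "real \<Rightarrow> real"
  assumes h [measurable]: "h \<in> borel_measurable borel"
    and I: "has_bochner_integral lborel (\<lambda>v. radial_const (real CARD('n)) * v powr (real CARD('n) / 2 - 1) * indicator {0<..} v * h v) I"
  shows "has_bochner_integral lborel (\<lambda>y :: real ^ 'n::finite. h ((norm y)\<^sup>2)) I"
proof -
  let ?d = "\<lambda>v. radial_const (real CARD('n)) * v powr (real CARD('n) / 2 - 1) * indicator {0<..} v"
  have nn: "AE v in lborel. 0 \<le> ?d v"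
    by (intro AE_I2) (auto intro!: mult_nonneg_nonneg less_imp_le[OF radial_const_pos])
  have "has_bochner_integral (density lborel (\<lambda>v. ennreal (?d v))) h I"
    using I by (intro has_bochner_integral_density nn) (auto simp: mult.assoc)
  hence "has_bochner_integral (distr (lborel :: (real ^ 'n) measure) borel (\<lambda>y. (norm y)\<^sup>2)) h I"
    unfolding distr_norm_square .
  thus ?thesis by (simp add: has_bochner_integral_iff integrable_distr_eq integral_distr)
qed

lemma powr_cancel:
  fixes v s :: real
  assumes "v > 0"
  shows "v powr (s - 1) * v powr (- s) = 1 / v"
  using assms by (simp add: powr_diff powr_minus)

text \<open>The parameter \<open>t\<close> is the squared radius, and the normalisation is
  \<open>t powr (n / 2)\<close> instead of the volume of the ball, so this is the mean oscillation
  up to the factor \<open>unit_ball_vol n\<close>.\<close>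

definition mean_oscillation :: "(real ^ 'n \<Rightarrow> complex) \<Rightarrow> real ^ 'n \<Rightarrow> real \<Rightarrow> ennreal" where
  "mean_oscillation g x t = ennreal (t powr (- real CARD('n) / 2)) *
     (\<integral>\<^sup>+z. ennreal (norm (g (x + z) - g x)) * indicator {z. (norm z)\<^sup>2 < t} z \<partial>lborel)"

locale marchaud_frame = haar_frame e G for e :: "nat \<Rightarrow> 'n::finite" and G +
  fixes m :: nat
  assumes m: "real m > real CARD('n) / 2 - 1"
begin

definition "\<alpha> = real CARD('n) / 2 - 1"

lemma \<alpha>: "0 < \<alpha>" "\<alpha> < real m" using m card3 by (auto simp: \<alpha>_def)

definition inversion_summand :: "(real ^ 'n \<Rightarrow> complex) \<Rightarrow> real ^ 'n \<Rightarrow> real \<Rightarrow> complex" where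
  "inversion_summand g x r =
     (\<Sum>j\<le>m. of_nat (m choose j) * (- 1) ^ j * plane_average g x (sqrt (real j * r))) / of_real (r powr (real CARD('n) / 2))"

definition "ker_const = radial_const (real CARD('n) - 2) / radial_const (real CARD('n))"

lemma ker_const_pos: "ker_const > 0"
  unfolding ker_const_def using card3 by (intro divide_pos_pos radial_const_pos) auto

text \<open>The kernel of the truncated integral. It is self-similar, \<open>ker \<epsilon> z =
  \<epsilon> powr (- n / 2) * ker 1 (z / sqrt \<epsilon>)\<close>, so its total mass does not depend
  on \<open>\<epsilon>\<close>.\<close>

definition ker :: "real \<Rightarrow> real ^ 'n \<Rightarrow> real" where
  "ker \<epsilon> z = ker_const / \<alpha> * ((norm z)\<^sup>2) powr (- real CARD('n) / 2) * diff_kernel m \<alpha> ((norm z)\<^sup>2 / \<epsilon>)"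

text \<open>The contribution of the single index \<open>j\<close>: the integral over
  \<open>r > \<epsilon>\<close> of \<open>r powr (- n / 2)\<close> times \<open>plane_weight\<close>
  at \<open>s = j * r\<close>, evaluated by \<open>nn_integral_marchaud\<close>.\<close>

definition jker :: "real \<Rightarrow> real \<Rightarrow> real ^ 'n \<Rightarrow> real" where
  "jker j \<epsilon> z = ker_const * ((norm z)\<^sup>2) powr (- \<alpha>) * (\<epsilon> powr (- \<alpha>) * max 0 ((norm z)\<^sup>2 - j * \<epsilon>) powr \<alpha> / (\<alpha> * (norm z)\<^sup>2))"

lemma jker_measurable [measurable]: "jker j \<epsilon> \<in> borel_measurable borel"
  unfolding jker_def by measurable

lemma jker_nonneg: "0 \<le> jker j \<epsilon> z"
  unfolding jker_def using ker_const_pos \<alpha> by (auto intro!: mult_nonneg_nonneg divide_nonneg_nonneg)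

text \<open>The order \<open>1 / |z|^2\<close> cannot be improved at infinity for a single
  \<open>j\<close>; only the alternating sum over \<open>j\<close> is integrable there. This
  dictates the condition \<open>good\<close> below.\<close>

lemma jker_le:
  assumes "j \<ge> 0" "\<epsilon> > 0"
  shows "jker j \<epsilon> z \<le> ker_const * \<epsilon> powr (- \<alpha>) / \<alpha> * (1 / (norm z)\<^sup>2)"
proof (cases "z = 0")
  case False
  define w where "w = (norm z)\<^sup>2"
  have w: "w > 0" using False by (simp add: w_def)
  have "max 0 (w - j * \<epsilon>) powr \<alpha> \<le> w powr \<alpha>" using w assms \<alpha> by (intro powr_mono2) auto
  hence "jker j \<epsilon> z \<le> ker_const * w powr (- \<alpha>) * (\<epsilon> powr (- \<alpha>) * w powr \<alpha> / (\<alpha> * w))"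
    unfolding jker_def w_def[symmetric] using ker_const_pos \<alpha> w
    by (intro mult_left_mono divide_right_mono) auto
  also have "\<dots> = ker_const * \<epsilon> powr (- \<alpha>) / \<alpha> * (1 / w) * (w powr (- \<alpha>) * w powr \<alpha>)" by (simp add: field_simps)
  also have "w powr (- \<alpha>) * w powr \<alpha> = 1" using w by (simp add: powr_add[symmetric])
  finally show ?thesis by (simp add: w_def)
qed (simp add: jker_def)

lemma sum_jker:
  assumes \<epsilon>: "\<epsilon> > 0"
  shows "(\<Sum>j\<le>m. real (m choose j) * (- 1) ^ j * jker (real j) \<epsilon> z) = ker \<epsilon> z"
proof (cases "z = 0")
  case False
  define w where "w = (norm z)\<^sup>2"
  have w: "w > 0" using False by (simp add: w_def)
  have e: "\<epsilon> powr (- \<alpha>) * max 0 (w - real j * \<epsilon>) powr \<alpha> = max 0 (w / \<epsilon> - real j) powr \<alpha>" for j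
  proof -
    have "max 0 (w - real j * \<epsilon>) = \<epsilon> * max 0 (w / \<epsilon> - real j)"
      using \<epsilon> by (simp add: max_def field_simps)
    hence "max 0 (w - real j * \<epsilon>) powr \<alpha> = \<epsilon> powr \<alpha> * max 0 (w / \<epsilon> - real j) powr \<alpha>"
      using \<epsilon> by (simp add: powr_mult)
    moreover have "\<epsilon> powr (- \<alpha>) * \<epsilon> powr \<alpha> = 1" using \<epsilon> by (simp add: powr_add[symmetric])
    ultimately show ?thesis by (metis mult.assoc mult_1)
  qed
  have p: "w powr (- \<alpha>) / w = w powr (- real CARD('n) / 2)"
  proof -
    have "- real CARD('n) / 2 = - \<alpha> - 1" by (simp add: \<alpha>_def field_simps)
    thus ?thesis using w by (simp only: powr_diff powr_one)
  qed
  have "(\<Sum>j\<le>m. real (m choose j) * (- 1) ^ j * jker (real j) \<epsilon> z) =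
     (\<Sum>j\<le>m. (ker_const / \<alpha> * (w powr (- \<alpha>) / w)) * (real (m choose j) * (- 1) ^ j * max 0 (w / \<epsilon> - real j) powr \<alpha>))"
    unfolding jker_def w_def[symmetric] e by (rule sum.cong) (auto simp: field_simps)
  also have "\<dots> = (ker_const / \<alpha> * (w powr (- \<alpha>) / w)) * diff_kernel m \<alpha> (w / \<epsilon>)"
    unfolding diff_kernel_def by (rule sum_distrib_left[symmetric])
  finally show ?thesis unfolding ker_def p by (simp add: w_def)
qed (simp add: jker_def ker_def)

text \<open>Points at which all the terms of the truncated integral converge absolutely.\<close>

definition good :: "(real ^ 'n \<Rightarrow> complex) \<Rightarrow> real ^ 'n \<Rightarrow> bool" where
  "good g x \<longleftrightarrow> (\<integral>\<^sup>+z. ennreal (norm (g (x + z)) / (norm z)\<^sup>2) \<partial>lborel) < \<infinity>"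

lemma nn_integral_jker_finite:
  assumes g [measurable]: "g \<in> borel_measurable borel" and x: "good g x" and j: "j \<ge> 0" and \<epsilon>: "\<epsilon> > 0"
  shows "(\<integral>\<^sup>+z. ennreal (jker j \<epsilon> z) * ennreal (norm (g (x + z))) \<partial>lborel) < \<infinity>"
proof -
  define C where "C = ker_const * \<epsilon> powr (- \<alpha>) / \<alpha>"
  have C: "C \<ge> 0" using ker_const_pos \<alpha> by (simp add: C_def)
  have "(\<integral>\<^sup>+z. ennreal (jker j \<epsilon> z) * ennreal (norm (g (x + z))) \<partial>lborel) \<le> (\<integral>\<^sup>+z. ennreal C * ennreal (norm (g (x + z)) / (norm z)\<^sup>2) \<partial>lborel)"
  proof (rule nn_integral_mono)
    fix z
    have "jker j \<epsilon> z * norm (g (x + z)) \<le> C * (1 / (norm z)\<^sup>2) * norm (g (x + z))"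
      unfolding C_def by (intro mult_right_mono jker_le j \<epsilon>) simp
    also have "\<dots> = C * (norm (g (x + z)) / (norm z)\<^sup>2)" by simp
    finally show "ennreal (jker j \<epsilon> z) * ennreal (norm (g (x + z))) \<le> ennreal C * ennreal (norm (g (x + z)) / (norm z)\<^sup>2)"
      using C jker_nonneg by (simp add: ennreal_mult'[symmetric] ennreal_leI)
  qed
  also have "\<dots> = ennreal C * (\<integral>\<^sup>+z. ennreal (norm (g (x + z)) / (norm z)\<^sup>2) \<partial>lborel)"
    by (rule nn_integral_cmult) measurable
  also have "\<dots> < \<infinity>" using x by (simp add: good_def ennreal_mult_less_top)
  finally show ?thesis .
qed

text \<open>Fubini in \<open>r\<close> and \<open>z\<close>: integrating over \<open>r\<close> first
  gives \<open>jker\<close>, integrating over \<open>z\<close> first gives the plane average. The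
  terms of the bracket can be treated one at a time because truncation at \<open>\<epsilon>\<close>
  keeps each of them absolutely convergent at good points.\<close>

lemma summand_integral:
  assumes g [measurable]: "g \<in> borel_measurable borel" and x: "good g x" and \<epsilon>: "\<epsilon> > 0"
  shows "has_bochner_integral lborel (\<lambda>r. indicator {\<epsilon><..} r *\<^sub>R (plane_average g x (sqrt (real j * r)) / of_real (r powr (real CARD('n) / 2))))
     (LINT z|lborel. jker (real j) \<epsilon> z *\<^sub>R g (x + z))"
proof -
  let ?n = "real CARD('n)"
  define U where "U r z = indicator {\<epsilon><..} r * (r powr (- 1 - \<alpha>) * plane_weight ?n (real j * r) ((norm z)\<^sup>2))" for r and z :: "real ^ 'n"
  have nex: "?n / 2 = 1 + \<alpha>" "1 - ?n / 2 = - \<alpha>" "?n / 2 - 2 = \<alpha> - 1" by (simp_all add: \<alpha>_def)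
  have Unn: "U r z \<ge> 0" for r z unfolding U_def using card3 by (auto intro!: mult_nonneg_nonneg plane_weight_nonneg)
  have [measurable]: "(\<lambda>p. U (fst p) (snd p)) \<in> borel_measurable (lborel \<Otimes>\<^sub>M lborel)"
  proof -
    have "(\<lambda>p :: real \<times> (real ^ 'n). (real j * fst p, (norm (snd p))\<^sup>2)) \<in> lborel \<Otimes>\<^sub>M lborel \<rightarrow>\<^sub>M borel \<Otimes>\<^sub>M borel" by measurable
    from measurable_compose[OF this plane_weight_measurable[of ?n]]
    show ?thesis unfolding U_def by simp
  qed
  have U1 [measurable]: "(\<lambda>z. U r z) \<in> borel_measurable borel" "(\<lambda>r. U r z) \<in> borel_measurable borel" for r z
    unfolding U_def plane_weight_def by measurable
  have Ur: "(\<integral>\<^sup>+r. ennreal (U r z) \<partial>lborel) = ennreal (jker (real j) \<epsilon> z)" for z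
  proof (cases "z = 0")
    case True
    have "U r z = 0" for r using True \<epsilon> by (auto simp: U_def plane_weight_def indicator_def mult_less_0_iff)
    thus ?thesis using True by (simp add: jker_def)
  next
    case False
    define w where "w = (norm z)\<^sup>2"
    have w: "w > 0" using False by (simp add: w_def)
    have cn: "0 \<le> ker_const * w powr (- \<alpha>)" using ker_const_pos by simp
    have "(\<integral>\<^sup>+r. ennreal (U r z) \<partial>lborel) = (\<integral>\<^sup>+r. ennreal (ker_const * w powr (- \<alpha>)) * (ennreal (r powr (- 1 - \<alpha>) * (if real j * r < w then (w - real j * r) powr (\<alpha> - 1) else 0)) * indicator {\<epsilon><..} r) \<partial>lborel)"
      unfolding U_def plane_weight_def w_def[symmetric] nex ker_const_def[symmetric]
      by (intro nn_integral_cong) (auto simp: indicator_def ennreal_mult'[OF cn, symmetric] mult_ac)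
    also have "\<dots> = ennreal (ker_const * w powr (- \<alpha>)) * ennreal (\<epsilon> powr (- \<alpha>) * max 0 (w - real j * \<epsilon>) powr \<alpha> / (\<alpha> * w))"
      using nn_integral_marchaud[OF \<alpha>(1) \<epsilon> w, of "real j"] by (subst nn_integral_cmult) auto
    also have "\<dots> = ennreal (jker (real j) \<epsilon> z)"
      unfolding jker_def w_def[symmetric] by (rule ennreal_mult'[OF cn, symmetric])
    finally show ?thesis .
  qed
  let ?F = "\<lambda>r z. U r z *\<^sub>R g (x + z)"
  have nF: "ennreal (norm (?F r z)) = ennreal (U r z) * ennreal (norm (g (x + z)))" for r z
    using Unn by (simp add: ennreal_mult')
  have [measurable]: "case_prod ?F \<in> borel_measurable (lborel \<Otimes>\<^sub>M lborel)"
    by (simp add: case_prod_unfold)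
  have fin: "(\<integral>\<^sup>+z. \<integral>\<^sup>+r. ennreal (norm (?F r z)) \<partial>lborel \<partial>lborel) < \<infinity>"
  proof -
    have "(\<integral>\<^sup>+z. \<integral>\<^sup>+r. ennreal (norm (?F r z)) \<partial>lborel \<partial>lborel) = (\<integral>\<^sup>+z. ennreal (jker (real j) \<epsilon> z) * ennreal (norm (g (x + z))) \<partial>lborel)"
      unfolding nF by (intro nn_integral_cong) (subst nn_integral_multc, simp_all add: Ur)
    thus ?thesis using nn_integral_jker_finite[OF g x _ \<epsilon>, of "real j"] by simp
  qed
  have nnP: "(\<integral>\<^sup>+p. ennreal (norm (case_prod ?F p)) \<partial>(lborel \<Otimes>\<^sub>M lborel)) = (\<integral>\<^sup>+z. \<integral>\<^sup>+r. ennreal (norm (?F r z)) \<partial>lborel \<partial>lborel)"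
    by (subst lborel_pair.nn_integral_snd[symmetric]) auto
  have int: "integrable (lborel \<Otimes>\<^sub>M lborel) (case_prod ?F)"
    unfolding integrable_iff_bounded nnP using fin by simp
  have "(\<integral>\<^sup>+r. \<integral>\<^sup>+z. ennreal (norm (?F r z)) \<partial>lborel \<partial>lborel) < \<infinity>"
  proof -
    have "(\<integral>\<^sup>+r. \<integral>\<^sup>+z. ennreal (norm (?F r z)) \<partial>lborel \<partial>lborel) = (\<integral>\<^sup>+z. \<integral>\<^sup>+r. ennreal (norm (?F r z)) \<partial>lborel \<partial>lborel)"
      by (rule lborel_pair.Fubini'[symmetric]) (simp add: case_prod_unfold)
    thus ?thesis using fin by simp
  qed
  \<comment> \<open>The plane average is known to be the weighted integral only where the latter
    converges absolutely, which Fubini grants for almost every \<open>r\<close>.\<close>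
  hence "AE r in lborel. (\<integral>\<^sup>+z. ennreal (norm (?F r z)) \<partial>lborel) \<noteq> \<infinity>"
    by (intro nn_integral_PInf_AE) auto
  hence ae: "AE r in lborel. (LINT z|lborel. ?F r z) = indicator {\<epsilon><..} r *\<^sub>R (plane_average g x (sqrt (real j * r)) / of_real (r powr (?n / 2)))"
  proof eventually_elim
    case (elim r)
    show ?case
    proof (cases "r > \<epsilon>")
      case True
      have r: "r > 0" using True \<epsilon> by simp
      define c where "c = r powr (- 1 - \<alpha>)"
      have c: "c > 0" using r by (simp add: c_def)
      have sq: "(sqrt (real j * r))\<^sup>2 = real j * r" using r by simp
      have U: "U r z = c * plane_weight ?n ((sqrt (real j * r))\<^sup>2) ((norm z)\<^sup>2)" for z
        unfolding sq using True by (simp add: U_def c_def)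
      have wn: "0 \<le> plane_weight ?n s w" for s w using card3 by (intro plane_weight_nonneg) auto
      have "(\<integral>\<^sup>+z. ennreal (norm (?F r z)) \<partial>lborel) = ennreal c * (\<integral>\<^sup>+z. ennreal (plane_weight ?n ((sqrt (real j * r))\<^sup>2) ((norm z)\<^sup>2)) * ennreal (norm (g (x + z))) \<partial>lborel)"
        unfolding nF U using c wn
        by (subst nn_integral_cmult[symmetric]) (auto simp: ennreal_mult mult.assoc)
      with elim c have "(\<integral>\<^sup>+z. ennreal (plane_weight ?n ((sqrt (real j * r))\<^sup>2) ((norm z)\<^sup>2)) * ennreal (norm (g (x + z))) \<partial>lborel) < \<infinity>"
        unfolding infinity_ennreal_def less_top[symmetric]
        by (metis ennreal_eq_0_iff ennreal_mult_eq_top_iff not_le)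
      from plane_average_eq[OF g _ this] r
      have "plane_average g x (sqrt (real j * r)) = (LINT z|lborel. plane_weight ?n ((sqrt (real j * r))\<^sup>2) ((norm z)\<^sup>2) *\<^sub>R g (x + z))"
        by simp
      moreover have "(LINT z|lborel. ?F r z) = c *\<^sub>R (LINT z|lborel. plane_weight ?n ((sqrt (real j * r))\<^sup>2) ((norm z)\<^sup>2) *\<^sub>R g (x + z))"
        unfolding U scaleR_scaleR[symmetric] by (rule integral_scaleR_right)
      moreover have "c = 1 / (r powr (?n / 2))"
      proof -
        have "- 1 - \<alpha> = - (?n / 2)" by (simp add: nex)
        thus ?thesis unfolding c_def by (simp only: powr_minus divide_inverse mult_1)
      qed
      ultimately show ?thesis using True by (simp add: scaleR_conv_of_real)
    next
      case False
      hence "U r z = 0" for z by (simp add: U_def)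
      thus ?thesis using False by simp
    qed
  qed
  have m1: "(\<lambda>r. indicator {\<epsilon><..} r *\<^sub>R (plane_average g x (sqrt (real j * r)) / of_real (r powr (?n / 2)))) \<in> borel_measurable lborel"
    by measurable
  have i1: "integrable lborel (\<lambda>r. LINT z|lborel. ?F r z)" by (rule lborel_pair.integrable_fst[OF int])
  have "integrable lborel (\<lambda>r. indicator {\<epsilon><..} r *\<^sub>R (plane_average g x (sqrt (real j * r)) / of_real (r powr (?n / 2))))"
    by (rule Bochner_Integration.integrable_cong_AE_imp[OF i1 m1]) (use ae in \<open>auto elim!: eventually_mono\<close>)
  moreover have "(LINT r|lborel. indicator {\<epsilon><..} r *\<^sub>R (plane_average g x (sqrt (real j * r)) / of_real (r powr (?n / 2)))) = (LINT r|lborel. LINT z|lborel. ?F r z)"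
    by (rule integral_cong_AE[OF m1 borel_measurable_integrable[OF i1]]) (use ae in \<open>auto elim!: eventually_mono\<close>)
  moreover have "(LINT r|lborel. LINT z|lborel. ?F r z) = (LINT z|lborel. LINT r|lborel. ?F r z)"
    by (rule lborel_pair.Fubini_integral[OF int, symmetric])
  moreover have "(LINT r|lborel. ?F r z) = jker (real j) \<epsilon> z *\<^sub>R g (x + z)" for z
  proof -
    have hb: "has_bochner_integral lborel (\<lambda>r. U r z) (jker (real j) \<epsilon> z)"
      by (rule has_bochner_integral_nn_integral) (auto simp: Unn jker_nonneg Ur)
    hence "has_bochner_integral lborel (\<lambda>r. U r z *\<^sub>R g (x + z)) (jker (real j) \<epsilon> z *\<^sub>R g (x + z))"
      by (rule has_bochner_integral_scaleR_left)
    thus ?thesis by (rule has_bochner_integral_integral_eq)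
  qed
  ultimately show ?thesis by (simp add: has_bochner_integral_iff)
qed

lemma truncated_integral:
  assumes g [measurable]: "g \<in> borel_measurable borel" and x: "good g x" and \<epsilon>: "\<epsilon> > 0"
  shows "set_integrable lborel {\<epsilon><..} (inversion_summand g x)"
    and "(LBINT r:{\<epsilon><..}. inversion_summand g x r) = (LINT z|lborel. ker \<epsilon> z *\<^sub>R g (x + z))"
    and "integrable lborel (\<lambda>z. ker \<epsilon> z *\<^sub>R g (x + z))"
proof -
  let ?n = "real CARD('n)"
  have ij: "integrable lborel (\<lambda>z. jker (real j) \<epsilon> z *\<^sub>R g (x + z))" for j
    using nn_integral_jker_finite[OF g x _ \<epsilon>, of "real j"] jker_nonneg
    by (auto simp: integrable_iff_bounded ennreal_mult')
  have "has_bochner_integral lborel (\<lambda>r. \<Sum>j\<le>m. (real (m choose j) * (- 1) ^ j) *\<^sub>R (indicator {\<epsilon><..} r *\<^sub>R (plane_average g x (sqrt (real j * r)) / of_real (r powr (?n / 2)))))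
      (\<Sum>j\<le>m. (real (m choose j) * (- 1) ^ j) *\<^sub>R (LINT z|lborel. jker (real j) \<epsilon> z *\<^sub>R g (x + z)))"
    by (intro has_bochner_integral_sum has_bochner_integral_scaleR_right summand_integral g x \<epsilon>)
  also have "(\<lambda>r. \<Sum>j\<le>m. (real (m choose j) * (- 1) ^ j) *\<^sub>R (indicator {\<epsilon><..} r *\<^sub>R (plane_average g x (sqrt (real j * r)) / of_real (r powr (?n / 2)))))
     = (\<lambda>r. indicator {\<epsilon><..} r *\<^sub>R inversion_summand g x r)"
    by (rule ext) (auto simp: inversion_summand_def indicator_def sum_divide_distrib scaleR_conv_of_real)
  also have "(\<Sum>j\<le>m. (real (m choose j) * (- 1) ^ j) *\<^sub>R (LINT z|lborel. jker (real j) \<epsilon> z *\<^sub>R g (x + z)))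
     = (LINT z|lborel. (\<Sum>j\<le>m. (real (m choose j) * (- 1) ^ j) *\<^sub>R (jker (real j) \<epsilon> z *\<^sub>R g (x + z))))"
    by (subst Bochner_Integration.integral_sum) (auto intro: ij simp del: scaleR_scaleR)
  also have "(\<lambda>z. \<Sum>j\<le>m. (real (m choose j) * (- 1) ^ j) *\<^sub>R (jker (real j) \<epsilon> z *\<^sub>R g (x + z))) = (\<lambda>z. ker \<epsilon> z *\<^sub>R g (x + z))"
    by (simp add: sum_jker[OF \<epsilon>, symmetric] scaleR_sum_left fun_eq_iff)
  finally have hb: "has_bochner_integral lborel (\<lambda>r. indicator {\<epsilon><..} r *\<^sub>R inversion_summand g x r) (LINT z|lborel. ker \<epsilon> z *\<^sub>R g (x + z))" .
  show "set_integrable lborel {\<epsilon><..} (inversion_summand g x)"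
    using hb unfolding set_integrable_def by (simp add: has_bochner_integral_iff)
  show "(LBINT r:{\<epsilon><..}. inversion_summand g x r) = (LINT z|lborel. ker \<epsilon> z *\<^sub>R g (x + z))"
    using hb unfolding set_lebesgue_integral_def by (simp add: has_bochner_integral_iff)
  have "integrable lborel (\<lambda>z. \<Sum>j\<le>m. (real (m choose j) * (- 1) ^ j) *\<^sub>R (jker (real j) \<epsilon> z *\<^sub>R g (x + z)))"
    by (intro Bochner_Integration.integrable_sum integrable_scaleR_right ij)
  thus "integrable lborel (\<lambda>z. ker \<epsilon> z *\<^sub>R g (x + z))"
    by (simp add: sum_jker[OF \<epsilon>, symmetric] scaleR_sum_left)
qed

definition "inv_const = pi powr \<alpha> * kappa CARD('n) m"

text \<open>In the variable \<open>v = |z|^2\<close> the powers of the radial density and of the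
  kernel multiply to \<open>1 / v\<close>, and the measure \<open>dv / v\<close> is invariant under
  scaling by \<open>\<epsilon>\<close>; so the integral is a fixed multiple of that of
  \<open>diff_kernel m \<alpha> w / w\<close>.\<close>

lemma ker_integral:
  assumes \<epsilon>: "\<epsilon> > 0"
  shows "has_bochner_integral lborel (ker \<epsilon>) inv_const"
proof -
  let ?n = "real CARD('n)"
  let ?d = "\<lambda>w. indicator {0<..} w * (diff_kernel m \<alpha> w / w)"
  have rc: "radial_const ?n \<noteq> 0" using radial_const_pos[of ?n] by simp
  have "has_bochner_integral lborel ?d (Gamma (?n / 2) * kappa CARD('n) m)"
    unfolding \<alpha>_def by (rule diff_kernel_integral) (use m card3 in auto)
  hence i: "integrable lborel ?d" and v: "(LINT w|lborel. ?d w) = Gamma (?n / 2) * kappa CARD('n) m"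
    by (auto simp: has_bochner_integral_iff)
  have "has_bochner_integral lborel (\<lambda>v. ?d (0 + (1 / \<epsilon>) * v)) (\<epsilon> *\<^sub>R (Gamma (?n / 2) * kappa CARD('n) m))"
  proof -
    have "integrable lborel (\<lambda>v. ?d (0 + (1 / \<epsilon>) * v))" using i \<epsilon> by (intro lborel_integrable_real_affine) auto
    moreover have "(LINT w|lborel. ?d w) = \<bar>1 / \<epsilon>\<bar> *\<^sub>R (LINT v|lborel. ?d (0 + (1 / \<epsilon>) * v))"
      using \<epsilon> by (intro lborel_integral_real_affine) auto
    ultimately show ?thesis using \<epsilon> v by (simp add: has_bochner_integral_iff field_simps)
  qed
  hence h: "has_bochner_integral lborel (\<lambda>v. (radial_const ?n * (ker_const / \<alpha>) / \<epsilon>) * ?d (0 + (1 / \<epsilon>) * v))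
     ((radial_const ?n * (ker_const / \<alpha>) / \<epsilon>) * (\<epsilon> *\<^sub>R (Gamma (?n / 2) * kappa CARD('n) m)))"
    by (rule has_bochner_integral_mult_right)
  have fe: "(\<lambda>v. (radial_const ?n * (ker_const / \<alpha>) / \<epsilon>) * ?d (0 + (1 / \<epsilon>) * v)) =
     (\<lambda>v. radial_const ?n * v powr (?n / 2 - 1) * indicator {0<..} v * (ker_const / \<alpha> * v powr (- ?n / 2) * diff_kernel m \<alpha> (v / \<epsilon>)))"
  proof
    fix v :: real
    show "(radial_const ?n * (ker_const / \<alpha>) / \<epsilon>) * ?d (0 + (1 / \<epsilon>) * v) =
      radial_const ?n * v powr (?n / 2 - 1) * indicator {0<..} v * (ker_const / \<alpha> * v powr (- ?n / 2) * diff_kernel m \<alpha> (v / \<epsilon>))"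
    proof (cases "v > 0")
      case True
      have p: "v powr (?n / 2 - 1) * v powr (- ?n / 2) = 1 / v"
        using powr_cancel[OF True, of "?n / 2"] by (simp only: minus_divide_left)
      have "radial_const ?n * v powr (?n / 2 - 1) * (ker_const / \<alpha> * v powr (- ?n / 2) * diff_kernel m \<alpha> (v / \<epsilon>))
         = radial_const ?n * (ker_const / \<alpha>) * (v powr (?n / 2 - 1) * v powr (- ?n / 2)) * diff_kernel m \<alpha> (v / \<epsilon>)"
        by simp
      thus ?thesis unfolding p using True \<epsilon> by (simp add: indicator_def)
    next
      case False
      hence "\<not> 0 < v / \<epsilon>" using \<epsilon> by (simp add: zero_less_divide_iff)
      thus ?thesis using False by simp
    qed
  qed
  \<comment> \<open>\<open>radial_const (n - 2) = pi powr \<alpha> / Gamma \<alpha>\<close> meets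
    \<open>Gamma (n / 2) = \<alpha> * Gamma \<alpha>\<close>; only
    \<open>pi powr \<alpha> * kappa\<close> survives.\<close>
  have c: "(radial_const ?n * (ker_const / \<alpha>) / \<epsilon>) * (\<epsilon> *\<^sub>R (Gamma (?n / 2) * kappa CARD('n) m)) = inv_const"
  proof -
    have n2: "(?n - 2) / 2 = \<alpha>" "?n / 2 = \<alpha> + 1" by (simp_all add: \<alpha>_def field_simps)
    have "\<alpha> \<notin> \<int>\<^sub>\<le>\<^sub>0" using \<alpha> by (auto elim!: nonpos_Ints_cases)
    hence G: "Gamma (\<alpha> + 1) = \<alpha> * Gamma \<alpha>" by (rule Gamma_plus1)
    have g0: "Gamma \<alpha> \<noteq> 0" using \<alpha> by (intro less_imp_neq[OF Gamma_real_pos, symmetric])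
    have "(radial_const ?n * (ker_const / \<alpha>) / \<epsilon>) * (\<epsilon> *\<^sub>R (Gamma (?n / 2) * kappa CARD('n) m)) = radial_const (?n - 2) / \<alpha> * Gamma (?n / 2) * kappa CARD('n) m"
      using \<epsilon> rc by (simp add: ker_const_def)
    also have "\<dots> = inv_const"
      unfolding radial_const_def n2 G inv_const_def using g0 \<alpha> by simp
    finally show ?thesis .
  qed
  have "has_bochner_integral lborel (\<lambda>y :: real ^ 'n. ker_const / \<alpha> * ((norm y)\<^sup>2) powr (- ?n / 2) * diff_kernel m \<alpha> ((norm y)\<^sup>2 / \<epsilon>)) inv_const"
    by (rule has_bochner_integral_radial) (use h[unfolded fe c] in auto)
  thus ?thesis unfolding ker_def[abs_def] .
qed

end

section \<open>Error estimate for the truncated integrals\<close>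

context marchaud_frame
begin

text \<open>Divided by \<open>w = |z|^2\<close> this is the decreasing majorant of the kernel: of
  order \<open>\<epsilon> powr (- \<alpha>) / w\<close> while \<open>w\<close> is below
  \<open>\<epsilon>\<close>, with \<open>m\<close> further powers of decay beyond.\<close>

definition "profile \<epsilon> w = \<epsilon> powr (- \<alpha>) * (1 + w / \<epsilon>) powr (- real m)"

lemma ker_bound:
  obtains C where "C > 0" "\<And>\<epsilon> z. \<epsilon> > 0 \<Longrightarrow> z \<noteq> 0 \<Longrightarrow> \<bar>ker \<epsilon> z\<bar> \<le> C * (profile \<epsilon> ((norm z)\<^sup>2) / (norm z)\<^sup>2)"
proof -
  obtain C where C: "C > 0" "\<And>w. w > 0 \<Longrightarrow> \<bar>diff_kernel m \<alpha> w\<bar> \<le> C * (w powr \<alpha> * (1 + w) powr (- real m))"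
    using diff_kernel_bound[OF \<alpha>] by blast
  have k0: "ker_const / \<alpha> > 0" using ker_const_pos \<alpha> by simp
  have "\<bar>ker \<epsilon> z\<bar> \<le> (ker_const / \<alpha> * C) * (profile \<epsilon> ((norm z)\<^sup>2) / (norm z)\<^sup>2)" if \<epsilon>: "\<epsilon> > 0" and z: "z \<noteq> 0" for \<epsilon> z
  proof -
    define w where "w = (norm z)\<^sup>2"
    have w: "w > 0" using z by (simp add: w_def)
    have e: "- real CARD('n) / 2 = - \<alpha> - 1" by (simp add: \<alpha>_def field_simps)
    have p: "w powr (- real CARD('n) / 2) * (w / \<epsilon>) powr \<alpha> = \<epsilon> powr (- \<alpha>) / w"
      unfolding e using w \<epsilon> by (simp add: powr_diff powr_minus powr_divide field_simps)
    have "\<bar>ker \<epsilon> z\<bar> = ker_const / \<alpha> * w powr (- real CARD('n) / 2) * \<bar>diff_kernel m \<alpha> (w / \<epsilon>)\<bar>"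
      unfolding ker_def w_def[symmetric] abs_mult using ker_const_pos \<alpha> by simp
    also have "\<dots> \<le> ker_const / \<alpha> * w powr (- real CARD('n) / 2) * (C * ((w / \<epsilon>) powr \<alpha> * (1 + w / \<epsilon>) powr (- real m)))"
      using C(2)[of "w / \<epsilon>"] w \<epsilon> less_imp_le[OF k0] by (intro mult_left_mono mult_nonneg_nonneg) auto
    also have "\<dots> = (ker_const / \<alpha> * C) * (w powr (- real CARD('n) / 2) * (w / \<epsilon>) powr \<alpha>) * (1 + w / \<epsilon>) powr (- real m)"
      by simp
    finally show ?thesis unfolding p profile_def w_def[symmetric] by simp
  qed
  thus ?thesis using that[of "ker_const / \<alpha> * C"] C k0 by (metis mult_pos_pos)
qed

text \<open>The radial majorant of the kernel is a superposition of indicator functions of balls.\<close>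

lemma profile_layer:
  assumes \<epsilon>: "\<epsilon> > 0" and w: "w > 0"
  shows "ennreal (profile \<epsilon> w / w) \<le> ennreal (2 ^ (m + 2)) * (\<integral>\<^sup>+t. ennreal (profile \<epsilon> t / t\<^sup>2) * indicator {w<..} t \<partial>lborel)"
proof -
  \<comment> \<open>\<open>c\<close> is a lower bound for \<open>profile \<epsilon> t / t^2\<close>
    on the interval from \<open>w\<close> to \<open>2 * w\<close>: there
    \<open>1 + t / \<epsilon>\<close> at most doubles, which costs \<open>2 ^ m\<close>, and
    \<open>t^2\<close> at most quadruples, which costs 4. Integrating \<open>c\<close> over this
    interval of length \<open>w\<close> recovers the left side.\<close>
  define c where "c = profile \<epsilon> w / (2 ^ (m + 2) * w\<^sup>2)"
  have pn: "profile \<epsilon> t \<ge> 0" for t by (simp add: profile_def)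
  have c: "c \<ge> 0" by (simp add: c_def pn)
  have le: "c \<le> profile \<epsilon> t / t\<^sup>2" if t: "w < t" "t \<le> 2 * w" for t
  proof -
    have "1 + t / \<epsilon> \<le> 2 * (1 + w / \<epsilon>)"
    proof -
      have "t / \<epsilon> \<le> 2 * w / \<epsilon>" using t \<epsilon> by (intro divide_right_mono) auto
      thus ?thesis by simp
    qed
    hence "(2 * (1 + w / \<epsilon>)) powr (- real m) \<le> (1 + t / \<epsilon>) powr (- real m)"
      using t \<epsilon> w by (intro powr_mono2') (auto intro!: add_pos_nonneg)
    moreover have "(2 * (1 + w / \<epsilon>)) powr (- real m) = (1 + w / \<epsilon>) powr (- real m) / 2 ^ m"
    proof -
      have "1 + w / \<epsilon> \<ge> 0" using \<epsilon> w by simp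
      moreover have "(2::real) powr (- real m) = 1 / 2 ^ m" by (simp add: powr_minus powr_realpow divide_inverse)
      ultimately show ?thesis by (subst powr_mult) simp_all
    qed
    ultimately have 1: "profile \<epsilon> w / 2 ^ m \<le> profile \<epsilon> t"
      unfolding profile_def by (simp add: mult_left_mono flip: times_divide_eq_right)
    have 2: "t\<^sup>2 \<le> 4 * w\<^sup>2" using power_mono[of t "2 * w" 2] t w by (simp add: power_mult_distrib)
    have "c = (profile \<epsilon> w / 2 ^ m) / (4 * w\<^sup>2)" by (simp add: c_def power_add)
    also have "\<dots> \<le> profile \<epsilon> t / t\<^sup>2" using 1 2 w t pn by (intro frac_le) auto
    finally show ?thesis .
  qed
  have "ennreal (profile \<epsilon> w / w) = ennreal (2 ^ (m + 2)) * (ennreal c * ennreal w)"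
    using w c by (simp add: ennreal_mult'[symmetric]) (simp add: c_def power2_eq_square)
  also have "ennreal c * ennreal w = (\<integral>\<^sup>+t. ennreal c * indicator {w<..2 * w} t \<partial>lborel)"
    using w by (subst nn_integral_cmult) auto
  also have "\<dots> \<le> (\<integral>\<^sup>+t. ennreal (profile \<epsilon> t / t\<^sup>2) * indicator {w<..} t \<partial>lborel)"
    using le by (intro nn_integral_mono) (auto simp: indicator_def intro: ennreal_leI)
  finally show ?thesis by (simp add: mult_left_mono)
qed

text \<open>What is left of \<open>profile \<epsilon> t / t^2\<close> after the substitution
  \<open>t = \<epsilon> * \<tau>\<close>, once \<open>t powr (- n / 2)\<close> has been moved into
  \<open>mean_oscillation\<close>; no \<open>\<epsilon>\<close> remains.\<close>

definition "conv_weight \<tau> = \<tau> powr (\<alpha> - 1) * (1 + \<tau>) powr (- real m)"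

text \<open>The kernel has total mass \<open>inv_const\<close>, so the error is the integral of
  \<open>ker \<epsilon> z\<close> against \<open>g (x + z) - g x\<close>; the layer representation
  of the majorant rewrites its bound as an average of oscillations over balls. The constant
  \<open>C\<close> precedes \<open>g\<close>, \<open>x\<close> and \<open>\<epsilon>\<close>, which
  is what uniform convergence needs.\<close>

lemma inversion_error:
  obtains C where "C \<ge> 0"
    "\<And>g x \<epsilon>. g \<in> borel_measurable borel \<Longrightarrow> good g x \<Longrightarrow> \<epsilon> > 0 \<Longrightarrow>
      ennreal (norm ((LBINT r:{\<epsilon><..}. inversion_summand g x r) - of_real inv_const * g x)) \<le>
      ennreal C * (\<integral>\<^sup>+\<tau>. ennreal (conv_weight \<tau>) * indicator {0<..} \<tau> * mean_oscillation g x (\<epsilon> * \<tau>) \<partial>lborel)"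
proof -
  let ?n = "real CARD('n)"
  obtain C where C: "C > 0" "\<And>\<epsilon> z. \<epsilon> > 0 \<Longrightarrow> z \<noteq> 0 \<Longrightarrow> \<bar>ker \<epsilon> z\<bar> \<le> C * (profile \<epsilon> ((norm z)\<^sup>2) / (norm z)\<^sup>2)"
    using ker_bound by blast
  have main: "ennreal (norm ((LBINT r:{\<epsilon><..}. inversion_summand g x r) - of_real inv_const * g x)) \<le>
      ennreal (C * 2 ^ (m + 2)) * (\<integral>\<^sup>+\<tau>. ennreal (conv_weight \<tau>) * indicator {0<..} \<tau> * mean_oscillation g x (\<epsilon> * \<tau>) \<partial>lborel)"
    if g [measurable]: "g \<in> borel_measurable borel" and x: "good g x" and \<epsilon>: "\<epsilon> > 0" for g x \<epsilon>
  proof -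
    define \<Delta> where "\<Delta> z = norm (g (x + z) - g x)" for z
    have [measurable]: "\<Delta> \<in> borel_measurable borel" unfolding \<Delta>_def by measurable
    define q where "q t = profile \<epsilon> t / t\<^sup>2" for t
    have qn: "q t \<ge> 0" for t by (simp add: q_def profile_def)
    have [measurable]: "q \<in> borel_measurable borel" unfolding q_def profile_def by measurable
    have i1: "integrable lborel (\<lambda>z. ker \<epsilon> z *\<^sub>R g (x + z))" by (rule truncated_integral[OF g x \<epsilon>])
    have k: "integrable lborel (ker \<epsilon>)" "(LINT z|lborel. ker \<epsilon> z) = inv_const"
      using ker_integral[OF \<epsilon>] by (auto simp: has_bochner_integral_iff)
    have i2: "integrable lborel (\<lambda>z. ker \<epsilon> z *\<^sub>R g x)" using k by (intro integrable_scaleR_left) auto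
    have i3: "integrable lborel (\<lambda>z. ker \<epsilon> z *\<^sub>R (g (x + z) - g x))"
      using Bochner_Integration.integrable_diff[OF i1 i2] by (simp add: scaleR_diff_right)
    have "(LBINT r:{\<epsilon><..}. inversion_summand g x r) - of_real inv_const * g x = (LINT z|lborel. ker \<epsilon> z *\<^sub>R g (x + z)) - (LINT z|lborel. ker \<epsilon> z *\<^sub>R g x)"
      using truncated_integral(2)[OF g x \<epsilon>] k by (simp add: scaleR_conv_of_real)
    also have "\<dots> = (LINT z|lborel. ker \<epsilon> z *\<^sub>R (g (x + z) - g x))"
      using Bochner_Integration.integral_diff[OF i1 i2] by (simp add: scaleR_diff_right)
    finally have "ennreal (norm ((LBINT r:{\<epsilon><..}. inversion_summand g x r) - of_real inv_const * g x)) \<le> (\<integral>\<^sup>+z. ennreal (norm (ker \<epsilon> z *\<^sub>R (g (x + z) - g x))) \<partial>lborel)"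
      using integral_norm_bound_ennreal[OF i3] by simp
    also have "\<dots> \<le> (\<integral>\<^sup>+z. ennreal (C * 2 ^ (m + 2)) * (\<integral>\<^sup>+t. ennreal (q t) * indicator {(norm z)\<^sup>2<..} t * ennreal (\<Delta> z) \<partial>lborel) \<partial>lborel)"
    proof (rule nn_integral_mono)
      fix z :: "real ^ 'n"
      show "ennreal (norm (ker \<epsilon> z *\<^sub>R (g (x + z) - g x))) \<le> ennreal (C * 2 ^ (m + 2)) * (\<integral>\<^sup>+t. ennreal (q t) * indicator {(norm z)\<^sup>2<..} t * ennreal (\<Delta> z) \<partial>lborel)"
      proof (cases "z = 0")
        case False
        have "norm (ker \<epsilon> z *\<^sub>R (g (x + z) - g x)) \<le> C * (profile \<epsilon> ((norm z)\<^sup>2) / (norm z)\<^sup>2) * \<Delta> z"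
          unfolding norm_scaleR \<Delta>_def by (intro mult_right_mono C(2) \<epsilon> False) simp
        hence "ennreal (norm (ker \<epsilon> z *\<^sub>R (g (x + z) - g x))) \<le> ennreal (C * (profile \<epsilon> ((norm z)\<^sup>2) / (norm z)\<^sup>2) * \<Delta> z)"
          by (rule ennreal_leI)
        also have "\<dots> = ennreal C * ennreal (profile \<epsilon> ((norm z)\<^sup>2) / (norm z)\<^sup>2) * ennreal (\<Delta> z)"
        proof -
          have "0 \<le> \<Delta> z" "0 \<le> C" using C by (simp_all add: \<Delta>_def)
          thus ?thesis by (simp only: ennreal_mult'' ennreal_mult')
        qed
        also have "\<dots> \<le> ennreal C * (ennreal (2 ^ (m + 2)) * (\<integral>\<^sup>+t. ennreal (q t) * indicator {(norm z)\<^sup>2<..} t \<partial>lborel)) * ennreal (\<Delta> z)"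
          unfolding q_def using profile_layer[OF \<epsilon>, of "(norm z)\<^sup>2"] False by (intro mult_right_mono mult_left_mono) auto
        also have "\<dots> = ennreal (C * 2 ^ (m + 2)) * ((\<integral>\<^sup>+t. ennreal (q t) * indicator {(norm z)\<^sup>2<..} t \<partial>lborel) * ennreal (\<Delta> z))"
          using C by (simp add: ennreal_mult mult.assoc)
        also have "(\<integral>\<^sup>+t. ennreal (q t) * indicator {(norm z)\<^sup>2<..} t \<partial>lborel) * ennreal (\<Delta> z) = (\<integral>\<^sup>+t. ennreal (q t) * indicator {(norm z)\<^sup>2<..} t * ennreal (\<Delta> z) \<partial>lborel)"
          by (rule nn_integral_multc[symmetric]) measurable
        finally show ?thesis .
      qed simp
    qed
    also have "\<dots> = ennreal (C * 2 ^ (m + 2)) * (\<integral>\<^sup>+z. \<integral>\<^sup>+t. ennreal (q t) * indicator {(norm z)\<^sup>2<..} t * ennreal (\<Delta> z) \<partial>lborel \<partial>lborel)"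
    proof (rule nn_integral_cmult)
      have "(\<lambda>p :: (real ^ 'n) \<times> real. ennreal (q (snd p)) * indicator {p. (norm (fst p))\<^sup>2 < snd p} p * ennreal (\<Delta> (fst p))) \<in> borel_measurable (lborel \<Otimes>\<^sub>M lborel)"
        by measurable
      hence "(\<lambda>(z :: real ^ 'n, t). ennreal (q t) * indicator {(norm z)\<^sup>2<..} t * ennreal (\<Delta> z)) \<in> borel_measurable (lborel \<Otimes>\<^sub>M lborel)"
        by (simp add: case_prod_unfold indicator_def)
      thus "(\<lambda>z :: real ^ 'n. \<integral>\<^sup>+t. ennreal (q t) * indicator {(norm z)\<^sup>2<..} t * ennreal (\<Delta> z) \<partial>lborel) \<in> borel_measurable lborel"
        by measurable
    qed
    \<comment> \<open>Exchanging the integrals turns the half-lines \<open>t > |z|^2\<close> into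
      the balls \<open>|z|^2 < t\<close>.\<close>
    also have "(\<integral>\<^sup>+z. \<integral>\<^sup>+t. ennreal (q t) * indicator {(norm (z :: real ^ 'n))\<^sup>2<..} t * ennreal (\<Delta> z) \<partial>lborel \<partial>lborel)
       = (\<integral>\<^sup>+t. \<integral>\<^sup>+z. ennreal (q t) * indicator {(norm z)\<^sup>2<..} t * ennreal (\<Delta> z) \<partial>lborel \<partial>lborel)"
    proof (rule lborel_pair.Fubini'[symmetric])
      have "(\<lambda>p :: (real ^ 'n) \<times> real. ennreal (q (snd p)) * indicator {p. (norm (fst p))\<^sup>2 < snd p} p * ennreal (\<Delta> (fst p))) \<in> borel_measurable (lborel \<Otimes>\<^sub>M lborel)"
        by measurable
      thus "(\<lambda>(z :: real ^ 'n, t). ennreal (q t) * indicator {(norm z)\<^sup>2<..} t * ennreal (\<Delta> z)) \<in> borel_measurable (lborel \<Otimes>\<^sub>M lborel)"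
        by (simp add: case_prod_unfold indicator_def)
    qed
    also have "\<dots> = (\<integral>\<^sup>+t. ennreal (q t) * (\<integral>\<^sup>+z. ennreal (\<Delta> z) * indicator {z. (norm z)\<^sup>2 < t} z \<partial>lborel) \<partial>lborel)"
    proof (rule nn_integral_cong)
      fix t
      have "(\<integral>\<^sup>+(z :: real ^ 'n). ennreal (q t) * indicator {(norm z)\<^sup>2<..} t * ennreal (\<Delta> z) \<partial>lborel) = (\<integral>\<^sup>+z. ennreal (q t) * (ennreal (\<Delta> z) * indicator {z. (norm z)\<^sup>2 < t} z) \<partial>lborel)"
        by (intro nn_integral_cong) (auto simp: indicator_def)
      also have "\<dots> = ennreal (q t) * (\<integral>\<^sup>+z. ennreal (\<Delta> z) * indicator {z. (norm z)\<^sup>2 < t} z \<partial>lborel)"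
        by (rule nn_integral_cmult) measurable
      finally show "(\<integral>\<^sup>+(z :: real ^ 'n). ennreal (q t) * indicator {(norm z)\<^sup>2<..} t * ennreal (\<Delta> z) \<partial>lborel) = \<dots>" .
    qed
    also have "\<dots> = ennreal \<bar>\<epsilon>\<bar> * (\<integral>\<^sup>+\<tau>. ennreal (q (0 + \<epsilon> * \<tau>)) * (\<integral>\<^sup>+z. ennreal (\<Delta> z) * indicator {z. (norm z)\<^sup>2 < 0 + \<epsilon> * \<tau>} z \<partial>lborel) \<partial>lborel)"
    proof (rule nn_integral_real_affine)
      have "(\<lambda>p :: real \<times> (real ^ 'n). ennreal (\<Delta> (snd p)) * indicator {p. (norm (snd p))\<^sup>2 < fst p} p) \<in> borel_measurable (borel \<Otimes>\<^sub>M lborel)"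
        by measurable
      hence [measurable]: "(\<lambda>(t, z :: real ^ 'n). ennreal (\<Delta> z) * indicator {z. (norm z)\<^sup>2 < t} z) \<in> borel_measurable (borel \<Otimes>\<^sub>M lborel)"
        by (simp add: case_prod_unfold indicator_def)
      show "(\<lambda>t. ennreal (q t) * (\<integral>\<^sup>+z. ennreal (\<Delta> z) * indicator {z. (norm z)\<^sup>2 < t} z \<partial>lborel)) \<in> borel_measurable borel"
        by measurable
    qed (use \<epsilon> in simp)
    also have "\<dots> \<le> (\<integral>\<^sup>+\<tau>. ennreal (conv_weight \<tau>) * indicator {0<..} \<tau> * mean_oscillation g x (\<epsilon> * \<tau>) \<partial>lborel)"
    proof -
      have "ennreal \<bar>\<epsilon>\<bar> * (\<integral>\<^sup>+\<tau>. ennreal (q (0 + \<epsilon> * \<tau>)) * (\<integral>\<^sup>+z. ennreal (\<Delta> z) * indicator {z. (norm z)\<^sup>2 < 0 + \<epsilon> * \<tau>} z \<partial>lborel) \<partial>lborel)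
         = (\<integral>\<^sup>+\<tau>. ennreal \<bar>\<epsilon>\<bar> * (ennreal (q (0 + \<epsilon> * \<tau>)) * (\<integral>\<^sup>+z. ennreal (\<Delta> z) * indicator {z. (norm z)\<^sup>2 < 0 + \<epsilon> * \<tau>} z \<partial>lborel)) \<partial>lborel)"
      proof (rule nn_integral_cmult[symmetric])
        have "(\<lambda>p :: real \<times> (real ^ 'n). ennreal (\<Delta> (snd p)) * indicator {p. (norm (snd p))\<^sup>2 < 0 + \<epsilon> * fst p} p) \<in> borel_measurable (borel \<Otimes>\<^sub>M lborel)"
          by measurable
        hence [measurable]: "(\<lambda>(\<tau>, z :: real ^ 'n). ennreal (\<Delta> z) * indicator {z. (norm z)\<^sup>2 < 0 + \<epsilon> * \<tau>} z) \<in> borel_measurable (borel \<Otimes>\<^sub>M lborel)"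
          by (simp add: case_prod_unfold indicator_def)
        show "(\<lambda>\<tau>. ennreal (q (0 + \<epsilon> * \<tau>)) * (\<integral>\<^sup>+z. ennreal (\<Delta> z) * indicator {z. (norm z)\<^sup>2 < 0 + \<epsilon> * \<tau>} z \<partial>lborel)) \<in> borel_measurable lborel"
          by measurable
      qed
      also have "\<dots> \<le> (\<integral>\<^sup>+\<tau>. ennreal (conv_weight \<tau>) * indicator {0<..} \<tau> * mean_oscillation g x (\<epsilon> * \<tau>) \<partial>lborel)"
      proof (rule nn_integral_mono)
        fix \<tau> :: real
        let ?B = "\<integral>\<^sup>+z. ennreal (\<Delta> z) * indicator {z. (norm z)\<^sup>2 < 0 + \<epsilon> * \<tau>} z \<partial>lborel"
        show "ennreal \<bar>\<epsilon>\<bar> * (ennreal (q (0 + \<epsilon> * \<tau>)) * ?B) \<le> ennreal (conv_weight \<tau>) * indicator {0<..} \<tau> * mean_oscillation g x (\<epsilon> * \<tau>)"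
        proof (cases "\<tau> > 0")
          case False
          hence "\<epsilon> * \<tau> \<le> 0" using \<epsilon> by (simp add: mult_le_0_iff)
          hence "indicator {z. (norm z)\<^sup>2 < 0 + \<epsilon> * \<tau>} z = (0 :: ennreal)" for z :: "real ^ 'n"
          proof -
            have "\<not> (norm z)\<^sup>2 < 0 + \<epsilon> * \<tau>" using \<open>\<epsilon> * \<tau> \<le> 0\<close> zero_le_power2[of "norm z"] by linarith
            thus ?thesis by simp
          qed
          thus ?thesis by simp
        next
          case True
          have et: "\<epsilon> * \<tau> > 0" using True \<epsilon> by simp
          have n2: "- ?n / 2 = - \<alpha> - 1" by (simp add: \<alpha>_def field_simps)
          have "\<epsilon> * q (\<epsilon> * \<tau>) = conv_weight \<tau> * (\<epsilon> * \<tau>) powr (- ?n / 2)"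
            unfolding n2 q_def profile_def conv_weight_def using True \<epsilon>
            by (simp add: powr_mult powr_diff powr_minus power2_eq_square field_simps)
          hence "ennreal (\<epsilon> * q (\<epsilon> * \<tau>)) * ?B = ennreal (conv_weight \<tau> * (\<epsilon> * \<tau>) powr (- ?n / 2)) * ?B" by simp
          thus ?thesis using True \<epsilon> qn unfolding mean_oscillation_def \<Delta>_def
            by (simp add: ennreal_mult conv_weight_def mult.assoc)
        qed
      qed
      finally show ?thesis .
    qed
    finally show ?thesis by (simp add: mult_left_mono)
  qed
  show ?thesis by (rule that[of "C * 2 ^ (m + 2)"]) (use C main in auto)
qed

lemma conv_weight_finite: "(\<integral>\<^sup>+\<tau>. ennreal (conv_weight \<tau>) * indicator {0<..} \<tau> \<partial>lborel) < \<infinity>"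
  unfolding conv_weight_def by (rule nn_integral_beta_finite[OF \<alpha>])

text \<open>The integral is split where \<open>\<epsilon> * \<tau>\<close> reaches
  \<open>\<delta>\<close>: below, the oscillation is small; above, it is bounded, and the tail of
  \<open>conv_weight\<close> beyond a multiple of \<open>\<delta> / \<epsilon>\<close> tends to zero
  with \<open>\<epsilon>\<close> because \<open>m > \<alpha>\<close>.\<close>

lemma conv_bound:
  assumes \<epsilon>: "\<epsilon> > 0" and \<delta>: "\<delta> > 0" and small: "\<And>t. 0 < t \<Longrightarrow> t < \<delta> \<Longrightarrow> D t \<le> ennreal \<eta>"
    and bound: "\<And>t. 0 < t \<Longrightarrow> D t \<le> ennreal B"
  shows "(\<integral>\<^sup>+\<tau>. ennreal (conv_weight \<tau>) * indicator {0<..} \<tau> * D (\<epsilon> * \<tau>) \<partial>lborel) \<le>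
    (\<integral>\<^sup>+\<tau>. ennreal (conv_weight \<tau>) * indicator {0<..} \<tau> \<partial>lborel) * ennreal \<eta> +
    ennreal ((2 * \<epsilon> / \<delta>) powr (real m - \<alpha>) / (real m - \<alpha>)) * ennreal B"
proof -
  \<comment> \<open>Half the splitting point, so that
    \<open>\<epsilon> * \<tau> \<ge> \<delta>\<close> gives the strict inequality
    \<open>\<tau> > ?R\<close>.\<close>
  let ?R = "\<delta> / (2 * \<epsilon>)"
  have R: "?R > 0" using \<epsilon> \<delta> by simp
  have "(\<integral>\<^sup>+\<tau>. ennreal (conv_weight \<tau>) * indicator {0<..} \<tau> * D (\<epsilon> * \<tau>) \<partial>lborel) \<le>
    (\<integral>\<^sup>+\<tau>. ennreal (conv_weight \<tau>) * indicator {0<..} \<tau> * ennreal \<eta> + ennreal (\<tau> powr (- 1 - (real m - \<alpha>))) * indicator {?R<..} \<tau> * ennreal B \<partial>lborel)"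
  proof (rule nn_integral_mono)
    fix \<tau> :: real
    show "ennreal (conv_weight \<tau>) * indicator {0<..} \<tau> * D (\<epsilon> * \<tau>) \<le>
      ennreal (conv_weight \<tau>) * indicator {0<..} \<tau> * ennreal \<eta> + ennreal (\<tau> powr (- 1 - (real m - \<alpha>))) * indicator {?R<..} \<tau> * ennreal B"
    proof (cases "\<tau> > 0")
      case True
      have et: "\<epsilon> * \<tau> > 0" using True \<epsilon> by simp
      show ?thesis
      proof (cases "\<epsilon> * \<tau> < \<delta>")
        case True
        have "ennreal (conv_weight \<tau>) * indicator {0<..} \<tau> * D (\<epsilon> * \<tau>) \<le> ennreal (conv_weight \<tau>) * indicator {0<..} \<tau> * ennreal \<eta>"
          by (intro mult_left_mono small et True) simp
        thus ?thesis by (rule order_trans) simp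
      next
        case False
        have tR: "\<tau> > ?R"
        proof -
          have "\<delta> < 2 * (\<epsilon> * \<tau>)" using False \<delta> by linarith
          thus ?thesis using \<epsilon> by (simp add: divide_less_eq mult_ac)
        qed
        have "(1 + \<tau>) powr (- real m) \<le> \<tau> powr (- real m)" using \<open>\<tau> > 0\<close> by (intro powr_mono2') auto
        hence "conv_weight \<tau> \<le> \<tau> powr (\<alpha> - 1) * \<tau> powr (- real m)" unfolding conv_weight_def by (rule mult_left_mono) simp
        also have "\<dots> = \<tau> powr (- 1 - (real m - \<alpha>))"
          unfolding powr_add[symmetric] by (rule arg_cong[where f="\<lambda>s. \<tau> powr s"]) linarith
        finally have "ennreal (conv_weight \<tau>) * D (\<epsilon> * \<tau>) \<le> ennreal (\<tau> powr (- 1 - (real m - \<alpha>))) * ennreal B"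
          by (intro mult_mono ennreal_leI bound et) auto
        hence "ennreal (conv_weight \<tau>) * indicator {0<..} \<tau> * D (\<epsilon> * \<tau>) \<le> ennreal (\<tau> powr (- 1 - (real m - \<alpha>))) * indicator {?R<..} \<tau> * ennreal B"
          using tR \<open>\<tau> > 0\<close> by simp
        thus ?thesis by (rule order_trans) simp
      qed
    qed simp
  qed
  also have "\<dots> = (\<integral>\<^sup>+\<tau>. ennreal (conv_weight \<tau>) * indicator {0<..} \<tau> * ennreal \<eta> \<partial>lborel) + (\<integral>\<^sup>+\<tau>. ennreal (\<tau> powr (- 1 - (real m - \<alpha>))) * indicator {?R<..} \<tau> * ennreal B \<partial>lborel)"
    unfolding conv_weight_def by (rule nn_integral_add) measurable
  also have "\<dots> = (\<integral>\<^sup>+\<tau>. ennreal (conv_weight \<tau>) * indicator {0<..} \<tau> \<partial>lborel) * ennreal \<eta> + ennreal (?R powr (- (real m - \<alpha>)) / (real m - \<alpha>)) * ennreal B"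
    unfolding conv_weight_def using \<alpha> R
    by (subst (1 2) nn_integral_multc) (measurable, subst nn_integral_powr_tail, auto)
  also have "?R powr (- (real m - \<alpha>)) = (2 * \<epsilon> / \<delta>) powr (real m - \<alpha>)"
  proof -
    have "?R = inverse (2 * \<epsilon> / \<delta>)" by simp
    thus ?thesis using \<epsilon> \<delta> by (simp only: powr_minus inverse_powr) (simp add: inverse_powr powr_minus)
  qed
  finally show ?thesis .
qed

text \<open>One statement serves both function spaces: \<open>X\<close> is a single Lebesgue point
  in the first case and a closed ball in the second.\<close>

theorem uniform_inversion:
  assumes g: "g \<in> borel_measurable borel" and good: "\<And>x. x \<in> X \<Longrightarrow> good g x"
    and small: "\<And>\<eta>. \<eta> > 0 \<Longrightarrow> \<exists>\<delta>>0. \<forall>x\<in>X. \<forall>t. 0 < t \<and> t < \<delta> \<longrightarrow> mean_oscillation g x t \<le> ennreal \<eta>"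
    and bound: "\<And>x t. x \<in> X \<Longrightarrow> t > 0 \<Longrightarrow> mean_oscillation g x t \<le> ennreal B"
  shows "uniform_limit X (\<lambda>\<epsilon> x. LBINT r:{\<epsilon><..}. inversion_summand g x r) (\<lambda>x. of_real inv_const * g x) (at_right 0)"
  unfolding uniform_limit_iff
proof (intro allI impI)
  fix \<eta> :: real assume \<eta>: "\<eta> > 0"
  obtain C where C: "C \<ge> 0"
    "\<And>g x \<epsilon>. g \<in> borel_measurable borel \<Longrightarrow> good g x \<Longrightarrow> \<epsilon> > 0 \<Longrightarrow>
      ennreal (norm ((LBINT r:{\<epsilon><..}. inversion_summand g x r) - of_real inv_const * g x)) \<le>
      ennreal C * (\<integral>\<^sup>+\<tau>. ennreal (conv_weight \<tau>) * indicator {0<..} \<tau> * mean_oscillation g x (\<epsilon> * \<tau>) \<partial>lborel)"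
    using inversion_error by blast
  obtain W where W: "W \<ge> 0" "(\<integral>\<^sup>+\<tau>. ennreal (conv_weight \<tau>) * indicator {0<..} \<tau> \<partial>lborel) = ennreal W"
    using conv_weight_finite by (metis ennreal_cases infinity_ennreal_def less_irrefl)
  \<comment> \<open>The increments by 1 keep the quotient meaningful if \<open>C\<close> or
    \<open>W\<close> vanishes and give \<open>C * W * \<eta>' \<le> \<eta> / 2\<close>.\<close>
  define \<eta>' where "\<eta>' = \<eta> / (2 * (C + 1) * (W + 1))"
  have \<eta>': "\<eta>' > 0" using \<eta> C W by (simp add: \<eta>'_def)
  obtain \<delta> where \<delta>: "\<delta> > 0" "\<And>x t. x \<in> X \<Longrightarrow> 0 < t \<Longrightarrow> t < \<delta> \<Longrightarrow> mean_oscillation g x t \<le> ennreal \<eta>'"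
    using small[OF \<eta>'] by blast
  define B' where "B' = max 0 B"
  have B': "B' \<ge> 0" "ennreal B \<le> ennreal B'" by (auto simp: B'_def intro: ennreal_leI)
  let ?h = "\<lambda>\<epsilon>. (2 * \<epsilon> / \<delta>) powr (real m - \<alpha>) / (real m - \<alpha>)"
  have CW: "C * (W * \<eta>') < \<eta>" 
  proof -
    have "C * W \<le> (C + 1) * (W + 1)" using C W by (intro mult_mono) auto
    hence "C * W * \<eta>' \<le> (C + 1) * (W + 1) * \<eta>'" using \<eta>' by (intro mult_right_mono) auto
    also have "\<dots> = \<eta> / 2"
    proof -
      have "a * b * (\<eta> / (2 * a * b)) = \<eta> / 2" if "a > 0" "b > 0" for a b using that by simp
      thus ?thesis unfolding \<eta>'_def using C(1) W(1) by (metis add_nonneg_pos zero_less_one)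
    qed
    finally show ?thesis using \<eta> by simp
  qed
  have "((\<lambda>\<epsilon>. C * (W * \<eta>' + ?h \<epsilon> * B')) \<longlongrightarrow> C * (W * \<eta>' + (2 * 0 / \<delta>) powr (real m - \<alpha>) / (real m - \<alpha>) * B')) (at_right 0)"
  proof -
    have lim: "((\<lambda>\<epsilon>. (2 * \<epsilon> / \<delta>) powr (real m - \<alpha>)) \<longlongrightarrow> (2 * 0 / \<delta>) powr (real m - \<alpha>)) (at_right 0)"
    proof (rule tendsto_powr')
      show "2 * 0 / \<delta> \<noteq> 0 \<or> 0 < real m - \<alpha> \<and> (\<forall>\<^sub>F x in at_right 0. 0 \<le> 2 * x / \<delta>)"
        using \<alpha> \<delta> by (auto simp: eventually_at_right_field intro!: exI[of _ 1])
    qed (use \<delta> in \<open>auto intro!: tendsto_eq_intros\<close>)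
    show ?thesis by (intro tendsto_mult tendsto_add tendsto_divide tendsto_const lim) (use \<alpha> in auto)
  qed
  hence "\<forall>\<^sub>F \<epsilon> in at_right 0. C * (W * \<eta>' + ?h \<epsilon> * B') < \<eta>"
    by (rule order_tendstoD(2)) (use CW \<alpha> in simp)
  moreover have "\<forall>\<^sub>F \<epsilon> in at_right 0. (\<epsilon> :: real) > 0" by (rule eventually_at_right_less)
  ultimately show "\<forall>\<^sub>F \<epsilon> in at_right 0. \<forall>x\<in>X. dist (LBINT r:{\<epsilon><..}. inversion_summand g x r) (of_real inv_const * g x) < \<eta>"
  proof eventually_elim
    case (elim \<epsilon>)
    show ?case
    proof
      fix x assume x: "x \<in> X"
      have h: "?h \<epsilon> \<ge> 0" using \<alpha> by simp
      have "ennreal (norm ((LBINT r:{\<epsilon><..}. inversion_summand g x r) - of_real inv_const * g x)) \<le>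
        ennreal C * (\<integral>\<^sup>+\<tau>. ennreal (conv_weight \<tau>) * indicator {0<..} \<tau> * mean_oscillation g x (\<epsilon> * \<tau>) \<partial>lborel)"
        by (rule C(2)[OF g good[OF x] elim(2)])
      also have "\<dots> \<le> ennreal C * (ennreal W * ennreal \<eta>' + ennreal (?h \<epsilon>) * ennreal B')"
        unfolding W(2)[symmetric]
        by (intro mult_left_mono conv_bound elim \<delta> x order_trans[OF bound B'(2)]) auto
      also have "\<dots> = ennreal (C * (W * \<eta>' + ?h \<epsilon> * B'))"
      proof -
        have "ennreal C * (ennreal W * ennreal \<eta>' + ennreal H * ennreal B') = ennreal (C * (W * \<eta>' + H * B'))"
          if "H \<ge> 0" for H
          using C(1) W(1) \<eta>' B'(1) that by (simp add: ennreal_mult ennreal_plus)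
        thus ?thesis using h .
      qed
      finally have "norm ((LBINT r:{\<epsilon><..}. inversion_summand g x r) - of_real inv_const * g x) \<le> C * (W * \<eta>' + ?h \<epsilon> * B')"
        by (subst (asm) ennreal_le_iff)
           (intro mult_nonneg_nonneg add_nonneg_nonneg C(1) W(1) less_imp_le[OF \<eta>'] B'(1) h)
      thus "dist (LBINT r:{\<epsilon><..}. inversion_summand g x r) (of_real inv_const * g x) < \<eta>"
        using elim(1) by (simp add: dist_norm)
    qed
  qed
qed

end

section \<open>Lebesgue points\<close>

text \<open>Vitali's theorem supplies disjoint balls on which \<open>f\<close> has average above
  \<open>q\<close>, all inside an open set \<open>U\<close> that barely exceeds \<open>P\<close> in
  \<open>f\<close>-mass. On \<open>P\<close> the density is below \<open>p\<close>, so the union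
  \<open>V\<close> satisfies \<open>q |V| \<le> p |V| + \<eta>'\<close>, which forces
  \<open>V\<close> to be small; it covers all but a negligible part of the set.\<close>

lemma negligible_high_averages:
  fixes f :: "'a::euclidean_space \<Rightarrow> real"
  assumes f [measurable]: "f \<in> borel_measurable borel" and nn: "\<And>x. f x \<ge> 0"
    and fin: "(\<integral>\<^sup>+y. ennreal (f y) * indicator (ball 0 N) y \<partial>lborel) < \<infinity>"
    and pq: "0 \<le> p" "p < q"
  shows "negligible {x \<in> ball 0 N. f x < p \<and> (\<forall>d>0. \<exists>r>0. r < d \<and> ennreal q * emeasure lborel (ball x r) < (\<integral>\<^sup>+y. ennreal (f y) * indicator (ball x r) y \<partial>lborel))}"
    (is "negligible ?E")
proof -
  define M where "M = density lborel (\<lambda>y. ennreal (f y) * indicator (ball 0 N) y)"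
  have sM [simp, measurable_cong]: "sets M = sets borel" by (simp add: M_def)
  have [measurable]: "ball x r \<in> sets borel" for x :: 'a and r by (intro borel_open open_ball)
  have MA: "emeasure M A = (\<integral>\<^sup>+y. ennreal (f y) * indicator (ball 0 N) y * indicator A y \<partial>lborel)" if "A \<in> sets borel" for A
    using that unfolding M_def by (subst emeasure_density) auto
  have fM: "emeasure M (space M) \<noteq> \<infinity>"
    using fin MA[of UNIV] by (simp add: M_def)
  interpret M: finite_measure M by standard (use fM in simp)
  define P where "P = {x \<in> ball 0 N. f x < p}"
  have P [measurable]: "P \<in> sets borel" unfolding P_def by measurable
  show ?thesis
    unfolding negligible_outer_le
  proof (intro allI impI)
    fix \<eta> :: real assume \<eta>: "\<eta> > 0"
    \<comment> \<open>With this excess the inequality \<open>q * v \<le> p * v + \<eta>'\<close>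
      yields \<open>v \<le> \<eta> / 2\<close>.\<close>
    define \<eta>' where "\<eta>' = \<eta> * (q - p) / 2"
    have \<eta>': "\<eta>' > 0" using \<eta> pq by (simp add: \<eta>'_def)
    have "(INF U \<in> {U. P \<subseteq> U \<and> open U}. emeasure M U) < emeasure M P + ennreal \<eta>'"
    proof -
      have "emeasure M P < emeasure M P + ennreal \<eta>'"
        using \<eta>' by (simp add: M.emeasure_eq_measure ennreal_plus[symmetric] ennreal_less_iff del: ennreal_plus)
      thus ?thesis using outer_regular[OF sM fM P] by simp
    qed
    then obtain O1 where O1: "P \<subseteq> O1" "open O1" "emeasure M O1 < emeasure M P + ennreal \<eta>'"
      by (auto simp: INF_less_iff)
    define U where "U = O1 \<inter> ball 0 N"
    have U: "open U" "P \<subseteq> U" "U \<subseteq> ball 0 N" using O1 by (auto simp: U_def P_def)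
    hence [measurable]: "U \<in> sets borel" by auto
    have MUP: "emeasure M (U - P) \<le> ennreal \<eta>'"
    proof -
      have "emeasure M P + emeasure M (U - P) = emeasure M U"
        using U by (subst plus_emeasure) (auto intro!: arg_cong[where f="emeasure M"])
      also have "\<dots> \<le> emeasure M O1" using O1 by (intro emeasure_mono) (auto simp: U_def)
      also have "\<dots> \<le> emeasure M P + ennreal \<eta>'" using O1(3) by simp
      finally show ?thesis using M.emeasure_finite[of P] by (simp add: ennreal_add_left_cancel_le)
    qed
    define K where "K = {(x, r). r > 0 \<and> ball x r \<subseteq> U \<and> ennreal q * emeasure lborel (ball x r) < (\<integral>\<^sup>+y. ennreal (f y) * indicator (ball x r) y \<partial>lborel)}"
    have cov: "\<exists>i. i \<in> K \<and> x \<in> ball (fst i) (snd i) \<and> snd i < d" if x: "x \<in> ?E" and d: "d > 0" for x d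
    proof -
      have "x \<in> U" using x U(2) by (auto simp: P_def)
      then obtain d' where d': "d' > 0" "ball x d' \<subseteq> U" using U(1) openE by blast
      have "min d d' > 0" using d d' by simp
      moreover have "\<forall>d>0. \<exists>r>0. r < d \<and> ennreal q * emeasure lborel (ball x r) < (\<integral>\<^sup>+y. ennreal (f y) * indicator (ball x r) y \<partial>lborel)"
        using x by blast
      ultimately obtain r where r: "r > 0" "r < min d d'" "ennreal q * emeasure lborel (ball x r) < (\<integral>\<^sup>+y. ennreal (f y) * indicator (ball x r) y \<partial>lborel)"
        by blast
      have "ball x r \<subseteq> ball x d'" using r by (intro subset_ball) auto
      thus ?thesis using r d' by (intro exI[of _ "(x, r)"]) (auto simp: K_def)
    qed
    obtain C where C: "countable C" "C \<subseteq> K" "pairwise (\<lambda>i j. disjnt (ball (fst i) (snd i)) (ball (fst j) (snd j))) C"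
      "negligible (?E - (\<Union>i\<in>C. ball (fst i) (snd i)))"
      by (rule Vitali_covering_theorem_balls[OF cov])
    define B where "B i = ball (fst i :: 'a) (snd i)" for i
    have KU: "ball (fst i) (snd i) \<subseteq> U" if "i \<in> K" for i
      using that unfolding K_def by (simp only: case_prod_unfold mem_Collect_eq)
    define V where "V = (\<Union>i\<in>C. B i)"
    have "B i \<subseteq> U" if "i \<in> C" for i using KU[of i] that C(2) by (auto simp only: B_def)
    hence V: "open V" "V \<subseteq> U" unfolding V_def by (auto simp: B_def)
    hence [measurable]: "V \<in> sets borel" by auto
    have dis: "disjoint_family_on B C"
      using C(3) by (auto simp: disjoint_family_on_def pairwise_def disjnt_def B_def)
    have sumV: "emeasure L V = (\<integral>\<^sup>+i. emeasure L (B i) \<partial>count_space C)" if "sets L = sets borel" for L :: "'a measure"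
      unfolding V_def by (rule emeasure_UN_countable) (use C dis that in \<open>auto simp: B_def\<close>)
    have "ennreal q * emeasure lborel V = (\<integral>\<^sup>+i. ennreal q * emeasure lborel (B i) \<partial>count_space C)"
      by (subst sumV) (auto simp: nn_integral_cmult)
    also have "\<dots> \<le> (\<integral>\<^sup>+i. emeasure M (B i) \<partial>count_space C)"
    proof (rule nn_integral_mono)
      fix i assume "i \<in> space (count_space C)"
      hence i: "i \<in> K" using C by auto
      have Bi: "B i \<subseteq> U" using KU[OF i] by (simp only: B_def)
      have "ennreal q * emeasure lborel (B i) \<le> (\<integral>\<^sup>+y. ennreal (f y) * indicator (B i) y \<partial>lborel)"
        using i unfolding K_def B_def by (simp only: case_prod_unfold mem_Collect_eq less_imp_le)
      also have "\<dots> = (\<integral>\<^sup>+y. ennreal (f y) * indicator (ball 0 N) y * indicator (B i) y \<partial>lborel)"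
        by (rule nn_integral_cong) (use Bi U(3) in \<open>auto simp: indicator_def\<close>)
      also have "\<dots> = emeasure M (B i)" by (rule MA[symmetric]) (auto simp: B_def)
      finally show "ennreal q * emeasure lborel (B i) \<le> emeasure M (B i)" .
    qed
    also have "\<dots> = emeasure M V" by (rule sumV[symmetric]) simp
    also have "\<dots> = emeasure M (V \<inter> P) + emeasure M (V - P)"
      by (subst plus_emeasure) (auto intro!: arg_cong[where f="emeasure M"])
    also have "\<dots> \<le> ennreal p * emeasure lborel V + ennreal \<eta>'"
    proof (rule add_mono)
      have "emeasure M (V \<inter> P) = (\<integral>\<^sup>+y. ennreal (f y) * indicator (ball 0 N) y * indicator (V \<inter> P) y \<partial>lborel)"
        by (rule MA) simp
      also have "\<dots> \<le> (\<integral>\<^sup>+y. ennreal p * indicator V y \<partial>lborel)"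
        by (rule nn_integral_mono) (auto simp: indicator_def P_def intro: ennreal_leI)
      finally show "emeasure M (V \<inter> P) \<le> ennreal p * emeasure lborel V"
        by (simp add: nn_integral_cmult)
      have "emeasure M (V - P) \<le> emeasure M (U - P)" using V by (intro emeasure_mono) auto
      thus "emeasure M (V - P) \<le> ennreal \<eta>'" using MUP by (rule order_trans)
    qed
    finally have ineq: "ennreal q * emeasure lborel V \<le> ennreal p * emeasure lborel V + ennreal \<eta>'" .
    have "emeasure lborel V \<le> emeasure lborel (ball (0::'a) N)" using V U by (intro emeasure_mono) auto
    also have "\<dots> < \<infinity>" by (rule emeasure_lborel_ball_finite)
    finally have fV: "emeasure lborel V \<noteq> \<infinity>" by simp
    define v where "v = measure lborel V"
    have v: "emeasure lborel V = ennreal v" "v \<ge> 0" using fV by (auto simp: v_def emeasure_eq_ennreal_measure)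
    have "q * v \<le> p * v + \<eta>'"
    proof -
      have "ennreal (q * v) \<le> ennreal (p * v + \<eta>')"
        using ineq pq v \<eta>' by (simp add: ennreal_mult ennreal_plus)
      thus ?thesis using pq v \<eta>' by (subst (asm) ennreal_le_iff) auto
    qed
    moreover have "(q - p) * v = q * v - p * v" by (simp add: left_diff_distrib)
    moreover have "(q - p) * (\<eta> / 2) = \<eta>'" by (simp add: \<eta>'_def mult.commute)
    ultimately have "(q - p) * v \<le> (q - p) * (\<eta> / 2)" by linarith
    hence v2: "v \<le> \<eta> / 2" using pq by (simp add: mult_le_cancel_left)
    have V_lm: "V \<in> lmeasurable" using fV by (intro fmeasurableI) (auto simp: top.not_eq_extremum less_top)
    define X where "X = ?E - V"
    have n: "X \<in> null_sets lebesgue"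
      using C(4) unfolding X_def V_def B_def negligible_iff_null_sets .
    have "V \<union> X \<in> lmeasurable" by (rule fmeasurable.Un[OF V_lm fmeasurableI_null_sets[OF n]])
    moreover have "measure lebesgue (V \<union> X) = measure lebesgue V"
      by (rule measure_Un_null_set[OF fmeasurableD[OF V_lm] n])
    moreover have "measure lebesgue V = v" by (simp add: v_def)
    moreover have "?E \<subseteq> V \<union> X" unfolding X_def by blast
    moreover have "v \<le> \<eta>" using v2 \<eta> by linarith
    ultimately show "\<exists>T. ?E \<subseteq> T \<and> T \<in> lmeasurable \<and> measure lebesgue T \<le> \<eta>"
      by (intro exI[of _ "V \<union> X"]) (simp only:)
  qed
qed

text \<open>If the bound fails for some \<open>s > f x\<close>, rationals \<open>p < q\<close> fit
  between \<open>f x\<close> and \<open>s\<close>, and \<open>x\<close> lies in one of countably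
  many negligible sets.\<close>

lemma AE_averages_limsup:
  fixes f :: "'a::euclidean_space \<Rightarrow> real"
  assumes f [measurable]: "f \<in> borel_measurable borel" and nn: "\<And>x. f x \<ge> 0"
    and fin: "\<And>N. (\<integral>\<^sup>+y. ennreal (f y) * indicator (ball 0 N) y \<partial>lborel) < \<infinity>"
  shows "AE x in lborel. \<forall>s>f x. \<exists>d>0. \<forall>r. 0 < r \<and> r < d \<longrightarrow>
    (\<integral>\<^sup>+y. ennreal (f y) * indicator (ball x r) y \<partial>lborel) \<le> ennreal s * emeasure lborel (ball x r)"
proof -
  define E where "E N p q = {x \<in> ball 0 N. f x < p \<and> (\<forall>d>0. \<exists>r>0. r < d \<and> ennreal q * emeasure lborel (ball x r) < (\<integral>\<^sup>+y. ennreal (f y) * indicator (ball x r) y \<partial>lborel))}" for N p q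
  have neg: "negligible (E N p q)" if "0 \<le> p" "p < q" for N p q
    unfolding E_def by (rule negligible_high_averages[OF f nn fin that])
  define I where "I = {(N::nat, p::rat, q::rat). 0 \<le> p \<and> p < q}"
  have "negligible (\<Union>(N, p, q)\<in>I. E (real N) (of_rat p) (of_rat q))"
  proof (rule negligible_countable_Union)
    show "countable ((\<lambda>(N, p, q). E (real N) (of_rat p) (of_rat q)) ` I)"
      by (intro countable_image) auto
  qed (auto simp: I_def of_rat_less intro!: neg)
  hence "(\<Union>(N, p, q)\<in>I. E (real N) (of_rat p) (of_rat q)) \<in> null_sets lebesgue"
    by (simp only: negligible_iff_null_sets)
  from AE_not_in[OF this] have "AE x in lborel. x \<notin> (\<Union>(N, p, q)\<in>I. E (real N) (of_rat p) (of_rat q))"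
    by (simp only: AE_completion_iff)
  thus ?thesis
  proof eventually_elim
    case (elim x)
    show ?case
    proof (intro allI impI)
      fix s assume s: "f x < s"
      obtain p' where p': "f x < p'" "p' < s" "p' \<in> \<rat>" using Rats_dense_in_real[OF s] by auto
      obtain q' where q': "p' < q'" "q' < s" "q' \<in> \<rat>" using Rats_dense_in_real[OF p'(2)] by auto
      obtain p q where pq: "p' = of_rat p" "q' = of_rat q" using p' q' by (auto elim!: Rats_cases)
      obtain N where N: "norm x < real N" using reals_Archimedean2 by blast
      have "(0::real) < of_rat p" using nn[of x] p'(1) pq(1) by linarith
      hence "0 \<le> p" by simp
      hence "(N, p, q) \<in> I" using q' pq by (auto simp: I_def of_rat_less)
      with elim have "x \<notin> E (real N) p' q'" using pq by auto
      with N p'(1) have "\<exists>d>0. \<forall>r>0. r < d \<longrightarrow> \<not> ennreal q' * emeasure lborel (ball x r) < (\<integral>\<^sup>+y. ennreal (f y) * indicator (ball x r) y \<partial>lborel)"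
        unfolding E_def by auto
      then obtain d where d: "d > 0" "\<And>r. r > 0 \<Longrightarrow> r < d \<Longrightarrow> (\<integral>\<^sup>+y. ennreal (f y) * indicator (ball x r) y \<partial>lborel) \<le> ennreal q' * emeasure lborel (ball x r)"
        unfolding not_less by blast
      have "ennreal q' \<le> ennreal s" using q' by (intro ennreal_leI) auto
      hence "ennreal q' * emeasure lborel (ball x r) \<le> ennreal s * emeasure lborel (ball x r)" for r
        by (rule mult_right_mono) simp
      thus "\<exists>d>0. \<forall>r. 0 < r \<and> r < d \<longrightarrow> (\<integral>\<^sup>+y. ennreal (f y) * indicator (ball x r) y \<partial>lborel) \<le> ennreal s * emeasure lborel (ball x r)"
        using d by (meson order_trans)
    qed
  qed
qed

text \<open>The one-sided estimate is applied to \<open>|g - c|\<close> for all \<open>c\<close> in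
  a countable dense set; choosing \<open>c\<close> close to \<open>g x\<close> then controls the
  oscillation about \<open>g x\<close> itself.\<close>

lemma AE_lebesgue_point:
  fixes g :: "real ^ 'n::finite \<Rightarrow> complex"
  assumes g [measurable]: "g \<in> borel_measurable borel"
    and fin: "\<And>N. (\<integral>\<^sup>+y. ennreal (norm (g y)) * indicator (ball 0 N) y \<partial>lborel) < \<infinity>"
  shows "AE x in lborel. \<forall>\<eta>>0. \<exists>d>0. \<forall>t. 0 < t \<and> t < d \<longrightarrow> mean_oscillation g x t \<le> ennreal \<eta>"
proof -
  obtain D :: "complex set" where D: "countable D" "\<And>X. open X \<Longrightarrow> X \<noteq> {} \<Longrightarrow> \<exists>d\<in>D. d \<in> X"
    using countable_dense_setE by blast
  let ?n = "real CARD('n)"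
  have [measurable]: "ball x r \<in> sets borel" for x :: "real ^ 'n" and r by (intro borel_open open_ball)
  define v where "v = unit_ball_vol (real CARD('n))"
  have v: "v > 0" by (simp add: v_def)
  have "AE x in lborel. \<forall>c\<in>D. \<forall>s>norm (g x - c). \<exists>d>0. \<forall>r. 0 < r \<and> r < d \<longrightarrow>
    (\<integral>\<^sup>+y. ennreal (norm (g y - c)) * indicator (ball x r) y \<partial>lborel) \<le> ennreal s * emeasure lborel (ball x r)"
  proof (rule AE_ball_countable'[OF _ D(1)])
    fix c
    show "AE x in lborel. \<forall>s>norm (g x - c). \<exists>d>0. \<forall>r. 0 < r \<and> r < d \<longrightarrow>
      (\<integral>\<^sup>+y. ennreal (norm (g y - c)) * indicator (ball x r) y \<partial>lborel) \<le> ennreal s * emeasure lborel (ball x r)"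
    proof (rule AE_averages_limsup)
      fix N
      have "(\<integral>\<^sup>+y. ennreal (norm (g y - c)) * indicator (ball 0 N) y \<partial>lborel) \<le> (\<integral>\<^sup>+y. ennreal (norm (g y)) * indicator (ball 0 N) y + ennreal (norm c) * indicator (ball 0 N) y \<partial>lborel)"
      proof (rule nn_integral_mono)
        fix y
        have "ennreal (norm (g y - c)) \<le> ennreal (norm (g y)) + ennreal (norm c)"
          unfolding ennreal_plus[symmetric, OF norm_ge_zero norm_ge_zero] by (intro ennreal_leI norm_triangle_ineq4)
        thus "ennreal (norm (g y - c)) * indicator (ball 0 N) y \<le> ennreal (norm (g y)) * indicator (ball 0 N) y + ennreal (norm c) * indicator (ball 0 N) y"
          by (auto simp: indicator_def)
      qed
      also have "\<dots> = (\<integral>\<^sup>+y. ennreal (norm (g y)) * indicator (ball 0 N) y \<partial>lborel) + ennreal (norm c) * emeasure lborel (ball (0 :: real ^ 'n) N)"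
        by (subst nn_integral_add) (auto simp: nn_integral_cmult)
      also have "\<dots> < \<infinity>" using fin[of N] emeasure_lborel_ball_finite[of "0 :: real ^ 'n" N]
        by (simp add: ennreal_mult_less_top)
      finally show "(\<integral>\<^sup>+y. ennreal (norm (g y - c)) * indicator (ball 0 N) y \<partial>lborel) < \<infinity>" .
    qed auto
  qed
  thus ?thesis
  proof eventually_elim
    case (elim x)
    show ?case
    proof (intro allI impI)
      fix \<eta> :: real assume \<eta>: "\<eta> > 0"
      \<comment> \<open>Both \<open>|g - c|\<close> and the constant \<open>|g x - c|\<close>
        contribute \<open>s\<close> times the volume \<open>v * sqrt t ^ n\<close>, hence the
        2.\<close>
      define s where "s = \<eta> / (2 * v)"
      have s: "s > 0" using \<eta> v by (simp add: s_def)
      obtain c where c: "c \<in> D" "c \<in> ball (g x) s" using D(2)[of "ball (g x) s"] s by auto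
      hence cs: "norm (g x - c) < s" by (simp add: dist_norm)
      obtain d where d: "d > 0" "\<And>r. 0 < r \<Longrightarrow> r < d \<Longrightarrow> (\<integral>\<^sup>+y. ennreal (norm (g y - c)) * indicator (ball x r) y \<partial>lborel) \<le> ennreal s * emeasure lborel (ball x r)"
        using elim c(1) cs by blast
      have "mean_oscillation g x t \<le> ennreal \<eta>" if t: "0 < t" "t < d\<^sup>2" for t
      proof -
        have rt: "0 < sqrt t" "sqrt t < d" using t d(1) by (auto intro: real_less_lsqrt)
        have "(\<integral>\<^sup>+z. ennreal (norm (g (x + z) - g x)) * indicator {z. (norm z)\<^sup>2 < t} z \<partial>lborel) \<le>
          (\<integral>\<^sup>+z. ennreal (norm (g (x + z) - c)) * indicator (ball x (sqrt t)) (x + z) + ennreal s * indicator (ball x (sqrt t)) (x + z) \<partial>lborel)"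
        proof (rule nn_integral_mono)
          fix z :: "real ^ 'n"
          have i: "indicator {z. (norm z)\<^sup>2 < t} z = (indicator (ball x (sqrt t)) (x + z) :: ennreal)"
            using t by (auto simp: indicator_def dist_norm real_less_rsqrt dest: real_less_lsqrt intro: real_less_rsqrt)
              (metis norm_ge_zero not_less real_sqrt_le_mono real_sqrt_unique)
          have "norm (g (x + z) - g x) \<le> norm (g (x + z) - c) + norm (g x - c)"
            by (metis norm_minus_commute norm_triangle_sub norm_triangle_ineq4 add_diff_eq diff_diff_eq2 diff_add_cancel)
          also have "\<dots> \<le> norm (g (x + z) - c) + s" using cs by simp
          finally have "ennreal (norm (g (x + z) - g x)) \<le> ennreal (norm (g (x + z) - c)) + ennreal s"
            unfolding ennreal_plus[symmetric, OF norm_ge_zero less_imp_le[OF s]] by (rule ennreal_leI)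
          thus "ennreal (norm (g (x + z) - g x)) * indicator {z. (norm z)\<^sup>2 < t} z \<le>
            ennreal (norm (g (x + z) - c)) * indicator (ball x (sqrt t)) (x + z) + ennreal s * indicator (ball x (sqrt t)) (x + z)"
            unfolding i by (auto simp: indicator_def)
        qed
        also have "\<dots> = (\<integral>\<^sup>+y. ennreal (norm (g y - c)) * indicator (ball x (sqrt t)) y + ennreal s * indicator (ball x (sqrt t)) y \<partial>distr lborel borel ((+) x))"
          by (subst nn_integral_distr) auto
        also have "\<dots> = (\<integral>\<^sup>+y. ennreal (norm (g y - c)) * indicator (ball x (sqrt t)) y \<partial>lborel) + ennreal s * emeasure lborel (ball x (sqrt t))"
          unfolding lborel_distr_plus by (subst nn_integral_add) (auto simp: nn_integral_cmult)
        also have "\<dots> \<le> ennreal s * emeasure lborel (ball x (sqrt t)) + ennreal s * emeasure lborel (ball x (sqrt t))"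
          by (intro add_mono d rt) simp
        also have "emeasure lborel (ball x (sqrt t)) = ennreal (v * sqrt t ^ CARD('n))"
          using t by (simp add: emeasure_ball v_def)
        also have "ennreal s * ennreal (v * sqrt t ^ CARD('n)) + ennreal s * ennreal (v * sqrt t ^ CARD('n)) = ennreal (\<eta> * sqrt t ^ CARD('n))"
        proof -
          define A where "A = s * (v * sqrt t ^ CARD('n))"
          have A: "A \<ge> 0" using s v t by (simp add: A_def)
          have "ennreal s * ennreal (v * sqrt t ^ CARD('n)) = ennreal A"
            unfolding A_def using s by (intro ennreal_mult'[symmetric]) simp
          moreover have "ennreal A + ennreal A = ennreal (A + A)" by (rule ennreal_plus[symmetric, OF A A])
          moreover have "A + A = \<eta> * sqrt t ^ CARD('n)" using v by (simp add: A_def s_def)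
          ultimately show ?thesis by simp
        qed
        finally have "mean_oscillation g x t \<le> ennreal (t powr (- ?n / 2)) * ennreal (\<eta> * sqrt t ^ CARD('n))"
          unfolding mean_oscillation_def by (rule mult_left_mono) simp
        also have "\<dots> = ennreal (\<eta> * (t powr (- ?n / 2) * sqrt t ^ CARD('n)))"
          by (subst ennreal_mult'[symmetric]) (simp_all add: mult_ac)
        also have "t powr (- ?n / 2) * sqrt t ^ CARD('n) = 1"
        proof -
          have "sqrt t ^ CARD('n) = (t powr (1 / 2)) powr ?n"
            using t by (subst powr_realpow) (auto simp: powr_half_sqrt)
          also have "\<dots> = t powr (?n / 2)" unfolding powr_powr by simp
          finally show ?thesis using t by (simp add: powr_minus)
        qed
        finally show ?thesis by simp
      qed
      thus "\<exists>d>0. \<forall>t. 0 < t \<and> t < d \<longrightarrow> mean_oscillation g x t \<le> ennreal \<eta>"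
        using d(1) by (intro exI[of _ "d\<^sup>2"]) auto
    qed
  qed
qed

section \<open>Hyperplanes in the coordinates of their poles\<close>

text \<open>The change of variable \<open>v = 1 / t^2\<close> on negative \<open>t\<close>, with
  positive derivative \<open>- 2 / t^3\<close>. The sign is negative because the pole form evaluates
  \<open>\<phi>\<close> at \<open>- 1 / |x|\<close>. The substitution rule is applied on compact
  intervals, whose images \<open>S k\<close> exhaust the positive half-line.\<close>

lemma distr_inverse_square:
  "distr (density lborel (\<lambda>t. ennreal (- 2 / t ^ 3) * indicator {..<0} t)) borel (\<lambda>t. 1 / t\<^sup>2) = density lborel (indicator {0<..} :: real \<Rightarrow> ennreal)"
    (is "?M1 = ?M2")
proof (rule measure_eqI)
  fix A assume "A \<in> sets ?M1"
  hence A [measurable]: "A \<in> sets borel" by simp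
  define S where "S k = {1 / (real (Suc k))\<^sup>2 .. (real (Suc k))\<^sup>2}" for k
  have [measurable]: "S k \<in> sets borel" for k by (simp add: S_def)
  have eq: "emeasure ?M1 (A \<inter> S k) = emeasure ?M2 (A \<inter> S k)" for k
  proof -
    define s where "s = real (Suc k)"
    have s: "s \<ge> 1" by (simp add: s_def)
    have iff: "1 / t\<^sup>2 \<in> S k \<longleftrightarrow> t \<in> {- s .. - (1 / s)}" if t: "t < 0" for t
    proof -
      have "1 / s\<^sup>2 \<le> 1 / t\<^sup>2 \<longleftrightarrow> t\<^sup>2 \<le> s\<^sup>2" using s t by (simp add: field_simps)
      also have "\<dots> \<longleftrightarrow> - s \<le> t" using abs_le_square_iff[of t s] s t by auto
      finally have 1: "1 / s\<^sup>2 \<le> 1 / t\<^sup>2 \<longleftrightarrow> - s \<le> t" .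
      have "1 / t\<^sup>2 \<le> s\<^sup>2 \<longleftrightarrow> (1 / s)\<^sup>2 \<le> t\<^sup>2" using s t by (simp add: field_simps)
      also have "\<dots> \<longleftrightarrow> t \<le> - (1 / s)" using abs_le_square_iff[of "1 / s" t] s t by auto
      finally show ?thesis using 1 by (simp add: S_def s_def)
    qed
    have "emeasure ?M1 (A \<inter> S k) = emeasure (density lborel (\<lambda>t. ennreal (- 2 / t ^ 3) * indicator {..<0} t)) ((\<lambda>t. 1 / t\<^sup>2) -` (A \<inter> S k))"
      by (subst emeasure_distr) auto
    also have "\<dots> = (\<integral>\<^sup>+t. ennreal (- 2 / t ^ 3) * indicator {..<0} t * indicator ((\<lambda>t. 1 / t\<^sup>2) -` (A \<inter> S k)) t \<partial>lborel)"
      by (subst emeasure_density) (auto intro!: measurable_sets_borel[of _ borel])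
    also have "\<dots> = (\<integral>\<^sup>+t. ennreal (indicator A (1 / t\<^sup>2) * (- 2 / t ^ 3)) * indicator {- s .. - (1 / s)} t \<partial>lborel)"
    proof (rule nn_integral_cong)
      fix t
      have "\<not> t \<le> - (1 / s)" if "\<not> t < 0" using that s by (auto simp: not_le intro: less_le_trans[of _ 0])
      thus "ennreal (- 2 / t ^ 3) * indicator {..<0} t * indicator ((\<lambda>t. 1 / t\<^sup>2) -` (A \<inter> S k)) t =
         ennreal (indicator A (1 / t\<^sup>2) * (- 2 / t ^ 3)) * indicator {- s .. - (1 / s)} t"
        using iff[of t] by (cases "t < 0") (auto simp: indicator_def)
    qed
    also have "\<dots> = (\<integral>\<^sup>+x. ennreal (indicator A x) * indicator {1 / (- s)\<^sup>2 .. 1 / (- (1 / s))\<^sup>2} x \<partial>lborel)"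
    proof -
      have neg: "x < 0" if "x \<in> {- s .. - (1 / s)}" for x using that s by (auto intro: le_less_trans)
      have "(\<integral>\<^sup>+x. ennreal (indicator A x * indicator {1 / (- s)\<^sup>2 .. 1 / (- (1 / s))\<^sup>2} x) \<partial>lborel) =
        (\<integral>\<^sup>+t. ennreal (indicator A (1 / t\<^sup>2) * (- 2 / t ^ 3) * indicator {- s .. - (1 / s)} t) \<partial>lborel)"
      proof (rule nn_integral_substitution)
        show "set_borel_measurable borel {1 / (- s)\<^sup>2 .. 1 / (- (1 / s))\<^sup>2} (indicator A :: real \<Rightarrow> real)"
          unfolding set_borel_measurable_def by measurable
        fix x assume x: "x \<in> {- s .. - (1 / s)}"
        show "((\<lambda>t. 1 / t\<^sup>2) has_real_derivative - 2 / x ^ 3) (at x)"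
          using neg[OF x] by (auto intro!: derivative_eq_intros simp: power2_eq_square power3_eq_cube field_simps)
        show "0 \<le> - 2 / x ^ 3" 
        proof -
          have "x ^ 3 < 0" using neg[OF x] by (simp add: power_less_zero_eq)
          thus ?thesis by (intro divide_nonpos_nonpos) auto
        qed
      next
        show "continuous_on {- s .. - (1 / s)} (\<lambda>x. - 2 / x ^ 3)"
          using neg by (intro continuous_intros) force
        have "1 / s \<le> 1" using s by simp
        thus "- s \<le> - (1 / s)" using s by linarith
      qed
      moreover have "ennreal (indicator A (1 / t\<^sup>2) * (- 2 / t ^ 3) * indicator {- s .. - (1 / s)} t) = ennreal (indicator A (1 / t\<^sup>2) * (- 2 / t ^ 3)) * indicator {- s .. - (1 / s)} t" for t
        by (auto simp: indicator_def)
      moreover have "ennreal (indicator A x * indicator {1 / (- s)\<^sup>2 .. 1 / (- (1 / s))\<^sup>2} x) = ennreal (indicator A x) * indicator {1 / (- s)\<^sup>2 .. 1 / (- (1 / s))\<^sup>2} x" for x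
        by (auto simp: indicator_def)
      ultimately show ?thesis by simp
    qed
    also have "{1 / (- s)\<^sup>2 .. 1 / (- (1 / s))\<^sup>2} = S k"
    proof -
      have "(- s)\<^sup>2 = s\<^sup>2" "1 / (- (1 / s))\<^sup>2 = s\<^sup>2" by (simp_all add: power_divide)
      thus ?thesis unfolding S_def s_def[symmetric] by (simp only:)
    qed
    also have "(\<integral>\<^sup>+x. ennreal (indicator A x) * indicator (S k) x \<partial>lborel) = (\<integral>\<^sup>+x. indicator {0<..} x * indicator (A \<inter> S k) x \<partial>lborel)"
    proof (rule nn_integral_cong)
      fix x :: real
      have "x > 0" if "x \<in> S k"
      proof -
        have "0 < 1 / (real (Suc k))\<^sup>2" by simp
        thus ?thesis using that unfolding S_def by (meson atLeastAtMost_iff less_le_trans)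
      qed
      thus "ennreal (indicator A x) * indicator (S k) x = indicator {0<..} x * indicator (A \<inter> S k) x"
        by (auto simp: indicator_def)
    qed
    also have "\<dots> = emeasure ?M2 (A \<inter> S k)"
      by (subst emeasure_density) auto
    finally show ?thesis .
  qed
  have mono: "incseq (\<lambda>k. A \<inter> S k)"
  proof (rule incseq_SucI)
    fix k
    have "1 / (real (Suc (Suc k)))\<^sup>2 \<le> 1 / (real (Suc k))\<^sup>2" "(real (Suc k))\<^sup>2 \<le> (real (Suc (Suc k)))\<^sup>2"
      by (auto intro!: divide_left_mono power_mono mult_pos_pos)
    thus "A \<inter> S k \<subseteq> A \<inter> S (Suc k)" 
      unfolding S_def by (intro Int_mono subset_refl) (simp only: atLeastatMost_subset_iff simp_thms)
  qed
  have un: "(\<Union>k. A \<inter> S k) = A \<inter> {0<..}"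
  proof (intro set_eqI iffI)
    fix x assume "x \<in> (\<Union>k. A \<inter> S k)"
    then obtain k where k: "x \<in> A" "x \<in> S k" by auto
    have "0 < 1 / (real (Suc k))\<^sup>2" by simp
    thus "x \<in> A \<inter> {0<..}" using k unfolding S_def by (metis IntI atLeastAtMost_iff greaterThan_iff less_le_trans)
  next
    fix x assume x: "x \<in> A \<inter> {0<..}"
    obtain k where k: "max x (1 / x) \<le> real k" using real_arch_simple by blast
    define s where "s = real (Suc k)"
    have s: "x \<le> s" "1 / x \<le> s" "1 \<le> s" using k by (auto simp: s_def)
    have ss: "s \<le> s\<^sup>2" using s(3) by (simp add: power2_eq_square)
    have "x \<le> s\<^sup>2" "1 / x \<le> s\<^sup>2" using s ss by linarith+
    hence "x \<in> S k" using x s(3) unfolding S_def s_def[symmetric] by (auto simp: field_simps)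
    thus "x \<in> (\<Union>k. A \<inter> S k)" using x by auto
  qed
  have "(\<lambda>k. emeasure ?M1 (A \<inter> S k)) \<longlonglongrightarrow> emeasure ?M1 (A \<inter> {0<..})"
    using Lim_emeasure_incseq[OF _ mono, of ?M1] unfolding un by (simp add: image_subset_iff)
  moreover have "(\<lambda>k. emeasure ?M2 (A \<inter> S k)) \<longlonglongrightarrow> emeasure ?M2 (A \<inter> {0<..})"
    using Lim_emeasure_incseq[OF _ mono, of ?M2] unfolding un by (simp add: image_subset_iff)
  ultimately have "emeasure ?M1 (A \<inter> {0<..}) = emeasure ?M2 (A \<inter> {0<..})"
    unfolding eq by (rule LIMSEQ_unique)
  moreover have "emeasure ?M2 (A \<inter> {0<..}) = emeasure ?M2 A"
    by (subst (1 2) emeasure_density) (auto intro!: nn_integral_cong simp: indicator_def)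
  moreover have "emeasure ?M1 (A \<inter> {0<..}) = emeasure ?M1 A"
  proof -
    have "emeasure ?M1 B = (\<integral>\<^sup>+t. ennreal (- 2 / t ^ 3) * indicator {..<0} t * indicator B (1 / t\<^sup>2) \<partial>lborel)"
      if [measurable]: "B \<in> sets borel" for B
    proof -
      have "emeasure ?M1 B = (\<integral>\<^sup>+x. indicator B x \<partial>?M1)" by simp
      also have "\<dots> = (\<integral>\<^sup>+t. indicator B (1 / t\<^sup>2) \<partial>density lborel (\<lambda>t. ennreal (- 2 / t ^ 3) * indicator {..<0} t))"
        by (subst nn_integral_distr) auto
      finally show ?thesis by (subst (asm) nn_integral_density) auto
    qed
    thus ?thesis by (simp, intro nn_integral_cong) (auto simp: indicator_def)
  qed
  ultimately show "emeasure ?M1 A = emeasure ?M2 A" by simp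
qed simp

lemma nn_integral_inverse_square:
  assumes [measurable]: "h \<in> borel_measurable borel"
  shows "(\<integral>\<^sup>+v. indicator {0<..} v * h v \<partial>lborel) = (\<integral>\<^sup>+t. ennreal (- 2 / t ^ 3) * indicator {..<0} t * h (1 / t\<^sup>2) \<partial>(lborel :: real measure))"
proof -
  have "(\<integral>\<^sup>+v. indicator {0<..} v * h v \<partial>lborel) = (\<integral>\<^sup>+v. h v \<partial>density lborel (indicator {0<..} :: real \<Rightarrow> ennreal))"
    by (subst nn_integral_density) auto
  also have "\<dots> = (\<integral>\<^sup>+t. h (1 / t\<^sup>2) \<partial>density lborel (\<lambda>t. ennreal (- 2 / t ^ 3) * indicator {..<0} t))"
    unfolding distr_inverse_square[symmetric] by (subst nn_integral_distr) auto
  also have "\<dots> = (\<integral>\<^sup>+t. ennreal (- 2 / t ^ 3) * indicator {..<0} t * h (1 / t\<^sup>2) \<partial>lborel)"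
    by (subst nn_integral_density) auto
  finally show ?thesis .
qed

context haar_frame
begin

text \<open>Polar coordinates with \<open>x = - \<theta> / t\<close> and \<open>t < 0\<close>. The
  density \<open>|t| powr (- n - 1)\<close>, times the \<open>|t| powr ((n - 1) * p)\<close>
  produced by the pole form of \<open>\<phi>\<close>, is the weight
  \<open>|t| powr ((n - 1) * (p - 1) - 2)\<close> of \<open>tilde_Lp\<close>.\<close>

lemma nn_integral_polar_nu:
  fixes H :: "real ^ 'n \<Rightarrow> ennreal"
  assumes H [measurable]: "H \<in> borel_measurable borel"
  shows "(\<integral>\<^sup>+x. H x \<partial>lborel) = (\<integral>\<^sup>+\<theta>. \<integral>\<^sup>+t. ennreal (2 * radial_const (real CARD('n)) * \<bar>t\<bar> powr (- real CARD('n) - 1)) * indicator {..<0} t * H (- (1 / t) *\<^sub>R \<theta>) \<partial>lborel \<partial>SP)"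
  unfolding nn_integral_polar[OF H]
proof (rule nn_integral_cong)
  fix \<theta>
  let ?n = "real CARD('n)"
  let ?F = "\<lambda>v. ennreal (radial_const ?n * v powr (?n / 2 - 1)) * H (sqrt v *\<^sub>R \<theta>)"
  have rc: "radial_const ?n \<ge> 0" by (intro less_imp_le radial_const_pos) simp
  have "(\<integral>\<^sup>+v. ennreal (radial_const ?n * v powr (?n / 2 - 1)) * indicator {0<..} v * H (sqrt v *\<^sub>R \<theta>) \<partial>lborel) = (\<integral>\<^sup>+v. indicator {0<..} v * ?F v \<partial>lborel)"
    by (simp add: mult_ac)
  also have "\<dots> = (\<integral>\<^sup>+t. ennreal (- 2 / t ^ 3) * indicator {..<0} t * ?F (1 / t\<^sup>2) \<partial>(lborel :: real measure))"
    by (rule nn_integral_inverse_square) measurable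
  also have "\<dots> = (\<integral>\<^sup>+t. ennreal (2 * radial_const ?n * \<bar>t\<bar> powr (- ?n - 1)) * indicator {..<0} t * H (- (1 / t) *\<^sub>R \<theta>) \<partial>lborel)"
  proof (rule nn_integral_cong)
    fix t :: real
    show "ennreal (- 2 / t ^ 3) * indicator {..<0} t * ?F (1 / t\<^sup>2) = ennreal (2 * radial_const ?n * \<bar>t\<bar> powr (- ?n - 1)) * indicator {..<0} t * H (- (1 / t) *\<^sub>R \<theta>)"
    proof (cases "t < 0")
      case True
      define s where "s = - t"
      have s: "s > 0" "t = - s" using True by (auto simp: s_def)
      have sq: "sqrt (1 / t\<^sup>2) = - (1 / t)" using s by (simp add: real_sqrt_divide)
      have i: "1 / s\<^sup>2 = s powr (- 2)" using s by (simp add: powr_minus divide_inverse)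
      have c: "2 / s ^ 3 = 2 * s powr (- 3)" using s by (simp add: powr_minus divide_inverse)
      have "2 / s ^ 3 * (radial_const ?n * (1 / s\<^sup>2) powr (?n / 2 - 1)) = 2 * radial_const ?n * (s powr (- 3) * s powr (- 2 * (?n / 2 - 1)))"
        unfolding i c powr_powr by simp
      also have "s powr (- 3) * s powr (- 2 * (?n / 2 - 1)) = s powr (- ?n - 1)"
        unfolding powr_add[symmetric] by (rule arg_cong[where f="\<lambda>z. s powr z"]) (simp add: field_simps)
      finally have e: "2 / s ^ 3 * (radial_const ?n * (1 / s\<^sup>2) powr (?n / 2 - 1)) = 2 * radial_const ?n * s powr (- ?n - 1)" .
      have t3: "- 2 / t ^ 3 = 2 / s ^ 3" "t\<^sup>2 = s\<^sup>2" "\<bar>t\<bar> = s" using s by (simp_all add: power3_eq_cube)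
      have "ennreal (2 / s ^ 3) * ennreal (radial_const ?n * (1 / s\<^sup>2) powr (?n / 2 - 1)) = ennreal (2 * radial_const ?n * s powr (- ?n - 1))"
        unfolding e[symmetric] using s by (intro ennreal_mult'[symmetric]) simp
      thus ?thesis using True unfolding sq unfolding t3 by (simp add: mult.assoc[symmetric])
    qed simp
  qed
  finally show "(\<integral>\<^sup>+v. ennreal (radial_const ?n * v powr (?n / 2 - 1)) * indicator {0<..} v * H (sqrt v *\<^sub>R \<theta>) \<partial>lborel) =
     (\<integral>\<^sup>+t. ennreal (2 * radial_const ?n * \<bar>t\<bar> powr (- ?n - 1)) * indicator {..<0} t * H (- (1 / t) *\<^sub>R \<theta>) \<partial>lborel)" .
qed

lemma nn_integral_SP_uminus:
  assumes "h \<in> borel_measurable SP"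
  shows "(\<integral>\<^sup>+\<theta>. h (- \<theta>) \<partial>SP) = (\<integral>\<^sup>+\<theta>. h \<theta> \<partial>SP)"
proof -
  have T: "orthogonal_transformation (uminus :: real ^ 'n \<Rightarrow> real ^ 'n)"
    by (simp add: orthogonal_transformation_def linear_uminus)
  have "(\<integral>\<^sup>+\<theta>. h \<theta> \<partial>distr SP SP uminus) = (\<integral>\<^sup>+\<theta>. h (- \<theta>) \<partial>SP)"
    by (rule nn_integral_distr[OF orthogonal_SP[OF T]]) (use assms in simp)
  thus ?thesis by (simp add: inv_SP[OF T])
qed

text \<open>Every nonzero pole is represented by one \<open>t\<close> of each sign; this is the
  other half, needed because almost-everywhere statements about hyperplanes range over all pairs
  \<open>(\<theta>, t)\<close>.\<close>

lemma nn_integral_polar_nu_pos: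
  fixes H :: "real ^ 'n \<Rightarrow> ennreal"
  assumes H [measurable]: "H \<in> borel_measurable borel"
  shows "(\<integral>\<^sup>+x. H x \<partial>lborel) = (\<integral>\<^sup>+\<theta>. \<integral>\<^sup>+t. ennreal (2 * radial_const (real CARD('n)) * \<bar>t\<bar> powr (- real CARD('n) - 1)) * indicator {0<..} t * H (- (1 / t) *\<^sub>R \<theta>) \<partial>lborel \<partial>SP)"
proof -
  let ?w = "\<lambda>t. ennreal (2 * radial_const (real CARD('n)) * \<bar>t\<bar> powr (- real CARD('n) - 1))"
  define h where "h \<theta> = (\<integral>\<^sup>+t. ?w t * indicator {0<..} t * H (- (1 / t) *\<^sub>R \<theta>) \<partial>lborel)" for \<theta>
  have hm: "h \<in> borel_measurable SP"
    unfolding h_def by (rule measurable_SP) measurable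
  have "(\<integral>\<^sup>+t. ?w t * indicator {..<0} t * H (- (1 / t) *\<^sub>R \<theta>) \<partial>lborel) = h (- \<theta>)" for \<theta>
  proof -
    have "(\<integral>\<^sup>+t. ?w t * indicator {..<0} t * H (- (1 / t) *\<^sub>R \<theta>) \<partial>lborel) = ennreal \<bar>- 1\<bar> * (\<integral>\<^sup>+t. ?w (0 + (- 1) * t) * indicator {..<0} (0 + (- 1) * t) * H (- (1 / (0 + (- 1) * t)) *\<^sub>R \<theta>) \<partial>lborel)"
      by (rule nn_integral_real_affine) auto
    also have "\<dots> = h (- \<theta>)" unfolding h_def
      by (simp, intro nn_integral_cong) (auto simp: indicator_def)
    finally show ?thesis .
  qed
  hence "(\<integral>\<^sup>+x. H x \<partial>lborel) = (\<integral>\<^sup>+\<theta>. h (- \<theta>) \<partial>SP)" unfolding nn_integral_polar_nu[OF H] by simp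
  also have "\<dots> = (\<integral>\<^sup>+\<theta>. h \<theta> \<partial>SP)" by (rule nn_integral_SP_uminus[OF hm])
  finally show ?thesis by (simp add: h_def)
qed

lemma HM_eq: "hyperplane_measure = SP \<Otimes>\<^sub>M lborel"
  by (simp add: hyperplane_measure_def)

lemma nn_integral_HM:
  assumes "f \<in> borel_measurable (SP \<Otimes>\<^sub>M lborel)"
  shows "(\<integral>\<^sup>+z. f z \<partial>(hyperplane_measure :: ((real ^ 'n) \<times> real) measure)) = (\<integral>\<^sup>+\<theta>. \<integral>\<^sup>+t. f (\<theta>, t) \<partial>lborel \<partial>SP)"
  unfolding HM_eq by (rule lborel.nn_integral_fst[symmetric]) fact

lemma AE_HM_iff:
  assumes N: "N \<in> sets (SP \<Otimes>\<^sub>M lborel)"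
    and z: "(\<integral>\<^sup>+\<theta>. \<integral>\<^sup>+t. w t * indicator N (\<theta>, t) \<partial>lborel \<partial>SP) = 0" and w: "w \<in> borel_measurable lborel"
  shows "AE z in (hyperplane_measure :: ((real ^ 'n) \<times> real) measure). w (snd z) = 0 \<or> z \<notin> N"
proof -
  note [measurable] = N w
  have m: "(\<lambda>z. w (snd z) * indicator N z) \<in> borel_measurable (SP \<Otimes>\<^sub>M lborel)" by measurable
  have "(\<integral>\<^sup>+z. w (snd z) * indicator N z \<partial>(hyperplane_measure :: ((real ^ 'n) \<times> real) measure)) = 0"
    using z by (subst nn_integral_HM[OF m]) simp
  hence "AE z in (hyperplane_measure :: ((real ^ 'n) \<times> real) measure). w (snd z) * indicator N z = 0"
    using m by (subst (asm) nn_integral_0_iff_AE) (simp_all add: HM_eq)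
  thus ?thesis by eventually_elim (auto simp: indicator_def split: if_splits)
qed

lemma AE_HM_nonzero: "AE z in (hyperplane_measure :: ((real ^ 'n) \<times> real) measure). snd z \<noteq> 0"
proof -
  have "(\<integral>\<^sup>+\<theta>. \<integral>\<^sup>+t. 1 * indicator {z \<in> space (SP \<Otimes>\<^sub>M (lborel :: real measure)). snd z = 0} (\<theta>, t) \<partial>lborel \<partial>SP) = (\<integral>\<^sup>+\<theta>. 0 \<partial>SP)"
  proof (rule nn_integral_cong)
    fix \<theta>
    have "(\<integral>\<^sup>+t. 1 * indicator {z \<in> space (SP \<Otimes>\<^sub>M (lborel :: real measure)). snd z = 0} (\<theta>, t) \<partial>lborel) = (\<integral>\<^sup>+(t :: real). 0 \<partial>lborel)"
      by (rule nn_integral_cong_AE, rule AE_mp[OF AE_lborel_singleton[of 0]]) (auto simp: indicator_def)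
    thus "(\<integral>\<^sup>+t. 1 * indicator {z \<in> space (SP \<Otimes>\<^sub>M (lborel :: real measure)). snd z = 0} (\<theta>, t) \<partial>lborel) = 0" by simp
  qed
  hence "AE z in (hyperplane_measure :: ((real ^ 'n) \<times> real) measure). (1::ennreal) = 0 \<or> z \<notin> {z \<in> space (SP \<Otimes>\<^sub>M (lborel :: real measure)). snd z = 0}"
  proof (intro AE_HM_iff[where w="\<lambda>_. 1"])
    show "{z \<in> space (SP \<Otimes>\<^sub>M (lborel :: real measure)). snd z = 0} \<in> sets (SP \<Otimes>\<^sub>M lborel)" by measurable
  qed simp_all
  moreover have "AE z in (hyperplane_measure :: ((real ^ 'n) \<times> real) measure). z \<in> space (SP \<Otimes>\<^sub>M (lborel :: real measure))"
    unfolding HM_eq by simp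
  ultimately show ?thesis by eventually_elim auto
qed

text \<open>The polar densities for \<open>t < 0\<close> and for \<open>t > 0\<close> vanish nowhere
  on their half-lines, so a null set of poles comes from a null set of pairs; the remaining pairs,
  with \<open>t = 0\<close>, are themselves null.\<close>

lemma AE_HM_of_AE_lborel:
  assumes N: "N \<in> null_sets (lborel :: (real ^ 'n) measure)"
  shows "AE z in hyperplane_measure. - (1 / snd z) *\<^sub>R fst z \<notin> N"
proof -
  have [measurable]: "N \<in> sets borel" using N by auto
  let ?w = "\<lambda>t. ennreal (2 * radial_const (real CARD('n)) * \<bar>t\<bar> powr (- real CARD('n) - 1))"
  let ?N = "{z \<in> space (SP \<Otimes>\<^sub>M lborel). - (1 / snd z) *\<^sub>R fst z \<in> N}"
  have [measurable]: "(\<lambda>z. - (1 / snd z) *\<^sub>R fst z) \<in> borel_measurable (SP \<Otimes>\<^sub>M lborel)"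
    using measurable_compose[OF measurable_fst id_measurable_SP, of "lborel :: real measure"] by measurable
  have Ns: "?N \<in> sets (SP \<Otimes>\<^sub>M lborel)" by measurable
  have z: "(\<integral>\<^sup>+x. indicator N x \<partial>lborel) = 0" using N by (simp add: null_sets_def)
  have rc: "radial_const (real CARD('n)) > 0" by (rule radial_const_pos) simp
  have sp: "indicator ?N (\<theta>, t) = (indicator N (- (1 / t) *\<^sub>R \<theta>) :: ennreal)" if "\<theta> \<in> space SP" for \<theta> t
    using that by (auto simp: indicator_def space_pair_measure)
  have 1: "(\<integral>\<^sup>+\<theta>. \<integral>\<^sup>+t. ?w t * indicator {..<0} t * indicator ?N (\<theta>, t) \<partial>lborel \<partial>SP) = 0"
    unfolding z[symmetric] by (subst nn_integral_polar_nu, measurable) (intro nn_integral_cong, simp only: sp)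
  have 2: "(\<integral>\<^sup>+\<theta>. \<integral>\<^sup>+t. ?w t * indicator {0<..} t * indicator ?N (\<theta>, t) \<partial>lborel \<partial>SP) = 0"
    unfolding z[symmetric] by (subst nn_integral_polar_nu_pos, measurable) (intro nn_integral_cong, simp only: sp)
  have "AE z in (hyperplane_measure :: ((real ^ 'n) \<times> real) measure). z \<in> space (SP \<Otimes>\<^sub>M lborel)"
    unfolding HM_eq by simp
  moreover note AE_HM_nonzero AE_HM_iff[OF Ns 1] AE_HM_iff[OF Ns 2]
  ultimately have "AE z in hyperplane_measure. z \<in> space (SP \<Otimes>\<^sub>M lborel) \<and> snd z \<noteq> 0 \<and>
     (?w (snd z) * indicator {..<0} (snd z) = 0 \<or> z \<notin> ?N) \<and> (?w (snd z) * indicator {0<..} (snd z) = 0 \<or> z \<notin> ?N)"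
    by (auto simp: AE_conj_iff)
  thus ?thesis
  proof eventually_elim
    case (elim z)
    have "?w (snd z) \<noteq> 0" using elim rc by (simp add: ennreal_eq_0_iff not_le)
    hence "z \<notin> ?N" using elim by (auto simp: indicator_def split: if_splits)
    thus ?case using elim by auto
  qed
qed

text \<open>The default at the origin keeps the values on the sphere, so that \<open>dir\<close> is
  measurable into \<open>SP\<close> without exception.\<close>

definition dir :: "real ^ 'n \<Rightarrow> real ^ 'n" where
  "dir x = (if x = 0 then axis b 1 else x /\<^sub>R norm x)"

lemma dir_measurable [measurable]: "dir \<in> borel \<rightarrow>\<^sub>M SP"
  unfolding measurable_cong_sets[OF refl sets_SP]
proof (rule measurable_restrict_space2)
  show "dir \<in> space borel \<rightarrow> sphere 0 1" by (auto simp: dir_def)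
  show "dir \<in> borel_measurable borel" unfolding dir_def by measurable
qed

text \<open>The transport opposite to \<open>AE_HM_of_AE_lborel\<close>, used for a Borel version of
  \<open>\<phi>\<close>: representations with \<open>t < 0\<close> are the ones that the pole form
  evaluates. The origin is added because it is the pole of no hyperplane.\<close>

lemma null_sets_pullback:
  assumes N: "N \<in> null_sets (hyperplane_measure :: ((real ^ 'n) \<times> real) measure)"
  shows "insert 0 {x. x \<noteq> 0 \<and> (dir x, - inverse (norm x)) \<in> N} \<in> null_sets lborel"
proof -
  have [measurable]: "N \<in> sets (SP \<Otimes>\<^sub>M lborel)" using N by (auto simp: HM_eq)
  let ?N = "{x. x \<noteq> 0 \<and> (dir x, - inverse (norm x)) \<in> N}"
  have Nb [measurable]: "?N \<in> sets borel" by measurable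
  let ?w = "\<lambda>t. ennreal (2 * radial_const (real CARD('n)) * \<bar>t\<bar> powr (- real CARD('n) - 1))"
  have "(\<integral>\<^sup>+x. indicator ?N x \<partial>lborel) = (\<integral>\<^sup>+\<theta>. \<integral>\<^sup>+t. ?w t * indicator {..<0} t * indicator ?N (- (1 / t) *\<^sub>R \<theta>) \<partial>lborel \<partial>SP)"
    by (rule nn_integral_polar_nu) measurable
  also have "\<dots> = (\<integral>\<^sup>+\<theta>. \<integral>\<^sup>+t. ?w t * indicator {..<0} t * indicator N (\<theta>, t) \<partial>lborel \<partial>SP)"
  proof (intro nn_integral_cong)
    fix \<theta> t assume "\<theta> \<in> space SP"
    hence n: "norm \<theta> = 1" by (simp add: space_SP)
    show "?w t * indicator {..<0} t * indicator ?N (- (1 / t) *\<^sub>R \<theta>) = ?w t * indicator {..<0} t * indicator N (\<theta>, t)"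
    proof (cases "t < 0")
      case True
      have nn: "norm (- (1 / t) *\<^sub>R \<theta>) = - (1 / t)" using True n by simp
      hence x0: "- (1 / t) *\<^sub>R \<theta> \<noteq> 0" using True by auto
      have d: "dir (- (1 / t) *\<^sub>R \<theta>) = \<theta>"
        unfolding dir_def nn using x0 True by simp
      have "- inverse (norm (- (1 / t) *\<^sub>R \<theta>)) = t" unfolding nn using True by simp
      thus ?thesis using x0 d by (auto simp: indicator_def)
    qed simp
  qed
  also have "\<dots> = (\<integral>\<^sup>+z. ?w (snd z) * indicator {..<0} (snd z) * indicator N z \<partial>hyperplane_measure)"
    by (subst nn_integral_HM) auto
  also have "\<dots> = (\<integral>\<^sup>+z. 0 \<partial>(hyperplane_measure :: ((real ^ 'n) \<times> real) measure))"
    using AE_not_in[OF N] by (intro nn_integral_cong_AE) (auto elim!: eventually_mono)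
  finally have "?N \<in> null_sets lborel" by (simp add: null_sets_def)
  moreover have "{0 :: real ^ 'n} \<in> null_sets lborel" by (rule finite_imp_null_set_lborel) simp
  ultimately have "{0} \<union> ?N \<in> null_sets lborel" by (intro null_sets.Un)
  thus ?thesis by simp
qed

end

section \<open>Convergence of the truncated integrals\<close>

text \<open>Young's inequality without its factors \<open>1 / p\<close> and \<open>1 / q\<close>:
  compare \<open>y\<close> with \<open>x powr (p - 1)\<close>; one of the two terms on the right
  then dominates the product alone.\<close>

lemma powr_young:
  fixes x y p :: real
  assumes "0 \<le> x" "0 \<le> y" "1 < p"
  shows "x * y \<le> x powr p + y powr (p / (p - 1))"
proof (cases "x = 0 \<or> y = 0")
  case False
  hence x: "x > 0" and y: "y > 0" using assms by auto
  show ?thesis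
  proof (cases "y \<le> x powr (p - 1)")
    case True
    have "x * y \<le> x * x powr (p - 1)" using True x by (intro mult_left_mono) auto
    also have "\<dots> = x powr p" using x by (simp add: powr_diff)
    finally show ?thesis by (simp add: add_increasing2)
  next
    case False
    have "x = (x powr (p - 1)) powr (1 / (p - 1))" using x assms by (simp add: powr_powr)
    also have "\<dots> \<le> y powr (1 / (p - 1))" using False assms by (intro powr_mono2) auto
    finally have "x * y \<le> y powr (1 / (p - 1)) * y" using y by (intro mult_right_mono) auto
    also have "\<dots> = y powr (1 / (p - 1) + 1)" using y by (simp add: powr_add)
    also have "1 / (p - 1) + 1 = p / (p - 1)" using assms by (simp add: field_simps)
    finally show ?thesis by (simp add: add_increasing)
  qed
qed auto

lemma completion_ex_borel_measurable_complex:
  fixes f :: "'a \<Rightarrow> complex"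
  assumes f: "f \<in> borel_measurable (completion M)"
  shows "\<exists>f'\<in>borel_measurable M. AE x in M. f x = f' x"
proof -
  have "(\<lambda>x. Re (f x)) \<in> borel_measurable (completion M)" "(\<lambda>x. Im (f x)) \<in> borel_measurable (completion M)"
    using f by measurable
  from this[THEN completion_ex_borel_measurable_real]
  obtain u v where uv: "u \<in> borel_measurable M" "AE x in M. Re (f x) = u x"
    "v \<in> borel_measurable M" "AE x in M. Im (f x) = v x"
    by blast
  have m: "(\<lambda>x. complex_of_real (u x) + \<i> * complex_of_real (v x)) \<in> borel_measurable M"
    using uv by measurable
  have a: "AE x in M. f x = complex_of_real (u x) + \<i> * complex_of_real (v x)"
    using uv(2,4) by eventually_elim (simp add: complex_eq_iff)
  show ?thesis by (rule bexI[where P="\<lambda>f'. AE x in M. f x = f' x", OF a m])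
qed

lemma nn_integral_lborel_shift:
  fixes x :: "'a::euclidean_space"
  assumes [measurable]: "h \<in> borel_measurable borel"
  shows "(\<integral>\<^sup>+z. h (x + z) \<partial>lborel) = (\<integral>\<^sup>+z. h z \<partial>lborel)"
proof -
  have "(\<integral>\<^sup>+z. h z \<partial>distr lborel borel ((+) x)) = (\<integral>\<^sup>+z. h (x + z) \<partial>lborel)"
    by (subst nn_integral_distr) auto
  thus ?thesis by (simp add: lborel_distr_plus)
qed

text \<open>In the squared radius the integrand is a multiple of \<open>v powr (n / 2 - 2)\<close>,
  integrable at \<open>0\<close> because \<open>n > 2\<close>.\<close>

lemma nn_integral_near_origin:
  assumes "CARD('n) \<ge> 3"
  shows "(\<integral>\<^sup>+(z :: real ^ 'n::finite). ennreal (1 / (norm z)\<^sup>2) * indicator {z. (norm z)\<^sup>2 \<le> 1} z \<partial>lborel) < \<infinity>"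
proof -
  let ?n = "real CARD('n)"
  have n: "?n / 2 - 1 > 0" using assms by simp
  have rc: "0 \<le> radial_const ?n" by (intro less_imp_le radial_const_pos) simp
  have "(\<integral>\<^sup>+(z :: real ^ 'n). ennreal (1 / (norm z)\<^sup>2) * indicator {z. (norm z)\<^sup>2 \<le> 1} z \<partial>lborel) =
    (\<integral>\<^sup>+(z :: real ^ 'n). ennreal (1 / (norm z)\<^sup>2) * indicator {..1} ((norm z)\<^sup>2) \<partial>lborel)"
    by (intro nn_integral_cong) (auto simp: indicator_def)
  also have "\<dots> = (\<integral>\<^sup>+v. ennreal (radial_const ?n * v powr (?n / 2 - 1)) * indicator {0<..} v * (ennreal (1 / v) * indicator {..1} v) \<partial>lborel)"
    by (rule nn_integral_lborel_radial) measurable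
  also have "\<dots> = (\<integral>\<^sup>+v. ennreal (radial_const ?n) * (ennreal (v powr (?n / 2 - 1 - 1)) * indicator {0<..1} v) \<partial>lborel)"
  proof (rule nn_integral_cong)
    fix v :: real
    show "ennreal (radial_const ?n * v powr (?n / 2 - 1)) * indicator {0<..} v * (ennreal (1 / v) * indicator {..1} v) =
      ennreal (radial_const ?n) * (ennreal (v powr (?n / 2 - 1 - 1)) * indicator {0<..1} v)"
    proof (cases "v > 0")
      case True
      have "v powr (?n / 2 - 1 - 1) = v powr (?n / 2 - 1) * (1 / v)"
        using True by (subst powr_diff) simp
      thus ?thesis using True rc by (auto simp: indicator_def ennreal_mult'[symmetric] mult.assoc)
    qed simp
  qed
  also have "\<dots> = ennreal (radial_const ?n) * (\<integral>\<^sup>+v. ennreal (v powr (?n / 2 - 1 - 1)) * indicator {0<..1} v \<partial>lborel)"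
    by (rule nn_integral_cmult) measurable
  also have "\<dots> < \<infinity>" using nn_integral_powr_Ioo_0_1[OF n] by (simp add: ennreal_mult_less_top)
  finally show ?thesis .
qed

lemma nn_integral_away_from_origin:
  assumes q: "q > real CARD('n) / 2"
  shows "(\<integral>\<^sup>+(z :: real ^ 'n::finite). ennreal ((1 / (norm z)\<^sup>2) powr q) * indicator {z. 1 < (norm z)\<^sup>2} z \<partial>lborel) < \<infinity>"
proof -
  let ?n = "real CARD('n)"
  have rc: "0 \<le> radial_const ?n" by (intro less_imp_le radial_const_pos) simp
  have "(\<integral>\<^sup>+(z :: real ^ 'n). ennreal ((1 / (norm z)\<^sup>2) powr q) * indicator {z. 1 < (norm z)\<^sup>2} z \<partial>lborel) =
    (\<integral>\<^sup>+(z :: real ^ 'n). ennreal ((1 / (norm z)\<^sup>2) powr q) * indicator {1<..} ((norm z)\<^sup>2) \<partial>lborel)"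
    by (intro nn_integral_cong) (auto simp: indicator_def)
  also have "\<dots> = (\<integral>\<^sup>+v. ennreal (radial_const ?n * v powr (?n / 2 - 1)) * indicator {0<..} v * (ennreal ((1 / v) powr q) * indicator {1<..} v) \<partial>lborel)"
    by (rule nn_integral_lborel_radial) measurable
  also have "\<dots> = (\<integral>\<^sup>+v. ennreal (radial_const ?n) * (ennreal (v powr (- 1 - (q - ?n / 2))) * indicator {1<..} v) \<partial>lborel)"
  proof (rule nn_integral_cong)
    fix v :: real
    show "ennreal (radial_const ?n * v powr (?n / 2 - 1)) * indicator {0<..} v * (ennreal ((1 / v) powr q) * indicator {1<..} v) =
      ennreal (radial_const ?n) * (ennreal (v powr (- 1 - (q - ?n / 2))) * indicator {1<..} v)"
    proof (cases "v > 1")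
      case True
      have "(1 / v) powr q = v powr (- q)" using True by (simp add: powr_divide powr_minus_divide)
      hence "v powr (?n / 2 - 1) * (1 / v) powr q = v powr (?n / 2 - 1 + - q)" by (simp only: powr_add)
      also have "?n / 2 - 1 + - q = - 1 - (q - ?n / 2)" by simp
      finally have e: "v powr (?n / 2 - 1) * (1 / v) powr q = v powr (- 1 - (q - ?n / 2))" .
      have "ennreal (radial_const ?n * v powr (?n / 2 - 1)) * ennreal ((1 / v) powr q) = ennreal (radial_const ?n * v powr (?n / 2 - 1) * (1 / v) powr q)"
        using rc by (intro ennreal_mult'[symmetric]) simp
      also have "radial_const ?n * v powr (?n / 2 - 1) * (1 / v) powr q = radial_const ?n * v powr (- 1 - (q - ?n / 2))"
        unfolding e[symmetric] by simp
      also have "ennreal \<dots> = ennreal (radial_const ?n) * ennreal (v powr (- 1 - (q - ?n / 2)))"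
        by (rule ennreal_mult'[OF rc])
      finally show ?thesis using True by simp
    qed simp
  qed
  also have "\<dots> = ennreal (radial_const ?n) * (\<integral>\<^sup>+v. ennreal (v powr (- 1 - (q - ?n / 2))) * indicator {1<..} v \<partial>lborel)"
    by (rule nn_integral_cmult) measurable
  also have "\<dots> < \<infinity>" using q by (subst nn_integral_powr_tail) (auto simp: ennreal_mult_less_top)
  finally show ?thesis .
qed

context marchaud_frame
begin

lemma locally_integrable_of_Lp:
  fixes g :: "real ^ 'n \<Rightarrow> complex"
  assumes [measurable]: "g \<in> borel_measurable borel" and p: "1 \<le> p"
    and gp: "(\<integral>\<^sup>+x. ennreal (norm (g x) powr p) \<partial>lborel) < \<infinity>"
  shows "(\<integral>\<^sup>+y. ennreal (norm (g y)) * indicator (ball 0 N) y \<partial>lborel) < \<infinity>"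
proof -
  have [measurable]: "ball x r \<in> sets borel" for x :: "real ^ 'n" and r by (intro borel_open open_ball)
  have "(\<integral>\<^sup>+y. ennreal (norm (g y)) * indicator (ball 0 N) y \<partial>lborel) \<le> (\<integral>\<^sup>+y. indicator (ball 0 N) y + ennreal (norm (g y) powr p) \<partial>lborel)"
  proof (rule nn_integral_mono)
    fix y :: "real ^ 'n"
    have "norm (g y) \<le> 1 + norm (g y) powr p"
    proof (cases "norm (g y) \<le> 1")
      case False
      hence "norm (g y) powr 1 \<le> norm (g y) powr p" using p by (intro powr_mono) auto
      thus ?thesis using False by simp
    qed (simp add: add_increasing2)
    hence "ennreal (norm (g y)) \<le> ennreal (1 + norm (g y) powr p)" by (rule ennreal_leI)
    also have "\<dots> = 1 + ennreal (norm (g y) powr p)" by (simp add: ennreal_plus)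
    finally show "ennreal (norm (g y)) * indicator (ball 0 N) y \<le> indicator (ball 0 N) y + ennreal (norm (g y) powr p)"
      by (auto simp: indicator_def)
  qed
  also have "\<dots> = emeasure lborel (ball (0 :: real ^ 'n) N) + (\<integral>\<^sup>+y. ennreal (norm (g y) powr p) \<partial>lborel)"
    by (subst nn_integral_add) auto
  also have "\<dots> < \<infinity>" using gp emeasure_lborel_ball_finite[of "0 :: real ^ 'n" N] by simp
  finally show ?thesis .
qed

text \<open>Young's inequality with the conjugate exponent \<open>q = p / (p - 1)\<close>: the
  \<open>q\<close>-th power of \<open>1 / |z|^2\<close> is integrable at infinity when
  \<open>q > n / 2\<close>, which is \<open>p < n / (n - 2)\<close>. For \<open>p = 1\<close> the
  factor \<open>1 / |z|^2 \<le> 1\<close> is simply dropped.\<close>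

lemma far_part_finite:
  fixes g :: "real ^ 'n \<Rightarrow> complex"
  assumes [measurable]: "g \<in> borel_measurable borel" and p: "1 \<le> p" "p < real CARD('n) / (real CARD('n) - 2)"
    and gp: "(\<integral>\<^sup>+x. ennreal (norm (g x) powr p) \<partial>lborel) < \<infinity>"
  shows "(\<integral>\<^sup>+z. ennreal (norm (g (x + z)) / (norm z)\<^sup>2) * indicator {z. 1 < (norm z)\<^sup>2} z \<partial>lborel) < \<infinity>"
proof -
  have sh: "(\<integral>\<^sup>+z. ennreal (norm (g (x + z)) powr p) \<partial>lborel) < \<infinity>"
    using gp nn_integral_lborel_shift[of "\<lambda>z. ennreal (norm (g z) powr p)" x] by simp
  show ?thesis
  proof (cases "p = 1")
    case True
    have "(\<integral>\<^sup>+z. ennreal (norm (g (x + z)) / (norm z)\<^sup>2) * indicator {z. 1 < (norm z)\<^sup>2} z \<partial>lborel) \<le> (\<integral>\<^sup>+z. ennreal (norm (g (x + z)) powr p) \<partial>lborel)"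
    proof (rule nn_integral_mono)
      fix z :: "real ^ 'n"
      show "ennreal (norm (g (x + z)) / (norm z)\<^sup>2) * indicator {z. 1 < (norm z)\<^sup>2} z \<le> ennreal (norm (g (x + z)) powr p)"
      proof (cases "1 < (norm z)\<^sup>2")
        case z: True
        have "norm (g (x + z)) / (norm z)\<^sup>2 \<le> norm (g (x + z)) / 1"
          using z by (intro divide_left_mono) auto
        thus ?thesis using z True by (auto intro: ennreal_leI)
      qed simp
    qed
    thus ?thesis using sh by (rule le_less_trans)
  next
    case False
    hence p1: "p > 1" using p by simp
    define q where "q = p / (p - 1)"
    have n3: "real CARD('n) \<ge> 3" using card3 by simp
    have q: "q > real CARD('n) / 2"
    proof -
      have "p * (real CARD('n) - 2) < real CARD('n)" using p n3 by (simp add: field_simps)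
      hence "real CARD('n) * (p - 1) < 2 * p" by (simp add: algebra_simps)
      thus ?thesis using p1 by (simp add: q_def field_simps)
    qed
    have "(\<integral>\<^sup>+z. ennreal (norm (g (x + z)) / (norm z)\<^sup>2) * indicator {z. 1 < (norm z)\<^sup>2} z \<partial>lborel) \<le>
      (\<integral>\<^sup>+z. ennreal (norm (g (x + z)) powr p) + ennreal ((1 / (norm z)\<^sup>2) powr q) * indicator {z. 1 < (norm z)\<^sup>2} z \<partial>lborel)"
    proof (rule nn_integral_mono)
      fix z :: "real ^ 'n"
      have "norm (g (x + z)) * (1 / (norm z)\<^sup>2) \<le> norm (g (x + z)) powr p + (1 / (norm z)\<^sup>2) powr q"
        unfolding q_def by (rule powr_young) (use p1 in auto)
      hence "ennreal (norm (g (x + z)) / (norm z)\<^sup>2) \<le> ennreal (norm (g (x + z)) powr p + (1 / (norm z)\<^sup>2) powr q)"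
        by (intro ennreal_leI) simp
      also have "\<dots> = ennreal (norm (g (x + z)) powr p) + ennreal ((1 / (norm z)\<^sup>2) powr q)"
        by (rule ennreal_plus) auto
      finally show "ennreal (norm (g (x + z)) / (norm z)\<^sup>2) * indicator {z. 1 < (norm z)\<^sup>2} z \<le>
        ennreal (norm (g (x + z)) powr p) + ennreal ((1 / (norm z)\<^sup>2) powr q) * indicator {z. 1 < (norm z)\<^sup>2} z"
        by (auto simp: indicator_def)
    qed
    also have "\<dots> = (\<integral>\<^sup>+z. ennreal (norm (g (x + z)) powr p) \<partial>lborel) + (\<integral>\<^sup>+z. ennreal ((1 / (norm (z :: real ^ 'n))\<^sup>2) powr q) * indicator {z. 1 < (norm z)\<^sup>2} z \<partial>lborel)"
      by (rule nn_integral_add) measurable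
    also have "\<dots> < \<infinity>" using sh nn_integral_away_from_origin[OF q] by simp
    finally show ?thesis .
  qed
qed

text \<open>The convolution of a locally integrable function with an integrable kernel of bounded
  support is locally integrable, hence finite almost everywhere. Centres are restricted to the ball
  of radius \<open>N\<close>, whose translates by \<open>|z| \<le> 1\<close> stay within radius
  \<open>N + 1\<close>.\<close>

lemma AE_near_part_finite:
  fixes g :: "real ^ 'n \<Rightarrow> complex"
  assumes [measurable]: "g \<in> borel_measurable borel"
    and fin: "\<And>N. (\<integral>\<^sup>+y. ennreal (norm (g y)) * indicator (ball 0 N) y \<partial>lborel) < \<infinity>"
  shows "AE x in lborel. (\<integral>\<^sup>+z. ennreal (norm (g (x + z)) / (norm z)\<^sup>2) * indicator {z. (norm z)\<^sup>2 \<le> 1} z \<partial>lborel) < \<infinity>"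
proof -
  have [measurable]: "ball x r \<in> sets borel" for x :: "real ^ 'n" and r by (intro borel_open open_ball)
  define I where "I x = (\<integral>\<^sup>+z. ennreal (norm (g (x + z)) / (norm z)\<^sup>2) * indicator {z. (norm z)\<^sup>2 \<le> 1} z \<partial>lborel)" for x
  have [measurable]: "I \<in> borel_measurable borel"
    unfolding I_def by measurable
  have "AE x in lborel. I x * indicator (ball 0 (real N)) x \<noteq> \<infinity>" for N :: nat
  proof (rule nn_integral_PInf_AE)
    let ?k = "\<lambda>z :: real ^ 'n. ennreal (1 / (norm z)\<^sup>2) * indicator {z. (norm z)\<^sup>2 \<le> 1} z"
    have "(\<integral>\<^sup>+x. I x * indicator (ball 0 (real N)) x \<partial>lborel) = (\<integral>\<^sup>+x. \<integral>\<^sup>+z. ?k z * (ennreal (norm (g (x + z))) * indicator (ball 0 (real N)) x) \<partial>lborel \<partial>lborel)"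
    proof (rule nn_integral_cong)
      fix x :: "real ^ 'n"
      have "I x * indicator (ball 0 (real N)) x = (\<integral>\<^sup>+z. ennreal (norm (g (x + z)) / (norm z)\<^sup>2) * indicator {z. (norm z)\<^sup>2 \<le> 1} z * indicator (ball 0 (real N)) x \<partial>lborel)"
        unfolding I_def by (rule nn_integral_multc[symmetric]) measurable
      also have "\<dots> = (\<integral>\<^sup>+z. ?k z * (ennreal (norm (g (x + z))) * indicator (ball 0 (real N)) x) \<partial>lborel)"
        by (intro nn_integral_cong) (auto simp: indicator_def ennreal_mult'[symmetric])
      finally show "I x * indicator (ball 0 (real N)) x = (\<integral>\<^sup>+z. ?k z * (ennreal (norm (g (x + z))) * indicator (ball 0 (real N)) x) \<partial>lborel)" .
    qed
    also have "\<dots> = (\<integral>\<^sup>+z. \<integral>\<^sup>+x. ?k z * (ennreal (norm (g (x + z))) * indicator (ball 0 (real N)) x) \<partial>lborel \<partial>lborel)"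
      by (rule lborel_pair.Fubini') measurable
    also have "\<dots> \<le> (\<integral>\<^sup>+z. ?k z * (\<integral>\<^sup>+y. ennreal (norm (g y)) * indicator (ball 0 (real N + 1)) y \<partial>lborel) \<partial>lborel)"
    proof (rule nn_integral_mono)
      fix z :: "real ^ 'n"
      have "(\<integral>\<^sup>+x. ?k z * (ennreal (norm (g (x + z))) * indicator (ball 0 (real N)) x) \<partial>lborel) = ?k z * (\<integral>\<^sup>+x. ennreal (norm (g (x + z))) * indicator (ball 0 (real N)) x \<partial>lborel)"
        by (rule nn_integral_cmult) measurable
      also have "\<dots> \<le> ?k z * (\<integral>\<^sup>+y. ennreal (norm (g y)) * indicator (ball 0 (real N + 1)) y \<partial>lborel)"
      proof (cases "(norm z)\<^sup>2 \<le> 1")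
        case True
        hence z1: "norm z \<le> 1" using power2_le_imp_le[of "norm z" 1] by simp
        have "(\<integral>\<^sup>+x. ennreal (norm (g (x + z))) * indicator (ball 0 (real N)) x \<partial>lborel) \<le> (\<integral>\<^sup>+x. ennreal (norm (g (z + x))) * indicator (ball 0 (real N + 1)) (z + x) \<partial>lborel)"
        proof (rule nn_integral_mono)
          fix x :: "real ^ 'n"
          have "z + x \<in> ball 0 (real N + 1)" if "x \<in> ball 0 (real N)"
            using that z1 norm_triangle_ineq[of z x] by simp
          thus "ennreal (norm (g (x + z))) * indicator (ball 0 (real N)) x \<le> ennreal (norm (g (z + x))) * indicator (ball 0 (real N + 1)) (z + x)"
            by (auto simp: indicator_def add.commute)
        qed
        also have "\<dots> = (\<integral>\<^sup>+y. ennreal (norm (g y)) * indicator (ball 0 (real N + 1)) y \<partial>lborel)"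
          by (rule nn_integral_lborel_shift) measurable
        finally show ?thesis by (rule mult_left_mono) simp
      qed simp
      finally show "(\<integral>\<^sup>+x. ?k z * (ennreal (norm (g (x + z))) * indicator (ball 0 (real N)) x) \<partial>lborel) \<le> ?k z * (\<integral>\<^sup>+y. ennreal (norm (g y)) * indicator (ball 0 (real N + 1)) y \<partial>lborel)" .
    qed
    also have "\<dots> = (\<integral>\<^sup>+z. ?k z \<partial>lborel) * (\<integral>\<^sup>+y. ennreal (norm (g y)) * indicator (ball 0 (real N + 1)) y \<partial>lborel)"
      by (rule nn_integral_multc) measurable
    also have "\<dots> < \<infinity>" using nn_integral_near_origin[OF card3] fin[of "real N + 1"] by (simp add: ennreal_mult_less_top)
    finally show "(\<integral>\<^sup>+x. I x * indicator (ball 0 (real N)) x \<partial>lborel) \<noteq> \<infinity>" by simp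
  qed measurable
  hence "AE x in lborel. \<forall>N :: nat. I x * indicator (ball 0 (real N)) x \<noteq> \<infinity>"
    unfolding AE_all_countable by blast
  thus ?thesis
  proof eventually_elim
    case (elim x)
    obtain N where "norm x < real N" using reals_Archimedean2 by blast
    with elim[rule_format, of N] have "I x \<noteq> \<infinity>" by simp
    thus ?case by (simp add: I_def less_top)
  qed
qed

lemma AE_good:
  fixes g :: "real ^ 'n \<Rightarrow> complex"
  assumes g [measurable]: "g \<in> borel_measurable borel" and p: "1 \<le> p" "p < real CARD('n) / (real CARD('n) - 2)"
    and gp: "(\<integral>\<^sup>+x. ennreal (norm (g x) powr p) \<partial>lborel) < \<infinity>"
  shows "AE x in lborel. good g x"
  using AE_near_part_finite[OF g locally_integrable_of_Lp[OF g p(1) gp]]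
proof eventually_elim
  case (elim x)
  have "(\<integral>\<^sup>+z. ennreal (norm (g (x + z)) / (norm z)\<^sup>2) \<partial>lborel) =
    (\<integral>\<^sup>+z. ennreal (norm (g (x + z)) / (norm z)\<^sup>2) * indicator {z. (norm z)\<^sup>2 \<le> 1} z + ennreal (norm (g (x + z)) / (norm z)\<^sup>2) * indicator {z. 1 < (norm z)\<^sup>2} z \<partial>lborel)"
    by (intro nn_integral_cong) (auto simp: indicator_def)
  also have "\<dots> = (\<integral>\<^sup>+z. ennreal (norm (g (x + z)) / (norm z)\<^sup>2) * indicator {z. (norm z)\<^sup>2 \<le> 1} z \<partial>lborel) + (\<integral>\<^sup>+z. ennreal (norm (g (x + z)) / (norm z)\<^sup>2) * indicator {z. 1 < (norm z)\<^sup>2} z \<partial>lborel)"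
    by (rule nn_integral_add) measurable
  also have "\<dots> < \<infinity>" using elim far_part_finite[OF g p gp, of x] by simp
  finally show ?case by (simp add: good_def)
qed

lemma mean_oscillation_le:
  fixes g :: "real ^ 'n \<Rightarrow> complex"
  assumes t: "t > 0" and s: "s \<ge> 0" and le: "\<And>z. (norm z)\<^sup>2 < t \<Longrightarrow> norm (g (x + z) - g x) \<le> s"
  shows "mean_oscillation g x t \<le> ennreal (s * unit_ball_vol (real CARD('n)))"
proof -
  let ?n = "real CARD('n)"
  have [measurable]: "ball x r \<in> sets borel" for x :: "real ^ 'n" and r by (intro borel_open open_ball)
  have "(\<integral>\<^sup>+z. ennreal (norm (g (x + z) - g x)) * indicator {z. (norm z)\<^sup>2 < t} z \<partial>lborel) \<le> (\<integral>\<^sup>+z. ennreal s * indicator (ball (0 :: real ^ 'n) (sqrt t)) z \<partial>lborel)"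
  proof (rule nn_integral_mono)
    fix z :: "real ^ 'n"
    have "z \<in> ball 0 (sqrt t)" if "(norm z)\<^sup>2 < t" using that by (simp add: real_less_rsqrt)
    thus "ennreal (norm (g (x + z) - g x)) * indicator {z. (norm z)\<^sup>2 < t} z \<le> ennreal s * indicator (ball 0 (sqrt t)) z"
      using le[of z] by (auto simp: indicator_def intro: ennreal_leI)
  qed
  also have "\<dots> = ennreal s * ennreal (unit_ball_vol ?n * sqrt t ^ CARD('n))"
    using t by (subst nn_integral_cmult) (auto simp: emeasure_ball)
  finally have "mean_oscillation g x t \<le> ennreal (t powr (- ?n / 2)) * (ennreal s * ennreal (unit_ball_vol ?n * sqrt t ^ CARD('n)))"
    unfolding mean_oscillation_def by (rule mult_left_mono) simp
  also have "\<dots> = ennreal (s * unit_ball_vol ?n * (t powr (- ?n / 2) * sqrt t ^ CARD('n)))"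
    using s t by (simp add: ennreal_mult'[symmetric] mult_ac)
  also have "t powr (- ?n / 2) * sqrt t ^ CARD('n) = 1"
  proof -
    have "sqrt t ^ CARD('n) = (t powr (1 / 2)) powr ?n"
      using t by (subst powr_realpow) (auto simp: powr_half_sqrt)
    also have "\<dots> = t powr (?n / 2)" unfolding powr_powr by simp
    finally show ?thesis using t by (simp add: powr_minus)
  qed
  finally show ?thesis by simp
qed

text \<open>For \<open>t\<close> beyond \<open>d\<close> the integral \<open>I\<close> from
  \<open>good\<close> takes over: \<open>1 \<le> t / |z|^2\<close> on the punctured ball, so the
  first term is at most \<open>t powr (1 - n / 2) * I\<close>, which decreases in \<open>t\<close>;
  the constant \<open>g x\<close> contributes its norm times the unit ball volume.\<close>

lemma mean_oscillation_bounded: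
  fixes g :: "real ^ 'n \<Rightarrow> complex"
  assumes g [measurable]: "g \<in> borel_measurable borel" and x: "good g x"
    and small: "\<exists>d>0. \<forall>t. 0 < t \<and> t < d \<longrightarrow> mean_oscillation g x t \<le> ennreal 1"
  shows "\<exists>B. \<forall>t>0. mean_oscillation g x t \<le> ennreal B"
proof -
  let ?n = "real CARD('n)"
  obtain d where d: "d > 0" "\<And>t. 0 < t \<Longrightarrow> t < d \<Longrightarrow> mean_oscillation g x t \<le> ennreal 1" using small by blast
  define I where "I = enn2real (\<integral>\<^sup>+z. ennreal (norm (g (x + z)) / (norm z)\<^sup>2) \<partial>lborel)"
  have I: "I \<ge> 0" "(\<integral>\<^sup>+z. ennreal (norm (g (x + z)) / (norm z)\<^sup>2) \<partial>lborel) = ennreal I"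
    using x by (simp_all add: I_def good_def)
  define B where "B = 1 + d powr (1 - ?n / 2) * I + norm (g x) * unit_ball_vol ?n"
  have B1: "B \<ge> 1" using I(1) by (simp add: B_def add_nonneg_nonneg)
  have "mean_oscillation g x t \<le> ennreal B" if t: "t > 0" for t
  proof (cases "t < d")
    case True
    have "mean_oscillation g x t \<le> ennreal 1" by (rule d(2)[OF t True])
    also have "\<dots> \<le> ennreal B" using B1 by (rule ennreal_leI)
    finally show ?thesis .
  next
    case False
    have n3: "?n \<ge> 3" using card3 by simp
    have [measurable]: "{z :: real ^ 'n. (norm z)\<^sup>2 < t} \<in> sets borel" by measurable
    have "(\<integral>\<^sup>+z. ennreal (norm (g (x + z) - g x)) * indicator {z. (norm z)\<^sup>2 < t} z \<partial>lborel) \<le>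
      (\<integral>\<^sup>+z. ennreal t * ennreal (norm (g (x + z)) / (norm z)\<^sup>2) + ennreal (norm (g x)) * indicator {z. (norm z)\<^sup>2 < t} z \<partial>lborel)"
    proof (rule nn_integral_mono)
      fix z :: "real ^ 'n"
      show "ennreal (norm (g (x + z) - g x)) * indicator {z. (norm z)\<^sup>2 < t} z \<le> ennreal t * ennreal (norm (g (x + z)) / (norm z)\<^sup>2) + ennreal (norm (g x)) * indicator {z. (norm z)\<^sup>2 < t} z"
      proof (cases "z \<noteq> 0 \<and> (norm z)\<^sup>2 < t")
        case True
        have "norm (g (x + z)) * 1 \<le> norm (g (x + z)) * (t / (norm z)\<^sup>2)"
          using True by (intro mult_left_mono) auto
        hence "norm (g (x + z) - g x) \<le> t * (norm (g (x + z)) / (norm z)\<^sup>2) + norm (g x)"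
          using norm_triangle_ineq4[of "g (x + z)" "g x"] by (simp add: mult.commute)
        hence "ennreal (norm (g (x + z) - g x)) \<le> ennreal (t * (norm (g (x + z)) / (norm z)\<^sup>2) + norm (g x))"
          by (rule ennreal_leI)
        also have "\<dots> = ennreal t * ennreal (norm (g (x + z)) / (norm z)\<^sup>2) + ennreal (norm (g x))"
          using t by (subst ennreal_plus) (auto simp: ennreal_mult'[symmetric])
        finally show ?thesis using True by simp
      next
        case False
        thus ?thesis by (cases "z = 0") (auto simp: indicator_def)
      qed
    qed
    also have "\<dots> = ennreal t * ennreal I + ennreal (norm (g x)) * emeasure lborel {z :: real ^ 'n. (norm z)\<^sup>2 < t}"
      unfolding I(2)[symmetric]
      by (subst nn_integral_add, measurable, subst (1 2) nn_integral_cmult) auto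
    also have "emeasure lborel {z :: real ^ 'n. (norm z)\<^sup>2 < t} = ennreal (unit_ball_vol ?n * sqrt t ^ CARD('n))"
    proof -
      have "(norm z)\<^sup>2 < t \<longleftrightarrow> norm z < sqrt t" for z :: "real ^ 'n"
        using real_sqrt_less_iff[of "(norm z)\<^sup>2" t] by simp
      hence "{z :: real ^ 'n. (norm z)\<^sup>2 < t} = ball 0 (sqrt t)"
        by (simp only: set_eq_iff mem_Collect_eq mem_ball_0 simp_thms)
      thus ?thesis using t by (simp add: emeasure_ball)
    qed
    also have "ennreal t * ennreal I + ennreal (norm (g x)) * ennreal (unit_ball_vol ?n * sqrt t ^ CARD('n)) = ennreal (t * I + norm (g x) * (unit_ball_vol ?n * sqrt t ^ CARD('n)))"
      using t I by (subst ennreal_plus) (auto simp: ennreal_mult'[symmetric])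
    finally have "mean_oscillation g x t \<le> ennreal (t powr (- ?n / 2)) * ennreal (t * I + norm (g x) * (unit_ball_vol ?n * sqrt t ^ CARD('n)))"
      unfolding mean_oscillation_def by (rule mult_left_mono) simp
    also have "\<dots> = ennreal (t powr (- ?n / 2) * (t * I + norm (g x) * (unit_ball_vol ?n * sqrt t ^ CARD('n))))"
      by (rule ennreal_mult'[symmetric]) simp
    also have "\<dots> \<le> ennreal B"
    proof (rule ennreal_leI)
      have 1: "t powr (- ?n / 2) * sqrt t ^ CARD('n) = 1"
      proof -
        have "sqrt t ^ CARD('n) = (t powr (1 / 2)) powr ?n"
          using t by (subst powr_realpow) (auto simp: powr_half_sqrt)
        also have "\<dots> = t powr (?n / 2)" unfolding powr_powr by simp
        finally show ?thesis using t by (simp add: powr_minus)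
      qed
      have 2: "t powr (- ?n / 2) * t \<le> d powr (1 - ?n / 2)"
      proof -
        have "t powr (- ?n / 2) * t = t powr (- ?n / 2) * t powr 1" using t by simp
        also have "\<dots> = t powr (1 - ?n / 2)" unfolding powr_add[symmetric] by (rule arg_cong) simp
        also have "\<dots> \<le> d powr (1 - ?n / 2)" using False d n3 by (intro powr_mono2') auto
        finally show ?thesis .
      qed
      have "t powr (- ?n / 2) * (t * I + norm (g x) * (unit_ball_vol ?n * sqrt t ^ CARD('n)))
         = (t powr (- ?n / 2) * t) * I + norm (g x) * unit_ball_vol ?n * (t powr (- ?n / 2) * sqrt t ^ CARD('n))"
        by (simp add: algebra_simps)
      also have "\<dots> \<le> d powr (1 - ?n / 2) * I + norm (g x) * unit_ball_vol ?n"
        unfolding 1 using mult_right_mono[OF 2 I(1)] by simp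
      finally show "t powr (- ?n / 2) * (t * I + norm (g x) * (unit_ball_vol ?n * sqrt t ^ CARD('n))) \<le> B"
        by (simp add: B_def)
    qed
    finally show ?thesis .
  qed
  thus ?thesis by blast
qed

end

section \<open>The inversion formula\<close>

context marchaud_frame
begin

lemma inversion_integrand_eq:
  fixes \<phi> :: "real ^ 'n \<Rightarrow> real \<Rightarrow> complex"
  assumes "hyperplane_function \<phi>" "g \<in> borel_measurable borel" "N \<in> null_sets lborel"
    and "\<And>z. z \<notin> N \<Longrightarrow> point_function \<phi> z = g z" and "x \<noteq> 0" and r: "r \<ge> 0"
  shows "inversion_integrand G e m (Phi \<phi>) x r = inversion_summand g x r"
proof -
  have "shifted_dual G e (Phi \<phi>) x (sqrt (real j * r)) = plane_average g x (sqrt (real j * r))" for j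
    using r by (intro shifted_dual_eq_plane_average[OF assms(1-5)]) auto
  thus ?thesis unfolding inversion_integrand_def inversion_summand_def by simp
qed

lemma truncated_inversion_integrand:
  fixes \<phi> :: "real ^ 'n \<Rightarrow> real \<Rightarrow> complex"
  assumes a: "hyperplane_function \<phi>" "g \<in> borel_measurable borel" "N \<in> null_sets lborel"
    "\<forall>z. z \<notin> N \<longrightarrow> point_function \<phi> z = g z" "x \<noteq> 0" and \<epsilon>: "\<epsilon> > 0"
  shows "set_integrable lborel {\<epsilon><..} (inversion_integrand G e m (Phi \<phi>) x)
           \<longleftrightarrow> set_integrable lborel {\<epsilon><..} (inversion_summand g x)"
    and "(LBINT r:{\<epsilon><..}. inversion_integrand G e m (Phi \<phi>) x r) = (LBINT r:{\<epsilon><..}. inversion_summand g x r)"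
proof -
  have eq: "inversion_integrand G e m (Phi \<phi>) x r = inversion_summand g x r" if "r \<in> {\<epsilon><..}" for r
    using that \<epsilon> a by (intro inversion_integrand_eq[OF a(1-3)]) auto
  show "set_integrable lborel {\<epsilon><..} (inversion_integrand G e m (Phi \<phi>) x)
           \<longleftrightarrow> set_integrable lborel {\<epsilon><..} (inversion_summand g x)"
    by (rule set_integrable_cong[OF refl refl eq])
  show "(LBINT r:{\<epsilon><..}. inversion_integrand G e m (Phi \<phi>) x r) = (LBINT r:{\<epsilon><..}. inversion_summand g x r)"
    using eq by (intro set_lebesgue_integral_cong) auto
qed

text \<open>The constant \<open>pi powr (1 - n / 2) / kappa\<close> of the inversion formula is the
  reciprocal of \<open>inv_const\<close>.\<close>

lemma inversion_constant:
  fixes z :: complex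
  assumes "t \<noteq> 0"
  shows "of_real (pi powr (1 - real CARD('n) / 2) / (kappa CARD('n) m * \<bar>t\<bar> ^ (CARD('n) - 1))) * (of_real inv_const * z)
    = z / of_real (\<bar>t\<bar> ^ (CARD('n) - 1))"
proof -
  have k: "kappa CARD('n) m > 0" using card3 m by (intro kappa_pos) auto
  have "1 - real CARD('n) / 2 = - \<alpha>" by (simp add: \<alpha>_def)
  hence "pi powr (1 - real CARD('n) / 2) * pi powr \<alpha> = 1" by (simp add: powr_minus)
  hence "pi powr (1 - real CARD('n) / 2) / (kappa CARD('n) m * \<bar>t\<bar> ^ (CARD('n) - 1)) * inv_const = 1 / \<bar>t\<bar> ^ (CARD('n) - 1)"
    using k assms unfolding inv_const_def by (simp add: divide_simps)
  hence "of_real (pi powr (1 - real CARD('n) / 2) / (kappa CARD('n) m * \<bar>t\<bar> ^ (CARD('n) - 1))) * of_real inv_const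
    = (of_real (1 / \<bar>t\<bar> ^ (CARD('n) - 1)) :: complex)"
    unfolding of_real_mult[symmetric] by (rule arg_cong)
  hence "of_real (pi powr (1 - real CARD('n) / 2) / (kappa CARD('n) m * \<bar>t\<bar> ^ (CARD('n) - 1))) * of_real inv_const * z
    = (of_real (1 / \<bar>t\<bar> ^ (CARD('n) - 1)) :: complex) * z"
    by (rule arg_cong)
  thus ?thesis unfolding mult.assoc by simp
qed

text \<open>A Borel version is chosen on the space of hyperplanes and carried over to poles through
  \<open>dir\<close>; the null set where it differs from \<open>\<phi>\<close> pulls back to a null
  set.\<close>

lemma tilde_Lp_representative:
  fixes \<phi> :: "real ^ 'n \<Rightarrow> real \<Rightarrow> complex"
  assumes \<phi>: "\<phi> \<in> tilde_Lp p"
  obtains g N where "g \<in> borel_measurable borel" "N \<in> null_sets (lborel :: (real ^ 'n) measure)"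
    "\<And>z. z \<notin> N \<Longrightarrow> point_function \<phi> z = g z"
    "(\<integral>\<^sup>+x. ennreal (norm (g x) powr p) \<partial>lborel) < \<infinity>"
proof -
  let ?n = "real CARD('n)"
  let ?HM = "hyperplane_measure :: ((real ^ 'n) \<times> real) measure"
  have fm: "(\<lambda>(\<theta>, t). \<phi> \<theta> t) \<in> borel_measurable (completion ?HM)"
    and fin: "(\<integral>\<^sup>+ (\<theta>, t). ennreal (\<bar>t\<bar> powr ((?n - 1) * (p - 1) - 2) * norm (\<phi> \<theta> t) powr p) \<partial>completion ?HM) < \<infinity>"
    using \<phi> by (auto simp: tilde_Lp_def)
  obtain f' where f'm: "f' \<in> borel_measurable ?HM" and ae: "AE z in ?HM. (case z of (\<theta>, t) \<Rightarrow> \<phi> \<theta> t) = f' z"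
    using completion_ex_borel_measurable_complex[OF fm] by blast
  have [measurable]: "f' \<in> borel_measurable (SP \<Otimes>\<^sub>M lborel)" using f'm unfolding HM_eq .
  obtain N0 where N0: "\<And>z. z \<in> space ?HM - N0 \<Longrightarrow> (case z of (\<theta>, t) \<Rightarrow> \<phi> \<theta> t) = f' z" "N0 \<in> null_sets ?HM"
    by (rule AE_E3[OF ae]) blast
  define g where "g x = (if x = 0 then 0 else f' (dir x, - inverse (norm x)) / of_real (norm x ^ (CARD('n) - 1)))" for x
  have gm [measurable]: "g \<in> borel_measurable borel" unfolding g_def by measurable
  let ?N = "insert 0 {x. x \<noteq> 0 \<and> (dir x, - inverse (norm x)) \<in> N0}"
  show thesis
  proof (rule that[OF gm null_sets_pullback[OF N0(2)]])
    fix z assume z: "z \<notin> ?N"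
    have "(dir z, - inverse (norm z)) \<in> space ?HM"
      using z by (auto simp: HM_eq space_pair_measure space_SP dir_def)
    with N0(1)[of "(dir z, - inverse (norm z))"] z
    have "\<phi> (dir z) (- inverse (norm z)) = f' (dir z, - inverse (norm z))" by auto
    thus "point_function \<phi> z = g z" using z by (auto simp: g_def point_function_def dir_def)
  next
    let ?w = "\<lambda>z. ennreal (\<bar>snd z\<bar> powr ((?n - 1) * (p - 1) - 2) * norm (f' z) powr p)"
    let ?c = "2 * radial_const ?n"
    have c: "?c \<ge> 0" using radial_const_pos[of ?n] card3 by simp
    have "(\<integral>\<^sup>+x. ennreal (norm (g x) powr p) \<partial>lborel)
      = (\<integral>\<^sup>+\<theta>. \<integral>\<^sup>+t. ennreal (?c * \<bar>t\<bar> powr (- ?n - 1)) * indicator {..<0} t * ennreal (norm (g (- (1 / t) *\<^sub>R \<theta>)) powr p) \<partial>lborel \<partial>SP)"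
      by (rule nn_integral_polar_nu) measurable
    \<comment> \<open>An inequality is enough: the left side integrates over \<open>t < 0\<close>,
      the right side over all \<open>t\<close>.\<close>
    also have "\<dots> \<le> (\<integral>\<^sup>+\<theta>. \<integral>\<^sup>+t. ennreal ?c * ?w (\<theta>, t) \<partial>lborel \<partial>SP)"
    proof (intro nn_integral_mono)
      fix \<theta> and t :: real assume "\<theta> \<in> space SP"
      hence \<theta>: "norm \<theta> = 1" by (simp add: space_SP)
      show "ennreal (?c * \<bar>t\<bar> powr (- ?n - 1)) * indicator {..<0} t * ennreal (norm (g (- (1 / t) *\<^sub>R \<theta>)) powr p) \<le> ennreal ?c * ?w (\<theta>, t)"
      proof (cases "t < 0")
        case True
        let ?x = "- (1 / t) *\<^sub>R \<theta>"
        have nx: "norm ?x = inverse \<bar>t\<bar>" using \<theta> by (simp add: inverse_eq_divide)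
        have x0: "?x \<noteq> 0" using \<theta> True by auto
        have d: "dir ?x = \<theta>" unfolding dir_def nx using x0 True by (auto simp: abs_if)
        have e: "- inverse (norm ?x) = t" unfolding nx using True by simp
        have "g ?x = f' (dir ?x, - inverse (norm ?x)) / of_real (norm ?x ^ (CARD('n) - 1))"
          unfolding g_def by (rule if_not_P[OF x0])
        also have "\<dots> = f' (\<theta>, t) / of_real (inverse \<bar>t\<bar> ^ (CARD('n) - 1))" unfolding d e unfolding nx ..
        finally have "g ?x = f' (\<theta>, t) / of_real (inverse \<bar>t\<bar> ^ (CARD('n) - 1))" .
        hence "norm (g ?x) = norm (f' (\<theta>, t)) * \<bar>t\<bar> ^ (CARD('n) - 1)"
          by (simp add: norm_divide norm_mult norm_power power_inverse divide_inverse)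
        also have "\<bar>t\<bar> ^ (CARD('n) - 1) = \<bar>t\<bar> powr (?n - 1)"
          using True card3 by (subst powr_realpow[symmetric]) (auto simp: of_nat_diff)
        finally have "norm (g ?x) powr p = norm (f' (\<theta>, t)) powr p * \<bar>t\<bar> powr ((?n - 1) * p)"
          by (simp add: powr_mult powr_powr)
        hence "?c * \<bar>t\<bar> powr (- ?n - 1) * norm (g ?x) powr p
          = ?c * ((\<bar>t\<bar> powr (- ?n - 1) * \<bar>t\<bar> powr ((?n - 1) * p)) * norm (f' (\<theta>, t)) powr p)"
          by (simp only: mult_ac)
        also have "\<bar>t\<bar> powr (- ?n - 1) * \<bar>t\<bar> powr ((?n - 1) * p) = \<bar>t\<bar> powr ((?n - 1) * (p - 1) - 2)"
          unfolding powr_add[symmetric] by (rule arg_cong) (simp add: algebra_simps)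
        finally have "?c * \<bar>t\<bar> powr (- ?n - 1) * norm (g ?x) powr p
          = ?c * (\<bar>t\<bar> powr ((?n - 1) * (p - 1) - 2) * norm (f' (\<theta>, t)) powr p)" .
        hence "ennreal (?c * \<bar>t\<bar> powr (- ?n - 1) * norm (g ?x) powr p) = ennreal ?c * ?w (\<theta>, t)"
          unfolding fst_conv snd_conv ennreal_mult'[OF c, symmetric] by (rule arg_cong)
        moreover have "ennreal (?c * \<bar>t\<bar> powr (- ?n - 1)) * indicator {..<0} t * ennreal (norm (g ?x) powr p)
          = ennreal (?c * \<bar>t\<bar> powr (- ?n - 1) * norm (g ?x) powr p)"
          using c True by (subst ennreal_mult'') auto
        ultimately show ?thesis by (rule order_eq_refl[OF trans[rotated]])
      qed simp
    qed
    also have "\<dots> = (\<integral>\<^sup>+z. ennreal ?c * ?w z \<partial>?HM)"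
      by (rule nn_integral_HM[symmetric]) measurable
    also have "\<dots> = ennreal ?c * (\<integral>\<^sup>+z. ?w z \<partial>?HM)"
      unfolding HM_eq by (rule nn_integral_cmult) measurable
    also have "(\<integral>\<^sup>+z. ?w z \<partial>?HM) = (\<integral>\<^sup>+ (\<theta>, t). ennreal (\<bar>t\<bar> powr ((?n - 1) * (p - 1) - 2) * norm (\<phi> \<theta> t) powr p) \<partial>?HM)"
      by (rule nn_integral_cong_AE) (use ae in eventually_elim, auto split: prod.splits)
    also have "\<dots> = (\<integral>\<^sup>+ (\<theta>, t). ennreal (\<bar>t\<bar> powr ((?n - 1) * (p - 1) - 2) * norm (\<phi> \<theta> t) powr p) \<partial>completion ?HM)"
      by (rule nn_integral_completion[symmetric])
    also have "ennreal ?c * \<dots> < \<infinity>" using fin by (simp add: ennreal_mult_less_top)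
    finally show "(\<integral>\<^sup>+x. ennreal (norm (g x) powr p) \<partial>lborel) < \<infinity>" .
  qed
qed

text \<open>At a pole that is good, a Lebesgue point and outside the exceptional set, the uniform
  statement is applied to that single point; almost every hyperplane has such a pole.\<close>

lemma inversion_tilde_Lp:
  fixes \<phi> :: "real ^ 'n \<Rightarrow> real \<Rightarrow> complex"
  assumes \<phi>: "hyperplane_function \<phi>" and p: "1 \<le> p" "p < real CARD('n) / (real CARD('n) - 2)" and Lp: "\<phi> \<in> tilde_Lp p"
  shows "AE (\<theta>, t) in hyperplane_measure.
           (\<forall>\<epsilon>>0. set_integrable lborel {\<epsilon><..} (inversion_integrand G e m (Phi \<phi>) (nu_hyperplane \<theta> t))) \<and>
           (\<exists>I. ((\<lambda>\<epsilon>. LBINT r:{\<epsilon><..}. inversion_integrand G e m (Phi \<phi>) (nu_hyperplane \<theta> t) r) \<longlongrightarrow> I) (at_right 0) \<and>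
                \<phi> \<theta> t = of_real (pi powr (1 - real CARD('n) / 2) / (kappa CARD('n) m * \<bar>t\<bar> ^ (CARD('n) - 1))) * I)"
proof -
  obtain g N where g [measurable]: "g \<in> borel_measurable borel" and N: "N \<in> null_sets (lborel :: (real ^ 'n) measure)"
    and gN: "\<And>z. z \<notin> N \<Longrightarrow> point_function \<phi> z = g z"
    and gp: "(\<integral>\<^sup>+x. ennreal (norm (g x) powr p) \<partial>lborel) < \<infinity>"
    by (rule tilde_Lp_representative[OF Lp]) blast
  let ?leb = "\<lambda>x. \<forall>\<eta>>0. \<exists>d>0. \<forall>t. 0 < t \<and> t < d \<longrightarrow> mean_oscillation g x t \<le> ennreal \<eta>"
  have "AE x in lborel. good g x \<and> ?leb x \<and> x \<notin> N"
    using AE_good[OF g p gp] AE_lebesgue_point[OF g locally_integrable_of_Lp[OF g p(1) gp]] AE_not_in[OF N]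
    by eventually_elim blast
  then obtain N1 where N1: "\<And>x. x \<in> space lborel - N1 \<Longrightarrow> good g x \<and> ?leb x \<and> x \<notin> N" "N1 \<in> null_sets lborel"
    by (rule AE_E3) blast
  have "AE z in (hyperplane_measure :: ((real ^ 'n) \<times> real) measure). z \<in> space hyperplane_measure" by (rule AE_space)
  with AE_HM_nonzero AE_HM_of_AE_lborel[OF N1(2)]
  show ?thesis
  proof eventually_elim
    fix z :: "(real ^ 'n) \<times> real"
    assume t0: "snd z \<noteq> 0" and zN: "- (1 / snd z) *\<^sub>R fst z \<notin> N1" and sp: "z \<in> space hyperplane_measure"
    obtain \<theta> t where z: "z = (\<theta>, t)" by (cases z)
    have \<theta>: "norm \<theta> = 1" using sp by (auto simp: z HM_eq space_pair_measure space_SP)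
    have t: "t \<noteq> 0" using t0 by (simp add: z)
    define x where "x = - (1 / t) *\<^sub>R \<theta>"
    have nu: "nu_hyperplane \<theta> t = x" by (simp add: x_def nu_hyperplane_def inverse_eq_divide)
    have x: "good g x" "?leb x" "x \<notin> N" using N1(1)[of x] zN by (auto simp: z x_def)
    have x0: "x \<noteq> 0" using \<theta> t by (auto simp: x_def)
    have gN': "\<forall>z. z \<notin> N \<longrightarrow> point_function \<phi> z = g z" using gN by blast
    note eq = truncated_inversion_integrand[OF \<phi> g N gN' x0]
    obtain B where B: "\<And>t. t > 0 \<Longrightarrow> mean_oscillation g x t \<le> ennreal B"
      using mean_oscillation_bounded[OF g x(1)] x(2) zero_less_one by blast
    have "uniform_limit {x} (\<lambda>\<epsilon> x. LBINT r:{\<epsilon><..}. inversion_summand g x r) (\<lambda>x. of_real inv_const * g x) (at_right 0)"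
    proof (rule uniform_inversion[OF g])
      show "\<exists>\<delta>>0. \<forall>x\<in>{x}. \<forall>t. 0 < t \<and> t < \<delta> \<longrightarrow> mean_oscillation g x t \<le> ennreal \<eta>" if "\<eta> > 0" for \<eta>
        using x(2) that by blast
    qed (use x(1) B in auto)
    hence "((\<lambda>\<epsilon>. LBINT r:{\<epsilon><..}. inversion_summand g x r) \<longlongrightarrow> of_real inv_const * g x) (at_right 0)"
      by (rule tendsto_uniform_limitI) simp
    hence lim: "((\<lambda>\<epsilon>. LBINT r:{\<epsilon><..}. inversion_integrand G e m (Phi \<phi>) x r) \<longlongrightarrow> of_real inv_const * g x) (at_right 0)"
    proof (rule Lim_transform_eventually)
      show "\<forall>\<^sub>F \<epsilon> in at_right 0. (LBINT r:{\<epsilon><..}. inversion_summand g x r) = (LBINT r:{\<epsilon><..}. inversion_integrand G e m (Phi \<phi>) x r)"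
        using eventually_at_right_less[of "0 :: real"] by eventually_elim (simp add: eq(2))
    qed
    have val: "\<phi> \<theta> t = of_real (pi powr (1 - real CARD('n) / 2) / (kappa CARD('n) m * \<bar>t\<bar> ^ (CARD('n) - 1))) * (of_real inv_const * g x)"
      unfolding inversion_constant[OF t] point_function_nu[OF \<phi> \<theta> t] x_def[symmetric] gN[OF x(3)] ..
    show "case z of (\<theta>, t) \<Rightarrow>
           (\<forall>\<epsilon>>0. set_integrable lborel {\<epsilon><..} (inversion_integrand G e m (Phi \<phi>) (nu_hyperplane \<theta> t))) \<and>
           (\<exists>I. ((\<lambda>\<epsilon>. LBINT r:{\<epsilon><..}. inversion_integrand G e m (Phi \<phi>) (nu_hyperplane \<theta> t) r) \<longlongrightarrow> I) (at_right 0) \<and>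
                \<phi> \<theta> t = of_real (pi powr (1 - real CARD('n) / 2) / (kappa CARD('n) m * \<bar>t\<bar> ^ (CARD('n) - 1))) * I)"
      unfolding z prod.case nu
    proof (intro conjI exI allI impI)
      show "set_integrable lborel {\<epsilon><..} (inversion_integrand G e m (Phi \<phi>) x)" if "\<epsilon> > 0" for \<epsilon>
        unfolding eq(1)[OF that] by (rule truncated_integral(1)[OF g x(1) that])
    qed (rule lim val)+
  qed
qed

lemma tilde_C_representative:
  fixes \<phi> :: "real ^ 'n \<Rightarrow> real \<Rightarrow> complex"
  assumes \<phi>: "\<phi> \<in> tilde_C \<mu>" and \<mu>: "\<mu> \<ge> 0"
  obtains g C where "continuous_on UNIV g" "\<And>x. x \<noteq> 0 \<Longrightarrow> point_function \<phi> x = g x"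
    "C \<ge> 0" "\<And>x. norm (g x) \<le> C * (1 + norm x) powr (- \<mu>)"
proof -
  let ?n = "real CARD('n)"
  have ct: "continuous_on (sphere 0 1 \<times> (- {0})) (\<lambda>(\<theta>, t). \<phi> \<theta> t)" using \<phi> by (simp add: tilde_C_def)
  have "\<exists>B. \<exists>\<delta>>0. \<forall>\<theta> t. norm \<theta> = 1 \<and> 0 < \<bar>t\<bar> \<and> \<bar>t\<bar> < \<delta> \<longrightarrow> \<bar>t\<bar> powr (?n - 1 - \<mu>) * norm (\<phi> \<theta> t) \<le> B"
    using \<phi> unfolding tilde_C_def by blast
  then obtain B \<delta> where \<delta>: "\<delta> > 0" and B: "\<And>\<theta> t. norm \<theta> = 1 \<Longrightarrow> 0 < \<bar>t\<bar> \<Longrightarrow> \<bar>t\<bar> < \<delta> \<Longrightarrow> \<bar>t\<bar> powr (?n - 1 - \<mu>) * norm (\<phi> \<theta> t) \<le> B"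
    by blast
  have "\<exists>c. \<forall>\<epsilon>>0. \<exists>R. \<forall>\<theta> t. norm \<theta> = 1 \<and> R < \<bar>t\<bar> \<longrightarrow> norm (of_real (\<bar>t\<bar> ^ (CARD('n) - 1)) * \<phi> \<theta> t - c) < \<epsilon>"
    using \<phi> unfolding tilde_C_def by blast
  then obtain c where c: "\<And>\<epsilon>. \<epsilon> > 0 \<Longrightarrow> \<exists>R. \<forall>\<theta> t. norm \<theta> = 1 \<and> R < \<bar>t\<bar> \<longrightarrow> norm (of_real (\<bar>t\<bar> ^ (CARD('n) - 1)) * \<phi> \<theta> t - c) < \<epsilon>"
    by blast
  \<comment> \<open>Poles near the origin belong to distant hyperplanes, so the limit
    \<open>c\<close> at infinity becomes the value at \<open>0\<close>.\<close>
  define g where "g x = (if x = 0 then c else point_function \<phi> x)" for x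
  have pf: "point_function \<phi> x = of_real (\<bar>- inverse (norm x)\<bar> ^ (CARD('n) - 1)) * \<phi> (x /\<^sub>R norm x) (- inverse (norm x))" for x
    by (simp add: point_function_def power_inverse divide_inverse of_real_inverse)
  have nrm: "norm (x /\<^sub>R norm x) = 1" if "x \<noteq> 0" for x :: "real ^ 'n" using that by simp
  have "continuous_on (- {0}) (\<lambda>x. case (x /\<^sub>R norm x, - inverse (norm x)) of (\<theta>, t) \<Rightarrow> \<phi> \<theta> t)"
    by (rule continuous_on_compose2[OF ct]) (auto intro!: continuous_intros)
  hence "continuous_on (- {0}) (\<lambda>x. point_function \<phi> x)"
    unfolding point_function_def by (auto intro!: continuous_intros)
  hence cg: "continuous_on (- {0}) g"
    by (rule continuous_on_eq) (auto simp: g_def)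
  have "isCont g x" for x
  proof (cases "x = 0")
    case False
    thus ?thesis using cg by (auto simp: continuous_on_eq_continuous_at open_Compl)
  next
    case True
    have "\<exists>d>0. \<forall>y. dist y x < d \<longrightarrow> dist (g y) (g x) < \<eta>" if \<eta>: "\<eta> > 0" for \<eta>
    proof -
      obtain R where R: "\<And>\<theta> t. norm \<theta> = 1 \<Longrightarrow> R < \<bar>t\<bar> \<Longrightarrow> norm (of_real (\<bar>t\<bar> ^ (CARD('n) - 1)) * \<phi> \<theta> t - c) < \<eta>"
        using c[OF \<eta>] by blast
      have "dist (g y) (g x) < \<eta>" if y: "dist y x < inverse (max R 1)" for y
      proof (cases "y = 0")
        case False
        have "norm y < inverse (max R 1)" using y True by (simp add: dist_norm)
        hence "max R 1 < inverse (norm y)" using False inverse_less_imp_less[of "inverse (norm y)" "max R 1"]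
          by (intro inverse_less_imp_less[of "inverse (norm y)" "max R 1"]) auto
        hence "R < \<bar>- inverse (norm y)\<bar>" by simp
        from R[OF nrm[OF False] this] show ?thesis
          using False True unfolding g_def pf by (simp add: dist_norm)
      qed (use True \<eta> in simp)
      thus ?thesis by (intro exI[of _ "inverse (max R 1)"]) auto
    qed
    thus ?thesis by (auto simp: continuous_at_eps_delta)
  qed
  hence cont: "continuous_on UNIV g" by (simp add: continuous_on_eq_continuous_at)
  \<comment> \<open>Beyond \<open>\<rho>\<close> the distance \<open>1 / |x|\<close> is below
    \<open>\<delta>\<close>, where the bound for small \<open>t\<close> holds, and
    \<open>|x| > 1\<close> gives \<open>1 / |x| \<le> 2 / (1 + |x|)\<close>.\<close>
  define \<rho> where "\<rho> = max (inverse \<delta>) 1"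
  have \<rho>: "\<rho> \<ge> 1" by (simp add: \<rho>_def)
  have "bounded (g ` cball 0 \<rho>)"
    by (intro compact_imp_bounded compact_continuous_image continuous_on_subset[OF cont]) auto
  then obtain M where "\<forall>x\<in>cball 0 \<rho>. norm (g x) \<le> M" unfolding bounded_iff by auto
  hence M: "norm (g x) \<le> M" if "norm x \<le> \<rho>" for x using that by simp
  have M0: "M \<ge> 0" using order_trans[OF norm_ge_zero M[of 0]] \<rho> by simp
  \<comment> \<open>The first summand carries the compactness bound \<open>M\<close> inside radius
    \<open>\<rho>\<close>, the second the growth bound outside, where \<open>2 powr \<mu>\<close>
    pays for exchanging \<open>|x|\<close> with \<open>1 + |x|\<close>.\<close>
  let ?C = "M * (1 + \<rho>) powr \<mu> + \<bar>B\<bar> * 2 powr \<mu>"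
  have le: "norm (g x) \<le> ?C * (1 + norm x) powr (- \<mu>)" for x
  proof (cases "norm x \<le> \<rho>")
    case True
    have "1 \<le> ((1 + \<rho>) / (1 + norm x)) powr \<mu>" using True \<mu> \<rho>
      by (intro ge_one_powr_ge_zero) (auto simp: field_simps add_pos_nonneg)
    also have "\<dots> = (1 + \<rho>) powr \<mu> * (1 + norm x) powr (- \<mu>)"
      using \<rho> by (subst powr_divide) (auto simp: powr_minus_divide add_nonneg_nonneg)
    finally have "M * 1 \<le> M * ((1 + \<rho>) powr \<mu> * (1 + norm x) powr (- \<mu>))" using M0 by (intro mult_left_mono)
    also have "\<dots> \<le> ?C * (1 + norm x) powr (- \<mu>)" by (simp add: distrib_right mult.assoc)
    finally show ?thesis using M[OF True] by simp
  next
    case False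
    hence x1: "norm x > \<rho>" "norm x > 1" "x \<noteq> 0" using \<rho> by auto
    have "inverse (norm x) < inverse (inverse \<delta>)"
      by (rule less_imp_inverse_less) (use x1 \<delta> in \<open>auto simp: \<rho>_def\<close>)
    hence d: "0 < \<bar>- inverse (norm x)\<bar>" "\<bar>- inverse (norm x)\<bar> < \<delta>" using x1 by auto
    define s where "s = inverse (norm x)"
    have s: "s > 0" using x1 by (simp add: s_def)
    have b: "s powr (?n - 1 - \<mu>) * norm (\<phi> (x /\<^sub>R norm x) (- s)) \<le> B"
      using B[OF nrm[OF x1(3)] d] s by (simp add: s_def)
    have "norm (g x) = s ^ (CARD('n) - 1) * norm (\<phi> (x /\<^sub>R norm x) (- s))"
      using x1 s by (simp add: g_def pf norm_mult norm_power norm_inverse s_def)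
    also have "s ^ (CARD('n) - 1) = s powr \<mu> * s powr (?n - 1 - \<mu>)"
      unfolding powr_add[symmetric] using s card3 by (subst powr_realpow[symmetric]) (auto simp: of_nat_diff)
    also have "\<dots> * norm (\<phi> (x /\<^sub>R norm x) (- s)) = s powr \<mu> * (s powr (?n - 1 - \<mu>) * norm (\<phi> (x /\<^sub>R norm x) (- s)))"
      by (simp only: mult.assoc)
    also have "\<dots> \<le> s powr \<mu> * \<bar>B\<bar>" using b by (intro mult_left_mono) auto
    also have "s powr \<mu> \<le> (2 / (1 + norm x)) powr \<mu>"
      unfolding s_def using x1 \<mu> by (intro powr_mono2) (auto simp: field_simps)
    also have "(2 / (1 + norm x)) powr \<mu> = 2 powr \<mu> * (1 + norm x) powr (- \<mu>)"
      by (subst powr_divide) (auto simp: powr_minus_divide add_nonneg_nonneg)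
    also have "2 powr \<mu> * (1 + norm x) powr (- \<mu>) * \<bar>B\<bar> \<le> ?C * (1 + norm x) powr (- \<mu>)"
      using M0 by (simp add: distrib_right mult.assoc mult.commute[of "\<bar>B\<bar>"] mult.left_commute[of "\<bar>B\<bar>"])
    finally show ?thesis by (simp add: mult_right_mono)
  qed
  show thesis
  proof (rule that[OF cont _ _ le])
    show "point_function \<phi> x = g x" if "x \<noteq> 0" for x using that by (simp add: g_def)
    show "0 \<le> ?C" using M0 by simp
  qed
qed

text \<open>Under pointwise decay every point is good, not just almost every one. Decay about the
  origin becomes decay about \<open>x\<close> at the cost of \<open>(1 + |x|) powr \<mu>\<close>;
  the remaining radial integral of \<open>v powr (\<alpha> - 1) * (1 + v) powr (- \<mu> / 2)\<close>
  converges for \<open>\<mu> / 2 > \<alpha>\<close>, that is \<open>\<mu> > n - 2\<close>.\<close>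

lemma good_of_decay:
  fixes g :: "real ^ 'n \<Rightarrow> complex"
  assumes [measurable]: "g \<in> borel_measurable borel" and C: "C \<ge> 0" and \<mu>: "\<mu> > real CARD('n) - 2"
    and le: "\<And>x. norm (g x) \<le> C * (1 + norm x) powr (- \<mu>)"
  shows "good g x"
proof -
  let ?n = "real CARD('n)"
  have \<mu>0: "\<mu> > 0" using \<mu> card3 by simp
  let ?c = "C * (1 + norm x) powr \<mu>"
  have c: "?c \<ge> 0" using C by simp
  define h where "h v = ennreal ((1 + v) powr (- \<mu> / 2) / v)" for v :: real
  have [measurable]: "h \<in> borel_measurable borel" unfolding h_def by measurable
  have rc: "0 \<le> radial_const ?n" by (intro less_imp_le radial_const_pos) simp
  have pt: "ennreal (norm (g (x + z)) / (norm z)\<^sup>2) \<le> ennreal ?c * h ((norm z)\<^sup>2)" for z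
  proof -
    have "(1 + norm z) \<le> (1 + norm (x + z)) * (1 + norm x)"
    proof -
      have "norm z \<le> norm (x + z) + norm x" using norm_triangle_ineq4[of "x + z" x] by simp
      moreover have "0 \<le> norm (x + z) * norm x" by simp
      moreover have "(1 + norm (x + z)) * (1 + norm x) = 1 + norm x + norm (x + z) + norm (x + z) * norm x"
        by (simp add: algebra_simps)
      ultimately show ?thesis by linarith
    qed
    hence "(1 + norm z) / (1 + norm x) \<le> 1 + norm (x + z)" by (simp add: field_simps add_pos_nonneg)
    hence "(1 + norm (x + z)) powr (- \<mu>) \<le> ((1 + norm z) / (1 + norm x)) powr (- \<mu>)"
      using \<mu>0 by (intro powr_mono2') (auto intro!: divide_pos_pos add_pos_nonneg)
    also have "\<dots> = (1 + norm x) powr \<mu> * (1 + norm z) powr (- \<mu>)"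
      by (subst powr_divide) (auto simp: powr_minus_divide add_nonneg_nonneg)
    also have "(1 + norm z) powr (- \<mu>) = ((1 + norm z)\<^sup>2) powr (- \<mu> / 2)"
    proof -
      have "(1 + norm z)\<^sup>2 = (1 + norm z) powr 2" by (subst powr_numeral) (auto simp: add_pos_nonneg)
      thus ?thesis by (simp only: powr_powr) simp
    qed
    also have "\<dots> \<le> (1 + (norm z)\<^sup>2) powr (- \<mu> / 2)"
      using \<mu>0 by (intro powr_mono2') (auto simp: power2_sum add_pos_nonneg)
    finally have "(1 + norm (x + z)) powr (- \<mu>) \<le> (1 + norm x) powr \<mu> * (1 + (norm z)\<^sup>2) powr (- \<mu> / 2)"
      by (simp add: mult_left_mono)
    hence "C * (1 + norm (x + z)) powr (- \<mu>) \<le> C * ((1 + norm x) powr \<mu> * (1 + (norm z)\<^sup>2) powr (- \<mu> / 2))"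
      using C by (rule mult_left_mono)
    hence "norm (g (x + z)) \<le> ?c * (1 + (norm z)\<^sup>2) powr (- \<mu> / 2)"
      using le[of "x + z"] by (simp add: mult.assoc)
    hence "norm (g (x + z)) / (norm z)\<^sup>2 \<le> ?c * (1 + (norm z)\<^sup>2) powr (- \<mu> / 2) / (norm z)\<^sup>2"
      by (rule divide_right_mono) simp
    hence "ennreal (norm (g (x + z)) / (norm z)\<^sup>2) \<le> ennreal (?c * ((1 + (norm z)\<^sup>2) powr (- \<mu> / 2) / (norm z)\<^sup>2))"
      by (intro ennreal_leI) simp
    also have "\<dots> = ennreal ?c * h ((norm z)\<^sup>2)" unfolding h_def by (rule ennreal_mult'[OF c])
    finally show ?thesis .
  qed
  have "(\<integral>\<^sup>+z. ennreal (norm (g (x + z)) / (norm z)\<^sup>2) \<partial>lborel) \<le> (\<integral>\<^sup>+(z :: real ^ 'n). ennreal ?c * h ((norm z)\<^sup>2) \<partial>lborel)"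
    by (rule nn_integral_mono) (rule pt)
  also have "\<dots> = ennreal ?c * (\<integral>\<^sup>+(z :: real ^ 'n). h ((norm z)\<^sup>2) \<partial>lborel)"
    by (rule nn_integral_cmult) measurable
  also have "(\<integral>\<^sup>+(z :: real ^ 'n). h ((norm z)\<^sup>2) \<partial>lborel)
    = (\<integral>\<^sup>+v. ennreal (radial_const ?n * v powr (?n / 2 - 1)) * indicator {0<..} v * h v \<partial>lborel)"
    by (rule nn_integral_lborel_radial) measurable
  also have "\<dots> = (\<integral>\<^sup>+v. ennreal (radial_const ?n) * (ennreal (v powr (\<alpha> - 1) * (1 + v) powr (- (\<mu> / 2))) * indicator {0<..} v) \<partial>lborel)"
  proof (rule nn_integral_cong)
    fix v :: real
    show "ennreal (radial_const ?n * v powr (?n / 2 - 1)) * indicator {0<..} v * h v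
      = ennreal (radial_const ?n) * (ennreal (v powr (\<alpha> - 1) * (1 + v) powr (- (\<mu> / 2))) * indicator {0<..} v)"
    proof (cases "v > 0")
      case True
      have "v powr (?n / 2 - 1) = v powr (\<alpha> - 1) * v powr 1" unfolding powr_add[symmetric] by (simp add: \<alpha>_def)
      hence "radial_const ?n * v powr (?n / 2 - 1) * ((1 + v) powr (- \<mu> / 2) / v) = radial_const ?n * (v powr (\<alpha> - 1) * (1 + v) powr (- (\<mu> / 2)))"
        using True by simp
      thus ?thesis using True rc unfolding h_def by (simp add: ennreal_mult'[symmetric])
    qed simp
  qed
  also have "\<dots> = ennreal (radial_const ?n) * (\<integral>\<^sup>+v. ennreal (v powr (\<alpha> - 1) * (1 + v) powr (- (\<mu> / 2))) * indicator {0<..} v \<partial>lborel)"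
    by (rule nn_integral_cmult) measurable
  also have "ennreal ?c * \<dots> < \<infinity>"
    using nn_integral_beta_finite[of \<alpha> "\<mu> / 2"] \<alpha>(1) \<mu> by (simp add: ennreal_mult_less_top \<alpha>_def)
  finally show ?thesis unfolding good_def .
qed

text \<open>A compact set of hyperplanes that avoids \<open>t = 0\<close> has its poles in a closed
  ball, possibly around the origin; since \<open>g\<close> is continuous there too, it is uniformly
  continuous on a slightly larger ball and its oscillations are uniformly small.\<close>

lemma inversion_tilde_C:
  fixes \<phi> :: "real ^ 'n \<Rightarrow> real \<Rightarrow> complex"
  assumes \<phi>: "hyperplane_function \<phi>" and \<mu>: "\<mu> > real CARD('n) - 2" and C: "\<phi> \<in> tilde_C \<mu>"
  shows "\<exists>I. (\<forall>\<theta> t. norm \<theta> = 1 \<and> t \<noteq> 0 \<longrightarrow>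
                (\<forall>\<epsilon>>0. set_integrable lborel {\<epsilon><..} (inversion_integrand G e m (Phi \<phi>) (nu_hyperplane \<theta> t))) \<and>
                \<phi> \<theta> t = of_real (pi powr (1 - real CARD('n) / 2) / (kappa CARD('n) m * \<bar>t\<bar> ^ (CARD('n) - 1))) * I (\<theta>, t)) \<and>
             (\<forall>K. compact K \<and> K \<subseteq> sphere 0 1 \<times> (- {0}) \<longrightarrow>
                uniform_limit K (\<lambda>\<epsilon> (\<theta>, t). LBINT r:{\<epsilon><..}. inversion_integrand G e m (Phi \<phi>) (nu_hyperplane \<theta> t) r)
                  I (at_right 0))"
proof -
  let ?n = "real CARD('n)"
  have \<mu>0: "\<mu> \<ge> 0" using \<mu> card3 by simp
  obtain g C where cont: "continuous_on UNIV g" and gp: "\<And>x. x \<noteq> 0 \<Longrightarrow> point_function \<phi> x = g x"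
    and C: "C \<ge> 0" and le: "\<And>x. norm (g x) \<le> C * (1 + norm x) powr (- \<mu>)"
    by (rule tilde_C_representative[OF C \<mu>0]) blast
  have g: "g \<in> borel_measurable borel" by (rule borel_measurable_continuous_onI[OF cont])
  have good: "good g x" for x by (rule good_of_decay[OF g C \<mu> le])
  have gC: "norm (g x) \<le> C" for x
  proof -
    have "(1 + norm x) powr (- \<mu>) \<le> 1 powr (- \<mu>)" using \<mu>0 by (intro powr_mono2') auto
    hence "C * (1 + norm x) powr (- \<mu>) \<le> C * 1" using C by (intro mult_left_mono) auto
    thus ?thesis using le[of x] by simp
  qed
  have N: "{0} \<in> null_sets (lborel :: (real ^ 'n) measure)" by (auto simp: null_sets_def)
  have gN: "\<forall>z. z \<notin> {0} \<longrightarrow> point_function \<phi> z = g z" using gp by simp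
  note eq = truncated_inversion_integrand[OF \<phi> g N gN]
  have nu: "nu_hyperplane \<theta> t = - (1 / t) *\<^sub>R \<theta>" for \<theta> :: "real ^ 'n" and t by (simp add: nu_hyperplane_def inverse_eq_divide)
  have nu0: "nu_hyperplane \<theta> t \<noteq> 0" if "norm \<theta> = 1" "t \<noteq> 0" for \<theta> :: "real ^ 'n" and t using that by (auto simp: nu)
  have bound: "mean_oscillation g x t \<le> ennreal (2 * C * unit_ball_vol ?n)" if "t > 0" for x t
  proof (rule mean_oscillation_le[OF that])
    show "norm (g (x + z) - g x) \<le> 2 * C" for z
      using norm_triangle_ineq4[of "g (x + z)" "g x"] gC[of "x + z"] gC[of x] by linarith
  qed (use C in simp)
  have unif: "uniform_limit (cball 0 \<rho>) (\<lambda>\<epsilon> x. LBINT r:{\<epsilon><..}. inversion_summand g x r) (\<lambda>x. of_real inv_const * g x) (at_right 0)" for \<rho>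
  proof (rule uniform_inversion[OF g good _ bound])
    fix \<eta> :: real assume \<eta>: "\<eta> > 0"
    have v: "unit_ball_vol ?n > 0" by (rule unit_ball_vol_pos) simp
    have u: "uniformly_continuous_on (cball 0 (\<rho> + 1)) g"
      by (intro compact_uniformly_continuous continuous_on_subset[OF cont]) auto
    have "\<eta> / unit_ball_vol ?n > 0" using \<eta> v by simp
    with u obtain d where d: "d > 0" "\<And>x y. x \<in> cball 0 (\<rho> + 1) \<Longrightarrow> y \<in> cball 0 (\<rho> + 1) \<Longrightarrow> dist y x < d \<Longrightarrow> dist (g y) (g x) < \<eta> / unit_ball_vol ?n"
      by (rule uniformly_continuous_onE) blast
    show "\<exists>\<delta>>0. \<forall>x\<in>cball 0 \<rho>. \<forall>t. 0 < t \<and> t < \<delta> \<longrightarrow> mean_oscillation g x t \<le> ennreal \<eta>"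
    \<comment> \<open>The bound 1 keeps \<open>x + z\<close> in the ball of radius
      \<open>\<rho> + 1\<close> on which \<open>g\<close> is uniformly continuous; the square
      appears because \<open>t\<close> is a squared radius.\<close>
    proof (intro exI[of _ "(min d 1)\<^sup>2"] conjI ballI allI impI)
      show "(min d 1)\<^sup>2 > 0" using d by simp
      fix x :: "real ^ 'n" and t :: real assume x: "x \<in> cball 0 \<rho>" and t: "0 < t \<and> t < (min d 1)\<^sup>2"
      have "mean_oscillation g x t \<le> ennreal (\<eta> / unit_ball_vol ?n * unit_ball_vol ?n)"
      proof (rule mean_oscillation_le)
        fix z :: "real ^ 'n" assume "(norm z)\<^sup>2 < t"
        hence "(norm z)\<^sup>2 < (min d 1)\<^sup>2" using t by simp
        hence "norm z < min d 1" by (rule power_less_imp_less_base) (use d in simp)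
        hence z: "norm z < d" "norm z < 1" by auto
        have "norm (x + z) \<le> \<rho> + 1" using norm_triangle_ineq[of x z] x z by simp
        hence "dist (g (x + z)) (g x) < \<eta> / unit_ball_vol ?n" using x z by (intro d(2)) (simp_all add: dist_norm[of "x + z" x])
        thus "norm (g (x + z) - g x) \<le> \<eta> / unit_ball_vol ?n" by (simp add: dist_norm)
      qed (use t \<eta> v in auto)
      thus "mean_oscillation g x t \<le> ennreal \<eta>" using v by simp
    qed
  qed
  let ?I = "\<lambda>(\<theta>, t). of_real inv_const * g (nu_hyperplane \<theta> t)"
  show ?thesis
  proof (intro exI[of _ ?I] conjI allI impI; (elim conjE)?)
    fix \<theta> :: "real ^ 'n" and t \<epsilon> :: real assume a: "norm \<theta> = 1" "t \<noteq> 0" and \<epsilon>: "\<epsilon> > 0"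
    show "set_integrable lborel {\<epsilon><..} (inversion_integrand G e m (Phi \<phi>) (nu_hyperplane \<theta> t))"
      unfolding eq(1)[OF nu0[OF a] \<epsilon>] by (rule truncated_integral(1)[OF g good \<epsilon>])
  next
    fix \<theta> :: "real ^ 'n" and t :: real assume a: "norm \<theta> = 1" "t \<noteq> 0"
    show "\<phi> \<theta> t = of_real (pi powr (1 - ?n / 2) / (kappa CARD('n) m * \<bar>t\<bar> ^ (CARD('n) - 1))) * ?I (\<theta>, t)"
      unfolding prod.case inversion_constant[OF a(2)] point_function_nu[OF \<phi> a] gp[OF nu0[OF a], symmetric]
      by (simp only: nu)
  next
    fix K :: "((real ^ 'n) \<times> real) set" assume K: "compact K" "K \<subseteq> sphere 0 1 \<times> (- {0})"
    have "continuous_on K (\<lambda>z. - (1 / snd z) *\<^sub>R fst z)"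
      using K(2) by (intro continuous_intros) auto
    hence "bounded ((\<lambda>z. - (1 / snd z) *\<^sub>R fst z) ` K)"
      using K(1) by (intro compact_imp_bounded compact_continuous_image)
    then obtain \<rho> where \<rho>: "\<And>z. z \<in> K \<Longrightarrow> norm (- (1 / snd z) *\<^sub>R fst z) \<le> \<rho>" unfolding bounded_iff by auto
    show "uniform_limit K (\<lambda>\<epsilon> (\<theta>, t). LBINT r:{\<epsilon><..}. inversion_integrand G e m (Phi \<phi>) (nu_hyperplane \<theta> t) r) ?I (at_right 0)"
      unfolding uniform_limit_iff
    proof (intro allI impI)
      fix \<eta> :: real assume "\<eta> > 0"
      with unif[of \<rho>] have "\<forall>\<^sub>F \<epsilon> in at_right 0. \<forall>x\<in>cball 0 \<rho>. dist (LBINT r:{\<epsilon><..}. inversion_summand g x r) (of_real inv_const * g x) < \<eta>"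
        unfolding uniform_limit_iff by blast
      thus "\<forall>\<^sub>F \<epsilon> in at_right 0. \<forall>z\<in>K. dist (case z of (\<theta>, t) \<Rightarrow> LBINT r:{\<epsilon><..}. inversion_integrand G e m (Phi \<phi>) (nu_hyperplane \<theta> t) r) (?I z) < \<eta>"
        using eventually_at_right_less[of "0 :: real"]
      proof eventually_elim
        fix \<epsilon> :: real
        assume lt: "\<forall>x\<in>cball 0 \<rho>. dist (LBINT r:{\<epsilon><..}. inversion_summand g x r) (of_real inv_const * g x) < \<eta>" and \<epsilon>: "0 < \<epsilon>"
        show "\<forall>z\<in>K. dist (case z of (\<theta>, t) \<Rightarrow> LBINT r:{\<epsilon><..}. inversion_integrand G e m (Phi \<phi>) (nu_hyperplane \<theta> t) r) (?I z) < \<eta>"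
        proof
          fix z assume z: "z \<in> K"
          obtain \<theta> t where zt: "z = (\<theta>, t)" by (cases z)
          have a: "norm \<theta> = 1" "t \<noteq> 0" using z K(2) by (auto simp: zt)
          have "nu_hyperplane \<theta> t \<in> cball 0 \<rho>" using \<rho>[OF z] by (simp add: zt nu)
          with lt show "dist (case z of (\<theta>, t) \<Rightarrow> LBINT r:{\<epsilon><..}. inversion_integrand G e m (Phi \<phi>) (nu_hyperplane \<theta> t) r) (?I z) < \<eta>"
            unfolding zt prod.case eq(2)[OF nu0[OF a] \<epsilon>] by blast
        qed
      qed
    qed
  qed
qed

end

theorem theorem4p13:
  fixes \<phi> :: "real ^ 'n \<Rightarrow> real \<Rightarrow> complex"
    and G :: "(real ^ 'n ^ 'n) measure"
    and e :: "nat \<Rightarrow> 'n"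
    and m :: nat
  assumes n: "CARD('n) \<ge> 3"
    and e: "bij_betw e {1..CARD('n)} UNIV"
    and G: "haar_prob_SO G"
    and \<phi>: "hyperplane_function \<phi>"
    and m: "real m > real CARD('n) / 2 - 1"
  shows
    "(\<forall>p::real. 1 \<le> p \<and> p < real CARD('n) / (real CARD('n) - 2) \<and> \<phi> \<in> tilde_Lp p \<longrightarrow>
        (AE (\<theta>, t) in hyperplane_measure.
           (\<forall>\<epsilon>>0. set_integrable lborel {\<epsilon><..}
              (inversion_integrand G e m (Phi \<phi>) (nu_hyperplane \<theta> t))) \<and>
           (\<exists>I. ((\<lambda>\<epsilon>. LBINT r:{\<epsilon><..}.
                    inversion_integrand G e m (Phi \<phi>) (nu_hyperplane \<theta> t) r) \<longlongrightarrow> I) (at_right 0) \<and>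
                \<phi> \<theta> t = of_real (pi powr (1 - real CARD('n) / 2)
                   / (kappa CARD('n) m * \<bar>t\<bar> ^ (CARD('n) - 1))) * I)))
     \<and>
     (\<forall>\<mu>::real. \<mu> > real CARD('n) - 2 \<and> \<phi> \<in> tilde_C \<mu> \<longrightarrow>
        (\<exists>I. (\<forall>\<theta> t. norm \<theta> = 1 \<and> t \<noteq> 0 \<longrightarrow>
                (\<forall>\<epsilon>>0. set_integrable lborel {\<epsilon><..}
                   (inversion_integrand G e m (Phi \<phi>) (nu_hyperplane \<theta> t))) \<and>
                \<phi> \<theta> t = of_real (pi powr (1 - real CARD('n) / 2)
                   / (kappa CARD('n) m * \<bar>t\<bar> ^ (CARD('n) - 1))) * I (\<theta>, t)) \<and>
             (\<forall>K. compact K \<and> K \<subseteq> sphere 0 1 \<times> (- {0}) \<longrightarrow>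
                uniform_limit K
                  (\<lambda>\<epsilon> (\<theta>, t). LBINT r:{\<epsilon><..}.
                     inversion_integrand G e m (Phi \<phi>) (nu_hyperplane \<theta> t) r)
                  I (at_right 0))))"
proof -
  interpret marchaud_frame e G m
    using n e G m by unfold_locales
  show ?thesis
    using inversion_tilde_Lp[OF \<phi>] inversion_tilde_C[OF \<phi>] by blast
qed

end
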